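(* Let $\mathbf{KH}$ be the category of compact Hausdorff spaces and continuous maps. Up to equivalence, $\mathbf{KH}$ is the unique non-trivial well-powered pretopos which is well-pointed, filtral and admits all set-indexed copowers of its terminal object. That is: $\mathbf{KH}$ is a well-powered, non-trivial, well-pointed and filtral pretopos which admits the copower $\sum_{I}\mathbf{1}$ of its terminal object $\mathbf{1}$ for every set $I$; and any category with all of these properties is equivalent to $\mathbf{KH}$.
   Context: Subobjects. A subobject of $X$ is an equivalence class of monomorphisms into $X$, where $m_1\sim m_2$ iff each factors through the other; $\mathrm{Sub}(X)$ is the poset of subobjects of $X$, with $m_1\le m_2$ iff $m_1$ factors through $m_2$. A category is well-powered if every $\mathrm{Sub}(X)$ is a set. For $f\colon X\to Y$ in a category with pullbacks, $f^*\colon \mathrm{Sub}(Y)\to\mathrm{Sub}(X)$ is pullback along $f$. The image of $f\colon X\to Y$ is the smallest subobject of $Y$ through which $f$ factors. Regular, coherent. A regular category is a category with finite limits in which every morphism has an image and image factorisations are stable under pullback. A coherent category is a regular category in which every $\mathrm{Sub}(X)$ has finite joins (including a bottom element) and every $f^*$ preserves them. In a coherent category each $\mathrm{Sub}(X)$ is a bounded distributive lattice and there is a strict initial object $\mathbf{0}$ (the least element of $\mathrm{Sub}(\mathbf{1})$, $\mathbf{1}$ the terminal object). The category is non-trivial if $\mathbf{0}\not\cong\mathbf{1}$. Pretopos. A category is exact if it is regular and every internal equivalence relation in it is effective, i.e. coincides with the kernel pair of its coequaliser. A category $\mathbf{C}$ is extensive if it has finite coproducts and the canonical functor $(\mathbf{C}/X_1)\times(\mathbf{C}/X_2)\to\mathbf{C}/(X_1+X_2)$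 is an equivalence for all $X_1,X_2$. A pretopos is an exact and extensive category; every pretopos is coherent. Well-pointed. A category with terminal object $\mathbf{1}$ is well-pointed if the functor $\mathrm{pt}=\mathrm{Hom}(\mathbf{1},-)$ to $\mathbf{Set}$ is faithful. Filtral. For a bounded distributive lattice $L$, let $\mathcal{C}(L)$ be the Boolean algebra of complemented elements of $L$ (its Boolean center), and for a bounded distributive lattice $M$ let $\mathcal{F}(M)$ be the set of all non-empty filters of $M$ (the improper filter included), ordered by reverse inclusion. $L$ is filtral if the map $L\to\mathcal{F}(\mathcal{C}(L))$, $x\mapsto \{y\in \mathcal{C}(L)\mid x\le y\}$, is an isomorphism of posets. An object $X$ of a coherent category is filtral if the lattice $\mathrm{Sub}(X)$ is filtral. A coherent category is filtral if for every object $Y$ there is a regular epimorphism $X\to Y$ with $X$ filtral. *)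

theory Defs
  imports "HOL-Analysis.Analysis" "HOL-Library.Equipollence" "HOL-Algebra.Lattice"
begin

section \<open>Smallness\<close>

text \<open>
  HOL has no type of all sets, so ``set'' versus ``class'' is rendered by a Grothendieck universe:
  a type \<open>'u\<close> of (strongly) inaccessible cardinality. A collection, of any type, is
  a set if it is small, i.e. has fewer elements than \<open>'u\<close>. Up to bijection the small
  sets are exactly the subsets of \<open>'u\<close> of cardinality less than that of \<open>'u\<close>.
  The argument of type \<open>'u itself\<close> of the definitions below names the universe.
\<close>

definition inaccessible :: "'u itself \<Rightarrow> bool" where
  "inaccessible U \<longleftrightarrow>
     (UNIV :: nat set) \<prec> (UNIV :: 'u set) \<and>
     (\<forall>A :: 'u set. A \<prec> (UNIV :: 'u set) \<longrightarrow> Pow A \<prec> (UNIV :: 'u set)) \<and>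
     (\<forall>(I :: 'u set) (A :: 'u \<Rightarrow> 'u set).
        I \<prec> (UNIV :: 'u set) \<longrightarrow> (\<forall>i\<in>I. A i \<prec> (UNIV :: 'u set)) \<longrightarrow>
        (\<Union>i\<in>I. A i) \<prec> (UNIV :: 'u set))"

definition small :: "'u itself \<Rightarrow> 'x set \<Rightarrow> bool" where
  "small U A \<longleftrightarrow> A \<prec> (UNIV :: 'u set)"


section \<open>Categories, functors, equivalences\<close>

record ('o, 'm) cat =
  Obj :: "'o set"
  Arr :: "'m set"
  Dom :: "'m \<Rightarrow> 'o"
  Cod :: "'m \<Rightarrow> 'o"
  Ident :: "'o \<Rightarrow> 'm"
  Comp :: "'m \<Rightarrow> 'm \<Rightarrow> 'm" (infixl "\<cdot>\<index>" 70)

definition Hom :: "('o, 'm) cat \<Rightarrow> 'o \<Rightarrow> 'o \<Rightarrow> 'm set" where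
  "Hom C X Y = {f \<in> Arr C. Dom C f = X \<and> Cod C f = Y}"

locale category =
  fixes C :: "('o, 'm) cat" (structure)
  assumes Dom_in_Obj: "f \<in> Arr C \<Longrightarrow> Dom C f \<in> Obj C"
    and Cod_in_Obj: "f \<in> Arr C \<Longrightarrow> Cod C f \<in> Obj C"
    and Ident_in_Hom: "X \<in> Obj C \<Longrightarrow> Ident C X \<in> Hom C X X"
    and Comp_in_Hom: "f \<in> Hom C X Y \<Longrightarrow> g \<in> Hom C Y Z \<Longrightarrow> g \<cdot> f \<in> Hom C X Z"
    and Comp_Ident: "f \<in> Hom C X Y \<Longrightarrow> f \<cdot> Ident C X = f"
    and Ident_Comp: "f \<in> Hom C X Y \<Longrightarrow> Ident C Y \<cdot> f = f"
    and Comp_assoc: "f \<in> Hom C W X \<Longrightarrow> g \<in> Hom C X Y \<Longrightarrow> h \<in> Hom C Y Z \<Longrightarrow>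
      (h \<cdot> g) \<cdot> f = h \<cdot> (g \<cdot> f)"

definition is_iso :: "('o, 'm) cat \<Rightarrow> 'm \<Rightarrow> bool" where
  "is_iso C f \<longleftrightarrow> f \<in> Arr C \<and>
     (\<exists>g \<in> Hom C (Cod C f) (Dom C f).
        g \<cdot>\<^bsub>C\<^esub> f = Ident C (Dom C f) \<and> f \<cdot>\<^bsub>C\<^esub> g = Ident C (Cod C f))"

definition isomorphic :: "('o, 'm) cat \<Rightarrow> 'o \<Rightarrow> 'o \<Rightarrow> bool" where
  "isomorphic C X Y \<longleftrightarrow> (\<exists>f \<in> Hom C X Y. is_iso C f)"

record ('o1, 'm1, 'o2, 'm2) cfunctor =
  FObj :: "'o1 \<Rightarrow> 'o2"
  FArr :: "'m1 \<Rightarrow> 'm2"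

definition is_functor ::
  "('o1, 'm1) cat \<Rightarrow> ('o2, 'm2) cat \<Rightarrow> ('o1, 'm1, 'o2, 'm2) cfunctor \<Rightarrow> bool" where
  "is_functor C D F \<longleftrightarrow> category C \<and> category D \<and>
     (\<forall>X \<in> Obj C. FObj F X \<in> Obj D) \<and>
     (\<forall>f \<in> Arr C. FArr F f \<in> Hom D (FObj F (Dom C f)) (FObj F (Cod C f))) \<and>
     (\<forall>X \<in> Obj C. FArr F (Ident C X) = Ident D (FObj F X)) \<and>
     (\<forall>f \<in> Arr C. \<forall>g \<in> Arr C. Dom C g = Cod C f \<longrightarrow>
        FArr F (g \<cdot>\<^bsub>C\<^esub> f) = FArr F g \<cdot>\<^bsub>D\<^esub> FArr F f)"

definition faithful ::
  "('o1, 'm1) cat \<Rightarrow> ('o2, 'm2) cat \<Rightarrow> ('o1, 'm1, 'o2, 'm2) cfunctor \<Rightarrow> bool" where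
  "faithful C D F \<longleftrightarrow> is_functor C D F \<and>
     (\<forall>X \<in> Obj C. \<forall>Y \<in> Obj C. inj_on (FArr F) (Hom C X Y))"

definition id_functor :: "('o, 'm, 'o, 'm) cfunctor" where
  "id_functor = \<lparr>FObj = (\<lambda>X. X), FArr = (\<lambda>f. f)\<rparr>"

definition comp_functor ::
  "('o2, 'm2, 'o3, 'm3) cfunctor \<Rightarrow> ('o1, 'm1, 'o2, 'm2) cfunctor \<Rightarrow> ('o1, 'm1, 'o3, 'm3) cfunctor"
  where
  "comp_functor G F = \<lparr>FObj = FObj G \<circ> FObj F, FArr = FArr G \<circ> FArr F\<rparr>"

definition natural_iso ::
  "('o1, 'm1) cat \<Rightarrow> ('o2, 'm2) cat \<Rightarrow> ('o1, 'm1, 'o2, 'm2) cfunctor \<Rightarrow>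
   ('o1, 'm1, 'o2, 'm2) cfunctor \<Rightarrow> ('o1 \<Rightarrow> 'm2) \<Rightarrow> bool" where
  "natural_iso C D F G t \<longleftrightarrow> is_functor C D F \<and> is_functor C D G \<and>
     (\<forall>X \<in> Obj C. t X \<in> Hom D (FObj F X) (FObj G X) \<and> is_iso D (t X)) \<and>
     (\<forall>f \<in> Arr C. t (Cod C f) \<cdot>\<^bsub>D\<^esub> FArr F f = FArr G f \<cdot>\<^bsub>D\<^esub> t (Dom C f))"

definition is_equivalence ::
  "('o1, 'm1) cat \<Rightarrow> ('o2, 'm2) cat \<Rightarrow> ('o1, 'm1, 'o2, 'm2) cfunctor \<Rightarrow> bool" where
  "is_equivalence C D F \<longleftrightarrow> is_functor C D F \<and>
     (\<exists>G \<eta> \<epsilon>. is_functor D C G \<and>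
        natural_iso C C id_functor (comp_functor G F) \<eta> \<and>
        natural_iso D D (comp_functor F G) id_functor \<epsilon>)"

definition equivalent_categories :: "('o1, 'm1) cat \<Rightarrow> ('o2, 'm2) cat \<Rightarrow> bool" where
  "equivalent_categories C D \<longleftrightarrow> (\<exists>F. is_equivalence C D F)"

definition product_cat :: "('o1, 'm1) cat \<Rightarrow> ('o2, 'm2) cat \<Rightarrow> ('o1 \<times> 'o2, 'm1 \<times> 'm2) cat" where
  "product_cat C D = \<lparr>
     Obj = Obj C \<times> Obj D,
     Arr = Arr C \<times> Arr D,
     Dom = (\<lambda>(f, g). (Dom C f, Dom D g)),
     Cod = (\<lambda>(f, g). (Cod C f, Cod D g)),
     Ident = (\<lambda>(X, Y). (Ident C X, Ident D Y)),
     Comp = (\<lambda>(f', g') (f, g). (f' \<cdot>\<^bsub>C\<^esub> f, g' \<cdot>\<^bsub>D\<^esub> g))\<rparr>"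

text \<open>
  An arrow \<open>(p, h, q)\<close> of the slice over \<open>X\<close> is a commutative triangle
  \<open>q \<cdot> h = p\<close>, going from the object \<open>p\<close> to the object \<open>q\<close>.
\<close>

definition slice_cat :: "('o, 'm) cat \<Rightarrow> 'o \<Rightarrow> ('m, 'm \<times> 'm \<times> 'm) cat" where
  "slice_cat C X = \<lparr>
     Obj = {p \<in> Arr C. Cod C p = X},
     Arr = {(p, h, q). p \<in> Arr C \<and> Cod C p = X \<and> q \<in> Arr C \<and> Cod C q = X \<and>
              h \<in> Hom C (Dom C p) (Dom C q) \<and> q \<cdot>\<^bsub>C\<^esub> h = p},
     Dom = (\<lambda>(p, h, q). p),
     Cod = (\<lambda>(p, h, q). q),
     Ident = (\<lambda>p. (p, Ident C (Dom C p), p)),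
     Comp = (\<lambda>(p', h', q') (p, h, q). (p, h' \<cdot>\<^bsub>C\<^esub> h, q'))\<rparr>"

text \<open>The category of small sets with elements in the type \<open>'x\<close>.\<close>

definition Set_cat :: "'u itself \<Rightarrow> ('x set, 'x set \<times> ('x \<Rightarrow> 'x) \<times> 'x set) cat" where
  "Set_cat U = \<lparr>
     Obj = {A. small U A},
     Arr = {(A, f, B). small U A \<and> small U B \<and> f \<in> A \<rightarrow>\<^sub>E B},
     Dom = (\<lambda>(A, f, B). A),
     Cod = (\<lambda>(A, f, B). B),
     Ident = (\<lambda>A. (A, (\<lambda>x\<in>A. x), A)),
     Comp = (\<lambda>(B', g, D) (A, f, B). (A, compose A g f, D))\<rparr>"


section \<open>Limits and colimits\<close>

definition is_terminal :: "('o, 'm) cat \<Rightarrow> 'o \<Rightarrow> bool" where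
  "is_terminal C T \<longleftrightarrow> T \<in> Obj C \<and> (\<forall>X \<in> Obj C. \<exists>!f. f \<in> Hom C X T)"

definition is_initial :: "('o, 'm) cat \<Rightarrow> 'o \<Rightarrow> bool" where
  "is_initial C Z \<longleftrightarrow> Z \<in> Obj C \<and> (\<forall>X \<in> Obj C. \<exists>!f. f \<in> Hom C Z X)"

definition terminal_obj :: "('o, 'm) cat \<Rightarrow> 'o" where
  "terminal_obj C = (SOME T. is_terminal C T)"

definition initial_obj :: "('o, 'm) cat \<Rightarrow> 'o" where
  "initial_obj C = (SOME Z. is_initial C Z)"

definition is_cone ::
  "('j, 'k) cat \<Rightarrow> ('o, 'm) cat \<Rightarrow> ('j, 'k, 'o, 'm) cfunctor \<Rightarrow> 'o \<Rightarrow> ('j \<Rightarrow> 'm) \<Rightarrow> bool" where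
  "is_cone J C D L p \<longleftrightarrow> L \<in> Obj C \<and>
     (\<forall>j \<in> Obj J. p j \<in> Hom C L (FObj D j)) \<and>
     (\<forall>u \<in> Arr J. FArr D u \<cdot>\<^bsub>C\<^esub> p (Dom J u) = p (Cod J u))"

definition is_limit ::
  "('j, 'k) cat \<Rightarrow> ('o, 'm) cat \<Rightarrow> ('j, 'k, 'o, 'm) cfunctor \<Rightarrow> 'o \<Rightarrow> ('j \<Rightarrow> 'm) \<Rightarrow> bool" where
  "is_limit J C D L p \<longleftrightarrow> is_cone J C D L p \<and>
     (\<forall>M q. is_cone J C D M q \<longrightarrow>
        (\<exists>!h. h \<in> Hom C M L \<and> (\<forall>j \<in> Obj J. p j \<cdot>\<^bsub>C\<^esub> h = q j)))"

text \<open>Every finite category is isomorphic to one whose objects and arrows are natural numbers.\<close>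

definition has_finite_limits :: "('o, 'm) cat \<Rightarrow> bool" where
  "has_finite_limits C \<longleftrightarrow>
     (\<forall>(J :: (nat, nat) cat) D. finite (Obj J) \<longrightarrow> finite (Arr J) \<longrightarrow> is_functor J C D \<longrightarrow>
        (\<exists>L p. is_limit J C D L p))"

definition is_pullback :: "('o, 'm) cat \<Rightarrow> 'm \<Rightarrow> 'm \<Rightarrow> 'm \<Rightarrow> 'm \<Rightarrow> bool" where
  "is_pullback C f g p q \<longleftrightarrow>
     f \<in> Arr C \<and> g \<in> Arr C \<and> p \<in> Arr C \<and> q \<in> Arr C \<and>
     Cod C f = Cod C g \<and> Dom C p = Dom C q \<and> Cod C p = Dom C f \<and> Cod C q = Dom C g \<and>
     f \<cdot>\<^bsub>C\<^esub> p = g \<cdot>\<^bsub>C\<^esub> q \<and>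
     (\<forall>W. \<forall>a \<in> Hom C W (Dom C f). \<forall>b \<in> Hom C W (Dom C g). f \<cdot>\<^bsub>C\<^esub> a = g \<cdot>\<^bsub>C\<^esub> b \<longrightarrow>
        (\<exists>!h. h \<in> Hom C W (Dom C p) \<and> p \<cdot>\<^bsub>C\<^esub> h = a \<and> q \<cdot>\<^bsub>C\<^esub> h = b))"

definition is_coequalizer :: "('o, 'm) cat \<Rightarrow> 'm \<Rightarrow> 'm \<Rightarrow> 'm \<Rightarrow> bool" where
  "is_coequalizer C f g q \<longleftrightarrow>
     f \<in> Arr C \<and> g \<in> Arr C \<and> q \<in> Arr C \<and>
     Dom C f = Dom C g \<and> Cod C f = Cod C g \<and> Dom C q = Cod C f \<and>
     q \<cdot>\<^bsub>C\<^esub> f = q \<cdot>\<^bsub>C\<^esub> g \<and>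
     (\<forall>W. \<forall>a \<in> Hom C (Cod C f) W. a \<cdot>\<^bsub>C\<^esub> f = a \<cdot>\<^bsub>C\<^esub> g \<longrightarrow>
        (\<exists>!h. h \<in> Hom C (Cod C q) W \<and> h \<cdot>\<^bsub>C\<^esub> q = a))"

definition regular_epi :: "('o, 'm) cat \<Rightarrow> 'm \<Rightarrow> bool" where
  "regular_epi C q \<longleftrightarrow> (\<exists>f g. is_coequalizer C f g q)"

definition is_coproduct ::
  "('o, 'm) cat \<Rightarrow> 'i set \<Rightarrow> ('i \<Rightarrow> 'o) \<Rightarrow> 'o \<Rightarrow> ('i \<Rightarrow> 'm) \<Rightarrow> bool" where
  "is_coproduct C I A S \<iota> \<longleftrightarrow> S \<in> Obj C \<and> (\<forall>i \<in> I. \<iota> i \<in> Hom C (A i) S) \<and>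
     (\<forall>W \<in> Obj C. \<forall>a. (\<forall>i \<in> I. a i \<in> Hom C (A i) W) \<longrightarrow>
        (\<exists>!h. h \<in> Hom C S W \<and> (\<forall>i \<in> I. h \<cdot>\<^bsub>C\<^esub> \<iota> i = a i)))"

definition has_finite_coproducts :: "('o, 'm) cat \<Rightarrow> bool" where
  "has_finite_coproducts C \<longleftrightarrow>
     (\<forall>(n :: nat) A. (\<forall>i<n. A i \<in> Obj C) \<longrightarrow> (\<exists>S \<iota>. is_coproduct C {..<n} A S \<iota>))"

definition is_binary_coproduct :: "('o, 'm) cat \<Rightarrow> 'o \<Rightarrow> 'o \<Rightarrow> 'o \<Rightarrow> 'm \<Rightarrow> 'm \<Rightarrow> bool" where
  "is_binary_coproduct C X Y S i j \<longleftrightarrow>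
     S \<in> Obj C \<and> i \<in> Hom C X S \<and> j \<in> Hom C Y S \<and>
     (\<forall>W. \<forall>a \<in> Hom C X W. \<forall>b \<in> Hom C Y W.
        \<exists>!h. h \<in> Hom C S W \<and> h \<cdot>\<^bsub>C\<^esub> i = a \<and> h \<cdot>\<^bsub>C\<^esub> j = b)"

definition chosen_coproduct :: "('o, 'm) cat \<Rightarrow> 'o \<Rightarrow> 'o \<Rightarrow> 'o \<times> 'm \<times> 'm" where
  "chosen_coproduct C X Y = (SOME (S, i, j). is_binary_coproduct C X Y S i j)"

definition coprod :: "('o, 'm) cat \<Rightarrow> 'o \<Rightarrow> 'o \<Rightarrow> 'o" where
  "coprod C X Y = fst (chosen_coproduct C X Y)"

definition inl :: "('o, 'm) cat \<Rightarrow> 'o \<Rightarrow> 'o \<Rightarrow> 'm" where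
  "inl C X Y = fst (snd (chosen_coproduct C X Y))"

definition inr :: "('o, 'm) cat \<Rightarrow> 'o \<Rightarrow> 'o \<Rightarrow> 'm" where
  "inr C X Y = snd (snd (chosen_coproduct C X Y))"

definition coprod_arr :: "('o, 'm) cat \<Rightarrow> 'm \<Rightarrow> 'm \<Rightarrow> 'm" where
  "coprod_arr C f g = (THE h.
     h \<in> Hom C (coprod C (Dom C f) (Dom C g)) (coprod C (Cod C f) (Cod C g)) \<and>
     h \<cdot>\<^bsub>C\<^esub> inl C (Dom C f) (Dom C g) = inl C (Cod C f) (Cod C g) \<cdot>\<^bsub>C\<^esub> f \<and>
     h \<cdot>\<^bsub>C\<^esub> inr C (Dom C f) (Dom C g) = inr C (Cod C f) (Cod C g) \<cdot>\<^bsub>C\<^esub> g)"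


section \<open>Subobjects\<close>

definition monic :: "('o, 'm) cat \<Rightarrow> 'm \<Rightarrow> bool" where
  "monic C m \<longleftrightarrow> m \<in> Arr C \<and>
     (\<forall>W. \<forall>a \<in> Hom C W (Dom C m). \<forall>b \<in> Hom C W (Dom C m). m \<cdot>\<^bsub>C\<^esub> a = m \<cdot>\<^bsub>C\<^esub> b \<longrightarrow> a = b)"

definition factors_through :: "('o, 'm) cat \<Rightarrow> 'm \<Rightarrow> 'm \<Rightarrow> bool" where
  "factors_through C f m \<longleftrightarrow> (\<exists>h \<in> Hom C (Dom C f) (Dom C m). f = m \<cdot>\<^bsub>C\<^esub> h)"

definition monos_into :: "('o, 'm) cat \<Rightarrow> 'o \<Rightarrow> 'm set" where
  "monos_into C X = {m. monic C m \<and> Cod C m = X}"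

definition sub_equiv :: "('o, 'm) cat \<Rightarrow> 'o \<Rightarrow> ('m \<times> 'm) set" where
  "sub_equiv C X = {(m, n). m \<in> monos_into C X \<and> n \<in> monos_into C X \<and>
     factors_through C m n \<and> factors_through C n m}"

definition Sub :: "('o, 'm) cat \<Rightarrow> 'o \<Rightarrow> 'm set gorder" where
  "Sub C X = \<lparr>
     carrier = monos_into C X // sub_equiv C X,
     eq = (=),
     le = (\<lambda>S T. \<exists>m \<in> S. \<exists>n \<in> T. factors_through C m n)\<rparr>"

text \<open>
  \<open>f\<^sup>*\<close>: as pullbacks along \<open>f\<close> of equivalent monomorphisms are unique up to
  isomorphism over the domain of \<open>f\<close>, all of them together form one equivalence class.
\<close>

definition sub_pullback :: "('o, 'm) cat \<Rightarrow> 'm \<Rightarrow> 'm set \<Rightarrow> 'm set" where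
  "sub_pullback C f S = {m. \<exists>n \<in> S. \<exists>q. is_pullback C f n m q}"

definition is_image :: "('o, 'm) cat \<Rightarrow> 'm \<Rightarrow> 'm set \<Rightarrow> bool" where
  "is_image C f S \<longleftrightarrow> least (Sub C (Cod C f)) S
     {T \<in> carrier (Sub C (Cod C f)). \<exists>m \<in> T. factors_through C f m}"

definition well_powered :: "'u itself \<Rightarrow> ('o, 'm) cat \<Rightarrow> bool" where
  "well_powered U C \<longleftrightarrow> category C \<and> (\<forall>X \<in> Obj C. small U (carrier (Sub C X)))"


section \<open>Regular and coherent categories, pretoposes\<close>

definition regular_category :: "('o, 'm) cat \<Rightarrow> bool" where
  "regular_category C \<longleftrightarrow> category C \<and> has_finite_limits C \<and>
     (\<forall>f \<in> Arr C. \<exists>S. is_image C f S) \<and>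
     (\<forall>f g p q S. is_pullback C f g p q \<longrightarrow> is_image C f S \<longrightarrow> is_image C q (sub_pullback C g S))"

text \<open>Finite joins are least upper bounds of finite sets; the empty set gives the bottom element.\<close>

definition coherent_category :: "('o, 'm) cat \<Rightarrow> bool" where
  "coherent_category C \<longleftrightarrow> regular_category C \<and>
     (\<forall>X \<in> Obj C. \<forall>F \<subseteq> carrier (Sub C X). finite F \<longrightarrow>
        (\<exists>S. least (Sub C X) S (Upper (Sub C X) F))) \<and>
     (\<forall>f \<in> Arr C. \<forall>F \<subseteq> carrier (Sub C (Cod C f)). \<forall>S. finite F \<longrightarrow>
        least (Sub C (Cod C f)) S (Upper (Sub C (Cod C f)) F) \<longrightarrow>
        least (Sub C (Dom C f)) (sub_pullback C f S)
          (Upper (Sub C (Dom C f)) (sub_pullback C f ` F)))"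

text \<open>
  An internal equivalence relation on \<open>X\<close> is a jointly monic pair
  \<open>r\<^sub>1, r\<^sub>2 : R \<rightarrow> X\<close> that is reflexive, symmetric and transitive.
\<close>

definition internal_equivalence :: "('o, 'm) cat \<Rightarrow> 'm \<Rightarrow> 'm \<Rightarrow> bool" where
  "internal_equivalence C r1 r2 \<longleftrightarrow>
     r1 \<in> Arr C \<and> r2 \<in> Arr C \<and> Dom C r1 = Dom C r2 \<and> Cod C r1 = Cod C r2 \<and>
     (\<forall>W. \<forall>a \<in> Hom C W (Dom C r1). \<forall>b \<in> Hom C W (Dom C r1).
        r1 \<cdot>\<^bsub>C\<^esub> a = r1 \<cdot>\<^bsub>C\<^esub> b \<longrightarrow> r2 \<cdot>\<^bsub>C\<^esub> a = r2 \<cdot>\<^bsub>C\<^esub> b \<longrightarrow> a = b) \<and>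
     (\<exists>d \<in> Hom C (Cod C r1) (Dom C r1).
        r1 \<cdot>\<^bsub>C\<^esub> d = Ident C (Cod C r1) \<and> r2 \<cdot>\<^bsub>C\<^esub> d = Ident C (Cod C r1)) \<and>
     (\<exists>s \<in> Hom C (Dom C r1) (Dom C r1). r1 \<cdot>\<^bsub>C\<^esub> s = r2 \<and> r2 \<cdot>\<^bsub>C\<^esub> s = r1) \<and>
     (\<forall>p1 p2. is_pullback C r2 r1 p1 p2 \<longrightarrow>
        (\<exists>t \<in> Hom C (Dom C p1) (Dom C r1).
           r1 \<cdot>\<^bsub>C\<^esub> t = r1 \<cdot>\<^bsub>C\<^esub> p1 \<and> r2 \<cdot>\<^bsub>C\<^esub> t = r2 \<cdot>\<^bsub>C\<^esub> p2))"

definition effective :: "('o, 'm) cat \<Rightarrow> 'm \<Rightarrow> 'm \<Rightarrow> bool" where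
  "effective C r1 r2 \<longleftrightarrow> (\<exists>q. is_coequalizer C r1 r2 q \<and> is_pullback C q q r1 r2)"

definition exact_category :: "('o, 'm) cat \<Rightarrow> bool" where
  "exact_category C \<longleftrightarrow> regular_category C \<and>
     (\<forall>r1 r2. internal_equivalence C r1 r2 \<longrightarrow> effective C r1 r2)"

text \<open>
  The canonical functor \<open>(C/X\<^sub>1) \<times> (C/X\<^sub>2) \<rightarrow> C/(X\<^sub>1 + X\<^sub>2)\<close>,
  \<open>(p\<^sub>1, p\<^sub>2) \<mapsto> p\<^sub>1 + p\<^sub>2\<close>. Other choices of the coproducts
  would give a naturally isomorphic functor.
\<close>

definition slice_coprod_functor ::
  "('o, 'm) cat \<Rightarrow> ('m \<times> 'm, ('m \<times> 'm \<times> 'm) \<times> ('m \<times> 'm \<times> 'm), 'm, 'm \<times> 'm \<times> 'm) cfunctor" where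
  "slice_coprod_functor C = \<lparr>
     FObj = (\<lambda>(p1, p2). coprod_arr C p1 p2),
     FArr = (\<lambda>((p1, h1, q1), (p2, h2, q2)).
       (coprod_arr C p1 p2, coprod_arr C h1 h2, coprod_arr C q1 q2))\<rparr>"

definition extensive_category :: "('o, 'm) cat \<Rightarrow> bool" where
  "extensive_category C \<longleftrightarrow> category C \<and> has_finite_coproducts C \<and>
     (\<forall>X1 \<in> Obj C. \<forall>X2 \<in> Obj C.
        is_equivalence (product_cat (slice_cat C X1) (slice_cat C X2))
          (slice_cat C (coprod C X1 X2)) (slice_coprod_functor C))"

definition pretopos :: "('o, 'm) cat \<Rightarrow> bool" where
  "pretopos C \<longleftrightarrow> exact_category C \<and> extensive_category C"

definition nontrivial_category :: "('o, 'm) cat \<Rightarrow> bool" where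
  "nontrivial_category C \<longleftrightarrow> \<not> isomorphic C (initial_obj C) (terminal_obj C)"


section \<open>Well-pointed categories, copowers\<close>

definition pt_functor ::
  "('o, 'm) cat \<Rightarrow> ('o, 'm, 'm set, 'm set \<times> ('m \<Rightarrow> 'm) \<times> 'm set) cfunctor" where
  "pt_functor C = (let H = Hom C (terminal_obj C) in \<lparr>
     FObj = H,
     FArr = (\<lambda>f. (H (Dom C f), (\<lambda>x \<in> H (Dom C f). f \<cdot>\<^bsub>C\<^esub> x), H (Cod C f)))\<rparr>)"

text \<open>
  That \<open>pt\<close> is a functor to the category of small sets includes that the hom-sets
  out of the terminal object are small; with faithfulness all hom-sets are small.
\<close>

definition well_pointed :: "'u itself \<Rightarrow> ('o, 'm) cat \<Rightarrow> bool" where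
  "well_pointed U C \<longleftrightarrow> category C \<and> (\<exists>T. is_terminal C T) \<and> faithful C (Set_cat U) (pt_functor C)"

definition has_terminal_copowers :: "'u itself \<Rightarrow> ('o, 'm) cat \<Rightarrow> bool" where
  "has_terminal_copowers U C \<longleftrightarrow>
     (\<forall>I :: 'u set. small U I \<longrightarrow> (\<exists>S \<iota>. is_coproduct C I (\<lambda>_. terminal_obj C) S \<iota>))"


section \<open>Filtral lattices and categories\<close>

definition bounded_distrib_lattice :: "'a gorder \<Rightarrow> bool" where
  "bounded_distrib_lattice L \<longleftrightarrow> bounded_lattice L \<and>
     (\<forall>x \<in> carrier L. \<forall>y \<in> carrier L. \<forall>z \<in> carrier L.
        x \<sqinter>\<^bsub>L\<^esub> (y \<squnion>\<^bsub>L\<^esub> z) = (x \<sqinter>\<^bsub>L\<^esub> y) \<squnion>\<^bsub>L\<^esub> (x \<sqinter>\<^bsub>L\<^esub> z))"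

definition boolean_center :: "'a gorder \<Rightarrow> 'a gorder" where
  "boolean_center L = L\<lparr>carrier :=
     {x \<in> carrier L. \<exists>y \<in> carrier L. x \<sqinter>\<^bsub>L\<^esub> y = \<bottom>\<^bsub>L\<^esub> \<and> x \<squnion>\<^bsub>L\<^esub> y = \<top>\<^bsub>L\<^esub>}\<rparr>"

definition lattice_filter :: "'a gorder \<Rightarrow> 'a set \<Rightarrow> bool" where
  "lattice_filter M F \<longleftrightarrow> F \<subseteq> carrier M \<and> F \<noteq> {} \<and>
     (\<forall>x \<in> F. \<forall>y \<in> carrier M. x \<sqsubseteq>\<^bsub>M\<^esub> y \<longrightarrow> y \<in> F) \<and>
     (\<forall>x \<in> F. \<forall>y \<in> F. x \<sqinter>\<^bsub>M\<^esub> y \<in> F)"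

definition filter_poset :: "'a gorder \<Rightarrow> 'a set gorder" where
  "filter_poset M = \<lparr>carrier = {F. lattice_filter M F}, eq = (=), le = (\<lambda>F G. G \<subseteq> F)\<rparr>"

definition poset_iso :: "'a gorder \<Rightarrow> 'b gorder \<Rightarrow> ('a \<Rightarrow> 'b) \<Rightarrow> bool" where
  "poset_iso A B f \<longleftrightarrow> order_emb A B f \<and> bij_betw f (carrier A) (carrier B)"

definition filtral_lattice :: "'a gorder \<Rightarrow> bool" where
  "filtral_lattice L \<longleftrightarrow> bounded_distrib_lattice L \<and>
     poset_iso L (filter_poset (boolean_center L))
       (\<lambda>x. {y \<in> carrier (boolean_center L). x \<sqsubseteq>\<^bsub>L\<^esub> y})"

definition filtral_obj :: "('o, 'm) cat \<Rightarrow> 'o \<Rightarrow> bool" where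
  "filtral_obj C X \<longleftrightarrow> X \<in> Obj C \<and> filtral_lattice (Sub C X)"

definition filtral_category :: "('o, 'm) cat \<Rightarrow> bool" where
  "filtral_category C \<longleftrightarrow> coherent_category C \<and>
     (\<forall>Y \<in> Obj C. \<exists>X f. f \<in> Hom C X Y \<and> regular_epi C f \<and> filtral_obj C X)"


section \<open>Compact Hausdorff spaces\<close>

text \<open>
  Every compact Hausdorff space with a small set of points is homeomorphic to one whose points
  lie in \<open>'u\<close>, so only the latter are taken as objects. Arrows carry their domain and
  codomain, and the underlying function is made unique by extensionality.
\<close>

definition KH :: "('u topology, 'u topology \<times> ('u \<Rightarrow> 'u) \<times> 'u topology) cat" where
  "KH = (let Ob = {X :: 'u topology.
                     compact_space X \<and> Hausdorff_space X \<and> small TYPE('u) (topspace X)} in \<lparr>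
     Obj = Ob,
     Arr = {(X, f, Y). X \<in> Ob \<and> Y \<in> Ob \<and> continuous_map X Y f \<and> f \<in> extensional (topspace X)},
     Dom = (\<lambda>(X, f, Y). X),
     Cod = (\<lambda>(X, f, Y). Y),
     Ident = (\<lambda>X. (X, (\<lambda>x \<in> topspace X. x), X)),
     Comp = (\<lambda>(Y', g, Z) (X, f, Y). (X, compose (topspace X) g f, Z))\<rparr>)"


section \<open>The characterising properties\<close>

definition KH_like :: "'u itself \<Rightarrow> ('o, 'm) cat \<Rightarrow> bool" where
  "KH_like U C \<longleftrightarrow> pretopos C \<and> nontrivial_category C \<and> well_powered U C \<and>
     well_pointed U C \<and> filtral_category C \<and> has_terminal_copowers U C"

end

theory Submission
  imports Defs
begin

text \<open>
  Let \<open>C\<close> have all the listed properties and write \<open>pt X = Hom(1, X)\<close>. By extensivity and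
  well-pointedness an object without points is initial. Filtrality then makes subobjects determined by their
  points: if \<open>X\<close> is filtral, all points of \<open>S\<close> lie in \<open>T \<le> y\<close>, and \<open>y\<close> is complemented by \<open>z\<close>, then
  \<open>S \<and> z\<close> has no points, so \<open>S \<le> y\<close>; as the complemented \<open>y\<close> above \<open>T\<close> determine \<open>T\<close>, also \<open>S \<le> T\<close>.
  The general case follows by pulling back along a filtral cover. The sets of points of subobjects
  are the closed sets of a topology on \<open>pt X\<close>. For filtral \<open>X\<close> it is the Stone topology of the
  Boolean center of \<open>Sub X\<close>, and in general it is the image of such a space under a closed map, hence
  compact Hausdorff. The resulting functor \<open>C \<rightarrow> KH\<close> is faithful as \<open>C\<close> is well-pointed. It is full,
  because the graph of a continuous map is closed, so it is a subobject of the product, and its projection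
  is an isomorphism. It is essentially surjective: in the space of points of a copower \<open>\<Sum>\<^sub>I 1\<close> the set \<open>I\<close>
  is dense and disjoint subsets of \<open>I\<close> have disjoint closures, so every compact Hausdorff topology on
  \<open>I\<close> is a continuous image of it, by a map whose kernel relation is effective in \<open>C\<close>.

  In \<open>KH\<close> itself, limits are closed subspaces of products, images are closed, and the quotient by a
  closed equivalence relation is again Hausdorff. Filtral covers and copowers of \<open>1\<close> are
  Stone-Cech compactifications of discrete spaces.
\<close>

section \<open>Smallness\<close>

text \<open>A coherent category has only finite meets and joins of subobjects, whereas a topology
  needs arbitrary intersections of closed sets, and here they must also be compact. Both rest on one
  half of filtrality: every filter of the Boolean center is the filter of some subobject, so a
  filter generated by an infinite family is again named by a subobject. The other half, that the map
  into filters reflects the order, makes points decide inclusion of subobjects. Once that holds in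
  every object, an arrow bijective on points is invertible, and arrows can be built from their
  effect on points. Both directions share two tools: \<open>set_rep\<close>, a poset represented
  faithfully by sets ordered by inclusion, and \<open>dense_extension\<close>, which extends
  functions from a dense set whose disjoint subsets have disjoint closures. The latter serves for
  the Stone-Cech compactification and for an abstract copower of \<open>1\<close> alike. Points of
  an abstract object are arrows of an arbitrary type, and limits or sums of spaces live over other
  types as well; all are renamed into \<open>'u\<close> by injections that exist because the sets
  are small.\<close>

lemma lepoll_linear: "A \<lesssim> B \<or> B \<lesssim> A"
  using ordLeq_total[OF card_of_Well_order[of A] card_of_Well_order[of B]]
  unfolding lepoll_def card_of_ordLeq .

lemma infinite_Times_lepoll:
  assumes "infinite A"
  shows "A \<times> A \<lesssim> A"
  using card_of_Times_same_infinite[OF assms]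
  by (simp add: eqpoll_iff_card_of_ordIso eqpoll_imp_lepoll)

lemma small_lepoll: "A \<lesssim> B \<Longrightarrow> small U B \<Longrightarrow> small U A"
  unfolding small_def by (rule lesspoll_trans1)

lemma small_subset: "A \<subseteq> B \<Longrightarrow> small U B \<Longrightarrow> small U A"
  by (rule small_lepoll[OF subset_imp_lepoll])

lemma small_image: "small U A \<Longrightarrow> small U (f ` A)"
  by (rule small_lepoll[OF image_lepoll])

text \<open>The source of every renaming into \<open>'u\<close>: spaces built over other types and
  points of abstract objects are copied along such an injection.\<close>

lemma small_inj:
  fixes A :: "'x set"
  assumes "small (U :: 'u itself) A"
  obtains e :: "'x \<Rightarrow> 'u" where "inj_on e A"
  using lesspoll_imp_lepoll[OF assms[unfolded small_def]] unfolding lepoll_def by blast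

context
  assumes inacc: "inaccessible TYPE('u)"
begin

lemma infinite_universe: "infinite (UNIV :: 'u set)"
  using inacc unfolding inaccessible_def
  by (meson infinite_le_lepoll lesspoll_imp_lepoll)

lemma small_finite: "finite A \<Longrightarrow> small TYPE('u) A"
  unfolding small_def by (simp add: finite_lesspoll_infinite infinite_universe)

text \<open>Inaccessibility speaks of subsets of \<open>'u\<close> only, so the power set is taken
  of an injective copy of \<open>A\<close> in \<open>'u\<close>.\<close>

lemma small_Pow:
  fixes A :: "'x set"
  assumes "small TYPE('u) A"
  shows "small TYPE('u) (Pow A)"
proof -
  obtain e :: "'x \<Rightarrow> 'u" where e: "inj_on e A"
    using small_inj[OF assms] .
  have "small TYPE('u) (e ` A)"
    by (rule small_image[OF assms])
  then have "small TYPE('u) (Pow (e ` A))"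
    using inacc unfolding inaccessible_def small_def by blast
  moreover have "Pow A \<lesssim> Pow (e ` A)"
    unfolding lepoll_def using inj_on_image_Pow[OF e] by blast
  ultimately show ?thesis
    by (rule small_lepoll[rotated])
qed

text \<open>Cardinals are comparable, so the product injects into the square of the larger factor.
  The square of an infinite set injects into the set, and if the larger factor is finite everything
  is.\<close>

lemma small_Times:
  assumes "small TYPE('u) A" "small TYPE('u) B"
  shows "small TYPE('u) (A \<times> B)"
proof -
  have main: "small TYPE('u) (A \<times> B)"
    if "A \<lesssim> B" "small TYPE('u) A" "small TYPE('u) B" for A :: "'x set" and B :: "'y set"
  proof (cases "finite B")
    case True
    then have "finite A"
      using that(1) by (meson eqpoll_finite_iff finite_lepoll_infinite lepoll_antisym)
    then show ?thesis
      using True by (simp add: small_finite)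
  next
    case False
    have "A \<times> B \<lesssim> B \<times> B"
      using that(1) by (simp add: times_lepoll_mono)
    also have "B \<times> B \<lesssim> B"
      by (rule infinite_Times_lepoll[OF False])
    finally show ?thesis
      using that(3) by (rule small_lepoll)
  qed
  show ?thesis
  proof (cases "A \<lesssim> B")
    case True
    then show ?thesis using main assms by blast
  next
    case False
    then have "small TYPE('u) (B \<times> A)"
      using main assms lepoll_linear by blast
    then show ?thesis
      by (rule small_lepoll[OF eqpoll_imp_lepoll[OF times_commute_eqpoll]])
  qed
qed

lemma small_UNION:
  fixes A :: "'i \<Rightarrow> 'u set"
  assumes "small TYPE('u) I" "\<And>i. i \<in> I \<Longrightarrow> small TYPE('u) (A i)"
  shows "small TYPE('u) (\<Union>i\<in>I. A i)"
proof -
  obtain e :: "'i \<Rightarrow> 'u" where e: "inj_on e I"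
    using small_inj[OF assms(1)] .
  have "small TYPE('u) (e ` I)"
    by (rule small_image[OF assms(1)])
  moreover have "\<forall>j\<in>e ` I. small TYPE('u) ((A \<circ> inv_into I e) j)"
    using assms(2) e by auto
  ultimately have "small TYPE('u) (\<Union>j\<in>e ` I. (A \<circ> inv_into I e) j)"
    using inacc unfolding inaccessible_def small_def by blast
  moreover have "(\<Union>j\<in>e ` I. (A \<circ> inv_into I e) j) = (\<Union>i\<in>I. A i)"
    using e by auto
  ultimately show ?thesis by simp
qed

text \<open>A function is coded by its graph, a subset of a small product. Extensionality of the
  members of \<open>PiE\<close> makes this coding injective.\<close>

lemma small_PiE:
  assumes "small TYPE('u) I" "small TYPE('u) (\<Union>i\<in>I. A i)"
  shows "small TYPE('u) (PiE I A)"
proof -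
  define gr where "gr f = {(i, f i) |i. i \<in> I}" for f :: "'a \<Rightarrow> 'b"
  have "inj_on gr (PiE I A)"
  proof (rule inj_onI)
    fix f g assume fg: "f \<in> PiE I A" "g \<in> PiE I A" and eq: "gr f = gr g"
    have "f i = g i" if "i \<in> I" for i
    proof -
      have "(i, f i) \<in> gr g"
        using eq that unfolding gr_def by blast
      then show ?thesis
        by (auto simp: gr_def)
    qed
    then show "f = g"
      using fg by (meson PiE_ext)
  qed
  moreover have "gr ` PiE I A \<subseteq> Pow (I \<times> (\<Union>i\<in>I. A i))"
    by (auto simp: gr_def)
  ultimately have "PiE I A \<lesssim> Pow (I \<times> (\<Union>i\<in>I. A i))"
    unfolding lepoll_def by blast
  then show ?thesis
    by (rule small_lepoll) (intro small_Pow small_Times assms)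
qed

end


section \<open>Categories and equivalences\<close>

lemma Hom_iff: "f \<in> Hom C X Y \<longleftrightarrow> f \<in> Arr C \<and> Dom C f = X \<and> Cod C f = Y"
  by (simp add: Hom_def)

lemma Arr_Hom: "f \<in> Arr C \<Longrightarrow> f \<in> Hom C (Dom C f) (Cod C f)"
  by (simp add: Hom_def)

lemma HomD:
  assumes "f \<in> Hom C X Y"
  shows "f \<in> Arr C" "Dom C f = X" "Cod C f = Y"
  using assms by (simp_all add: Hom_def)

context category
begin

lemma Hom_Obj:
  assumes "f \<in> Hom C X Y"
  shows "X \<in> Obj C" "Y \<in> Obj C"
  using assms Dom_in_Obj Cod_in_Obj by (auto simp: Hom_def)

lemma Comp_Arr:
  assumes "f \<in> Arr C" "g \<in> Arr C" "Dom C g = Cod C f"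
  shows "g \<cdot> f \<in> Arr C" "Dom C (g \<cdot> f) = Dom C f" "Cod C (g \<cdot> f) = Cod C g"
  using Comp_in_Hom[of f "Dom C f" "Cod C f" g "Cod C g"] assms by (auto simp: Hom_def)

lemma is_iso_iff:
  assumes "f \<in> Hom C X Y"
  shows "is_iso C f \<longleftrightarrow> (\<exists>g \<in> Hom C Y X. g \<cdot> f = Ident C X \<and> f \<cdot> g = Ident C Y)"
  using assms by (auto simp: is_iso_def Hom_def)

lemma is_iso_obtain:
  assumes "f \<in> Hom C X Y" "is_iso C f"
  obtains g where "g \<in> Hom C Y X" "g \<cdot> f = Ident C X" "f \<cdot> g = Ident C Y"
  using assms is_iso_iff by blast

end

section \<open>Functors and a criterion for equivalences\<close>

lemma is_functorD:
  assumes "is_functor C D F"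
  shows "category C" "category D"
    and "X \<in> Obj C \<Longrightarrow> FObj F X \<in> Obj D"
    and "f \<in> Hom C X Y \<Longrightarrow> FArr F f \<in> Hom D (FObj F X) (FObj F Y)"
    and "X \<in> Obj C \<Longrightarrow> FArr F (Ident C X) = Ident D (FObj F X)"
    and "f \<in> Hom C X Y \<Longrightarrow> g \<in> Hom C Y Z \<Longrightarrow>
      FArr F (g \<cdot>\<^bsub>C\<^esub> f) = FArr F g \<cdot>\<^bsub>D\<^esub> FArr F f"
  using assms unfolding is_functor_def Hom_def by auto

text \<open>The inverse functor chooses for each \<open>d\<close> an object \<open>c d\<close> with
  a mutually inverse pair \<open>e d\<close>, \<open>e' d\<close>, and sends \<open>g\<close> to the
  arrow whose \<open>F\<close>-image is the conjugate of \<open>g\<close> by this pair. Faithfulness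
  makes that arrow unique, so every equation in \<open>C\<close> is checked after applying
  \<open>F\<close>.\<close>

lemma is_equivalenceI:
  fixes C :: "('o1, 'm1) cat" and D :: "('o2, 'm2) cat"
  assumes F: "is_functor C D F"
    and full: "\<And>X Y g. X \<in> Obj C \<Longrightarrow> Y \<in> Obj C \<Longrightarrow> g \<in> Hom D (FObj F X) (FObj F Y) \<Longrightarrow>
      \<exists>f \<in> Hom C X Y. FArr F f = g"
    and faith: "\<And>X Y f f'. f \<in> Hom C X Y \<Longrightarrow> f' \<in> Hom C X Y \<Longrightarrow> FArr F f = FArr F f' \<Longrightarrow> f = f'"
    and es: "\<And>d. d \<in> Obj D \<Longrightarrow> \<exists>c \<in> Obj C. isomorphic D (FObj F c) d"
  shows "is_equivalence C D F"
proof -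
  interpret C: category C by (rule is_functorD(1)[OF F])
  interpret D: category D by (rule is_functorD(2)[OF F])
  note FO = is_functorD(3)[OF F] and FH = is_functorD(4)[OF F]
    and FI = is_functorD(5)[OF F] and FC = is_functorD(6)[OF F]
  have "\<forall>d\<in>Obj D. \<exists>c e e'. c \<in> Obj C \<and> e \<in> Hom D (FObj F c) d \<and> e' \<in> Hom D d (FObj F c) \<and>
      e' \<cdot>\<^bsub>D\<^esub> e = Ident D (FObj F c) \<and> e \<cdot>\<^bsub>D\<^esub> e' = Ident D d"
    using es unfolding isomorphic_def by (metis D.is_iso_obtain)
  then obtain c e e' where c: "\<And>d. d \<in> Obj D \<Longrightarrow> c d \<in> Obj C"
    and e: "\<And>d. d \<in> Obj D \<Longrightarrow> e d \<in> Hom D (FObj F (c d)) d"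
    and e': "\<And>d. d \<in> Obj D \<Longrightarrow> e' d \<in> Hom D d (FObj F (c d))"
    and e'e: "\<And>d. d \<in> Obj D \<Longrightarrow> e' d \<cdot>\<^bsub>D\<^esub> e d = Ident D (FObj F (c d))"
    and ee': "\<And>d. d \<in> Obj D \<Longrightarrow> e d \<cdot>\<^bsub>D\<^esub> e' d = Ident D d"
    by metis
  define G where "G = \<lparr>FObj = c, FArr = (\<lambda>g. SOME f. f \<in> Hom C (c (Dom D g)) (c (Cod D g)) \<and>
      FArr F f = e' (Cod D g) \<cdot>\<^bsub>D\<^esub> (g \<cdot>\<^bsub>D\<^esub> e (Dom D g)))\<rparr>"
  have GO: "FObj G d = c d" for d
    by (simp add: G_def)
  have mid: "e' Y \<cdot>\<^bsub>D\<^esub> (g \<cdot>\<^bsub>D\<^esub> e X) \<in> Hom D (FObj F (c X)) (FObj F (c Y))"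
    if "g \<in> Hom D X Y" for g X Y
    using D.Hom_Obj[OF that] that e e' D.Comp_in_Hom by meson
  have G: "FArr G g \<in> Hom C (c X) (c Y) \<and> FArr F (FArr G g) = e' Y \<cdot>\<^bsub>D\<^esub> (g \<cdot>\<^bsub>D\<^esub> e X)"
    if g: "g \<in> Hom D X Y" for g X Y
  proof -
    note O = D.Hom_Obj[OF g]
    have ex: "\<exists>f. f \<in> Hom C (c X) (c Y) \<and> FArr F f = e' Y \<cdot>\<^bsub>D\<^esub> (g \<cdot>\<^bsub>D\<^esub> e X)"
      using full[OF c[OF O(1)] c[OF O(2)] mid[OF g]] by blast
    have "FArr G g = (SOME f. f \<in> Hom C (c X) (c Y) \<and> FArr F f = e' Y \<cdot>\<^bsub>D\<^esub> (g \<cdot>\<^bsub>D\<^esub> e X))"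
      using HomD[OF g] by (simp add: G_def)
    with someI_ex[OF ex] show ?thesis by simp
  qed
  have G_unique: "f = FArr G g"
    if "g \<in> Hom D X Y" "f \<in> Hom C (c X) (c Y)" "FArr F f = e' Y \<cdot>\<^bsub>D\<^esub> (g \<cdot>\<^bsub>D\<^esub> e X)" for f g X Y
    using G[OF that(1)] that faith by metis
  \<comment> \<open>The square that says \<open>e\<close> is natural; it gives the counit at the end
    and is the computation behind functoriality of \<open>G\<close>.\<close>
  have eG: "e Y \<cdot>\<^bsub>D\<^esub> FArr F (FArr G g) = g \<cdot>\<^bsub>D\<^esub> e X" if g: "g \<in> Hom D X Y" for g X Y
  proof -
    note O = D.Hom_Obj[OF g]
    have ge: "g \<cdot>\<^bsub>D\<^esub> e X \<in> Hom D (FObj F (c X)) Y"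
      using D.Comp_in_Hom[OF e[OF O(1)] g] .
    have "e Y \<cdot>\<^bsub>D\<^esub> FArr F (FArr G g) = (e Y \<cdot>\<^bsub>D\<^esub> e' Y) \<cdot>\<^bsub>D\<^esub> (g \<cdot>\<^bsub>D\<^esub> e X)"
      using G[OF g] D.Comp_assoc[OF ge e'[OF O(2)] e[OF O(2)]] by simp
    then show ?thesis
      using ee'[OF O(2)] D.Ident_Comp[OF ge] by simp
  qed
  have GF: "is_functor D C G"
    unfolding is_functor_def
  proof (intro conjI ballI impI)
    show "category D" "category C" by (fact D.category_axioms C.category_axioms)+
    show "FObj G X \<in> Obj C" if "X \<in> Obj D" for X
      using c that by (simp add: GO)
    show "FArr G f \<in> Hom C (FObj G (Dom D f)) (FObj G (Cod D f))" if "f \<in> Arr D" for f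
      using G[OF Arr_Hom[OF that]] by (simp add: GO)
    show "FArr G (Ident D X) = Ident C (FObj G X)" if X: "X \<in> Obj D" for X
    proof (rule G_unique[symmetric, where X=X and Y=X])
      show "Ident D X \<in> Hom D X X" using D.Ident_in_Hom X .
      show "Ident C (FObj G X) \<in> Hom C (c X) (c X)" using C.Ident_in_Hom c X by (simp add: GO)
      show "FArr F (Ident C (FObj G X)) = e' X \<cdot>\<^bsub>D\<^esub> (Ident D X \<cdot>\<^bsub>D\<^esub> e X)"
        using FI[OF c[OF X]] e'e[OF X] D.Ident_Comp[OF e[OF X]] by (simp add: GO)
    qed
    show "FArr G (g \<cdot>\<^bsub>D\<^esub> f) = FArr G g \<cdot>\<^bsub>C\<^esub> FArr G f"
      if fg: "f \<in> Arr D" "g \<in> Arr D" "Dom D g = Cod D f" for f g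
    proof -
      obtain X Y Z where f: "f \<in> Hom D X Y" and g: "g \<in> Hom D Y Z"
        using fg by (metis Arr_Hom)
      note O = D.Hom_Obj[OF f] D.Hom_Obj[OF g]
      have Gf: "FArr G f \<in> Hom C (c X) (c Y)" and Gg: "FArr G g \<in> Hom C (c Y) (c Z)"
        using G f g by auto
      have fe: "f \<cdot>\<^bsub>D\<^esub> e X \<in> Hom D (FObj F (c X)) Y" and ge: "g \<cdot>\<^bsub>D\<^esub> e Y \<in> Hom D (FObj F (c Y)) Z"
        using D.Comp_in_Hom[OF e[OF O(1)] f] D.Comp_in_Hom[OF e[OF O(2)] g] .
      have "FArr F (FArr G g \<cdot>\<^bsub>C\<^esub> FArr G f) = (e' Z \<cdot>\<^bsub>D\<^esub> (g \<cdot>\<^bsub>D\<^esub> e Y)) \<cdot>\<^bsub>D\<^esub> FArr F (FArr G f)"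
        using FC[OF Gf Gg] G[OF g] by simp
      also have "\<dots> = e' Z \<cdot>\<^bsub>D\<^esub> ((g \<cdot>\<^bsub>D\<^esub> e Y) \<cdot>\<^bsub>D\<^esub> FArr F (FArr G f))"
        using D.Comp_assoc[OF FH[OF Gf] ge e'[OF O(4)]] .
      also have "(g \<cdot>\<^bsub>D\<^esub> e Y) \<cdot>\<^bsub>D\<^esub> FArr F (FArr G f) = g \<cdot>\<^bsub>D\<^esub> (f \<cdot>\<^bsub>D\<^esub> e X)"
        using D.Comp_assoc[OF FH[OF Gf] e[OF O(2)] g] eG[OF f] by simp
      also have "\<dots> = (g \<cdot>\<^bsub>D\<^esub> f) \<cdot>\<^bsub>D\<^esub> e X"
        using D.Comp_assoc[OF e[OF O(1)] f g] by simp
      finally show ?thesis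
        by (intro G_unique[symmetric, where X=X and Y=Z] D.Comp_in_Hom[OF f g] C.Comp_in_Hom[OF Gf Gg])
    qed
  qed
  \<comment> \<open>The unit is forced by the triangle identity: its image under \<open>F\<close>
    has to be the inverse of the counit at \<open>FObj F X\<close>.\<close>
  have "\<forall>X\<in>Obj C. \<exists>t. t \<in> Hom C X (c (FObj F X)) \<and> FArr F t = e' (FObj F X)"
    using full c FO e' by meson
  then obtain \<eta> where \<eta>: "\<And>X. X \<in> Obj C \<Longrightarrow> \<eta> X \<in> Hom C X (c (FObj F X))"
    and F\<eta>: "\<And>X. X \<in> Obj C \<Longrightarrow> FArr F (\<eta> X) = e' (FObj F X)"
    by metis
  have \<eta>iso: "is_iso C (\<eta> X)" if X: "X \<in> Obj C" for X
  proof -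
    obtain t where t: "t \<in> Hom C (c (FObj F X)) X" and Ft: "FArr F t = e (FObj F X)"
      using full[OF c[OF FO[OF X]] X e[OF FO[OF X]]] by blast
    have "t \<cdot>\<^bsub>C\<^esub> \<eta> X = Ident C X"
      by (rule faith[OF C.Comp_in_Hom[OF \<eta>[OF X] t] C.Ident_in_Hom[OF X]])
        (simp add: FC[OF \<eta>[OF X] t] F\<eta>[OF X] Ft ee' FO X FI)
    moreover have "\<eta> X \<cdot>\<^bsub>C\<^esub> t = Ident C (c (FObj F X))"
      by (rule faith[OF C.Comp_in_Hom[OF t \<eta>[OF X]] C.Ident_in_Hom[OF c[OF FO[OF X]]]])
        (simp add: FC[OF t \<eta>[OF X]] F\<eta>[OF X] Ft e'e FO X FI c)
    ultimately show ?thesis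
      using C.is_iso_iff[OF \<eta>[OF X]] t by blast
  qed
  have idC: "is_functor C C id_functor" and idD: "is_functor D D id_functor"
    using C.category_axioms D.category_axioms C.Ident_in_Hom D.Ident_in_Hom
    by (auto simp: is_functor_def id_functor_def Hom_def)
  have GFF: "is_functor C C (comp_functor G F)"
    unfolding is_functor_def comp_functor_def
  proof (simp, intro conjI ballI impI)
    show "category C" by (fact C.category_axioms)
    show "FObj G (FObj F X) \<in> Obj C" if "X \<in> Obj C" for X
      using that c FO by (simp add: GO)
    show "FArr G (FArr F f) \<in> Hom C (FObj G (FObj F (Dom C f))) (FObj G (FObj F (Cod C f)))"
      if "f \<in> Arr C" for f
      using is_functorD(4)[OF GF FH[OF Arr_Hom[OF that]]] .
    show "FArr G (FArr F (Ident C X)) = Ident C (FObj G (FObj F X))" if "X \<in> Obj C" for X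
      using FI[OF that] is_functorD(5)[OF GF FO[OF that]] by simp
    show "FArr G (FArr F (g \<cdot>\<^bsub>C\<^esub> f)) = FArr G (FArr F g) \<cdot>\<^bsub>C\<^esub> FArr G (FArr F f)"
      if "f \<in> Arr C" "g \<in> Arr C" "Dom C g = Cod C f" for f g
      using FC[of f _ _ g] FH is_functorD(6)[OF GF FH FH] that
      by (metis Arr_Hom)
  qed
  have FGF: "is_functor D D (comp_functor F G)"
    unfolding is_functor_def comp_functor_def
  proof (simp, intro conjI ballI impI)
    show "category D" by (fact D.category_axioms)
    show "FObj F (FObj G X) \<in> Obj D" if "X \<in> Obj D" for X
      using that c FO by (simp add: GO)
    show "FArr F (FArr G f) \<in> Hom D (FObj F (FObj G (Dom D f))) (FObj F (FObj G (Cod D f)))"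
      if "f \<in> Arr D" for f
      using FH[OF is_functorD(4)[OF GF Arr_Hom[OF that]]] .
    show "FArr F (FArr G (Ident D X)) = Ident D (FObj F (FObj G X))" if "X \<in> Obj D" for X
      using is_functorD(5)[OF GF that] FI c that by (simp add: GO)
    show "FArr F (FArr G (g \<cdot>\<^bsub>D\<^esub> f)) = FArr F (FArr G g) \<cdot>\<^bsub>D\<^esub> FArr F (FArr G f)"
      if "f \<in> Arr D" "g \<in> Arr D" "Dom D g = Cod D f" for f g
      using is_functorD(6)[OF GF, of f _ _ g] is_functorD(4)[OF GF] FC that
      by (metis Arr_Hom)
  qed
  have "natural_iso C C id_functor (comp_functor G F) \<eta>"
    unfolding natural_iso_def
  proof (intro conjI ballI idC GFF)
    show "\<eta> X \<in> Hom C (FObj id_functor X) (FObj (comp_functor G F) X)" if "X \<in> Obj C" for X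
      using \<eta>[OF that] by (simp add: id_functor_def comp_functor_def GO)
    show "is_iso C (\<eta> X)" if "X \<in> Obj C" for X
      by (rule \<eta>iso[OF that])
    show "\<eta> (Cod C f) \<cdot>\<^bsub>C\<^esub> FArr id_functor f = FArr (comp_functor G F) f \<cdot>\<^bsub>C\<^esub> \<eta> (Dom C f)"
      if f: "f \<in> Arr C" for f
    proof -
      obtain X Y where f: "f \<in> Hom C X Y"
        using f by (auto simp: Hom_def)
      note O = C.Hom_Obj[OF f] and Ff = FH[OF f]
      have GFf: "FArr G (FArr F f) \<in> Hom C (c (FObj F X)) (c (FObj F Y))"
        using G[OF Ff] by blast
      have Ffe: "FArr F f \<cdot>\<^bsub>D\<^esub> e (FObj F X) \<in> Hom D (FObj F (c (FObj F X))) (FObj F Y)"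
        using D.Comp_in_Hom[OF e Ff] FO O by blast
      have "FArr F (FArr G (FArr F f) \<cdot>\<^bsub>C\<^esub> \<eta> X)
          = (e' (FObj F Y) \<cdot>\<^bsub>D\<^esub> (FArr F f \<cdot>\<^bsub>D\<^esub> e (FObj F X))) \<cdot>\<^bsub>D\<^esub> e' (FObj F X)"
        using FC[OF \<eta>[OF O(1)] GFf] G[OF Ff] F\<eta>[OF O(1)] by simp
      also have "\<dots> = e' (FObj F Y) \<cdot>\<^bsub>D\<^esub> ((FArr F f \<cdot>\<^bsub>D\<^esub> e (FObj F X)) \<cdot>\<^bsub>D\<^esub> e' (FObj F X))"
        using D.Comp_assoc[OF e'[OF FO[OF O(1)]] Ffe e'[OF FO[OF O(2)]]] .
      also have "(FArr F f \<cdot>\<^bsub>D\<^esub> e (FObj F X)) \<cdot>\<^bsub>D\<^esub> e' (FObj F X) = FArr F f"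
        using D.Comp_assoc[OF e'[OF FO[OF O(1)]] e[OF FO[OF O(1)]] Ff] ee' FO O D.Comp_Ident[OF Ff] by simp
      also have "e' (FObj F Y) \<cdot>\<^bsub>D\<^esub> FArr F f = FArr F (\<eta> Y \<cdot>\<^bsub>C\<^esub> f)"
        using FC[OF f \<eta>[OF O(2)]] F\<eta>[OF O(2)] by simp
      finally have "\<eta> Y \<cdot>\<^bsub>C\<^esub> f = FArr G (FArr F f) \<cdot>\<^bsub>C\<^esub> \<eta> X"
        using faith[OF C.Comp_in_Hom[OF f \<eta>[OF O(2)]] C.Comp_in_Hom[OF \<eta>[OF O(1)] GFf]] by simp
      then show ?thesis
        using HomD[OF f] by (simp add: id_functor_def comp_functor_def)
    qed
  qed
  moreover have "natural_iso D D (comp_functor F G) id_functor e"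
    unfolding natural_iso_def
  proof (intro conjI ballI idD FGF)
    show "e X \<in> Hom D (FObj (comp_functor F G) X) (FObj id_functor X)" if "X \<in> Obj D" for X
      using e[OF that] by (simp add: id_functor_def comp_functor_def GO)
    show "is_iso D (e X)" if "X \<in> Obj D" for X
      using D.is_iso_iff[OF e[OF that]] e' e'e ee' that by blast
    show "e (Cod D f) \<cdot>\<^bsub>D\<^esub> FArr (comp_functor F G) f = FArr id_functor f \<cdot>\<^bsub>D\<^esub> e (Dom D f)"
      if "f \<in> Arr D" for f
      using eG[OF Arr_Hom[OF that]] by (simp add: id_functor_def comp_functor_def)
  qed
  ultimately show ?thesis
    unfolding is_equivalence_def using F GF by blast
qed

lemma category_product_cat:
  assumes "category C" "category D"
  shows "category (product_cat C D)"
proof -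
  interpret C: category C by fact
  interpret D: category D by fact
  show ?thesis
    by unfold_locales
      (auto simp: product_cat_def Hom_def C.Dom_in_Obj C.Cod_in_Obj D.Dom_in_Obj D.Cod_in_Obj
        C.Comp_Arr D.Comp_Arr
        intro: C.Comp_Ident C.Ident_Comp D.Comp_Ident D.Ident_Comp C.Comp_assoc D.Comp_assoc
        dest: C.Ident_in_Hom[unfolded Hom_def] D.Ident_in_Hom[unfolded Hom_def])
qed

lemma (in category) category_slice_cat: "category (slice_cat C X)"
proof
  fix f assume "f \<in> Arr (slice_cat C X)"
  then show "Dom (slice_cat C X) f \<in> Obj (slice_cat C X)" "Cod (slice_cat C X) f \<in> Obj (slice_cat C X)"
    by (auto simp: slice_cat_def)
next
  fix p assume "p \<in> Obj (slice_cat C X)"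
  then have p: "p \<in> Arr C" "Cod C p = X"
    by (auto simp: slice_cat_def)
  then have "p \<cdot> Ident C (Dom C p) = p"
    using Comp_Ident[OF Arr_Hom] by blast
  then show "Ident (slice_cat C X) p \<in> Hom (slice_cat C X) p p"
    using p Ident_in_Hom[OF Dom_in_Obj] by (auto simp: slice_cat_def Hom_def)
next
  fix f g p q r assume "f \<in> Hom (slice_cat C X) p q" "g \<in> Hom (slice_cat C X) q r"
  then obtain h k where f: "f = (p, h, q)" "h \<in> Hom C (Dom C p) (Dom C q)" "q \<cdot> h = p"
    and g: "g = (q, k, r)" "k \<in> Hom C (Dom C q) (Dom C r)" "r \<cdot> k = q"
    and pqr: "p \<in> Arr C" "q \<in> Arr C" "r \<in> Arr C" "Cod C p = X" "Cod C q = X" "Cod C r = X"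
    by (auto simp: slice_cat_def Hom_def)
  have "r \<cdot> (k \<cdot> h) = p"
    using Comp_assoc[OF f(2) g(2) Arr_Hom[OF pqr(3)]] f g by simp
  then show "g \<cdot>\<^bsub>slice_cat C X\<^esub> f \<in> Hom (slice_cat C X) p r"
    using Comp_in_Hom[OF f(2) g(2)] f(1) g(1) pqr by (auto simp: slice_cat_def Hom_def)
next
  fix f p q assume "f \<in> Hom (slice_cat C X) p q"
  then obtain h where f: "f = (p, h, q)" "h \<in> Hom C (Dom C p) (Dom C q)"
    by (auto simp: slice_cat_def Hom_def)
  then show "f \<cdot>\<^bsub>slice_cat C X\<^esub> Ident (slice_cat C X) p = f"
    "Ident (slice_cat C X) q \<cdot>\<^bsub>slice_cat C X\<^esub> f = f"
    using Comp_Ident[OF f(2)] Ident_Comp[OF f(2)] by (auto simp: slice_cat_def)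
next
  fix f g h p q r s
  assume "f \<in> Hom (slice_cat C X) p q" "g \<in> Hom (slice_cat C X) q r" "h \<in> Hom (slice_cat C X) r s"
  then obtain i j k where "f = (p, i, q)" "i \<in> Hom C (Dom C p) (Dom C q)"
    "g = (q, j, r)" "j \<in> Hom C (Dom C q) (Dom C r)" "h = (r, k, s)" "k \<in> Hom C (Dom C r) (Dom C s)"
    by (auto simp: slice_cat_def Hom_def)
  then show "(h \<cdot>\<^bsub>slice_cat C X\<^esub> g) \<cdot>\<^bsub>slice_cat C X\<^esub> f = h \<cdot>\<^bsub>slice_cat C X\<^esub> (g \<cdot>\<^bsub>slice_cat C X\<^esub> f)"
    using Comp_assoc by (auto simp: slice_cat_def)
qed

lemma category_Set_cat: "category (Set_cat U)"
proof -
  have [simp]: "compose A g (\<lambda>x\<in>A. x) = g" if "g \<in> A \<rightarrow>\<^sub>E B" for A B and g :: "'x \<Rightarrow> 'x"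
    using that by (auto simp: compose_def fun_eq_iff PiE_def extensional_def)
  have [simp]: "compose A (\<lambda>x\<in>B. x) g = g" if "g \<in> A \<rightarrow>\<^sub>E B" for A B and g :: "'x \<Rightarrow> 'x"
    using that by (auto simp: compose_def fun_eq_iff PiE_def Pi_def extensional_def)
  show ?thesis
    by unfold_locales
      (fastforce simp: Set_cat_def Hom_def compose_def fun_eq_iff extensional_def PiE_iff)+
qed


section \<open>Subobjects and pullbacks\<close>

text \<open>For monic \<open>m\<close> this is the class of \<open>m\<close> under
  \<open>sub_equiv\<close>, written without the quotient so that subobjects can be handled through a
  representative.\<close>

definition subobj :: "('o, 'm) cat \<Rightarrow> 'm \<Rightarrow> 'm set" where
  "subobj C m = {n. monic C n \<and> Cod C n = Cod C m \<and> factors_through C m n \<and> factors_through C n m}"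

lemma monicD:
  "monic C m \<Longrightarrow> a \<in> Hom C W (Dom C m) \<Longrightarrow> b \<in> Hom C W (Dom C m) \<Longrightarrow>
    m \<cdot>\<^bsub>C\<^esub> a = m \<cdot>\<^bsub>C\<^esub> b \<Longrightarrow> a = b"
  unfolding monic_def by blast

lemma monic_Arr: "monic C m \<Longrightarrow> m \<in> Arr C"
  unfolding monic_def by blast

lemma monic_Hom: "monic C m \<Longrightarrow> Cod C m = X \<Longrightarrow> m \<in> Hom C (Dom C m) X"
  by (simp add: Hom_iff monic_Arr)

context category
begin

section \<open>Factorisation and the order on subobjects\<close>

lemma factors_refl: "f \<in> Arr C \<Longrightarrow> factors_through C f f"
  unfolding factors_through_def
  using Comp_Ident[OF Arr_Hom] Ident_in_Hom[OF Dom_in_Obj] by metis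

lemma factors_trans:
  assumes "factors_through C f m" "factors_through C m n" "n \<in> Arr C"
  shows "factors_through C f n"
proof -
  obtain h k where h: "h \<in> Hom C (Dom C f) (Dom C m)" "f = m \<cdot> h"
    and k: "k \<in> Hom C (Dom C m) (Dom C n)" "m = n \<cdot> k"
    using assms unfolding factors_through_def by blast
  have "f = n \<cdot> (k \<cdot> h)"
    using Comp_assoc[OF h(1) k(1) Arr_Hom[OF assms(3)]] h(2) k(2) by simp
  then show ?thesis
    unfolding factors_through_def using Comp_in_Hom[OF h(1) k(1)] by blast
qed

lemma factors_Comp:
  assumes "f \<in> Hom C X Y" "m \<in> Hom C Y Z"
  shows "factors_through C (m \<cdot> f) m"
  unfolding factors_through_def using assms HomD[OF Comp_in_Hom[OF assms]] HomD[OF assms(2)]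
    by auto

lemma Ident_monic: "X \<in> Obj C \<Longrightarrow> monic C (Ident C X)"
  unfolding monic_def using Ident_in_Hom Ident_Comp by (metis HomD(1,2))

lemma factors_Ident: "f \<in> Hom C Y X \<Longrightarrow> factors_through C f (Ident C X)"
  unfolding factors_through_def using Ident_in_Hom Ident_Comp Hom_Obj by (metis HomD(2))

lemma carrier_Sub: "carrier (Sub C X) = subobj C ` monos_into C X"
proof -
  have "sub_equiv C X `` {m} = subobj C m" if "m \<in> monos_into C X" for m
    using that by (auto simp: sub_equiv_def subobj_def monos_into_def)
  then show ?thesis
    by (auto simp: Sub_def quotient_def image_iff)
qed

lemma subobj_closed: "monic C m \<Longrightarrow> Cod C m = X \<Longrightarrow> subobj C m \<in> carrier (Sub C X)"
  unfolding carrier_Sub by (simp add: monos_into_def)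

lemma Sub_obtain:
  assumes "S \<in> carrier (Sub C X)"
  obtains m where "monic C m" "Cod C m = X" "S = subobj C m"
  using assms unfolding carrier_Sub monos_into_def by blast

lemma mem_subobj_self: "monic C m \<Longrightarrow> m \<in> subobj C m"
  using factors_refl[OF monic_Arr[of C m]] by (simp add: subobj_def)

text \<open>The order on classes asks for some pair of representatives. Members of one class factor
  through each other, so transitivity carries the factorisation to any other pair.\<close>

lemma le_Sub:
  assumes "monic C m" "monic C n"
  shows "subobj C m \<sqsubseteq>\<^bsub>Sub C X\<^esub> subobj C n \<longleftrightarrow> factors_through C m n"
proof
  assume "subobj C m \<sqsubseteq>\<^bsub>Sub C X\<^esub> subobj C n"
  then obtain m' n' where "m' \<in> subobj C m" "n' \<in> subobj C n" "factors_through C m' n'"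
    by (auto simp: Sub_def)
  then show "factors_through C m n"
    using factors_trans[OF _ factors_trans[OF _ _ monic_Arr[OF assms(2)]] monic_Arr[OF assms(2)], of m m' n']
    by (simp add: subobj_def)
next
  assume "factors_through C m n"
  then show "subobj C m \<sqsubseteq>\<^bsub>Sub C X\<^esub> subobj C n"
    using mem_subobj_self assms by (auto simp: Sub_def)
qed

lemma subobj_eq_iff:
  assumes "monic C m" "monic C n" "Cod C m = Cod C n"
  shows "subobj C m = subobj C n \<longleftrightarrow> factors_through C m n \<and> factors_through C n m"
proof
  assume "subobj C m = subobj C n"
  then show "factors_through C m n \<and> factors_through C n m"
    using mem_subobj_self[OF assms(1)] by (auto simp: subobj_def)
next
  assume "factors_through C m n \<and> factors_through C n m"
  then show "subobj C m = subobj C n"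
    using factors_trans[OF _ _ monic_Arr] assms by (auto simp: subobj_def)
qed

lemma ex_subobj_factors_iff:
  assumes m: "monic C m"
  shows "(\<exists>n \<in> subobj C m. factors_through C f n) \<longleftrightarrow> factors_through C f m"
proof
  assume "\<exists>n \<in> subobj C m. factors_through C f n"
  then obtain n where "factors_through C n m" "factors_through C f n"
    unfolding subobj_def by blast
  then show "factors_through C f m"
    using factors_trans[OF _ _ monic_Arr[OF m]] by blast
next
  assume "factors_through C f m"
  then show "\<exists>n \<in> subobj C m. factors_through C f n"
    using mem_subobj_self[OF m] by blast
qed

text \<open>Turns a least element among classes into a universal property of a representing mono,
  the form in which stability of images is used later.\<close>

lemma is_image_subobj_iff:
  assumes f: "f \<in> Arr C" and m: "monic C m" "Cod C m = Cod C f"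
  shows "is_image C f (subobj C m) \<longleftrightarrow> factors_through C f m \<and>
    (\<forall>n. monic C n \<longrightarrow> Cod C n = Cod C f \<longrightarrow> factors_through C f n \<longrightarrow> factors_through C m n)"
proof -
  define A where "A = {n. monic C n \<and> Cod C n = Cod C f \<and> factors_through C f n}"
  have set: "{T \<in> carrier (Sub C (Cod C f)). \<exists>k \<in> T. factors_through C f k} = subobj C ` A"
    using ex_subobj_factors_iff by (auto simp: carrier_Sub monos_into_def A_def)
  have "subobj C m \<in> subobj C ` A \<longleftrightarrow> factors_through C f m"
  proof
    assume "subobj C m \<in> subobj C ` A"
    then obtain n where n: "n \<in> A" "subobj C m = subobj C n" by blast
    then have "factors_through C n m"
      using subobj_eq_iff[OF m(1), of n] m(2) by (auto simp: A_def)
    then show "factors_through C f m"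
      using n(1) factors_trans[OF _ _ monic_Arr[OF m(1)]] by (auto simp: A_def)
  qed (use m in \<open>auto simp: A_def\<close>)
  moreover have "(\<forall>T\<in>subobj C ` A. subobj C m \<sqsubseteq>\<^bsub>Sub C (Cod C f)\<^esub> T) \<longleftrightarrow>
      (\<forall>n\<in>A. factors_through C m n)"
    using le_Sub[OF m(1)] by (auto simp: A_def)
  moreover have "subobj C ` A \<subseteq> carrier (Sub C (Cod C f))"
    by (auto simp: A_def subobj_closed)
  ultimately show ?thesis
    unfolding is_image_def least_def set by (auto simp: A_def)
qed

lemma split_monic_iso:
  assumes "monic C m" "m \<in> Hom C X Y" "k \<in> Hom C Y X" "m \<cdot> k = Ident C Y"
  shows "k \<cdot> m = Ident C X"
proof (rule monicD[OF assms(1)])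
  show "k \<cdot> m \<in> Hom C X (Dom C m)" "Ident C X \<in> Hom C X (Dom C m)"
    using Comp_in_Hom[OF assms(2,3)] HomD[OF assms(2)] Ident_in_Hom Hom_Obj[OF assms(2)] by auto
  have "m \<cdot> (k \<cdot> m) = Ident C Y \<cdot> m"
    using Comp_assoc[OF assms(2,3,2)] assms(4) by simp
  then show "m \<cdot> (k \<cdot> m) = m \<cdot> Ident C X"
    using Ident_Comp[OF assms(2)] Comp_Ident[OF assms(2)] by simp
qed

section \<open>Pullbacks and inverse images of subobjects\<close>

lemma is_pullbackD:
  assumes "is_pullback C f g p q"
  shows "p \<in> Hom C (Dom C p) (Dom C f)" "q \<in> Hom C (Dom C p) (Dom C g)"
    "f \<in> Hom C (Dom C f) (Cod C f)" "g \<in> Hom C (Dom C g) (Cod C f)" "f \<cdot> p = g \<cdot> q"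
    "a \<in> Hom C W (Dom C f) \<Longrightarrow> b \<in> Hom C W (Dom C g) \<Longrightarrow> f \<cdot> a = g \<cdot> b \<Longrightarrow>
       \<exists>h. h \<in> Hom C W (Dom C p) \<and> p \<cdot> h = a \<and> q \<cdot> h = b"
proof -
  note pb = assms[unfolded is_pullback_def]
  show "p \<in> Hom C (Dom C p) (Dom C f)" "q \<in> Hom C (Dom C p) (Dom C g)"
    "f \<in> Hom C (Dom C f) (Cod C f)" "g \<in> Hom C (Dom C g) (Cod C f)" "f \<cdot> p = g \<cdot> q"
    using pb by (simp_all add: Hom_iff)
  assume "a \<in> Hom C W (Dom C f)" "b \<in> Hom C W (Dom C g)" "f \<cdot> a = g \<cdot> b"
  then show "\<exists>h. h \<in> Hom C W (Dom C p) \<and> p \<cdot> h = a \<and> q \<cdot> h = b"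
    using pb by (meson ex1_implies_ex)
qed

lemma is_pullback_unique:
  assumes pb: "is_pullback C f g p q" and h: "h \<in> Hom C W (Dom C p)" "k \<in> Hom C W (Dom C p)"
    and eq: "p \<cdot> h = p \<cdot> k" "q \<cdot> h = q \<cdot> k"
  shows "h = k"
proof -
  note D = is_pullbackD(1-5)[OF pb]
  have a: "p \<cdot> h \<in> Hom C W (Dom C f)" and b: "q \<cdot> h \<in> Hom C W (Dom C g)"
    using Comp_in_Hom[OF h(1)] D by auto
  have "f \<cdot> (p \<cdot> h) = g \<cdot> (q \<cdot> h)"
    using Comp_assoc[OF h(1) D(1,3)] Comp_assoc[OF h(1) D(2,4)] D(5) by simp
  then have "\<exists>!l. l \<in> Hom C W (Dom C p) \<and> p \<cdot> l = p \<cdot> h \<and> q \<cdot> l = q \<cdot> h"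
    using pb a b unfolding is_pullback_def by blast
  then show ?thesis using h eq by metis
qed

lemma is_pullbackI:
  assumes "p \<in> Hom C P X" "q \<in> Hom C P Y" "f \<in> Hom C X Z" "g \<in> Hom C Y Z" "f \<cdot> p = g \<cdot> q"
    and "\<And>W a b. a \<in> Hom C W X \<Longrightarrow> b \<in> Hom C W Y \<Longrightarrow> f \<cdot> a = g \<cdot> b \<Longrightarrow>
       \<exists>h. h \<in> Hom C W P \<and> p \<cdot> h = a \<and> q \<cdot> h = b"
    and "\<And>W h k. h \<in> Hom C W P \<Longrightarrow> k \<in> Hom C W P \<Longrightarrow> p \<cdot> h = p \<cdot> k \<Longrightarrow> q \<cdot> h = q \<cdot> k \<Longrightarrow> h = k"
  shows "is_pullback C f g p q"
  unfolding is_pullback_def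
proof (intro conjI allI ballI impI)
  fix W a b assume "a \<in> Hom C W (Dom C f)" "b \<in> Hom C W (Dom C g)" "f \<cdot> a = g \<cdot> b"
  then have "a \<in> Hom C W X" "b \<in> Hom C W Y" "f \<cdot> a = g \<cdot> b"
    using HomD(2)[OF assms(3)] HomD(2)[OF assms(4)] by auto
  from assms(6)[OF this] obtain h where "h \<in> Hom C W P \<and> p \<cdot> h = a \<and> q \<cdot> h = b"
    by blast
  then show "\<exists>!h. h \<in> Hom C W (Dom C p) \<and> p \<cdot> h = a \<and> q \<cdot> h = b"
    using assms(7) HomD(2)[OF assms(1)] by (metis (no_types, lifting))
qed (use HomD[OF assms(1)] HomD[OF assms(2)] HomD[OF assms(3)] HomD[OF assms(4)] assms(5) in simp_all)

lemma pullback_monic: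
  assumes pb: "is_pullback C f n m q" and n: "monic C n"
  shows "monic C m"
  unfolding monic_def
proof (intro conjI allI ballI impI)
  note D = is_pullbackD(1-5)[OF pb]
  show "m \<in> Arr C" using HomD(1)[OF D(1)] .
  fix W a b assume a: "a \<in> Hom C W (Dom C m)" and b: "b \<in> Hom C W (Dom C m)" and eq: "m \<cdot> a = m \<cdot> b"
  have "n \<cdot> (q \<cdot> a) = f \<cdot> (m \<cdot> a)"
    using Comp_assoc[OF a D(2,4)] Comp_assoc[OF a D(1,3)] D(5) by simp
  also have "\<dots> = n \<cdot> (q \<cdot> b)"
    using Comp_assoc[OF b D(2,4)] Comp_assoc[OF b D(1,3)] D(5) eq by simp
  finally have "q \<cdot> a = q \<cdot> b"
    using monicD[OF n] Comp_in_Hom[OF a D(2)] Comp_in_Hom[OF b D(2)] by blast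
  then show "a = b"
    using is_pullback_unique[OF pb a b eq] by blast
qed

text \<open>With \<open>g\<close> read as a generalised element of the domain of \<open>f\<close>,
  this is the membership rule for the inverse image of \<open>n\<close>. Later facts about pulled
  back subobjects mostly go through it instead of the universal property.\<close>

lemma factors_pullback:
  assumes pb: "is_pullback C f n m q" and g: "g \<in> Hom C W (Dom C f)"
  shows "factors_through C g m \<longleftrightarrow> factors_through C (f \<cdot> g) n"
proof -
  note D = is_pullbackD(1-5)[OF pb]
  note Dg = HomD[OF g] and Dfg = HomD[OF Comp_in_Hom[OF g D(3)]]
  show ?thesis
  proof
    assume "factors_through C g m"
    then obtain h where h: "h \<in> Hom C W (Dom C m)" "g = m \<cdot> h"
      unfolding factors_through_def using Dg by auto
    have "f \<cdot> g = n \<cdot> (q \<cdot> h)"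
      using Comp_assoc[OF h(1) D(1,3)] Comp_assoc[OF h(1) D(2,4)] D(5) h(2) by simp
    then show "factors_through C (f \<cdot> g) n"
      unfolding factors_through_def using Comp_in_Hom[OF h(1) D(2)] Dfg by auto
  next
    assume "factors_through C (f \<cdot> g) n"
    then obtain k where k: "k \<in> Hom C W (Dom C n)" "f \<cdot> g = n \<cdot> k"
      unfolding factors_through_def using Dfg by auto
    then show "factors_through C g m"
      unfolding factors_through_def using is_pullbackD(6)[OF pb g k(1)] Dg by auto
  qed
qed

text \<open>Pullbacks of equivalent monos factor through each other by the membership rule.
  Conversely, a mono \<open>m'\<close> equivalent to \<open>m\<close> is itself a pullback of
  \<open>n\<close>: its second leg is \<open>q\<close> precomposed with the comparison
  \<open>k\<close> from \<open>m'\<close> to \<open>m\<close>.\<close>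

lemma sub_pullback_subobj:
  assumes pb: "is_pullback C f n m q" and n: "monic C n"
  shows "sub_pullback C f (subobj C n) = subobj C m"
proof
  note D = is_pullbackD(1-5)[OF pb] and mm = pullback_monic[OF pb n]
  note mD = HomD[OF D(1)]
  show "sub_pullback C f (subobj C n) \<subseteq> subobj C m"
  proof
    fix m' assume "m' \<in> sub_pullback C f (subobj C n)"
    then obtain n' q' where n': "n' \<in> subobj C n" and pb': "is_pullback C f n' m' q'"
      unfolding sub_pullback_def by blast
    have n'n: "monic C n'" "factors_through C n' n" "factors_through C n n'"
      using n' unfolding subobj_def by auto
    note D' = is_pullbackD(1-5)[OF pb'] and mm' = pullback_monic[OF pb' n'n(1)]
    have "factors_through C m' m"
      unfolding factors_pullback[OF pb D'(1)]
      unfolding D'(5)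
      using factors_trans[OF factors_Comp[OF D'(2,4)] n'n(2) monic_Arr[OF n]] .
    moreover have "factors_through C m m'"
      unfolding factors_pullback[OF pb' D(1)]
      unfolding D(5)
      using factors_trans[OF factors_Comp[OF D(2,4)] n'n(3) monic_Arr[OF n'n(1)]] .
    ultimately show "m' \<in> subobj C m"
      unfolding subobj_def using mm' HomD(3)[OF D'(1)] HomD(3)[OF D(1)] by simp
  qed
  show "subobj C m \<subseteq> sub_pullback C f (subobj C n)"
  proof
    fix m' assume "m' \<in> subobj C m"
    then have m': "monic C m'" "Cod C m' = Dom C f"
      and ff: "factors_through C m m'" "factors_through C m' m"
      unfolding subobj_def using mD(3) by simp_all
    obtain k where k: "k \<in> Hom C (Dom C m') (Dom C m)" "m' = m \<cdot> k"
      using ff(2) unfolding factors_through_def by blast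
    obtain l where l: "l \<in> Hom C (Dom C m) (Dom C m')" "m = m' \<cdot> l"
      using ff(1) unfolding factors_through_def by blast
    have hm': "m' \<in> Hom C (Dom C m') (Dom C f)"
      using m' monic_Arr[OF m'(1)] by (simp add: Hom_iff)
    have "m \<cdot> (k \<cdot> l) = m \<cdot> Ident C (Dom C m)"
      using Comp_assoc[OF l(1) k(1) D(1)] k(2)[symmetric] l(2)[symmetric] Comp_Ident[OF D(1)] by simp
    then have kl: "k \<cdot> l = Ident C (Dom C m)"
      using monicD[OF mm Comp_in_Hom[OF l(1) k(1)] Ident_in_Hom] Dom_in_Obj mD(1) by blast
    have "is_pullback C f n m' (q \<cdot> k)"
    proof (rule is_pullbackI[OF hm' Comp_in_Hom[OF k(1) D(2)] D(3,4)])
      show "f \<cdot> m' = n \<cdot> (q \<cdot> k)"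
        using Comp_assoc[OF k(1) D(1,3)] Comp_assoc[OF k(1) D(2,4)] k(2) D(5) by simp
    next
      fix W a b assume ab: "a \<in> Hom C W (Dom C f)" "b \<in> Hom C W (Dom C n)" "f \<cdot> a = n \<cdot> b"
      obtain h where h: "h \<in> Hom C W (Dom C m)" "m \<cdot> h = a" "q \<cdot> h = b"
        using is_pullbackD(6)[OF pb ab] by blast
      have "m' \<cdot> (l \<cdot> h) = a"
        using Comp_assoc[OF h(1) l(1) hm'] l(2)[symmetric] h(2) by simp
      moreover have "(q \<cdot> k) \<cdot> (l \<cdot> h) = q \<cdot> ((k \<cdot> l) \<cdot> h)"
        using Comp_assoc[OF Comp_in_Hom[OF h(1) l(1)] k(1) D(2)] Comp_assoc[OF h(1) l(1) k(1)] by simp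
      then have "(q \<cdot> k) \<cdot> (l \<cdot> h) = b"
        using kl Ident_Comp[OF h(1)] h(3) by simp
      ultimately show "\<exists>h. h \<in> Hom C W (Dom C m') \<and> m' \<cdot> h = a \<and> q \<cdot> k \<cdot> h = b"
        using Comp_in_Hom[OF h(1) l(1)] by blast
    next
      fix W h h' assume "h \<in> Hom C W (Dom C m')" "h' \<in> Hom C W (Dom C m')" "m' \<cdot> h = m' \<cdot> h'"
      then show "h = h'" using monicD[OF m'(1)] by blast
    qed
    then show "m' \<in> sub_pullback C f (subobj C n)"
      unfolding sub_pullback_def using mem_subobj_self[OF n] by blast
  qed
qed

text \<open>Objects 0, 1, 2 (named like their identities) and arrows 3 from 0 to 2 and 4 from 1 to 2.\<close>

definition (in -) cospan_cat :: "(nat, nat) cat" where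
  "cospan_cat = \<lparr>Obj = {0, 1, 2}, Arr = {0, 1, 2, 3, 4},
     Dom = (\<lambda>a. if a = 3 then 0 else if a = 4 then 1 else a),
     Cod = (\<lambda>a. if a = 3 \<or> a = 4 then 2 else a),
     Ident = (\<lambda>x. x), Comp = (\<lambda>b a. if a = 3 \<or> a = 4 then a else b)\<rparr>"

lemma ex_pullback:
  assumes lim: "has_finite_limits C" and f: "f \<in> Hom C X Z" and g: "g \<in> Hom C Y Z"
  shows "\<exists>p q. is_pullback C f g p q"
proof -
  define D where "D = \<lparr>FObj = (\<lambda>x::nat. if x = 0 then X else if x = 1 then Y else Z),
    FArr = (\<lambda>a::nat. if a = 0 then Ident C X else if a = 1 then Ident C Y else if a = 2 then Ident C Z
      else if a = 3 then f else g)\<rparr>"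
  note O = Hom_Obj[OF f] Hom_Obj[OF g]
  have catJ: "category cospan_cat"
    by unfold_locales (auto simp: cospan_cat_def Hom_def)
  have "is_functor cospan_cat C D"
    unfolding is_functor_def
  proof (intro conjI ballI impI)
    show "FObj D x \<in> Obj C" if "x \<in> Obj cospan_cat" for x
      using O by (auto simp: D_def)
    show "FArr D a \<in> Hom C (FObj D (Dom cospan_cat a)) (FObj D (Cod cospan_cat a))"
      if "a \<in> Arr cospan_cat" for a
      using that f g O Ident_in_Hom by (auto simp: D_def cospan_cat_def)
    show "FArr D (Ident cospan_cat x) = Ident C (FObj D x)" if "x \<in> Obj cospan_cat" for x
      using that by (auto simp: D_def cospan_cat_def)
    show "FArr D (b \<cdot>\<^bsub>cospan_cat\<^esub> a) = FArr D b \<cdot> FArr D a"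
      if "a \<in> Arr cospan_cat" "b \<in> Arr cospan_cat" "Dom cospan_cat b = Cod cospan_cat a" for a b
      using that Comp_Ident[OF f] Comp_Ident[OF g] Ident_Comp[OF f] Ident_Comp[OF g]
        Comp_Ident[OF Ident_in_Hom] O
      by (auto simp: D_def cospan_cat_def split: if_splits)
  qed (fact catJ category_axioms)+
  then obtain L p where L: "is_limit cospan_cat C D L p"
    using lim[unfolded has_finite_limits_def, rule_format, of cospan_cat D]
    by (auto simp: cospan_cat_def)
  have cone_iff: "is_cone cospan_cat C D M q \<longleftrightarrow> q 0 \<in> Hom C M X \<and> q 1 \<in> Hom C M Y \<and>
      q 2 \<in> Hom C M Z \<and> f \<cdot> q 0 = q 2 \<and> g \<cdot> q 1 = q 2" for M q
    using Hom_Obj(1)[of "q 0" M X] Ident_Comp[of "q 0" M X] Ident_Comp[of "q 1" M Y]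
      Ident_Comp[of "q 2" M Z]
    by (simp add: is_cone_def D_def cospan_cat_def) blast
  have p: "p 0 \<in> Hom C L X" "p 1 \<in> Hom C L Y" "p 2 \<in> Hom C L Z" "f \<cdot> p 0 = p 2" "g \<cdot> p 1 = p 2"
    using L unfolding is_limit_def cone_iff by auto
  have univ: "\<exists>!h. h \<in> Hom C M L \<and> p 0 \<cdot> h = q 0 \<and> p 1 \<cdot> h = q 1 \<and> p 2 \<cdot> h = q 2"
    if "is_cone cospan_cat C D M q" for M q
  proof -
    have "\<exists>!h. h \<in> Hom C M L \<and> (\<forall>j \<in> {0, 1, 2}. p j \<cdot> h = q j)"
      using L that unfolding is_limit_def by (simp add: cospan_cat_def)
    then show ?thesis by simp
  qed
  \<comment> \<open>A cone over a cospan is determined by its two outer legs, as the leg to the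
    corner is forced to be \<open>f \<cdot> a\<close>.\<close>
  have mk: "is_cone cospan_cat C D M (\<lambda>j. if j = 0 then a else if j = 1 then b else f \<cdot> a)"
    if "a \<in> Hom C M X" "b \<in> Hom C M Y" "f \<cdot> a = g \<cdot> b" for M a b
    unfolding cone_iff using that Comp_in_Hom[OF that(1) f] by simp
  have "is_pullback C f g (p 0) (p 1)"
  proof (rule is_pullbackI[OF p(1,2) f g])
    show "f \<cdot> p 0 = g \<cdot> p 1" using p by simp
  next
    fix M a b assume "a \<in> Hom C M X" "b \<in> Hom C M Y" "f \<cdot> a = g \<cdot> b"
    from univ[OF mk[OF this]]
    show "\<exists>h. h \<in> Hom C M L \<and> p 0 \<cdot> h = a \<and> p 1 \<cdot> h = b" by auto
  next
    fix M h k assume h: "h \<in> Hom C M L" "k \<in> Hom C M L" "p 0 \<cdot> h = p 0 \<cdot> k" "p 1 \<cdot> h = p 1 \<cdot> k"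
    have "f \<cdot> (p 0 \<cdot> h) = g \<cdot> (p 1 \<cdot> h)"
      using Comp_assoc[OF h(1) p(1) f] Comp_assoc[OF h(1) p(2) g] p by simp
    note u = univ[OF mk[OF Comp_in_Hom[OF h(1) p(1)] Comp_in_Hom[OF h(1) p(2)] this]]
    have "p 2 \<cdot> h = f \<cdot> (p 0 \<cdot> h)" "p 2 \<cdot> k = f \<cdot> (p 0 \<cdot> h)"
      using Comp_assoc[OF h(1) p(1) f] Comp_assoc[OF h(2) p(1) f] p(4) h(3) by simp_all
    then show "h = k"
      using u h by auto
  qed
  then show ?thesis by blast
qed

end


section \<open>Compact spaces\<close>

text \<open>If no finite subfamily worked, then \<open>K\<close> together with the complement
  \<open>W\<close> of \<open>V\<close> would have the finite intersection property, and a common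
  point would contradict the inclusion.\<close>

lemma compact_space_Inter_subset_open:
  assumes X: "compact_space X" and cl: "\<And>S. S \<in> K \<Longrightarrow> closedin X S"
    and V: "openin X V" and sub: "topspace X \<inter> \<Inter>K \<subseteq> V"
  shows "\<exists>F. finite F \<and> F \<subseteq> K \<and> topspace X \<inter> \<Inter>F \<subseteq> V"
proof (rule ccontr)
  assume neg: "\<not> (\<exists>F. finite F \<and> F \<subseteq> K \<and> topspace X \<inter> \<Inter>F \<subseteq> V)"
  define W where "W = topspace X - V"
  have fip: "\<Inter>G \<noteq> {}" if G: "finite G" "G \<subseteq> insert W K" for G
  proof -
    have "\<not> topspace X \<inter> \<Inter>(G - {W}) \<subseteq> V"
      using neg[simplified not_ex, THEN spec, of "G - {W}"] G by blast
    then show ?thesis unfolding W_def by blast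
  qed
  have "\<forall>S\<in>insert W K. closedin X S"
    using cl V by (auto simp: W_def)
  with fip have "\<Inter>(insert W K) \<noteq> {}"
    by (intro X[unfolded compact_space_fip, THEN spec, THEN mp]) simp
  then show False
    using sub unfolding W_def by blast
qed

text \<open>A continuous injection from a compact into a Hausdorff space is closed. Hence the
  preimage of a closed \<open>D\<close> under the pointwise lift is the preimage under
  \<open>g\<close> of the closed image of \<open>D\<close>.\<close>

lemma continuous_map_factor_injective:
  assumes "compact_space R" "Hausdorff_space Z" "continuous_map R Z e" "inj_on e (topspace R)"
    and g: "continuous_map W Z g" and im: "g ` topspace W \<subseteq> e ` topspace R"
  shows "continuous_map W R (\<lambda>w. inv_into (topspace R) e (g w))"
proof -
  have cl: "closed_map R Z e"
    using continuous_imp_closed_map assms by blast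
  have in_R: "inv_into (topspace R) e (g w) \<in> topspace R" "e (inv_into (topspace R) e (g w)) = g w"
    if "w \<in> topspace W" for w
    using im that by (auto intro!: inv_into_into f_inv_into_f)
  show ?thesis
    unfolding continuous_map_closedin
  proof (intro conjI allI impI)
    show "(\<lambda>w. inv_into (topspace R) e (g w)) \<in> topspace W \<rightarrow> topspace R"
      using in_R by blast
    fix D assume D: "closedin R D"
    have "{w \<in> topspace W. inv_into (topspace R) e (g w) \<in> D} = {w \<in> topspace W. g w \<in> e ` D}"
      using in_R closedin_subset[OF D] inv_into_f_f[OF assms(4)] by (auto simp: image_iff) (metis subsetD)
    moreover have "closedin Z (e ` D)"
      using cl D by (simp add: closed_map_def)
    ultimately show "closedin W {w \<in> topspace W. inv_into (topspace R) e (g w) \<in> D}"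
      using g by (simp add: continuous_map_closedin)
  qed
qed

text \<open>The quotient topology on the image of \<open>f\<close>. It serves two purposes:
  quotients by closed equivalence relations, and, for injective \<open>f\<close>, copies of a space
  in another type.\<close>

definition final_topology :: "'a topology \<Rightarrow> ('a \<Rightarrow> 'b) \<Rightarrow> 'b topology" where
  "final_topology X f = topology (\<lambda>U. U \<subseteq> f ` topspace X \<and> openin X {x \<in> topspace X. f x \<in> U})"

lemma openin_final_topology:
  "openin (final_topology X f) U \<longleftrightarrow> U \<subseteq> f ` topspace X \<and> openin X {x \<in> topspace X. f x \<in> U}"
proof -
  have "istopology (\<lambda>U. U \<subseteq> f ` topspace X \<and> openin X {x \<in> topspace X. f x \<in> U})"
    unfolding istopology_def
  proof (intro conjI allI impI)
    fix S T assume "S \<subseteq> f ` topspace X \<and> openin X {x \<in> topspace X. f x \<in> S}"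
      "T \<subseteq> f ` topspace X \<and> openin X {x \<in> topspace X. f x \<in> T}"
    then show "S \<inter> T \<subseteq> f ` topspace X" "openin X {x \<in> topspace X. f x \<in> S \<inter> T}"
      by (auto simp: Collect_conj_eq Int_Collect
          intro: openin_Int[of X "{x \<in> topspace X. f x \<in> S}" "{x \<in> topspace X. f x \<in> T}", THEN back_subst[of "openin X"]])
  next
    fix \<K> assume K: "\<forall>S\<in>\<K>. S \<subseteq> f ` topspace X \<and> openin X {x \<in> topspace X. f x \<in> S}"
    then show "\<Union>\<K> \<subseteq> f ` topspace X" by blast
    have "{x \<in> topspace X. f x \<in> \<Union>\<K>} = (\<Union>S\<in>\<K>. {x \<in> topspace X. f x \<in> S})" by blast
    then show "openin X {x \<in> topspace X. f x \<in> \<Union>\<K>}" using K by auto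
  qed
  then show ?thesis
    unfolding final_topology_def by simp
qed

lemma topspace_final_topology: "topspace (final_topology X f) = f ` topspace X"
proof
  show "topspace (final_topology X f) \<subseteq> f ` topspace X"
    using openin_final_topology[of X f "topspace (final_topology X f)"] by simp
  have "{x \<in> topspace X. f x \<in> f ` topspace X} = topspace X" by blast
  then have "openin (final_topology X f) (f ` topspace X)"
    unfolding openin_final_topology by simp
  then show "f ` topspace X \<subseteq> topspace (final_topology X f)"
    by (rule openin_subset)
qed

lemma quotient_map_final_topology: "quotient_map X (final_topology X f) f"
  unfolding quotient_map_def by (auto simp: topspace_final_topology openin_final_topology)

lemma homeomorphic_map_final_topology:
  "inj_on f (topspace X) \<Longrightarrow> homeomorphic_map X (final_topology X f) f"
  by (simp add: homeomorphic_map_def quotient_map_final_topology)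

text \<open>The quotient is carried by a set of representatives, so it stays in the type of
  \<open>X\<close> and has no more points than \<open>X\<close>. Its Hausdorff property comes from
  closedness of \<open>f\<close>: a closed continuous image of a normal Hausdorff space is
  Hausdorff.\<close>

lemma compact_Hausdorff_quotient:
  assumes X: "compact_space X" "Hausdorff_space X"
    and R: "equiv (topspace X) R" "closedin (prod_topology X X) R"
  obtains f :: "'a \<Rightarrow> 'a" where "f ` topspace X \<subseteq> topspace X"
    "\<And>x y. x \<in> topspace X \<Longrightarrow> y \<in> topspace X \<Longrightarrow> f x = f y \<longleftrightarrow> (x, y) \<in> R"
    "compact_space (final_topology X f)" "Hausdorff_space (final_topology X f)"
proof -
  define f where "f x = (SOME y. (x, y) \<in> R)" for x
  have f: "(x, f x) \<in> R" if "x \<in> topspace X" for x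
    unfolding f_def using equiv_class_self[OF R(1) that] by (auto intro: someI)
  have Rsub: "R \<subseteq> topspace X \<times> topspace X"
    using closedin_subset[OF R(2)] by simp
  have feq: "f x = f y \<longleftrightarrow> (x, y) \<in> R" if xy: "x \<in> topspace X" "y \<in> topspace X" for x y
  proof
    assume "f x = f y"
    then show "(x, y) \<in> R"
      using f[OF xy(1)] f[OF xy(2)] R(1) unfolding equiv_def by (metis symD transD)
  next
    assume "(x, y) \<in> R"
    then have "R `` {x} = R `` {y}"
      by (rule equiv_class_eq[OF R(1)])
    then show "f x = f y"
      unfolding f_def by (metis Image_singleton_iff)
  qed
  let ?T = "final_topology X f"
  have q: "quotient_map X ?T f"
    by (rule quotient_map_final_topology)
  have cl: "closed_map X ?T f"
    unfolding closed_map_def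
  proof (intro allI impI)
    fix D assume D: "closedin X D"
    have sub: "D \<subseteq> topspace X" by (rule closedin_subset[OF D])
    \<comment> \<open>The saturation of \<open>D\<close> is the projection of a closed subset of the
      square, and projecting along a compact factor is a closed map.\<close>
    have "{x \<in> topspace X. f x \<in> f ` D} = snd ` (R \<inter> (D \<times> topspace X))"
    proof (intro subset_antisym subsetI)
      fix x assume "x \<in> {x \<in> topspace X. f x \<in> f ` D}"
      then obtain d where "x \<in> topspace X" "d \<in> D" "f d = f x" by auto
      then have "(d, x) \<in> R \<inter> (D \<times> topspace X)"
        using feq sub by blast
      then show "x \<in> snd ` (R \<inter> (D \<times> topspace X))"
        by (metis image_eqI snd_conv)
    next
      fix x assume "x \<in> snd ` (R \<inter> (D \<times> topspace X))"
      then obtain d where d: "d \<in> D" "x \<in> topspace X" "(d, x) \<in> R" by auto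
      then have "f d = f x" using feq sub by blast
      then show "x \<in> {x \<in> topspace X. f x \<in> f ` D}"
        using d by (metis (mono_tags, lifting) image_eqI mem_Collect_eq)
    qed
    moreover have "closedin X (snd ` (R \<inter> (D \<times> topspace X)))"
      using closed_map_snd[OF X(1), of X] closedin_Int[OF R(2), of "D \<times> topspace X"] D
      unfolding closed_map_def by (simp add: closedin_prod_Times_iff)
    ultimately show "closedin ?T (f ` D)"
      using q image_mono[OF sub, of f] unfolding quotient_map_closedin by (auto simp: topspace_final_topology)
  qed
  have cont: "continuous_map X ?T f"
    by (rule quotient_imp_continuous_map[OF q])
  have "compact_space ?T"
    using image_compactin[OF X(1)[unfolded compact_space_def] cont]
    by (simp add: compact_space_def topspace_final_topology)
  moreover have "Hausdorff_space ?T"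
    using normal_Hausdorff_space_closed_continuous_map_image[OF
        compact_Hausdorff_or_regular_imp_normal_space[OF X(1)] X(2) cl cont] X(2)
    by (simp add: topspace_final_topology)
  moreover have "f ` topspace X \<subseteq> topspace X"
    using f Rsub by blast
  ultimately show ?thesis
    using that feq by blast
qed

section \<open>Topologies given by closed sets, and extension from dense subsets\<close>

definition closed_sets_topology :: "'a set \<Rightarrow> 'a set set \<Rightarrow> 'a topology" where
  "closed_sets_topology E K = topology (\<lambda>U. U \<subseteq> E \<and> E - U \<in> K)"

text \<open>Intersecting with \<open>E\<close> lets the empty family contribute the whole space, so
  the last hypothesis also provides that \<open>E\<close> is closed.\<close>

lemma
  assumes sub: "\<And>A. A \<in> K \<Longrightarrow> A \<subseteq> E" and "{} \<in> K"
    and un: "\<And>A B. A \<in> K \<Longrightarrow> B \<in> K \<Longrightarrow> A \<union> B \<in> K"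
    and int: "\<And>F. F \<subseteq> K \<Longrightarrow> E \<inter> \<Inter>F \<in> K"
  shows topspace_closed_sets_topology: "topspace (closed_sets_topology E K) = E"
    and closedin_closed_sets_topology: "closedin (closed_sets_topology E K) A \<longleftrightarrow> A \<in> K"
proof -
  have "istopology (\<lambda>U. U \<subseteq> E \<and> E - U \<in> K)"
    unfolding istopology_def
  proof (intro conjI allI impI)
    fix S T assume "S \<subseteq> E \<and> E - S \<in> K" "T \<subseteq> E \<and> E - T \<in> K"
    then show "S \<inter> T \<subseteq> E" "E - S \<inter> T \<in> K"
      using un[of "E - S" "E - T"] by (auto simp: Diff_Int)
  next
    fix \<K> assume K: "\<forall>S\<in>\<K>. S \<subseteq> E \<and> E - S \<in> K"
    then show "\<Union>\<K> \<subseteq> E" by blast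
    have "E - \<Union>\<K> = E \<inter> \<Inter>((\<lambda>S. E - S) ` \<K>)" by blast
    also have "\<dots> \<in> K" using K by (intro int) blast
    finally show "E - \<Union>\<K> \<in> K" .
  qed
  then have op: "openin (closed_sets_topology E K) U \<longleftrightarrow> U \<subseteq> E \<and> E - U \<in> K" for U
    unfolding closed_sets_topology_def by simp
  have "openin (closed_sets_topology E K) E"
    using op \<open>{} \<in> K\<close> by simp
  then show ts: "topspace (closed_sets_topology E K) = E"
    using op[of "topspace (closed_sets_topology E K)"] openin_subset by fastforce
  show "closedin (closed_sets_topology E K) A \<longleftrightarrow> A \<in> K"
    unfolding closedin_def op ts using sub by (auto simp: double_diff)
qed

text \<open>The closure of the graph of \<open>g\<close> is again the graph of a function, because points of \<open>Y\<close> are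
  separated by disjoint open sets, whose preimages under \<open>g\<close> have disjoint closures.\<close>

lemma dense_extension:
  assumes Y: "compact_space Y" "Hausdorff_space Y"
    and i: "i ` I \<subseteq> topspace X" and g: "g ` I \<subseteq> topspace Y"
    and dense: "X closure_of (i ` I) = topspace X"
    and disj: "\<And>A B. A \<subseteq> I \<Longrightarrow> B \<subseteq> I \<Longrightarrow> A \<inter> B = {} \<Longrightarrow> X closure_of (i ` A) \<inter> X closure_of (i ` B) = {}"
  shows "\<exists>h. continuous_map X Y h \<and> (\<forall>x\<in>I. h (i x) = g x)"
proof -
  let ?P = "prod_topology X Y"
  define gr where "gr = (\<lambda>x. (i x, g x)) ` I"
  define G where "G = ?P closure_of gr"
  have gr_sub: "gr \<subseteq> topspace ?P" using i g by (auto simp: gr_def)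
  have grG: "gr \<subseteq> G" unfolding G_def by (rule closure_of_subset[OF gr_sub])
  have Gcl: "closedin ?P G" unfolding G_def by simp
  have Gsub: "G \<subseteq> topspace X \<times> topspace Y" using closedin_subset[OF Gcl] by simp
  \<comment> \<open>Projection along the compact \<open>Y\<close> is closed. With all of
    \<open>Y\<close> for \<open>D\<close> this shows that the closed relation \<open>G\<close> is
    defined everywhere, and with arbitrary \<open>D\<close> that the function it defines is
    continuous.\<close>
  have fstcl: "closedin X (fst ` (G \<inter> (topspace X \<times> D)))" if "closedin Y D" for D
    using closed_map_fst[OF Y(1), of X] closedin_Int[OF Gcl, of "topspace X \<times> D"] that
    unfolding closed_map_def by (simp add: closedin_prod_Times_iff)
  have "i ` I \<subseteq> fst ` (G \<inter> (topspace X \<times> topspace Y))"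
    using grG Gsub by (force simp: gr_def image_iff)
  then have total: "topspace X \<subseteq> fst ` (G \<inter> (topspace X \<times> topspace Y))"
    using closure_of_minimal[OF _ fstcl[OF closedin_topspace]] dense by blast
  have single: "y = z" if yz: "(x, y) \<in> G" "(x, z) \<in> G" for x y z
  proof (rule ccontr)
    assume "y \<noteq> z"
    moreover have "y \<in> topspace Y" "z \<in> topspace Y"
      using yz Gsub by auto
    ultimately obtain U V where UV: "openin Y U" "openin Y V" "y \<in> U" "z \<in> V" "disjnt U V"
      using Y(2) unfolding Hausdorff_space_def by metis
    have cls: "x \<in> X closure_of (i ` {a \<in> I. g a \<in> U})" if xyG: "(x, y) \<in> G" and U: "openin Y U" "y \<in> U" for y U
      unfolding in_closure_of
    proof (intro conjI allI impI)
      show "x \<in> topspace X" using xyG Gsub by blast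
      fix T assume T: "x \<in> T \<and> openin X T"
      then have "openin ?P (T \<times> U)" "(x, y) \<in> T \<times> U"
        using xyG U T by (auto simp: openin_prod_Times_iff)
      then obtain p where "p \<in> gr" "p \<in> T \<times> U"
        using xyG unfolding G_def in_closure_of by meson
      then obtain a where "a \<in> I" "(i a, g a) \<in> T \<times> U"
        unfolding gr_def by blast
      then show "\<exists>y. y \<in> i ` {a \<in> I. g a \<in> U} \<and> y \<in> T" by blast
    qed
    have "x \<in> X closure_of (i ` {a \<in> I. g a \<in> U}) \<inter> X closure_of (i ` {a \<in> I. g a \<in> V})"
      using cls yz UV by blast
    moreover have "{a \<in> I. g a \<in> U} \<inter> {a \<in> I. g a \<in> V} = {}"
      using UV(5) by (auto simp: disjnt_iff)
    ultimately show False
      using disj[of "{a \<in> I. g a \<in> U}" "{a \<in> I. g a \<in> V}"] by blast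
  qed
  define h where "h x = (THE y. (x, y) \<in> G)" for x
  have h_eq: "h x = y" if "(x, y) \<in> G" for x y
    unfolding h_def using that single by blast
  have hG: "(x, h x) \<in> G" if "x \<in> topspace X" for x
    using total that h_eq by force
  have "continuous_map X Y h"
    unfolding continuous_map_closedin
  proof (intro conjI allI impI)
    show "h \<in> topspace X \<rightarrow> topspace Y" using hG Gsub by blast
    fix D assume D: "closedin Y D"
    have "{x \<in> topspace X. h x \<in> D} = fst ` (G \<inter> (topspace X \<times> D))"
      using hG h_eq Gsub by (force simp: image_iff)
    then show "closedin X {x \<in> topspace X. h x \<in> D}"
      using fstcl[OF D] by simp
  qed
  moreover have "h (i x) = g x" if "x \<in> I" for x
    using h_eq grG that by (auto simp: gr_def)
  ultimately show ?thesis by blast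
qed

lemma continuous_maps_agree_dense:
  assumes "continuous_map X Y f" "continuous_map X Y g" "Hausdorff_space Y"
    and "X closure_of S = topspace X" "\<And>x. x \<in> S \<Longrightarrow> f x = g x" "x \<in> topspace X"
  shows "f x = g x"
  using forall_in_closure_of_eq[of x X S Y f g] assms by auto

text \<open>The principal ultrafilter at \<open>i\<close>, as an indicator function made extensional
  on \<open>Pow I\<close>.\<close>

definition stone_cech_pt :: "'a set \<Rightarrow> 'a \<Rightarrow> 'a set \<Rightarrow> bool" where
  "stone_cech_pt I i = (\<lambda>A\<in>Pow I. i \<in> A)"

text \<open>The Stone-Cech compactification of the discrete space \<open>I\<close>: a point \<open>p\<close> is (the indicator
  function of) the ultrafilter of all subsets \<open>A\<close> of \<open>I\<close> with \<open>p A\<close>.\<close>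

definition stone_cech :: "'a set \<Rightarrow> ('a set \<Rightarrow> bool) topology" where
  "stone_cech I = (let P = product_topology (\<lambda>_. discrete_topology UNIV) (Pow I)
     in subtopology P (P closure_of (stone_cech_pt I ` I)))"

lemma stone_cech:
  fixes I :: "'a set"
  shows compact_stone_cech: "compact_space (stone_cech I)"
    and Hausdorff_stone_cech: "Hausdorff_space (stone_cech I)"
    and stone_cech_pt: "stone_cech_pt I ` I \<subseteq> topspace (stone_cech I)"
    and topspace_stone_cech: "topspace (stone_cech I) \<subseteq> Pow I \<rightarrow>\<^sub>E UNIV"
    and stone_cech_dense: "stone_cech I closure_of (stone_cech_pt I ` I) = topspace (stone_cech I)"
    and stone_cech_disjoint: "A \<subseteq> I \<Longrightarrow> B \<subseteq> I \<Longrightarrow> A \<inter> B = {} \<Longrightarrow>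
      stone_cech I closure_of (stone_cech_pt I ` A) \<inter> stone_cech I closure_of (stone_cech_pt I ` B) = {}"
    and stone_cech_separated: "x \<in> topspace (stone_cech I) \<Longrightarrow> y \<in> topspace (stone_cech I) \<Longrightarrow> x \<noteq> y \<Longrightarrow>
      \<exists>V. closedin (stone_cech I) V \<and> openin (stone_cech I) V \<and> x \<in> V \<and> y \<notin> V"
proof -
  define P where "P = product_topology (\<lambda>_. discrete_topology (UNIV :: bool set)) (Pow I)"
  define S where "S = P closure_of (stone_cech_pt I ` I)"
  have sc: "stone_cech I = subtopology P S"
    by (simp add: stone_cech_def P_def S_def Let_def)
  have tP: "topspace P = Pow I \<rightarrow>\<^sub>E UNIV"
    by (simp add: P_def)
  have ptP: "stone_cech_pt I ` J \<subseteq> topspace P" for J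
    unfolding tP stone_cech_pt_def by (intro image_subsetI) (simp only: restrict_PiE_iff, simp)
  have cS: "closedin P S" unfolding S_def by simp
  have tS: "topspace (stone_cech I) = S"
    using closedin_subset[OF cS] by (auto simp: sc)
  have "compact_space P" "Hausdorff_space P"
    unfolding P_def by (simp_all add: compact_space_product_topology Hausdorff_space_product_topology compact_space_discrete_topology)
  then show "compact_space (stone_cech I)" "Hausdorff_space (stone_cech I)"
    unfolding sc using closedin_compact_space[OF _ cS] 
    by (auto simp: compact_space_subtopology Hausdorff_space_subtopology)
  show pt: "stone_cech_pt I ` I \<subseteq> topspace (stone_cech I)"
    unfolding tS S_def by (rule closure_of_subset[OF ptP])
  show "topspace (stone_cech I) \<subseteq> Pow I \<rightarrow>\<^sub>E UNIV"
    using closedin_subset[OF cS] by (simp add: tS tP)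
  show "stone_cech I closure_of (stone_cech_pt I ` I) = topspace (stone_cech I)"
    using pt unfolding tS unfolding sc closure_of_subtopology S_def by (simp add: inf.absorb2)
  \<comment> \<open>Evaluation at a subset \<open>A\<close> is continuous into a discrete space, so
    its fibres are clopen. Evaluating at \<open>A\<close> separates the closure of the points of
    \<open>A\<close> from that of any set disjoint from \<open>A\<close>, and distinct points differ
    at some \<open>A\<close>.\<close>
  have clopen: "closedin (stone_cech I) {p \<in> S. p A \<in> T} \<and> openin (stone_cech I) {p \<in> S. p A \<in> T}"
    if "A \<subseteq> I" for A T
  proof -
    have "continuous_map (stone_cech I) (discrete_topology UNIV) (\<lambda>p. p A)"
      unfolding sc P_def using that
      by (intro continuous_map_from_subtopology continuous_map_product_projection) simp
    from openin_continuous_map_preimage[OF this, of T] closedin_continuous_map_preimage[OF this, of T]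
    show ?thesis by (simp add: tS)
  qed
  {
    assume AB: "A \<subseteq> I" "B \<subseteq> I" "A \<inter> B = {}"
    have "stone_cech I closure_of (stone_cech_pt I ` A) \<subseteq> {p \<in> S. p A \<in> {True}}"
      using pt AB(1) clopen[OF AB(1), of "{True}"] unfolding tS
      by (intro closure_of_minimal) (auto simp: stone_cech_pt_def)
    moreover have "stone_cech I closure_of (stone_cech_pt I ` B) \<subseteq> {p \<in> S. p A \<in> {False}}"
      using pt AB clopen[OF AB(1), of "{False}"] unfolding tS
      by (intro closure_of_minimal) (auto simp: stone_cech_pt_def)
    ultimately show "stone_cech I closure_of (stone_cech_pt I ` A) \<inter> stone_cech I closure_of (stone_cech_pt I ` B) = {}"
      by blast
  }
  assume xy: "x \<in> topspace (stone_cech I)" "y \<in> topspace (stone_cech I)" "x \<noteq> y"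
  then obtain A where A: "A \<subseteq> I" "x A \<noteq> y A"
    using closedin_subset[OF cS] PiE_ext[of x "Pow I" "\<lambda>_. UNIV" y] unfolding tS tP by blast
  show "\<exists>V. closedin (stone_cech I) V \<and> openin (stone_cech I) V \<and> x \<in> V \<and> y \<notin> V"
    using clopen[OF A(1), of "{x A}"] A(2) xy unfolding tS by (intro exI[of _ "{p \<in> S. p A \<in> {x A}}"]) auto
qed


section \<open>Filtral lattices of closed sets\<close>

text \<open>In the applications, \<open>\<phi> x\<close> is a closed set of a space.\<close>

locale set_rep =
  fixes L :: "'a gorder" (structure) and \<phi> :: "'a \<Rightarrow> 'e set"
  assumes eq_eq: "eq L = (=)"
    and le_iff: "x \<in> carrier L \<Longrightarrow> y \<in> carrier L \<Longrightarrow> x \<sqsubseteq> y \<longleftrightarrow> \<phi> x \<subseteq> \<phi> y"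
    and inj: "inj_on \<phi> (carrier L)"
begin

lemma po: "partial_order L"
  using inj by unfold_locales (auto simp: eq_eq le_iff inj_on_def)

lemma least_Upper:
  assumes "F \<subseteq> carrier L" "s \<in> carrier L" "\<phi> s = \<Union>(\<phi> ` F)"
  shows "least L s (Upper L F)"
  unfolding least_def Upper_def using assms le_iff by (auto simp: subset_iff)

lemma least_Upper_iff:
  assumes "F \<subseteq> carrier L" "t \<in> carrier L" "\<phi> t = \<Union>(\<phi> ` F)"
  shows "least L s (Upper L F) \<longleftrightarrow> s \<in> carrier L \<and> \<phi> s = \<Union>(\<phi> ` F)"
  using partial_order.least_unique[OF po _ least_Upper[OF assms]] least_Upper assms by blast

lemma greatest_Lower:
  assumes "F \<subseteq> carrier L" "s \<in> carrier L" "\<phi> s = \<Inter>(\<phi> ` F)"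
  shows "greatest L s (Lower L F)"
  unfolding greatest_def Lower_def using assms le_iff by (auto simp: subset_iff)

end

text \<open>Passing to the center replaces the carrier, and with it the meaning of the meet, which
  is the greatest lower bound within the carrier. The two meets agree because the meet of
  complemented elements is complemented by the join of the complements. That is checked on sets,
  where distributivity is automatic.\<close>

lemma boolean_center_meet:
  fixes L (structure)
  assumes "set_rep L \<phi>" "bounded_lattice L"
    and join: "\<And>x y. x \<in> carrier L \<Longrightarrow> y \<in> carrier L \<Longrightarrow> \<phi> (x \<squnion> y) = \<phi> x \<union> \<phi> y"
    and meet: "\<And>x y. x \<in> carrier L \<Longrightarrow> y \<in> carrier L \<Longrightarrow> \<phi> (x \<sqinter> y) = \<phi> x \<inter> \<phi> y"
    and x: "x \<in> carrier (boolean_center L)" and y: "y \<in> carrier (boolean_center L)"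
  shows "x \<sqinter> y \<in> carrier (boolean_center L)" and "x \<sqinter>\<^bsub>boolean_center L\<^esub> y = x \<sqinter> y"
proof -
  interpret set_rep L \<phi> by fact
  interpret bounded_lattice L by fact
  let ?B = "boolean_center L"
  obtain x' where x': "x \<in> carrier L" "x' \<in> carrier L" "x \<sqinter> x' = \<bottom>" "x \<squnion> x' = \<top>"
    using x unfolding boolean_center_def by auto
  obtain y' where y': "y \<in> carrier L" "y' \<in> carrier L" "y \<sqinter> y' = \<bottom>" "y \<squnion> y' = \<top>"
    using y unfolding boolean_center_def by auto
  have \<phi>: "\<phi> x \<inter> \<phi> x' = \<phi> \<bottom>" "\<phi> y \<inter> \<phi> y' = \<phi> \<bottom>" "\<phi> x \<union> \<phi> x' = \<phi> \<top>" "\<phi> y \<union> \<phi> y' = \<phi> \<top>"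
    using meet[OF x'(1,2)] meet[OF y'(1,2)] join[OF x'(1,2)] join[OF y'(1,2)] x'(3,4) y'(3,4) by simp_all
  have bounds: "\<phi> \<bottom> \<subseteq> \<phi> z" "\<phi> z \<subseteq> \<phi> \<top>" if "z \<in> carrier L" for z
    using le_iff[OF bottom_closed that] le_iff[OF that top_closed] bottom_lower[OF that] top_higher[OF that] by simp_all
  have eqI: "z = w" if "z \<in> carrier L" "w \<in> carrier L" "\<phi> z = \<phi> w" for z w
    using inj that by (auto simp: inj_on_def)
  note m = meet_closed[OF x'(1) y'(1)] and j = join_closed[OF x'(2) y'(2)]
  have "\<phi> ((x \<sqinter> y) \<sqinter> (x' \<squnion> y')) = \<phi> \<bottom>"
    unfolding meet[OF m j] meet[OF x'(1) y'(1)] join[OF x'(2) y'(2)]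
    using \<phi> bounds[OF x'(1)] bounds[OF y'(1)] bounds[OF x'(2)] bounds[OF y'(2)] by blast
  then have 1: "(x \<sqinter> y) \<sqinter> (x' \<squnion> y') = \<bottom>"
    by (rule eqI[OF meet_closed[OF m j] bottom_closed])
  have "\<phi> ((x \<sqinter> y) \<squnion> (x' \<squnion> y')) = \<phi> \<top>"
    unfolding join[OF m j] meet[OF x'(1) y'(1)] join[OF x'(2) y'(2)] using \<phi> by blast
  then have 2: "(x \<sqinter> y) \<squnion> (x' \<squnion> y') = \<top>"
    by (rule eqI[OF join_closed[OF m j] top_closed])
  show mB: "x \<sqinter> y \<in> carrier ?B"
    unfolding boolean_center_def using m j 1 2 by auto
  have leB: "z \<sqsubseteq>\<^bsub>?B\<^esub> w \<longleftrightarrow> z \<sqsubseteq> w" for z w by (simp add: boolean_center_def)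
  have BL: "z \<in> carrier L" if "z \<in> carrier ?B" for z using that by (simp add: boolean_center_def)
  have g: "greatest ?B (x \<sqinter> y) (Lower ?B {x, y})"
    unfolding greatest_def Lower_def using mB x y meet_left[OF x'(1) y'(1)] meet_right[OF x'(1) y'(1)] BL x'(1) y'(1)
    by (auto simp: leB intro: meet_le)
  interpret B: partial_order ?B
    using po unfolding boolean_center_def partial_order_def partial_order_axioms_def
    by (auto intro!: weak_partial_order_subset)
  show "x \<sqinter>\<^bsub>?B\<^esub> y = x \<sqinter> y"
    using B.greatest_unique[OF someI[of "\<lambda>z. greatest ?B z (Lower ?B {x, y})", OF g] g]
    by (simp add: meet_def inf_def)
qed

text \<open>Stone duality for the closed sets of a compact space whose points are separated by
  clopen sets. The center consists of the clopen sets. A closed set is the intersection of the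
  clopen sets around it, so the map to filters reflects the order; a filter of clopen sets is
  recovered from its intersection by compactness.\<close>

lemma filtral_latticeI:
  fixes L (structure)
  assumes "set_rep L \<phi>" and im: "\<phi> ` carrier L = Collect (closedin X)"
    and X: "compact_space X"
    and sep: "\<And>x y. x \<in> topspace X \<Longrightarrow> y \<in> topspace X \<Longrightarrow> x \<noteq> y \<Longrightarrow>
      \<exists>V. closedin X V \<and> openin X V \<and> x \<in> V \<and> y \<notin> V"
  shows "filtral_lattice L"
proof -
  interpret set_rep L \<phi> by fact
  interpret partial_order L by (rule po)
  have cl: "closedin X (\<phi> x)" if "x \<in> carrier L" for x
    using im that by blast
  obtain \<psi> where \<psi>: "\<And>S. closedin X S \<Longrightarrow> \<psi> S \<in> carrier L \<and> \<phi> (\<psi> S) = S"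
    using im by (metis (no_types, lifting) image_iff mem_Collect_eq)
  have lub: "least L (\<psi> (\<phi> x \<union> \<phi> y)) (Upper L {x, y})" if "x \<in> carrier L" "y \<in> carrier L" for x y
    using that \<psi>[OF closedin_Un[OF cl cl], of x y] by (intro least_Upper) auto
  have glb: "greatest L (\<psi> (\<phi> x \<inter> \<phi> y)) (Lower L {x, y})" if "x \<in> carrier L" "y \<in> carrier L" for x y
    using that \<psi>[OF closedin_Int[OF cl cl], of x y] by (intro greatest_Lower) auto
  have bot: "least L (\<psi> {}) (carrier L)" and top: "greatest L (\<psi> (topspace X)) (carrier L)"
    using \<psi>[of "{}"] \<psi>[of "topspace X"] le_iff closedin_subset[OF cl] unfolding least_def greatest_def by auto
  interpret bounded_lattice L
    using lub glb bot top by unfold_locales blast+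
  have \<phi>join: "\<phi> (x \<squnion> y) = \<phi> x \<union> \<phi> y" if "x \<in> carrier L" "y \<in> carrier L" for x y
    using joinI[of x y "\<lambda>s. s = \<psi> (\<phi> x \<union> \<phi> y)"] least_unique lub that \<psi>[OF closedin_Un[OF cl cl], of x y] by simp
  have \<phi>meet: "\<phi> (x \<sqinter> y) = \<phi> x \<inter> \<phi> y" if "x \<in> carrier L" "y \<in> carrier L" for x y
    using meetI[of x y "\<lambda>s. s = \<psi> (\<phi> x \<inter> \<phi> y)"] greatest_unique glb that \<psi>[OF closedin_Int[OF cl cl], of x y] by simp
  have \<phi>bot: "\<phi> \<bottom> = {}"
    using least_unique[OF bottom_least bot] \<psi>[of "{}"] by simp
  have \<phi>top: "\<phi> \<top> = topspace X"
    using greatest_unique[OF top_greatest top] \<psi>[of "topspace X"] by simp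
  have eqI: "x = y" if "x \<in> carrier L" "y \<in> carrier L" "\<phi> x = \<phi> y" for x y
    using inj that by (auto simp: inj_on_def)
  have bdl: "bounded_distrib_lattice L"
    unfolding bounded_distrib_lattice_def
    by (intro conjI ballI eqI) (auto simp: \<phi>join \<phi>meet bounded_lattice_axioms)
  let ?B = "boolean_center L"
  have center: "x \<in> carrier ?B \<longleftrightarrow> x \<in> carrier L \<and> openin X (\<phi> x)" for x
  proof
    assume "x \<in> carrier ?B"
    then obtain y where xy: "x \<in> carrier L" "y \<in> carrier L" "x \<sqinter> y = \<bottom>" "x \<squnion> y = \<top>"
      unfolding boolean_center_def by auto
    then have "\<phi> x = topspace X - \<phi> y"
      using \<phi>join[of x y] \<phi>meet[of x y] \<phi>bot \<phi>top by auto
    then show "x \<in> carrier L \<and> openin X (\<phi> x)"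
      using xy cl by auto
  next
    assume x: "x \<in> carrier L \<and> openin X (\<phi> x)"
    let ?y = "\<psi> (topspace X - \<phi> x)"
    have y: "?y \<in> carrier L" "\<phi> ?y = topspace X - \<phi> x"
      using \<psi>[of "topspace X - \<phi> x"] x by auto
    have "x \<sqinter> ?y = \<bottom>" "x \<squnion> ?y = \<top>"
      using x y closedin_subset[OF cl, of x] by (auto intro!: eqI simp: \<phi>join \<phi>meet \<phi>bot \<phi>top)
    then show "x \<in> carrier ?B"
      unfolding boolean_center_def using x y by auto
  qed
  have leB: "x \<sqsubseteq>\<^bsub>?B\<^esub> y \<longleftrightarrow> x \<sqsubseteq> y" for x y
    by (simp add: boolean_center_def)
  have meetB: "x \<sqinter>\<^bsub>?B\<^esub> y = x \<sqinter> y" if "x \<in> carrier ?B" "y \<in> carrier ?B" for x y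
    by (rule boolean_center_meet(2)[OF assms(1) bounded_lattice_axioms _ _ that]) (erule (1) \<phi>join \<phi>meet)+
  \<comment> \<open>Compactness strengthens the separation of two points to that of a point from a
    closed set: finitely many clopen neighbourhoods of \<open>p\<close> already have an intersection
    avoiding the closed set.\<close>
  have separate: "\<exists>y \<in> carrier ?B. \<phi> z \<subseteq> \<phi> y \<and> p \<notin> \<phi> y"
    if z: "z \<in> carrier L" and p: "p \<in> topspace X" "p \<notin> \<phi> z" for z p
  proof -
    let ?K = "{V. closedin X V \<and> openin X V \<and> p \<in> V}"
    have sub: "topspace X \<inter> \<Inter>?K \<subseteq> topspace X - \<phi> z"
      using sep p closedin_subset[OF cl[OF z]] by blast
    have "\<exists>F. finite F \<and> F \<subseteq> ?K \<and> topspace X \<inter> \<Inter>F \<subseteq> topspace X - \<phi> z"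
      by (rule compact_space_Inter_subset_open[OF X _ _ sub]) (use cl[OF z] in auto)
    then obtain F where F: "finite F" "F \<subseteq> ?K" "topspace X \<inter> \<Inter>F \<subseteq> topspace X - \<phi> z"
      by blast
    let ?V = "topspace X \<inter> \<Inter>F"
    \<comment> \<open>The empty \<open>F\<close> is treated apart because its intersection is the
      whole type; then \<open>?V\<close> is the whole space.\<close>
    have "openin X ?V"
      using F by (cases "F = {}") (auto intro!: openin_Int openin_Inter)
    moreover have "closedin X ?V"
      using F by (cases "F = {}") (auto intro!: closedin_Int closedin_Inter)
    ultimately have "\<psi> (topspace X - ?V) \<in> carrier ?B \<and> \<phi> (\<psi> (topspace X - ?V)) = topspace X - ?V"
      using \<psi>[OF closedin_diff[OF closedin_topspace, of X ?V]] openin_diff[OF openin_topspace, of X ?V]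
      by (simp add: center)
    then show ?thesis
      using F p closedin_subset[OF cl[OF z]] by blast
  qed
  let ?f = "\<lambda>x. {y \<in> carrier ?B. x \<sqsubseteq> y}"
  have emb: "?f y \<subseteq> ?f x \<longleftrightarrow> x \<sqsubseteq> y" if xy: "x \<in> carrier L" "y \<in> carrier L" for x y
  proof
    assume sub: "?f y \<subseteq> ?f x"
    have "\<phi> x \<subseteq> \<phi> y"
    proof
      fix p assume "p \<in> \<phi> x"
      then have p: "p \<in> topspace X"
        using closedin_subset[OF cl[OF xy(1)]] by blast
      show "p \<in> \<phi> y"
      proof (rule ccontr)
        assume "p \<notin> \<phi> y"
        then obtain w where w: "w \<in> carrier ?B" "\<phi> y \<subseteq> \<phi> w" "p \<notin> \<phi> w"
          using separate[OF xy(2) p] by blast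
        then have wL: "w \<in> carrier L" using center by blast
        then have "w \<in> ?f y" using w le_iff[OF xy(2) wL] by simp
        then have "\<phi> x \<subseteq> \<phi> w" using sub le_iff[OF xy(1) wL] by blast
        then show False using \<open>p \<in> \<phi> x\<close> w(3) by blast
      qed
    qed
    then show "x \<sqsubseteq> y" using le_iff[OF xy] by blast
  next
    assume "x \<sqsubseteq> y"
    then show "?f y \<subseteq> ?f x"
      using le_trans[OF _ _ xy] center by auto
  qed
  have filt: "lattice_filter ?B (?f x)" if x: "x \<in> carrier L" for x
    unfolding lattice_filter_def
  proof (intro conjI ballI impI)
    have "\<top> \<in> ?f x" using x center \<phi>top by auto
    then show "?f x \<noteq> {}" by blast
    show "z \<in> ?f x" if "y \<in> ?f x" "z \<in> carrier ?B" "y \<sqsubseteq>\<^bsub>?B\<^esub> z" for y z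
      using that le_trans[of x y z] x center by (auto simp: leB)
    show "y \<sqinter>\<^bsub>?B\<^esub> z \<in> ?f x" if "y \<in> ?f x" "z \<in> ?f x" for y z
      using that x center by (auto simp: meetB \<phi>meet intro: meet_le)
  qed auto
  have surj: "\<exists>x \<in> carrier L. ?f x = F" if F: "lattice_filter ?B F" for F
  proof -
    have Fsub: "F \<subseteq> carrier ?B" and Fne: "F \<noteq> {}"
      using F unfolding lattice_filter_def by simp_all
    have Fup: "y \<in> F" if "x \<in> F" "y \<in> carrier ?B" "x \<sqsubseteq> y" for x y
      using F that unfolding lattice_filter_def leB by blast
    have Fmeet: "x \<sqinter> y \<in> F" if "x \<in> F" "y \<in> F" for x y
      using F that meetB[OF subsetD[OF Fsub that(1)] subsetD[OF Fsub that(2)]]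
      unfolding lattice_filter_def by metis
    let ?S = "\<Inter>(\<phi> ` F)"
    have Scl: "closedin X ?S"
      using Fne Fsub cl center by (intro closedin_Inter) auto
    note x = \<psi>[OF Scl]
    have FL: "w \<in> carrier L" if "w \<in> F" for w
      using Fsub center that by blast
    \<comment> \<open>A filter is closed under binary meets, so each finite intersection of its
      members contains a member. Compactness will present a clopen neighbourhood of
      \<open>?S\<close> as a superset of such an intersection.\<close>
    have fin: "\<exists>w\<in>F. \<phi> w \<subseteq> \<Inter>G" if "finite G" "G \<subseteq> \<phi> ` F" for G
      using that
    proof (induction G rule: finite_induct)
      case empty
      then show ?case using Fne by blast
    next
      case (insert A G)
      then obtain w v where "w \<in> F" "\<phi> w \<subseteq> \<Inter>G" "v \<in> F" "A = \<phi> v" by blast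
      then show ?case
        using Fmeet[of w v] \<phi>meet[OF FL FL, of w v] by (intro bexI[of _ "w \<sqinter> v"]) auto
    qed
    have "?f (\<psi> ?S) = F"
    proof (intro subset_antisym subsetI)
      fix y assume y: "y \<in> ?f (\<psi> ?S)"
      then have y': "y \<in> carrier L" "openin X (\<phi> y)" "?S \<subseteq> \<phi> y"
        using center x le_iff[OF conjunct1[OF x], of y] by auto
      have "\<exists>G. finite G \<and> G \<subseteq> \<phi> ` F \<and> topspace X \<inter> \<Inter>G \<subseteq> \<phi> y"
        by (rule compact_space_Inter_subset_open[OF X]) (use y' Fsub cl center in auto)
      then obtain G where G: "finite G" "G \<subseteq> \<phi> ` F" "topspace X \<inter> \<Inter>G \<subseteq> \<phi> y"
        by blast
      obtain w where w: "w \<in> F" "\<phi> w \<subseteq> \<Inter>G" using fin[OF G(1,2)] by blast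
      have wL: "w \<in> carrier L" by (rule FL[OF w(1)])
      have "\<phi> w \<subseteq> \<phi> y"
        using G(3) w(2) closedin_subset[OF cl[OF wL]] by blast
      then show "y \<in> F" using Fup[OF w(1)] y le_iff[OF wL y'(1)] by simp
    next
      fix y assume y: "y \<in> F"
      then have yB: "y \<in> carrier ?B" using Fsub by blast
      then have "y \<in> carrier L" using center by blast
      then have "\<psi> ?S \<sqsubseteq> y" using x le_iff[OF conjunct1[OF x]] y by auto
      then show "y \<in> ?f (\<psi> ?S)" using yB by blast
    qed
    then show ?thesis using x by blast
  qed
  have "weak_partial_order (filter_poset ?B)"
    by unfold_locales (auto simp: filter_poset_def)
  moreover have "bij_betw ?f (carrier L) (carrier (filter_poset ?B))"
    unfolding bij_betw_def
  proof
    show "inj_on ?f (carrier L)"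
    proof (rule inj_onI)
      fix x y assume xy: "x \<in> carrier L" "y \<in> carrier L" "?f x = ?f y"
      then have "x \<sqsubseteq> y" "y \<sqsubseteq> x"
        using emb[OF xy(1,2)] emb[OF xy(2,1)] by simp_all
      then show "x = y" using xy le_antisym by blast
    qed
    show "?f ` carrier L = carrier (filter_poset ?B)"
    proof
      show "?f ` carrier L \<subseteq> carrier (filter_poset ?B)"
        using filt by (auto simp: filter_poset_def)
      show "carrier (filter_poset ?B) \<subseteq> ?f ` carrier L"
      proof
        fix F assume "F \<in> carrier (filter_poset ?B)"
        then have "lattice_filter ?B F" by (simp add: filter_poset_def)
        from surj[OF this] show "F \<in> ?f ` carrier L" by auto
      qed
    qed
  qed
  ultimately have "poset_iso L (filter_poset ?B) ?f"
    unfolding poset_iso_def order_emb_def using emb weak_partial_order_axioms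
    by (auto simp: filter_poset_def)
  then show ?thesis
    unfolding filtral_lattice_def using bdl by simp
qed


section \<open>Coproducts\<close>

context category
begin

lemma is_binary_coproduct_of_family:
  assumes "is_coproduct C {..<2::nat} A S \<iota>"
  shows "is_binary_coproduct C (A 0) (A 1) S (\<iota> 0) (\<iota> 1)"
proof -
  have two: "(\<forall>k\<in>{..<2::nat}. P k) \<longleftrightarrow> P 0 \<and> P 1" for P
    by (auto simp: numeral_2_eq_2 less_Suc_eq)
  note S = assms[unfolded is_coproduct_def two]
  show ?thesis
    unfolding is_binary_coproduct_def
  proof (intro conjI allI ballI)
    fix W a b assume a: "a \<in> Hom C (A 0) W" and b: "b \<in> Hom C (A 1) W"
    have "W \<in> Obj C" by (rule Hom_Obj(2)[OF a])
    moreover have "(if (0::nat) = 0 then a else b) \<in> Hom C (A 0) W"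
      "(if (1::nat) = 0 then a else b) \<in> Hom C (A 1) W"
      using a b by simp_all
    ultimately have "\<exists>!h. h \<in> Hom C S W \<and> h \<cdot> \<iota> 0 = (if (0::nat) = 0 then a else b) \<and>
        h \<cdot> \<iota> 1 = (if (1::nat) = 0 then a else b)"
      using S[THEN conjunct2, THEN conjunct2, THEN bspec, of W, THEN spec, of "\<lambda>k. if k = 0 then a else b"]
      by blast
    then show "\<exists>!h. h \<in> Hom C S W \<and> h \<cdot> \<iota> 0 = a \<and> h \<cdot> \<iota> 1 = b"
      by simp
  qed (use S in blast)+
qed

lemma ex_binary_coproduct:
  assumes "has_finite_coproducts C" "X \<in> Obj C" "Y \<in> Obj C"
  shows "\<exists>S i j. is_binary_coproduct C X Y S i j"
proof -
  define A where "A = (\<lambda>k::nat. if k = 0 then X else Y)"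
  have "\<forall>k<2. A k \<in> Obj C" using assms by (simp add: A_def)
  then obtain S \<iota> where "is_coproduct C {..<2::nat} A S \<iota>"
    using assms(1)[unfolded has_finite_coproducts_def, THEN spec, of 2, THEN spec, of A] by blast
  from is_binary_coproduct_of_family[OF this] show ?thesis
    by (auto simp: A_def)
qed

lemma ex_initial:
  assumes "has_finite_coproducts C"
  shows "\<exists>Z. is_initial C Z"
proof -
  obtain S and \<iota> :: "nat \<Rightarrow> 'm" where S: "is_coproduct C {..<0::nat} (\<lambda>_. undefined) S \<iota>"
    using assms[unfolded has_finite_coproducts_def, THEN spec, of 0, THEN spec, of "\<lambda>_. undefined"] by blast
  then have "is_initial C S"
    by (simp add: is_coproduct_def is_initial_def)
  then show ?thesis by blast
qed

lemma binary_coproductD: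
  assumes "is_binary_coproduct C X Y S i j"
  shows "S \<in> Obj C" "i \<in> Hom C X S" "j \<in> Hom C Y S"
    and "a \<in> Hom C X W \<Longrightarrow> b \<in> Hom C Y W \<Longrightarrow> \<exists>h. h \<in> Hom C S W \<and> h \<cdot> i = a \<and> h \<cdot> j = b"
    and "h \<in> Hom C S W \<Longrightarrow> k \<in> Hom C S W \<Longrightarrow> h \<cdot> i = k \<cdot> i \<Longrightarrow> h \<cdot> j = k \<cdot> j \<Longrightarrow> h = k"
proof -
  note S = assms[unfolded is_binary_coproduct_def]
  show O: "S \<in> Obj C" and i: "i \<in> Hom C X S" and j: "j \<in> Hom C Y S"
    using S by simp_all
  have U: "\<exists>!h. h \<in> Hom C S W \<and> h \<cdot> i = a \<and> h \<cdot> j = b" if "a \<in> Hom C X W" "b \<in> Hom C Y W" for a b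
    using S that by blast
  show "a \<in> Hom C X W \<Longrightarrow> b \<in> Hom C Y W \<Longrightarrow> \<exists>h. h \<in> Hom C S W \<and> h \<cdot> i = a \<and> h \<cdot> j = b"
    by (rule ex1_implies_ex[OF U])
  assume "h \<in> Hom C S W" "k \<in> Hom C S W" "h \<cdot> i = k \<cdot> i" "h \<cdot> j = k \<cdot> j"
  then show "h = k"
    using U[OF Comp_in_Hom[OF i \<open>h \<in> Hom C S W\<close>] Comp_in_Hom[OF j \<open>h \<in> Hom C S W\<close>]]
    by (auto dest: ex1_implies_ex)
qed

lemma binary_coproduct_iso:
  assumes S: "is_binary_coproduct C X Y S i j" and T: "is_binary_coproduct C X Y T k l"
  obtains e where "e \<in> Hom C S T" "is_iso C e" "e \<cdot> i = k" "e \<cdot> j = l"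
proof -
  note S' = binary_coproductD[OF S] and T' = binary_coproductD[OF T]
  obtain e where e: "e \<in> Hom C S T" "e \<cdot> i = k" "e \<cdot> j = l"
    using S'(4)[OF T'(2,3)] by blast
  obtain d where d: "d \<in> Hom C T S" "d \<cdot> k = i" "d \<cdot> l = j"
    using T'(4)[OF S'(2,3)] by blast
  have "d \<cdot> e = Ident C S"
    using Comp_assoc[OF S'(2) e(1) d(1)] Comp_assoc[OF S'(3) e(1) d(1)] e d
      Ident_Comp[OF S'(2)] Ident_Comp[OF S'(3)]
    by (intro S'(5)[OF Comp_in_Hom[OF e(1) d(1)] Ident_in_Hom[OF S'(1)]]) simp_all
  moreover have "e \<cdot> d = Ident C T"
    using Comp_assoc[OF T'(2) d(1) e(1)] Comp_assoc[OF T'(3) d(1) e(1)] e d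
      Ident_Comp[OF T'(2)] Ident_Comp[OF T'(3)]
    by (intro T'(5)[OF Comp_in_Hom[OF d(1) e(1)] Ident_in_Hom[OF T'(1)]]) simp_all
  ultimately have "is_iso C e"
    using is_iso_iff[OF e(1)] d(1) by blast
  then show ?thesis using that e by blast
qed

end

locale coproduct_category = category +
  assumes fin_coproducts: "has_finite_coproducts C"
begin

lemma coprod_is_coproduct:
  assumes "X \<in> Obj C" "Y \<in> Obj C"
  shows "is_binary_coproduct C X Y (coprod C X Y) (inl C X Y) (inr C X Y)"
proof -
  obtain S i j where "is_binary_coproduct C X Y S i j"
    using ex_binary_coproduct[OF fin_coproducts assms] by blast
  then have "case (S, i, j) of (S, i, j) \<Rightarrow> is_binary_coproduct C X Y S i j"
    by simp
  then have "case chosen_coproduct C X Y of (S, i, j) \<Rightarrow> is_binary_coproduct C X Y S i j"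
    unfolding chosen_coproduct_def by (rule someI)
  then show ?thesis
    by (simp add: coprod_def inl_def inr_def split_beta)
qed

lemmas coprod_Obj = binary_coproductD(1)[OF coprod_is_coproduct]
  and inl_Hom = binary_coproductD(2)[OF coprod_is_coproduct]
  and inr_Hom = binary_coproductD(3)[OF coprod_is_coproduct]
  and coprod_ex = binary_coproductD(4)[OF coprod_is_coproduct]
  and coprod_eqI = binary_coproductD(5)[OF coprod_is_coproduct]

lemma coprod_arr:
  assumes f: "f \<in> Hom C X X'" and g: "g \<in> Hom C Y Y'"
  shows "coprod_arr C f g \<in> Hom C (coprod C X Y) (coprod C X' Y')"
    and "coprod_arr C f g \<cdot> inl C X Y = inl C X' Y' \<cdot> f"
    and "coprod_arr C f g \<cdot> inr C X Y = inr C X' Y' \<cdot> g"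
proof -
  note O = Hom_Obj[OF f] Hom_Obj[OF g]
  note D = HomD[OF f] HomD[OF g]
  have a: "inl C X' Y' \<cdot> f \<in> Hom C X (coprod C X' Y')" and b: "inr C X' Y' \<cdot> g \<in> Hom C Y (coprod C X' Y')"
    using Comp_in_Hom[OF f inl_Hom[OF O(2,4)]] Comp_in_Hom[OF g inr_Hom[OF O(2,4)]] .
  let ?P = "\<lambda>h. h \<in> Hom C (coprod C X Y) (coprod C X' Y') \<and> h \<cdot> inl C X Y = inl C X' Y' \<cdot> f \<and>
     h \<cdot> inr C X Y = inr C X' Y' \<cdot> g"
  obtain h where h: "?P h"
    using coprod_ex[OF O(1,3) a b] by blast
  have "coprod_arr C f g = (THE h. ?P h)"
    unfolding coprod_arr_def D ..
  moreover have "?P (THE h. ?P h)"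
  proof (rule theI[of ?P, OF h])
    fix k assume "?P k"
    then show "k = h" using coprod_eqI[OF O(1,3), of k "coprod C X' Y'" h] h by simp
  qed
  ultimately have "?P (coprod_arr C f g)" by simp
  then show "coprod_arr C f g \<in> Hom C (coprod C X Y) (coprod C X' Y')"
    "coprod_arr C f g \<cdot> inl C X Y = inl C X' Y' \<cdot> f"
    "coprod_arr C f g \<cdot> inr C X Y = inr C X' Y' \<cdot> g" by simp_all
qed

lemma coprod_arr_eqI:
  assumes f: "f \<in> Hom C X X'" and g: "g \<in> Hom C Y Y'"
    and h: "h \<in> Hom C (coprod C X Y) (coprod C X' Y')"
    and "h \<cdot> inl C X Y = inl C X' Y' \<cdot> f" "h \<cdot> inr C X Y = inr C X' Y' \<cdot> g"
  shows "coprod_arr C f g = h"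
  using coprod_eqI[OF Hom_Obj(1)[OF f] Hom_Obj(1)[OF g] coprod_arr(1)[OF f g] h] assms(4,5)
    coprod_arr(2,3)[OF f g] by simp

lemma coprod_arr_Ident:
  assumes "X \<in> Obj C" "Y \<in> Obj C"
  shows "coprod_arr C (Ident C X) (Ident C Y) = Ident C (coprod C X Y)"
  using Comp_Ident[OF inl_Hom[OF assms]] Ident_Comp[OF inl_Hom[OF assms]]
    Comp_Ident[OF inr_Hom[OF assms]] Ident_Comp[OF inr_Hom[OF assms]]
  by (intro coprod_arr_eqI[of _ X X _ Y Y] Ident_in_Hom coprod_Obj assms) simp_all

lemma coprod_arr_Comp:
  assumes f: "f \<in> Hom C X X'" "f' \<in> Hom C X' X''" and g: "g \<in> Hom C Y Y'" "g' \<in> Hom C Y' Y''"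
  shows "coprod_arr C (f' \<cdot> f) (g' \<cdot> g) = coprod_arr C f' g' \<cdot> coprod_arr C f g"
proof (rule coprod_arr_eqI[OF Comp_in_Hom[OF f] Comp_in_Hom[OF g]])
  note O = Hom_Obj[OF f(1)] Hom_Obj[OF f(2)] Hom_Obj[OF g(1)] Hom_Obj[OF g(2)]
  note c = coprod_arr[OF f(1) g(1)] and c' = coprod_arr[OF f(2) g(2)]
  note il = inl_Hom[OF O(1,5)] and il' = inl_Hom[OF O(2,6)] and il'' = inl_Hom[OF O(4,8)]
  note ir = inr_Hom[OF O(1,5)] and ir' = inr_Hom[OF O(2,6)] and ir'' = inr_Hom[OF O(4,8)]
  show "coprod_arr C f' g' \<cdot> coprod_arr C f g \<in> Hom C (coprod C X Y) (coprod C X'' Y'')"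
    by (rule Comp_in_Hom[OF c(1) c'(1)])
  show "coprod_arr C f' g' \<cdot> coprod_arr C f g \<cdot> inl C X Y = inl C X'' Y'' \<cdot> (f' \<cdot> f)"
    using Comp_assoc[OF il c(1) c'(1)] Comp_assoc[OF f(1) il' c'(1)] Comp_assoc[OF f il''] c(2) c'(2)
    by simp
  show "coprod_arr C f' g' \<cdot> coprod_arr C f g \<cdot> inr C X Y = inr C X'' Y'' \<cdot> (g' \<cdot> g)"
    using Comp_assoc[OF ir c(1) c'(1)] Comp_assoc[OF g(1) ir' c'(1)] Comp_assoc[OF g ir''] c(3) c'(3)
    by simp
qed

lemma Hom_slice_iff:
  "t \<in> Hom (slice_cat C X) p q \<longleftrightarrow> (\<exists>h. t = (p, h, q) \<and> p \<in> Arr C \<and> Cod C p = X \<and> q \<in> Arr C \<and>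
     Cod C q = X \<and> h \<in> Hom C (Dom C p) (Dom C q) \<and> q \<cdot> h = p)"
  by (auto simp: slice_cat_def Hom_iff)

lemma Obj_slice: "p \<in> Obj (slice_cat C X) \<longleftrightarrow> p \<in> Hom C (Dom C p) X"
  by (auto simp: slice_cat_def Hom_iff)

lemma Hom_product_iff:
  "t \<in> Hom (product_cat A B) P Q \<longleftrightarrow> fst t \<in> Hom A (fst P) (fst Q) \<and> snd t \<in> Hom B (snd P) (snd Q)"
  by (cases t; cases P; cases Q) (auto simp: product_cat_def Hom_iff)

lemma slice_coprod_is_functor:
  assumes X: "X1 \<in> Obj C" "X2 \<in> Obj C"
  shows "is_functor (product_cat (slice_cat C X1) (slice_cat C X2)) (slice_cat C (coprod C X1 X2))
    (slice_coprod_functor C)"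
  unfolding is_functor_def
proof (intro conjI ballI impI)
  let ?P = "product_cat (slice_cat C X1) (slice_cat C X2)"
  let ?S = "slice_cat C (coprod C X1 X2)"
  show "category ?P" by (intro category_product_cat category_slice_cat)
  show "category ?S" by (rule category_slice_cat)
  show "FObj (slice_coprod_functor C) P \<in> Obj ?S" if PO: "P \<in> Obj ?P" for P
  proof -
    obtain p1 p2 where P: "P = (p1, p2)" "p1 \<in> Hom C (Dom C p1) X1" "p2 \<in> Hom C (Dom C p2) X2"
      using PO by (auto simp: product_cat_def Obj_slice)
    show ?thesis
      unfolding Obj_slice using coprod_arr(1)[OF P(2,3)] HomD(2)[OF coprod_arr(1)[OF P(2,3)]]
      by (simp add: P(1) slice_coprod_functor_def)
  qed
  show "FArr (slice_coprod_functor C) f \<in> Hom ?S (FObj (slice_coprod_functor C) (Dom ?P f))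
      (FObj (slice_coprod_functor C) (Cod ?P f))" if "f \<in> Arr ?P" for f
  proof -
    obtain p1 h1 q1 p2 h2 q2 where f: "f = ((p1, h1, q1), (p2, h2, q2))"
      by (metis prod_cases3 surj_pair)
    have h: "p1 \<in> Hom C (Dom C p1) X1" "q1 \<in> Hom C (Dom C q1) X1" "h1 \<in> Hom C (Dom C p1) (Dom C q1)"
      "q1 \<cdot> h1 = p1" "p2 \<in> Hom C (Dom C p2) X2" "q2 \<in> Hom C (Dom C q2) X2"
      "h2 \<in> Hom C (Dom C p2) (Dom C q2)" "q2 \<cdot> h2 = p2"
      using that unfolding f by (simp_all add: product_cat_def slice_cat_def Hom_iff)
    note c = coprod_arr(1)[OF h(1,5)] coprod_arr(1)[OF h(2,6)] coprod_arr(1)[OF h(3,7)]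
    have "coprod_arr C q1 q2 \<cdot> coprod_arr C h1 h2 = coprod_arr C p1 p2"
      using coprod_arr_Comp[OF h(3,2) h(7,6)] h by simp
    then show ?thesis
      unfolding f Hom_slice_iff using HomD[OF c(1)] HomD[OF c(2)] c(3)
      by (simp add: slice_coprod_functor_def product_cat_def slice_cat_def)
  qed
  show "FArr (slice_coprod_functor C) (Ident ?P P) = Ident ?S (FObj (slice_coprod_functor C) P)"
    if PO: "P \<in> Obj ?P" for P
  proof -
    obtain p1 p2 where P: "P = (p1, p2)" "p1 \<in> Hom C (Dom C p1) X1" "p2 \<in> Hom C (Dom C p2) X2"
      using PO by (auto simp: product_cat_def Obj_slice)
    show ?thesis
      using coprod_arr_Ident[OF Hom_Obj(1)[OF P(2)] Hom_Obj(1)[OF P(3)]] HomD(2)[OF coprod_arr(1)[OF P(2,3)]]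
      by (simp add: P(1) slice_coprod_functor_def product_cat_def slice_cat_def)
  qed
  show "FArr (slice_coprod_functor C) (g \<cdot>\<^bsub>?P\<^esub> f) =
      FArr (slice_coprod_functor C) g \<cdot>\<^bsub>?S\<^esub> FArr (slice_coprod_functor C) f"
    if fg: "f \<in> Arr ?P" "g \<in> Arr ?P" "Dom ?P g = Cod ?P f" for f g
  proof -
    obtain p1 h1 q1 p2 h2 q2 where f: "f = ((p1, h1, q1), (p2, h2, q2))"
      by (metis prod_cases3 surj_pair)
    obtain r1 k1 s1 r2 k2 s2 where g: "g = ((r1, k1, s1), (r2, k2, s2))"
      by (metis prod_cases3 surj_pair)
    have h: "r1 = q1" "r2 = q2" "h1 \<in> Hom C (Dom C p1) (Dom C q1)" "k1 \<in> Hom C (Dom C q1) (Dom C s1)"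
      "h2 \<in> Hom C (Dom C p2) (Dom C q2)" "k2 \<in> Hom C (Dom C q2) (Dom C s2)"
      using fg unfolding f g by (simp_all add: product_cat_def slice_cat_def)
    show ?thesis
      using coprod_arr_Comp[OF h(3-6)] h
      by (simp add: f g slice_coprod_functor_def product_cat_def slice_cat_def)
  qed
qed

end


section \<open>Points\<close>

lemma (in category) terminal_obj: "is_terminal C T \<Longrightarrow> is_terminal C (terminal_obj C)"
  unfolding terminal_obj_def by (rule someI)

lemma (in category) initial_obj: "is_initial C T \<Longrightarrow> is_initial C (initial_obj C)"
  unfolding initial_obj_def by (rule someI)

lemma (in category) pt_is_functor:
  assumes T: "is_terminal C T"
    and small: "\<And>X. X \<in> Obj C \<Longrightarrow> small U (Hom C (terminal_obj C) X)"
  shows "is_functor C (Set_cat U) (pt_functor C)"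
  unfolding is_functor_def
proof (intro conjI ballI impI)
  let ?T = "terminal_obj C"
  show "category C" by (rule category_axioms)
  show "category (Set_cat U :: ('m set, 'm set \<times> ('m \<Rightarrow> 'm) \<times> 'm set) cat)" by (rule category_Set_cat)
  show "FObj (pt_functor C) X \<in> Obj (Set_cat U)" if "X \<in> Obj C" for X
    using small[OF that] by (simp add: pt_functor_def Set_cat_def Let_def)
  show "FArr (pt_functor C) f \<in> Hom (Set_cat U) (FObj (pt_functor C) (Dom C f)) (FObj (pt_functor C) (Cod C f))"
    if "f \<in> Arr C" for f
    using small[OF Dom_in_Obj[OF that]] small[OF Cod_in_Obj[OF that]] Comp_in_Hom[OF _ Arr_Hom[OF that]]
    unfolding Hom_iff[of _ "Set_cat U"] by (auto simp: pt_functor_def Set_cat_def Let_def)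
  show "FArr (pt_functor C) (Ident C X) = Ident (Set_cat U) (FObj (pt_functor C) X)" if "X \<in> Obj C" for X
    using HomD[OF Ident_in_Hom[OF that]] Ident_Comp[of _ ?T X]
    by (auto simp: pt_functor_def Set_cat_def Let_def fun_eq_iff)
  show "FArr (pt_functor C) (g \<cdot> f) = FArr (pt_functor C) g \<cdot>\<^bsub>Set_cat U\<^esub> FArr (pt_functor C) f"
    if fg: "f \<in> Arr C" "g \<in> Arr C" "Dom C g = Cod C f" for f g
  proof -
    have f: "f \<in> Hom C (Dom C f) (Cod C f)" and g: "g \<in> Hom C (Cod C f) (Cod C g)"
      using fg by (simp_all add: Hom_iff)
    show ?thesis
      using Comp_assoc[OF _ f g, of _ ?T] Comp_in_Hom[OF _ f, of _ ?T] HomD[OF Comp_in_Hom[OF f g]]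
      by (auto simp: pt_functor_def Set_cat_def Let_def fun_eq_iff compose_def fg(3))
  qed
qed

lemma (in category) pt_faithfulI:
  assumes F: "is_functor C (Set_cat U) (pt_functor C)"
    and sep: "\<And>X Y f g. f \<in> Hom C X Y \<Longrightarrow> g \<in> Hom C X Y \<Longrightarrow>
      (\<And>x. x \<in> Hom C (terminal_obj C) X \<Longrightarrow> f \<cdot> x = g \<cdot> x) \<Longrightarrow> f = g"
  shows "faithful C (Set_cat U) (pt_functor C)"
  unfolding faithful_def
proof (intro conjI ballI inj_onI F)
  fix X Y f g assume f: "f \<in> Hom C X Y" and g: "g \<in> Hom C X Y"
    and eq: "FArr (pt_functor C) f = FArr (pt_functor C) g"
  show "f = g"
  proof (rule sep[OF f g])
    fix x assume x: "x \<in> Hom C (terminal_obj C) X"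
    have "(\<lambda>x \<in> Hom C (terminal_obj C) X. f \<cdot> x) = (\<lambda>x \<in> Hom C (terminal_obj C) X. g \<cdot> x)"
      using eq HomD[OF f] HomD[OF g] by (simp add: pt_functor_def Let_def)
    from fun_cong[OF this, of x] show "f \<cdot> x = g \<cdot> x" using x by simp
  qed
qed

lemma (in category) pt_faithfulD:
  assumes F: "faithful C (Set_cat U) (pt_functor C)"
    and f: "f \<in> Hom C X Y" and g: "g \<in> Hom C X Y"
    and eq: "\<And>x. x \<in> Hom C (terminal_obj C) X \<Longrightarrow> f \<cdot> x = g \<cdot> x"
  shows "f = g"
proof -
  have "inj_on (FArr (pt_functor C)) (Hom C X Y)"
    using F Hom_Obj[OF f] unfolding faithful_def by blast
  moreover have "FArr (pt_functor C) f = FArr (pt_functor C) g"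
    using eq HomD[OF f] HomD[OF g] by (simp add: pt_functor_def Let_def cong: restrict_cong)
  ultimately show ?thesis
    using f g by (rule inj_onD)
qed


section \<open>The category of compact Hausdorff spaces\<close>

definition ap :: "'u topology \<times> ('u \<Rightarrow> 'u) \<times> 'u topology \<Rightarrow> 'u \<Rightarrow> 'u" where
  "ap u = fst (snd u)"

definition mk :: "'u topology \<Rightarrow> ('u \<Rightarrow> 'u) \<Rightarrow> 'u topology \<Rightarrow> 'u topology \<times> ('u \<Rightarrow> 'u) \<times> 'u topology" where
  "mk X f Y = (X, restrict f (topspace X), Y)"

section \<open>Arrows of \<open>KH\<close> as continuous functions\<close>

lemma Obj_KH:
  "X \<in> Obj KH \<longleftrightarrow> compact_space X \<and> Hausdorff_space X \<and> small TYPE('u) (topspace (X :: 'u topology))"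
  by (simp add: KH_def Let_def)

lemma Obj_KHD:
  fixes X :: "'u topology"
  assumes "X \<in> Obj KH"
  shows "compact_space X" "Hausdorff_space X" "small TYPE('u) (topspace X)"
  using assms by (simp_all add: Obj_KH)

lemma Hom_KH:
  "u \<in> Hom KH X Y \<longleftrightarrow> X \<in> Obj KH \<and> Y \<in> Obj KH \<and> u = (X, ap u, Y) \<and> continuous_map X Y (ap u) \<and>
     ap u \<in> extensional (topspace X)"
  by (cases u) (auto simp: Hom_def KH_def Let_def ap_def)

lemma mk_Hom: "X \<in> Obj KH \<Longrightarrow> Y \<in> Obj KH \<Longrightarrow> continuous_map X Y f \<Longrightarrow> mk X f Y \<in> Hom KH X Y"
  unfolding Hom_KH by (auto simp: mk_def ap_def elim: continuous_map_eq)

lemma ap_mk: "x \<in> topspace X \<Longrightarrow> ap (mk X f Y) x = f x"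
  by (simp add: ap_def mk_def)

lemma Hom_KH_eqI:
  assumes "u \<in> Hom KH X Y" "v \<in> Hom KH X Y" "\<And>x. x \<in> topspace X \<Longrightarrow> ap u x = ap v x"
  shows "u = v"
proof -
  have "ap u = ap v"
    by (rule extensionalityI[of _ "topspace X"]) (use assms in \<open>auto simp: Hom_KH\<close>)
  then show ?thesis using assms(1,2) unfolding Hom_KH by metis
qed

lemma ap_cont: "u \<in> Hom KH X Y \<Longrightarrow> continuous_map X Y (ap u)"
  by (simp add: Hom_KH)

lemma ap_in: "u \<in> Hom KH X Y \<Longrightarrow> x \<in> topspace X \<Longrightarrow> ap u x \<in> topspace Y"
  using continuous_map_image_subset_topspace[OF ap_cont] by blast

lemma Comp_KH: "u \<in> Hom KH X Y \<Longrightarrow> v \<in> Hom KH Y Z \<Longrightarrow> v \<cdot>\<^bsub>KH\<^esub> u = (X, compose (topspace X) (ap v) (ap u), Z)"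
proof -
  assume "u \<in> Hom KH X Y" "v \<in> Hom KH Y Z"
  then obtain f g where "u = (X, f, Y)" "v = (Y, g, Z)"
    unfolding Hom_KH by metis
  then show ?thesis
    by (simp add: KH_def Let_def ap_def)
qed

lemma ap_Comp: "u \<in> Hom KH X Y \<Longrightarrow> v \<in> Hom KH Y Z \<Longrightarrow> x \<in> topspace X \<Longrightarrow> ap (v \<cdot>\<^bsub>KH\<^esub> u) x = ap v (ap u x)"
  by (simp add: Comp_KH ap_def compose_def)

lemma Ident_KH: "Ident KH X = mk X (\<lambda>x. x) X"
  by (simp add: KH_def Let_def mk_def)

lemma ap_Ident: "x \<in> topspace X \<Longrightarrow> ap (Ident KH X) x = x"
  by (simp add: Ident_KH ap_mk)

lemma category_KH: "category KH"
proof
  fix f :: "'u topology \<times> ('u \<Rightarrow> 'u) \<times> 'u topology" assume "f \<in> Arr KH"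
  then show "Dom KH f \<in> Obj KH" "Cod KH f \<in> Obj KH"
    by (auto simp: KH_def Let_def)
next
  fix X :: "'u topology" assume "X \<in> Obj KH"
  then show "Ident KH X \<in> Hom KH X X"
    unfolding Ident_KH by (rule mk_Hom) (simp_all add: \<open>X \<in> Obj KH\<close>)
next
  have comp: "g \<cdot>\<^bsub>KH\<^esub> f \<in> Hom KH X Z" if "f \<in> Hom KH X Y" "g \<in> Hom KH Y Z"
    for f g and X Y Z :: "'u topology"
  proof -
    have "continuous_map X Z (compose (topspace X) (ap g) (ap f))"
      by (rule continuous_map_eq[OF continuous_map_compose[OF ap_cont[OF that(1)] ap_cont[OF that(2)]]])
        (simp add: compose_def)
    then show ?thesis
      unfolding Comp_KH[OF that] using that by (auto simp: Hom_KH ap_def)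
  qed
  have id: "Ident KH X \<in> Hom KH X X" if "X \<in> Obj KH" for X :: "'u topology"
    unfolding Ident_KH by (rule mk_Hom) (simp_all add: that)
  fix f g h and W X Y Z :: "'u topology"
  assume f: "f \<in> Hom KH W X"
  then have WX: "W \<in> Obj KH" "X \<in> Obj KH" by (simp_all add: Hom_KH)
  show "f \<cdot>\<^bsub>KH\<^esub> Ident KH W = f"
    by (rule Hom_KH_eqI[OF comp[OF id[OF WX(1)] f] f]) (simp add: ap_Comp[OF id[OF WX(1)] f] ap_Ident)
  show "Ident KH X \<cdot>\<^bsub>KH\<^esub> f = f"
    by (rule Hom_KH_eqI[OF comp[OF f id[OF WX(2)]] f]) (simp add: ap_Comp[OF f id[OF WX(2)]] ap_Ident ap_in[OF f])
  assume g: "g \<in> Hom KH X Y"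
  show "g \<cdot>\<^bsub>KH\<^esub> f \<in> Hom KH W Y"
    by (rule comp[OF f g])
  assume h: "h \<in> Hom KH Y Z"
  show "h \<cdot>\<^bsub>KH\<^esub> g \<cdot>\<^bsub>KH\<^esub> f = h \<cdot>\<^bsub>KH\<^esub> (g \<cdot>\<^bsub>KH\<^esub> f)"
    by (rule Hom_KH_eqI[OF comp[OF f comp[OF g h]] comp[OF comp[OF f g] h]])
      (simp add: ap_Comp[OF f comp[OF g h]] ap_Comp[OF comp[OF f g] h] ap_Comp[OF f g] ap_Comp[OF g h] ap_in[OF f])
qed

interpretation KH: category "KH :: ('u topology, 'u topology \<times> ('u \<Rightarrow> 'u) \<times> 'u topology) cat"
  by (rule category_KH)

text \<open>Limits, disjoint sums and Stone-Cech compactifications are constructed over other types;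
  this returns them to objects of \<open>KH\<close>.\<close>

lemma KH_copy:
  fixes T :: "'x topology"
  assumes "compact_space T" "Hausdorff_space T" "small TYPE('u) (topspace T)"
  obtains X :: "'u topology" and e d where "X \<in> Obj KH" "homeomorphic_maps T X e d"
proof -
  obtain e :: "'x \<Rightarrow> 'u" where "inj_on e (topspace T)"
    using small_inj[OF assms(3)] .
  then have h: "homeomorphic_map T (final_topology T e) e"
    by (rule homeomorphic_map_final_topology)
  have hs: "T homeomorphic_space final_topology T e"
    using h homeomorphic_map_imp_homeomorphic_space by blast
  have "final_topology T e \<in> Obj KH"
    unfolding Obj_KH using homeomorphic_compact_space[OF hs] homeomorphic_Hausdorff_space[OF hs]
      small_image[OF assms(3)] assms(1,2) by (simp add: topspace_final_topology)
  then show ?thesis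
    using h that unfolding homeomorphic_map_maps by blast
qed

lemma Obj_KH_closed_subtopology:
  assumes "X \<in> Obj KH" "closedin X S"
  shows "subtopology X S \<in> Obj KH"
  unfolding Obj_KH
proof (intro conjI)
  show "compact_space (subtopology X S)"
    using closedin_compact_space[OF Obj_KHD(1)[OF assms(1)] assms(2)] compact_space_subtopology by blast
  show "Hausdorff_space (subtopology X S)"
    by (rule Hausdorff_space_subtopology[OF Obj_KHD(2)[OF assms(1)]])
  show "small TYPE('a) (topspace (subtopology X S))"
    by (rule small_subset[OF _ Obj_KHD(3)[OF assms(1)]]) simp
qed

definition img :: "'u topology \<times> ('u \<Rightarrow> 'u) \<times> 'u topology \<Rightarrow> 'u set" where
  "img u = ap u ` topspace (Dom KH u)"

lemma img_eq: "u \<in> Hom KH X Y \<Longrightarrow> img u = ap u ` topspace X"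
  by (simp add: img_def HomD)

lemma closed_map_KH: "u \<in> Hom KH X Y \<Longrightarrow> closed_map X Y (ap u)"
  using continuous_imp_closed_map[OF ap_cont] KH.Hom_Obj by (metis Obj_KHD(1,2))

lemma closedin_img: "u \<in> Hom KH X Y \<Longrightarrow> closedin Y (img u)"
  using closed_map_KH unfolding img_eq closed_map_def by (metis closedin_topspace)

lemma img_Comp: "u \<in> Hom KH X Y \<Longrightarrow> v \<in> Hom KH Y Z \<Longrightarrow> img (v \<cdot>\<^bsub>KH\<^esub> u) = ap v ` img u"
  by (simp add: img_eq[OF KH.Comp_in_Hom] img_eq image_image ap_Comp)

lemma KH_factor:
  assumes u: "u \<in> Hom KH W Y" and m: "m \<in> Hom KH M Y" and inj: "inj_on (ap m) (topspace M)"
    and sub: "img u \<subseteq> img m"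
  obtains h where "h \<in> Hom KH W M" "m \<cdot>\<^bsub>KH\<^esub> h = u"
proof -
  note O = KH.Hom_Obj[OF u] KH.Hom_Obj[OF m]
  have sub': "ap u ` topspace W \<subseteq> ap m ` topspace M"
    using sub unfolding img_eq[OF u] img_eq[OF m] .
  have "continuous_map W M (\<lambda>w. inv_into (topspace M) (ap m) (ap u w))"
    by (rule continuous_map_factor_injective[OF Obj_KHD(1)[OF O(3)] Obj_KHD(2)[OF O(2)]
          ap_cont[OF m] inj ap_cont[OF u] sub'])
  then have h: "mk W (\<lambda>w. inv_into (topspace M) (ap m) (ap u w)) M \<in> Hom KH W M" (is "?h \<in> _")
    by (rule mk_Hom[OF O(1,3)])
  have "m \<cdot>\<^bsub>KH\<^esub> ?h = u"
    by (rule Hom_KH_eqI[OF KH.Comp_in_Hom[OF h m] u])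
      (use sub' in \<open>auto simp: ap_Comp[OF h m] ap_mk intro!: f_inv_into_f\<close>)
  then show ?thesis using that h by blast
qed

lemma img_mono_factors:
  assumes u: "u \<in> Hom KH W Y" and m: "m \<in> Hom KH M Y" and f: "factors_through KH u m"
  shows "img u \<subseteq> img m"
proof -
  obtain h where h: "h \<in> Hom KH W M" "u = m \<cdot>\<^bsub>KH\<^esub> h"
    using f HomD(2)[OF u] HomD(2)[OF m] unfolding factors_through_def by metis
  show ?thesis
    unfolding h(2) img_Comp[OF h(1) m] img_eq[OF h(1)] img_eq[OF m] using ap_in[OF h(1)] by blast
qed

context
  assumes inacc: "inaccessible TYPE('u)"
begin

section \<open>Subobjects in \<open>KH\<close> as closed sets\<close>

lemma Obj_KH_point: "discrete_topology {a :: 'u} \<in> Obj KH"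
  unfolding Obj_KH using small_finite[OF inacc, of "{a}"] by (simp add: compact_space_discrete_topology)

lemma point_Hom:
  assumes "X \<in> Obj KH" "x \<in> topspace X"
  shows "mk (discrete_topology {a :: 'u}) (\<lambda>_. x) X \<in> Hom KH (discrete_topology {a}) X"
  using assms by (intro mk_Hom Obj_KH_point) auto

text \<open>Points are arrows out of a one-point space, so a mono has to separate them.\<close>

lemma monic_KH:
  fixes m :: "'u topology \<times> ('u \<Rightarrow> 'u) \<times> 'u topology"
  assumes m: "m \<in> Hom KH X Y"
  shows "monic KH m \<longleftrightarrow> inj_on (ap m) (topspace X)"
proof
  assume mon: "monic KH m"
  show "inj_on (ap m) (topspace X)"
  proof (rule inj_onI)
    fix x y assume xy: "x \<in> topspace X" "y \<in> topspace X" "ap m x = ap m y"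
    let ?T = "discrete_topology {undefined :: 'u}"
    note px = point_Hom[OF KH.Hom_Obj(1)[OF m] xy(1), of undefined]
    note py = point_Hom[OF KH.Hom_Obj(1)[OF m] xy(2), of undefined]
    have "m \<cdot>\<^bsub>KH\<^esub> mk ?T (\<lambda>_. x) X = m \<cdot>\<^bsub>KH\<^esub> mk ?T (\<lambda>_. y) X"
      by (rule Hom_KH_eqI[OF KH.Comp_in_Hom[OF px m] KH.Comp_in_Hom[OF py m]])
        (simp add: ap_Comp[OF px m] ap_Comp[OF py m] ap_mk xy(3))
    then have "mk ?T (\<lambda>_. x) X = mk ?T (\<lambda>_. y) X"
      using monicD[OF mon] px py HomD(2)[OF m] by blast
    then have "ap (mk ?T (\<lambda>_. x) X) undefined = ap (mk ?T (\<lambda>_. y) X) undefined"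
      by (rule arg_cong[of _ _ "\<lambda>u. ap u undefined"])
    then show "x = y"
      by (simp add: ap_mk)
  qed
next
  assume inj: "inj_on (ap m) (topspace X)"
  show "monic KH m"
    unfolding monic_def
  proof (intro conjI allI ballI impI)
    show "m \<in> Arr KH" by (rule HomD(1)[OF m])
    fix W a b assume "a \<in> Hom KH W (Dom KH m)" "b \<in> Hom KH W (Dom KH m)" and eq: "m \<cdot>\<^bsub>KH\<^esub> a = m \<cdot>\<^bsub>KH\<^esub> b"
    then have a: "a \<in> Hom KH W X" and b: "b \<in> Hom KH W X"
      by (simp_all add: HomD(2)[OF m])
    show "a = b"
    proof (rule Hom_KH_eqI[OF a b])
      fix w assume w: "w \<in> topspace W"
      have "ap m (ap a w) = ap m (ap b w)"
        using eq ap_Comp[OF a m w] ap_Comp[OF b m w] by simp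
      then show "ap a w = ap b w"
        using inj ap_in[OF a w] ap_in[OF b w] by (simp add: inj_on_eq_iff)
    qed
  qed
qed

lemma factors_KH:
  fixes m :: "'u topology \<times> ('u \<Rightarrow> 'u) \<times> 'u topology"
  assumes u: "u \<in> Hom KH W Y" and m: "monic KH m" "m \<in> Hom KH M Y"
  shows "factors_through KH u m \<longleftrightarrow> img u \<subseteq> img m"
proof
  assume "img u \<subseteq> img m"
  then obtain h where "h \<in> Hom KH W M" "m \<cdot>\<^bsub>KH\<^esub> h = u"
    using KH_factor[OF u m(2) monic_KH[OF m(2), THEN iffD1, OF m(1)]] by blast
  then show "factors_through KH u m"
    unfolding factors_through_def using HomD(2)[OF u] HomD(2)[OF m(2)] by auto
qed (rule img_mono_factors[OF u m(2)])

text \<open>All monos in one class have the same image (\<open>sub_img_subobj\<close>), so the union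
  stands for that common image without a choice of representative.\<close>

definition sub_img :: "('u topology \<times> ('u \<Rightarrow> 'u) \<times> 'u topology) set \<Rightarrow> 'u set" where
  "sub_img S = (\<Union>m\<in>S. img m)"

lemma sub_img_subobj:
  fixes m :: "'u topology \<times> ('u \<Rightarrow> 'u) \<times> 'u topology"
  assumes m: "monic KH m"
  shows "sub_img (subobj KH m) = img m"
proof -
  have "img n \<subseteq> img m" if "n \<in> subobj KH m" for n
  proof (rule img_mono_factors)
    have n: "monic KH n" "Cod KH n = Cod KH m" "factors_through KH n m"
      using that by (simp_all add: subobj_def)
    show "n \<in> Hom KH (Dom KH n) (Cod KH m)" using monic_Arr[OF n(1)] n(2) by (simp add: Hom_iff)
    show "m \<in> Hom KH (Dom KH m) (Cod KH m)" by (rule Arr_Hom[OF monic_Arr[OF m]])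
    show "factors_through KH n m" by (rule n(3))
  qed
  then show ?thesis
    unfolding sub_img_def using KH.mem_subobj_self[OF m] by blast
qed

lemma set_rep_Sub: "set_rep (Sub KH (X :: 'u topology)) sub_img"
proof
  show "eq (Sub KH X) = (=)" by (simp add: Sub_def)
  fix S T assume S: "S \<in> carrier (Sub KH X)" and T: "T \<in> carrier (Sub KH X)"
  obtain m where m: "monic KH m" "Cod KH m = X" "S = subobj KH m" using KH.Sub_obtain[OF S] .
  obtain n where n: "monic KH n" "Cod KH n = X" "T = subobj KH n" using KH.Sub_obtain[OF T] .
  show "S \<sqsubseteq>\<^bsub>Sub KH X\<^esub> T \<longleftrightarrow> sub_img S \<subseteq> sub_img T"
    unfolding m(3) n(3) KH.le_Sub[OF m(1) n(1)] sub_img_subobj[OF m(1)] sub_img_subobj[OF n(1)]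
    by (rule factors_KH[OF monic_Hom[OF m(1,2)] n(1) monic_Hom[OF n(1,2)]])
next
  show "inj_on sub_img (carrier (Sub KH X))"
  proof (rule inj_onI)
    fix S T assume S: "S \<in> carrier (Sub KH X)" and T: "T \<in> carrier (Sub KH X)" and eq: "sub_img S = sub_img T"
    obtain m where m: "monic KH m" "Cod KH m = X" "S = subobj KH m" using KH.Sub_obtain[OF S] .
    obtain n where n: "monic KH n" "Cod KH n = X" "T = subobj KH n" using KH.Sub_obtain[OF T] .
    have "img m = img n"
      using eq by (simp add: m(3) n(3) sub_img_subobj[OF m(1)] sub_img_subobj[OF n(1)])
    then show "S = T"
      unfolding m(3) n(3) using KH.subobj_eq_iff[OF m(1) n(1)] m(2) n(2)
        factors_KH[OF monic_Hom[OF m(1,2)] n(1) monic_Hom[OF n(1,2)]]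
        factors_KH[OF monic_Hom[OF n(1,2)] m(1) monic_Hom[OF m(1,2)]] by simp
  qed
qed

lemma closed_sub:
  assumes X: "X \<in> Obj KH" and S: "closedin X S"
  obtains m where "m \<in> Hom KH (subtopology X S) (X :: 'u topology)" "monic KH m" "img m = S"
    "\<And>x. x \<in> S \<Longrightarrow> ap m x = x"
proof -
  let ?S = "subtopology X S"
  have ts: "topspace ?S = S" using closedin_subset[OF S] by auto
  have m: "mk ?S (\<lambda>x. x) X \<in> Hom KH ?S X" (is "?m \<in> _")
    by (rule mk_Hom[OF Obj_KH_closed_subtopology[OF X S] X]) simp
  have ap: "ap ?m x = x" if "x \<in> S" for x using that ts by (simp add: ap_mk)
  have "monic KH ?m" unfolding monic_KH[OF m] ts using ap by (auto intro: inj_onI)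
  moreover have "img ?m = S" unfolding img_eq[OF m] ts using ap by auto
  ultimately show ?thesis using that m ap by blast
qed

text \<open>Together with \<open>set_rep_Sub\<close> this identifies the poset of subobjects of
  \<open>X\<close> with its closed sets, which reduces images, joins and filtrality to point-set
  topology.\<close>

lemma sub_img_carrier:
  assumes X: "X \<in> Obj KH"
  shows "sub_img ` carrier (Sub KH X) = Collect (closedin (X :: 'u topology))"
proof (intro subset_antisym subsetI)
  fix S assume "S \<in> sub_img ` carrier (Sub KH X)"
  then obtain R where R: "R \<in> carrier (Sub KH X)" "S = sub_img R" by blast
  obtain m where m: "monic KH m" "Cod KH m = X" "R = subobj KH m" using KH.Sub_obtain[OF R(1)] .
  show "S \<in> Collect (closedin X)"
    using closedin_img[OF monic_Hom[OF m(1,2)]] by (simp add: R(2) m(3) sub_img_subobj[OF m(1)])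
next
  fix S assume "S \<in> Collect (closedin X)"
  then obtain m where m: "m \<in> Hom KH (subtopology X S) X" "monic KH m" "img m = S"
    using closed_sub[OF X] by blast
  have "subobj KH m \<in> carrier (Sub KH X)"
    by (rule KH.subobj_closed[OF m(2) HomD(3)[OF m(1)]])
  then show "S \<in> sub_img ` carrier (Sub KH X)"
    using sub_img_subobj[OF m(2)] m(3) by blast
qed

text \<open>The set-theoretic image is compact, hence closed, so it is itself the smallest closed
  set through which \<open>f\<close> factors.\<close>

lemma is_image_KH:
  assumes f: "f \<in> Hom KH X (Y :: 'u topology)"
  shows "is_image KH f S \<longleftrightarrow> S \<in> carrier (Sub KH Y) \<and> sub_img S = img f"
proof -
  interpret set_rep "Sub KH Y" sub_img by (rule set_rep_Sub)
  interpret partial_order "Sub KH Y" by (rule po)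
  obtain S0 where S0: "S0 \<in> carrier (Sub KH Y)" "sub_img S0 = img f"
    using sub_img_carrier[OF KH.Hom_Obj(2)[OF f]] closedin_img[OF f] by (metis (no_types, lifting) imageE mem_Collect_eq)
  have fac: "(\<exists>m \<in> T. factors_through KH f m) \<longleftrightarrow> img f \<subseteq> sub_img T" if T: "T \<in> carrier (Sub KH Y)" for T
  proof -
    obtain m where m: "monic KH m" "Cod KH m = Y" "T = subobj KH m" using KH.Sub_obtain[OF T] .
    have "(\<exists>n \<in> T. factors_through KH f n) \<longleftrightarrow> factors_through KH f m"
      unfolding m(3) by (rule KH.ex_subobj_factors_iff[OF m(1)])
    then show ?thesis
      unfolding m(3) sub_img_subobj[OF m(1)] factors_KH[OF f m(1) monic_Hom[OF m(1,2)]] .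
  qed
  have set: "{T \<in> carrier (Sub KH Y). \<exists>m \<in> T. factors_through KH f m} =
      {T \<in> carrier (Sub KH Y). img f \<subseteq> sub_img T}"
    using fac by auto
  have least0: "least (Sub KH Y) S0 {T \<in> carrier (Sub KH Y). img f \<subseteq> sub_img T}"
    unfolding least_def using S0 le_iff by auto
  show ?thesis
    unfolding is_image_def HomD(3)[OF f] set
  proof
    assume "least (Sub KH Y) S {T \<in> carrier (Sub KH Y). img f \<subseteq> sub_img T}"
    then have "S = S0" using least0 by (rule least_unique)
    then show "S \<in> carrier (Sub KH Y) \<and> sub_img S = img f" using S0 by simp
  next
    assume "S \<in> carrier (Sub KH Y) \<and> sub_img S = img f"
    then show "least (Sub KH Y) S {T \<in> carrier (Sub KH Y). img f \<subseteq> sub_img T}"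
      unfolding least_def using le_iff by auto
  qed
qed

lemma has_finite_limits_KH: "has_finite_limits (KH :: ('u topology, _) cat)"
  unfolding has_finite_limits_def
proof (intro allI impI)
  fix J :: "(nat, nat) cat" and D :: "(nat, nat, 'u topology, 'u topology \<times> ('u \<Rightarrow> 'u) \<times> 'u topology) cfunctor"
  assume finO: "finite (Obj J)" and F: "is_functor J KH D"
  interpret J: category J by (rule is_functorD(1)[OF F])
  have DO: "FObj D j \<in> Obj KH" if "j \<in> Obj J" for j by (rule is_functorD(3)[OF F that])
  have DA: "FArr D u \<in> Hom KH (FObj D (Dom J u)) (FObj D (Cod J u))" if "u \<in> Arr J" for u
    by (rule is_functorD(4)[OF F Arr_Hom[OF that]])
  define P where "P = product_topology (FObj D) (Obj J)"
  define E where "E u = {x \<in> topspace P. ap (FArr D u) (x (Dom J u)) = x (Cod J u)}" for u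
  \<comment> \<open>The equalisers \<open>E u\<close> are closed because the targets are Hausdorff.
    Adding \<open>topspace P\<close> keeps the intersection inside the product when the diagram has
    no arrows.\<close>
  define L where "L = \<Inter>(insert (topspace P) (E ` Arr J))"
  have projP: "continuous_map P (FObj D j) (\<lambda>x. x j)" if "j \<in> Obj J" for j
    unfolding P_def using that by (rule continuous_map_product_projection)
  have tP: "topspace P = (\<Pi>\<^sub>E j\<in>Obj J. topspace (FObj D j))"
    by (simp add: P_def)
  have "closedin P (E u)" if u: "u \<in> Arr J" for u
    unfolding E_def
  proof (rule closedin_continuous_maps_eq)
    show "Hausdorff_space (FObj D (Cod J u))" by (rule Obj_KHD(2)[OF DO[OF J.Cod_in_Obj[OF u]]])
    show "continuous_map P (FObj D (Cod J u)) (\<lambda>x. ap (FArr D u) (x (Dom J u)))"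
      using continuous_map_compose[OF projP[OF J.Dom_in_Obj[OF u]] ap_cont[OF DA[OF u]]]
      by (simp add: o_def)
    show "continuous_map P (FObj D (Cod J u)) (\<lambda>x. x (Cod J u))"
      by (rule projP[OF J.Cod_in_Obj[OF u]])
  qed
  then have Lcl: "closedin P L"
    unfolding L_def by (intro closedin_Inter) auto
  define T where "T = subtopology P L"
  have tT: "topspace T = {x \<in> topspace P. \<forall>u\<in>Arr J. ap (FArr D u) (x (Dom J u)) = x (Cod J u)}"
    unfolding T_def L_def E_def by auto
  have "compact_space P" "Hausdorff_space P"
    unfolding P_def using Obj_KHD[OF DO] by (auto simp: compact_space_product_topology Hausdorff_space_product_topology)
  then have "compact_space T" "Hausdorff_space T"
    unfolding T_def using closedin_compact_space[OF _ Lcl]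
    by (auto simp: compact_space_subtopology Hausdorff_space_subtopology)
  moreover have "small TYPE('u) (topspace T)"
  proof (rule small_subset)
    show "topspace T \<subseteq> (\<Pi>\<^sub>E j\<in>Obj J. topspace (FObj D j))" unfolding tT tP by blast
    show "small TYPE('u) (\<Pi>\<^sub>E j\<in>Obj J. topspace (FObj D j))"
      by (intro small_PiE[OF inacc] small_UNION[OF inacc] small_finite[OF inacc] finO Obj_KHD(3) DO)
  qed
  ultimately obtain X :: "'u topology" and e d where X: "X \<in> Obj KH" and ed: "homeomorphic_maps T X e d"
    by (rule KH_copy)
  have e: "continuous_map T X e" and d: "continuous_map X T d"
    and de: "\<And>x. x \<in> topspace T \<Longrightarrow> d (e x) = x" and ed': "\<And>x. x \<in> topspace X \<Longrightarrow> e (d x) = x"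
    using ed unfolding homeomorphic_maps_def by auto
  have dT: "d x \<in> topspace T" if "x \<in> topspace X" for x
    using continuous_map_image_subset_topspace[OF d] that by blast
  define p where "p j = mk X (\<lambda>x. d x j) (FObj D j)" for j
  have p: "p j \<in> Hom KH X (FObj D j)" if j: "j \<in> Obj J" for j
    unfolding p_def
  proof (rule mk_Hom[OF X DO[OF j]])
    have "continuous_map X P d"
      using d unfolding T_def by (simp add: continuous_map_in_subtopology)
    from continuous_map_compose[OF this projP[OF j]] show "continuous_map X (FObj D j) (\<lambda>x. d x j)"
      by (simp add: o_def)
  qed
  have ap_p: "ap (p j) x = d x j" if "x \<in> topspace X" for j x
    using that by (simp add: p_def ap_mk)
  have "is_limit J KH D X p"
    unfolding is_limit_def
  proof (intro conjI allI impI)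
    show "is_cone J KH D X p"
      unfolding is_cone_def
    proof (intro conjI ballI X p)
      fix u assume u: "u \<in> Arr J"
      note pd = p[OF J.Dom_in_Obj[OF u]] and pc = p[OF J.Cod_in_Obj[OF u]]
      show "FArr D u \<cdot>\<^bsub>KH\<^esub> p (Dom J u) = p (Cod J u)"
      proof (rule Hom_KH_eqI[OF KH.Comp_in_Hom[OF pd DA[OF u]] pc])
        fix x assume x: "x \<in> topspace X"
        show "ap (FArr D u \<cdot>\<^bsub>KH\<^esub> p (Dom J u)) x = ap (p (Cod J u)) x"
          using ap_Comp[OF pd DA[OF u] x] ap_p[OF x] dT[OF x] u unfolding tT by simp
      qed
    qed
    fix M q assume cone: "is_cone J KH D M q"
    then have M: "M \<in> Obj KH" and q: "\<And>j. j \<in> Obj J \<Longrightarrow> q j \<in> Hom KH M (FObj D j)"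
      and qu: "\<And>u. u \<in> Arr J \<Longrightarrow> FArr D u \<cdot>\<^bsub>KH\<^esub> q (Dom J u) = q (Cod J u)"
      unfolding is_cone_def by auto
    define g where "g m = (\<lambda>j\<in>Obj J. ap (q j) m)" for m
    have "continuous_map M P g"
      unfolding P_def continuous_map_componentwise
      using ap_cont[OF q] by (auto simp: g_def)
    moreover have gT: "g m \<in> topspace T" if m: "m \<in> topspace M" for m
      unfolding tT tP
    proof (intro CollectI conjI ballI)
      show "g m \<in> (\<Pi>\<^sub>E j\<in>Obj J. topspace (FObj D j))"
        unfolding g_def using ap_in[OF q m] by simp
      fix u assume u: "u \<in> Arr J"
      show "ap (FArr D u) (g m (Dom J u)) = g m (Cod J u)"
        using ap_Comp[OF q[OF J.Dom_in_Obj[OF u]] DA[OF u] m] qu[OF u] J.Dom_in_Obj[OF u] J.Cod_in_Obj[OF u]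
        by (simp add: g_def)
    qed
    ultimately have "continuous_map M T g"
      unfolding T_def continuous_map_in_subtopology using closedin_subset[OF Lcl] by (auto simp: T_def)
    then have "continuous_map M X (\<lambda>m. e (g m))"
      using continuous_map_compose[OF _ e] by (simp add: o_def)
    then have h: "mk M (\<lambda>m. e (g m)) X \<in> Hom KH M X" (is "?h \<in> _")
      by (rule mk_Hom[OF M X])
    show "\<exists>!h. h \<in> Hom KH M X \<and> (\<forall>j\<in>Obj J. p j \<cdot>\<^bsub>KH\<^esub> h = q j)"
    proof (rule ex1I[of _ ?h], intro conjI ballI h)
      fix j assume j: "j \<in> Obj J"
      show "p j \<cdot>\<^bsub>KH\<^esub> ?h = q j"
      proof (rule Hom_KH_eqI[OF KH.Comp_in_Hom[OF h p[OF j]] q[OF j]])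
        fix m assume m: "m \<in> topspace M"
        show "ap (p j \<cdot>\<^bsub>KH\<^esub> ?h) m = ap (q j) m"
          using ap_Comp[OF h p[OF j] m] ap_p[OF ap_in[OF h m]] de[OF gT[OF m]] j
          by (simp add: ap_mk[OF m] g_def)
      qed
    next
      fix k assume k: "k \<in> Hom KH M X \<and> (\<forall>j\<in>Obj J. p j \<cdot>\<^bsub>KH\<^esub> k = q j)"
      then have kH: "k \<in> Hom KH M X" by blast
      show "k = ?h"
      proof (rule Hom_KH_eqI[OF kH h])
        fix m assume m: "m \<in> topspace M"
        note km = ap_in[OF kH m]
        have "d (ap k m) = g m"
        proof (rule PiE_ext)
          show "d (ap k m) \<in> (\<Pi>\<^sub>E j\<in>Obj J. topspace (FObj D j))" "g m \<in> (\<Pi>\<^sub>E j\<in>Obj J. topspace (FObj D j))"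
            using dT[OF km] gT[OF m] unfolding tT tP by blast+
          fix j assume j: "j \<in> Obj J"
          then have "ap (p j \<cdot>\<^bsub>KH\<^esub> k) m = ap (q j) m" using k by simp
          then show "d (ap k m) j = g m j"
            using ap_Comp[OF kH p[OF j] m] ap_p[OF km] j by (simp add: g_def)
        qed
        then show "ap k m = ap ?h m"
          using ed'[OF km] by (simp add: ap_mk[OF m])
      qed
    qed
  qed
  then show "\<exists>L p. is_limit J KH D L p" by blast
qed

section \<open>Pullbacks, images and joins in \<open>KH\<close>\<close>

lemma ex_pullback_KH:
  "f \<in> Hom KH X Z \<Longrightarrow> g \<in> Hom KH Y (Z :: 'u topology) \<Longrightarrow> \<exists>p q. is_pullback KH f g p q"
  by (rule KH.ex_pullback[OF has_finite_limits_KH])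

text \<open>The universal property is applied to a one-point space. It shows that every abstract
  pullback has the expected points, so pullbacks need not be computed from a chosen
  construction.\<close>

lemma pullback_KH_points:
  fixes f :: "'u topology \<times> ('u \<Rightarrow> 'u) \<times> 'u topology"
  assumes pb: "is_pullback KH f g p q"
    and x: "x \<in> topspace (Dom KH f)" and y: "y \<in> topspace (Dom KH g)" and eq: "ap f x = ap g y"
  shows "\<exists>z \<in> topspace (Dom KH p). ap p z = x \<and> ap q z = y"
proof -
  note D = KH.is_pullbackD(1-5)[OF pb]
  let ?T = "discrete_topology {undefined :: 'u}"
  note a = point_Hom[OF KH.Hom_Obj(1)[OF D(3)] x, of undefined]
  note b = point_Hom[OF KH.Hom_Obj(1)[OF D(4)] y, of undefined]
  have t: "undefined \<in> topspace ?T" by simp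
  have "f \<cdot>\<^bsub>KH\<^esub> mk ?T (\<lambda>_. x) (Dom KH f) = g \<cdot>\<^bsub>KH\<^esub> mk ?T (\<lambda>_. y) (Dom KH g)"
    by (rule Hom_KH_eqI[OF KH.Comp_in_Hom[OF a D(3)] KH.Comp_in_Hom[OF b D(4)]])
      (simp add: ap_Comp[OF a D(3)] ap_Comp[OF b D(4)] ap_mk eq)
  from KH.is_pullbackD(6)[OF pb a b this]
  obtain h where h: "h \<in> Hom KH ?T (Dom KH p)" "p \<cdot>\<^bsub>KH\<^esub> h = mk ?T (\<lambda>_. x) (Dom KH f)"
    "q \<cdot>\<^bsub>KH\<^esub> h = mk ?T (\<lambda>_. y) (Dom KH g)" by blast
  have "ap p (ap h undefined) = x" "ap q (ap h undefined) = y"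
    using ap_Comp[OF h(1) D(1) t] ap_Comp[OF h(1) D(2) t] ap_mk[OF t] h(2,3) by metis+
  then show ?thesis
    using ap_in[OF h(1) t] by blast
qed

lemma sub_pullback_KH:
  assumes f: "f \<in> Hom KH X (Y :: 'u topology)" and S: "S \<in> carrier (Sub KH Y)"
  shows "sub_pullback KH f S \<in> carrier (Sub KH X)"
    and "sub_img (sub_pullback KH f S) = {x \<in> topspace X. ap f x \<in> sub_img S}"
proof -
  obtain n where n: "monic KH n" "Cod KH n = Y" "S = subobj KH n" using KH.Sub_obtain[OF S] .
  note nH = monic_Hom[OF n(1,2)]
  obtain m q where pb: "is_pullback KH f n m q"
    using ex_pullback_KH[OF f nH] by blast
  note D = KH.is_pullbackD(1-5)[OF pb] and mm = KH.pullback_monic[OF pb n(1)]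
  have Df: "Dom KH f = X" by (rule HomD(2)[OF f])
  note eq = KH.sub_pullback_subobj[OF pb n(1)]
  show "sub_pullback KH f S \<in> carrier (Sub KH X)"
    unfolding n(3) eq by (rule KH.subobj_closed[OF mm]) (use HomD(3)[OF D(1)] Df in simp)
  have "img m = {x \<in> topspace X. ap f x \<in> img n}"
  proof (intro subset_antisym subsetI)
    fix x assume "x \<in> img m"
    then obtain z where z: "z \<in> topspace (Dom KH m)" "x = ap m z" unfolding img_def by blast
    have "ap f x = ap n (ap q z)"
      using ap_Comp[OF D(1,3) z(1)] ap_Comp[OF D(2,4) z(1)] D(5) z(2) by simp
    then show "x \<in> {x \<in> topspace X. ap f x \<in> img n}"
      using ap_in[OF D(1) z(1)] ap_in[OF D(2) z(1)] z(2) Df unfolding img_def by auto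
  next
    fix x assume "x \<in> {x \<in> topspace X. ap f x \<in> img n}"
    then obtain y where "x \<in> topspace X" "y \<in> topspace (Dom KH n)" "ap f x = ap n y" unfolding img_def by blast
    from pullback_KH_points[OF pb _ this(2,3)] this(1) Df show "x \<in> img m"
      unfolding img_def by auto
  qed
  then show "sub_img (sub_pullback KH f S) = {x \<in> topspace X. ap f x \<in> sub_img S}"
    unfolding n(3) eq sub_img_subobj[OF mm] sub_img_subobj[OF n(1)] .
qed

lemma regular_KH: "regular_category (KH :: ('u topology, _) cat)"
  unfolding regular_category_def
proof (intro conjI ballI allI impI category_KH has_finite_limits_KH)
  fix f :: "'u topology \<times> ('u \<Rightarrow> 'u) \<times> 'u topology" assume "f \<in> Arr KH"
  then have f: "f \<in> Hom KH (Dom KH f) (Cod KH f)" by (rule Arr_Hom)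
  show "\<exists>S. is_image KH f S"
    unfolding is_image_KH[OF f]
    using sub_img_carrier[OF KH.Hom_Obj(2)[OF f]] closedin_img[OF f] by (metis (no_types, lifting) imageE mem_Collect_eq)
next
  fix f g p q :: "'u topology \<times> ('u \<Rightarrow> 'u) \<times> 'u topology" and S
  assume pb: "is_pullback KH f g p q" and im: "is_image KH f S"
  note D = KH.is_pullbackD(1-5)[OF pb]
  have S: "S \<in> carrier (Sub KH (Cod KH f))" "sub_img S = img f"
    using im unfolding is_image_KH[OF D(3)] by simp_all
  have "{y \<in> topspace (Dom KH g). ap g y \<in> img f} = img q"
  proof (intro subset_antisym subsetI)
    fix y assume "y \<in> {y \<in> topspace (Dom KH g). ap g y \<in> img f}"
    then obtain x where "y \<in> topspace (Dom KH g)" "x \<in> topspace (Dom KH f)" "ap f x = ap g y"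
      unfolding img_def by auto
    from pullback_KH_points[OF pb this(2,1,3)] show "y \<in> img q"
      unfolding img_eq[OF D(2)] by auto
  next
    fix y assume "y \<in> img q"
    then obtain z where z: "z \<in> topspace (Dom KH p)" "y = ap q z" unfolding img_eq[OF D(2)] by blast
    have "ap g y = ap f (ap p z)"
      using ap_Comp[OF D(1,3) z(1)] ap_Comp[OF D(2,4) z(1)] D(5) z(2) by simp
    then show "y \<in> {y \<in> topspace (Dom KH g). ap g y \<in> img f}"
      using ap_in[OF D(1) z(1)] ap_in[OF D(2) z(1)] z(2) unfolding img_def by auto
  qed
  then show "is_image KH q (sub_pullback KH g S)"
    unfolding is_image_KH[OF D(2)] using sub_pullback_KH[OF D(4) S(1)] S(2) by simp
qed

text \<open>Finite joins are unions of closed sets, and \<open>f\<^sup>*\<close> acts as the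
  preimage, which commutes with unions.\<close>

lemma coherent_KH: "coherent_category (KH :: ('u topology, _) cat)"
  unfolding coherent_category_def
proof (intro conjI ballI allI impI regular_KH)
  have join: "\<exists>S \<in> carrier (Sub KH X). sub_img S = \<Union>(sub_img ` F)"
    if X: "X \<in> Obj KH" and F: "F \<subseteq> carrier (Sub KH X)" "finite F" for X :: "'u topology" and F
  proof -
    have "closedin X (\<Union>(sub_img ` F))"
      using F sub_img_carrier[OF X] by (intro closedin_Union) auto
    then show ?thesis
      using sub_img_carrier[OF X] by (metis (no_types, lifting) imageE mem_Collect_eq)
  qed
  fix X :: "'u topology" and F
  assume X: "X \<in> Obj KH" and F: "F \<subseteq> carrier (Sub KH X)" "finite F"
  show "\<exists>S. least (Sub KH X) S (Upper (Sub KH X) F)"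
    using join[OF X F] set_rep.least_Upper[OF set_rep_Sub F(1)] by blast
next
  fix f :: "'u topology \<times> ('u \<Rightarrow> 'u) \<times> 'u topology" and F S
  assume f: "f \<in> Arr KH" and F: "F \<subseteq> carrier (Sub KH (Cod KH f))" "finite F"
    and S: "least (Sub KH (Cod KH f)) S (Upper (Sub KH (Cod KH f)) F)"
  note fH = Arr_Hom[OF f]
  have "closedin (Cod KH f) (\<Union>(sub_img ` F))"
    using F sub_img_carrier[OF KH.Hom_Obj(2)[OF fH]] by (intro closedin_Union) auto
  then obtain S0 where "S0 \<in> carrier (Sub KH (Cod KH f))" "sub_img S0 = \<Union>(sub_img ` F)"
    using sub_img_carrier[OF KH.Hom_Obj(2)[OF fH]] by (metis (no_types, lifting) imageE mem_Collect_eq)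
  then have S': "S \<in> carrier (Sub KH (Cod KH f))" "sub_img S = \<Union>(sub_img ` F)"
    using S set_rep.least_Upper_iff[OF set_rep_Sub F(1)] by blast+
  show "least (Sub KH (Dom KH f)) (sub_pullback KH f S) (Upper (Sub KH (Dom KH f)) (sub_pullback KH f ` F))"
  proof (rule set_rep.least_Upper[OF set_rep_Sub])
    show "sub_pullback KH f ` F \<subseteq> carrier (Sub KH (Dom KH f))"
      using sub_pullback_KH(1)[OF fH] F(1) by blast
    show "sub_pullback KH f S \<in> carrier (Sub KH (Dom KH f))"
      by (rule sub_pullback_KH(1)[OF fH S'(1)])
    have "sub_img (sub_pullback KH f T) = {x \<in> topspace (Dom KH f). ap f x \<in> sub_img T}" if "T \<in> F" for T
      using sub_pullback_KH(2)[OF fH subsetD[OF F(1) that]] .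
    then show "sub_img (sub_pullback KH f S) = \<Union>(sub_img ` (sub_pullback KH f ` F))"
      unfolding sub_pullback_KH(2)[OF fH S'(1)] S'(2) by auto
  qed
qed

end


section \<open>Quotients and coproducts of compact Hausdorff spaces\<close>

context
  assumes inacc: "inaccessible TYPE('u)"
begin

section \<open>Terminal object, well-poweredness and well-pointedness of \<open>KH\<close>\<close>

lemma is_terminal_KH_point: "is_terminal KH (discrete_topology {a :: 'u})"
  unfolding is_terminal_def
proof (intro conjI ballI Obj_KH_point[OF inacc])
  fix X :: "'u topology" assume X: "X \<in> Obj KH"
  have h: "mk X (\<lambda>_. a) (discrete_topology {a}) \<in> Hom KH X (discrete_topology {a})"
    by (intro mk_Hom X Obj_KH_point[OF inacc]) simp
  show "\<exists>!f. f \<in> Hom KH X (discrete_topology {a})"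
  proof (rule ex1I, rule h)
    fix f assume f: "f \<in> Hom KH X (discrete_topology {a})"
    show "f = mk X (\<lambda>_. a) (discrete_topology {a})"
      by (rule Hom_KH_eqI[OF f h]) (use ap_in[OF f] in \<open>auto simp: ap_mk\<close>)
  qed
qed

lemma terminal_KH_topspace:
  assumes T: "is_terminal KH (T :: 'u topology)"
  obtains t where "topspace T = {t}"
proof -
  let ?P = "discrete_topology {undefined :: 'u}"
  have TO: "T \<in> Obj KH" and uniq: "\<And>X. X \<in> Obj KH \<Longrightarrow> \<exists>!f. f \<in> Hom KH X T"
    using T unfolding is_terminal_def by auto
  note U = uniq[OF Obj_KH_point[OF inacc, of undefined]]
  then obtain f where f: "f \<in> Hom KH ?P T" by blast
  have "x = ap f undefined" if x: "x \<in> topspace T" for x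
  proof -
    have "mk ?P (\<lambda>_. x) T = f"
      using U f point_Hom[OF inacc TO x, of undefined] by blast
    then show ?thesis using ap_mk[of undefined ?P "\<lambda>_. x" T] by simp
  qed
  moreover have "ap f undefined \<in> topspace T"
    using ap_in[OF f, of undefined] by simp
  ultimately have "topspace T = {ap f undefined}" by blast
  then show ?thesis using that by blast
qed

lemma well_powered_KH: "well_powered TYPE('u) (KH :: ('u topology, _) cat)"
  unfolding well_powered_def
proof (intro conjI ballI category_KH)
  fix X :: "'u topology" assume X: "X \<in> Obj KH"
  have "sub_img ` carrier (Sub KH X) \<subseteq> Pow (topspace X)"
    unfolding sub_img_carrier[OF inacc X] using closedin_subset by blast
  then have "carrier (Sub KH X) \<lesssim> Pow (topspace X)"
    using set_rep.inj[OF set_rep_Sub[OF inacc, of X]] unfolding lepoll_def by blast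
  then show "small TYPE('u) (carrier (Sub KH X))"
    by (rule small_lepoll[OF _ small_Pow[OF inacc Obj_KHD(3)[OF X]]])
qed

lemma well_pointed_KH: "well_pointed TYPE('u) (KH :: ('u topology, _) cat)"
  unfolding well_pointed_def
proof (intro conjI category_KH)
  let ?C = "KH :: ('u topology, 'u topology \<times> ('u \<Rightarrow> 'u) \<times> 'u topology) cat"
  show "\<exists>T. is_terminal ?C T" using is_terminal_KH_point by blast
  define T where "T = terminal_obj ?C"
  have T: "is_terminal ?C T"
    unfolding T_def by (rule KH.terminal_obj[OF is_terminal_KH_point])
  obtain t where t: "topspace T = {t}" using terminal_KH_topspace[OF T] .
  have pt: "f = g" if f: "f \<in> Hom ?C T X" "g \<in> Hom ?C T X" "ap f t = ap g t" for f g X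
    by (rule Hom_KH_eqI[OF f(1,2)]) (simp add: t f(3))
  show "faithful ?C (Set_cat TYPE('u)) (pt_functor ?C)"
  proof (rule KH.pt_faithfulI[OF KH.pt_is_functor[OF T]], unfold T_def[symmetric])
    fix X :: "'u topology" assume X: "X \<in> Obj KH"
    have "(\<lambda>f. ap f t) ` Hom ?C T X \<subseteq> topspace X"
      using ap_in t by fastforce
    moreover have "inj_on (\<lambda>f. ap f t) (Hom ?C T X)"
      using pt by (auto intro: inj_onI)
    ultimately have "Hom ?C T X \<lesssim> topspace X"
      unfolding lepoll_def by blast
    then show "small TYPE('u) (Hom ?C T X)"
      by (rule small_lepoll[OF _ Obj_KHD(3)[OF X]])
  next
    fix X Y :: "'u topology" and f g
    assume f: "f \<in> Hom KH X Y" and g: "g \<in> Hom KH X Y"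
      and eq: "\<And>x. x \<in> Hom KH T X \<Longrightarrow> f \<cdot>\<^bsub>KH\<^esub> x = g \<cdot>\<^bsub>KH\<^esub> x"
    show "f = g"
    proof (rule Hom_KH_eqI[OF f g])
      fix x assume x: "x \<in> topspace X"
      have TO: "T \<in> Obj KH" using T by (simp add: is_terminal_def)
      have tt: "t \<in> topspace T" by (simp add: t)
      have p: "mk T (\<lambda>_. x) X \<in> Hom KH T X"
        by (rule mk_Hom[OF TO KH.Hom_Obj(1)[OF f]]) (simp add: x)
      have "ap (f \<cdot>\<^bsub>KH\<^esub> mk T (\<lambda>_. x) X) t = ap (g \<cdot>\<^bsub>KH\<^esub> mk T (\<lambda>_. x) X) t"
        using eq[OF p] by simp
      then show "ap f x = ap g x"
        by (simp add: ap_Comp[OF p f tt] ap_Comp[OF p g tt] ap_mk[OF tt])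
    qed
  qed
qed

text \<open>A continuous surjection from a compact onto a Hausdorff space is a quotient map, so a
  function that is well defined on its fibres descends continuously.\<close>

lemma KH_descend:
  assumes f: "f \<in> Hom KH X (Y :: 'u topology)" and surj: "img f = topspace Y" and a: "a \<in> Hom KH X W"
    and eq: "\<And>x x'. x \<in> topspace X \<Longrightarrow> x' \<in> topspace X \<Longrightarrow> ap f x = ap f x' \<Longrightarrow> ap a x = ap a x'"
  shows "\<exists>!h. h \<in> Hom KH Y W \<and> h \<cdot>\<^bsub>KH\<^esub> f = a"
proof -
  note O = KH.Hom_Obj[OF f] KH.Hom_Obj[OF a]
  have surj': "ap f ` topspace X = topspace Y"
    using surj unfolding img_eq[OF f] .
  have q: "quotient_map X Y (ap f)"
    by (rule continuous_imp_quotient_map[OF ap_cont[OF f] Obj_KHD(1)[OF O(1)] Obj_KHD(2)[OF O(2)] surj'])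
  define h where "h y = ap a (inv_into (topspace X) (ap f) y)" for y
  have hf: "h (ap f x) = ap a x" if x: "x \<in> topspace X" for x
    unfolding h_def
    using eq[OF inv_into_into[of "ap f x" "ap f" "topspace X"] x f_inv_into_f[of "ap f x" "ap f" "topspace X"]] x
    by blast
  have "continuous_map X W (h \<circ> ap f)"
    by (rule continuous_map_eq[OF ap_cont[OF a]]) (simp add: hf)
  then have "continuous_map Y W h"
    using continuous_compose_quotient_map_eq[OF q] by blast
  then have h: "mk Y h W \<in> Hom KH Y W"
    by (rule mk_Hom[OF O(2,4)])
  show ?thesis
  proof (rule ex1I[of _ "mk Y h W"], intro conjI h)
    show "mk Y h W \<cdot>\<^bsub>KH\<^esub> f = a"
      by (rule Hom_KH_eqI[OF KH.Comp_in_Hom[OF f h] a]) (simp add: ap_Comp[OF f h] ap_mk ap_in[OF f] hf)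
    fix k assume k: "k \<in> Hom KH Y W \<and> k \<cdot>\<^bsub>KH\<^esub> f = a"
    then have kH: "k \<in> Hom KH Y W" by blast
    show "k = mk Y h W"
    proof (rule Hom_KH_eqI[OF kH h])
      fix y assume "y \<in> topspace Y"
      then obtain x where x: "x \<in> topspace X" "y = ap f x" using surj' by blast
      then show "ap k y = ap (mk Y h W) y"
        using ap_Comp[OF f kH x(1)] k by (simp add: ap_mk ap_in[OF f] hf)
    qed
  qed
qed

text \<open>A surjection is the coequaliser of its kernel pair: the points of the pullback of
  \<open>f\<close> with itself give all pairs with equal value under \<open>f\<close>, so an arrow
  coequalising the two legs is constant on fibres.\<close>

lemma regular_epi_KH:
  assumes f: "f \<in> Hom KH X (Y :: 'u topology)" and surj: "img f = topspace Y"
  shows "regular_epi KH f"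
proof -
  obtain p q where pb: "is_pullback KH f f p q"
    using ex_pullback_KH[OF inacc f f] by blast
  note D = KH.is_pullbackD(1,2,5)[OF pb, unfolded HomD(2)[OF f]]
  have "is_coequalizer KH p q f"
    unfolding is_coequalizer_def
  proof (intro conjI allI ballI impI)
    fix W a assume "a \<in> Hom KH (Cod KH p) W" and eq: "a \<cdot>\<^bsub>KH\<^esub> p = a \<cdot>\<^bsub>KH\<^esub> q"
    then have a: "a \<in> Hom KH X W" using HomD(3)[OF D(1)] by simp
    have "ap a x = ap a x'" if xx: "x \<in> topspace X" "x' \<in> topspace X" "ap f x = ap f x'" for x x'
    proof -
      obtain z where z: "z \<in> topspace (Dom KH p)" "ap p z = x" "ap q z = x'"
        using pullback_KH_points[OF inacc pb, of x x'] xx HomD(2)[OF f] by auto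
      have "ap a (ap p z) = ap a (ap q z)"
        using ap_Comp[OF D(1) a z(1)] ap_Comp[OF D(2) a z(1)] eq by simp
      then show ?thesis using z by simp
    qed
    then show "\<exists>!h. h \<in> Hom KH (Cod KH f) W \<and> h \<cdot>\<^bsub>KH\<^esub> f = a"
      unfolding HomD(3)[OF f] by (rule KH_descend[OF f surj a])
  qed (use HomD[OF D(1)] HomD[OF D(2)] HomD[OF f] D(3) in simp_all)
  then show ?thesis unfolding regular_epi_def by blast
qed

text \<open>Joint monicity makes \<open>pr\<close> injective on points, hence an embedding of
  \<open>R\<close> onto a closed relation \<open>Rel\<close> in the square of \<open>X\<close>; the
  structure arrows make \<open>Rel\<close> an equivalence relation. The pair is then the kernel pair
  of the quotient map, since an arrow into the square that lands in \<open>Rel\<close> lifts along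
  \<open>pr\<close> continuously.\<close>

lemma effective_KH:
  assumes eqv: "internal_equivalence KH r1 (r2 :: 'u topology \<times> ('u \<Rightarrow> 'u) \<times> 'u topology)"
  shows "effective KH r1 r2"
proof -
  define R where "R = Dom KH r1"
  define X where "X = Cod KH r1"
  note E = eqv[unfolded internal_equivalence_def, folded R_def X_def]
  have r1: "r1 \<in> Hom KH R X" and r2: "r2 \<in> Hom KH R X"
    using E by (auto simp: Hom_iff R_def X_def)
  note O = KH.Hom_Obj[OF r1]
  have jm: "z = z'" if z: "z \<in> topspace R" "z' \<in> topspace R" "ap r1 z = ap r1 z'" "ap r2 z = ap r2 z'" for z z'
  proof -
    let ?T = "discrete_topology {undefined :: 'u}"
    note a = point_Hom[OF inacc O(1) z(1), of undefined]
    note b = point_Hom[OF inacc O(1) z(2), of undefined]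
    have "r1 \<cdot>\<^bsub>KH\<^esub> mk ?T (\<lambda>_. z) R = r1 \<cdot>\<^bsub>KH\<^esub> mk ?T (\<lambda>_. z') R"
      by (rule Hom_KH_eqI[OF KH.Comp_in_Hom[OF a r1] KH.Comp_in_Hom[OF b r1]])
        (simp add: ap_Comp[OF a r1] ap_Comp[OF b r1] ap_mk z(3))
    moreover have "r2 \<cdot>\<^bsub>KH\<^esub> mk ?T (\<lambda>_. z) R = r2 \<cdot>\<^bsub>KH\<^esub> mk ?T (\<lambda>_. z') R"
      by (rule Hom_KH_eqI[OF KH.Comp_in_Hom[OF a r2] KH.Comp_in_Hom[OF b r2]])
        (simp add: ap_Comp[OF a r2] ap_Comp[OF b r2] ap_mk z(4))
    ultimately have "mk ?T (\<lambda>_. z) R = mk ?T (\<lambda>_. z') R"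
      using E a b by blast
    then have "ap (mk ?T (\<lambda>_. z) R) undefined = ap (mk ?T (\<lambda>_. z') R) undefined"
      by (rule arg_cong[of _ _ "\<lambda>u. ap u undefined"])
    then show ?thesis by (simp add: ap_mk)
  qed
  define pr where "pr z = (ap r1 z, ap r2 z)" for z
  have pr_cont: "continuous_map R (prod_topology X X) pr"
    unfolding pr_def continuous_map_pairwise using ap_cont[OF r1] ap_cont[OF r2] by (simp add: o_def)
  have pr_inj: "inj_on pr (topspace R)"
    using jm by (auto simp: pr_def intro: inj_onI)
  have HX: "Hausdorff_space (prod_topology X X)"
    using Obj_KHD(2)[OF O(2)] by (simp add: Hausdorff_space_prod_topology)
  define Rel where "Rel = pr ` topspace R"
  have Rel_cl: "closedin (prod_topology X X) Rel"
    using continuous_imp_closed_map[OF pr_cont Obj_KHD(1)[OF O(1)] HX] unfolding closed_map_def Rel_def by blast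
  have RelI: "(ap r1 z, ap r2 z) \<in> Rel" if "z \<in> topspace R" for z
    using that by (auto simp: Rel_def pr_def)
  have RelE: "\<exists>z \<in> topspace R. ap r1 z = x \<and> ap r2 z = y" if "(x, y) \<in> Rel" for x y
    using that by (auto simp: Rel_def pr_def)
  have "equiv (topspace X) Rel"
  proof (rule equivI)
    show "Rel \<subseteq> topspace X \<times> topspace X"
      using closedin_subset[OF Rel_cl] by simp
    show "refl_on (topspace X) Rel"
    proof (rule refl_onI)
      fix x assume x: "x \<in> topspace X"
      obtain d where d: "d \<in> Hom KH X R" "r1 \<cdot>\<^bsub>KH\<^esub> d = Ident KH X" "r2 \<cdot>\<^bsub>KH\<^esub> d = Ident KH X"
        using E by blast
      have "ap r1 (ap d x) = x" "ap r2 (ap d x) = x"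
        using ap_Comp[OF d(1) r1 x] ap_Comp[OF d(1) r2 x] d(2,3) by (simp_all add: ap_Ident[OF x])
      then show "(x, x) \<in> Rel" using RelI[OF ap_in[OF d(1) x]] by simp
    qed
    show "sym Rel"
    proof (rule symI)
      fix x y assume "(x, y) \<in> Rel"
      then obtain z where z: "z \<in> topspace R" "ap r1 z = x" "ap r2 z = y" using RelE by blast
      obtain s where s: "s \<in> Hom KH R R" "r1 \<cdot>\<^bsub>KH\<^esub> s = r2" "r2 \<cdot>\<^bsub>KH\<^esub> s = r1"
        using E by blast
      have "ap r1 (ap s z) = y" "ap r2 (ap s z) = x"
        using ap_Comp[OF s(1) r1 z(1)] ap_Comp[OF s(1) r2 z(1)] s(2,3) z by simp_all
      then show "(y, x) \<in> Rel" using RelI[OF ap_in[OF s(1) z(1)]] by simp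
    qed
    show "trans Rel"
    proof (rule transI)
      fix x y w assume xy: "(x, y) \<in> Rel" and yw: "(y, w) \<in> Rel"
      obtain z where z: "z \<in> topspace R" "ap r1 z = x" "ap r2 z = y" using RelE[OF xy] by blast
      obtain z' where z': "z' \<in> topspace R" "ap r1 z' = y" "ap r2 z' = w" using RelE[OF yw] by blast
      obtain p1 p2 where pb: "is_pullback KH r2 r1 p1 p2"
        using ex_pullback_KH[OF inacc r2 r1] by blast
      note D = KH.is_pullbackD(1,2)[OF pb, unfolded HomD(2)[OF r1] HomD(2)[OF r2]]
      obtain t where t: "t \<in> Hom KH (Dom KH p1) R" "r1 \<cdot>\<^bsub>KH\<^esub> t = r1 \<cdot>\<^bsub>KH\<^esub> p1" "r2 \<cdot>\<^bsub>KH\<^esub> t = r2 \<cdot>\<^bsub>KH\<^esub> p2"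
        using E pb by blast
      obtain v where v: "v \<in> topspace (Dom KH p1)" "ap p1 v = z" "ap p2 v = z'"
        using pullback_KH_points[OF inacc pb, of z z'] z z' HomD(2)[OF r1] HomD(2)[OF r2] by auto
      have "ap r1 (ap t v) = x" "ap r2 (ap t v) = w"
        using ap_Comp[OF t(1) r1 v(1)] ap_Comp[OF t(1) r2 v(1)] ap_Comp[OF D(1) r1 v(1)]
          ap_Comp[OF D(2) r2 v(1)] t(2,3) v z z' by simp_all
      then show "(x, w) \<in> Rel" using RelI[OF ap_in[OF t(1) v(1)]] by simp
    qed
  qed
  then obtain f where f: "f ` topspace X \<subseteq> topspace X"
    "\<And>x y. x \<in> topspace X \<Longrightarrow> y \<in> topspace X \<Longrightarrow> f x = f y \<longleftrightarrow> (x, y) \<in> Rel"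
    "compact_space (final_topology X f)" "Hausdorff_space (final_topology X f)"
    using compact_Hausdorff_quotient[OF Obj_KHD(1,2)[OF O(2)] _ Rel_cl] by blast
  define Q where "Q = final_topology X f"
  have tQ: "topspace Q = f ` topspace X" by (simp add: Q_def topspace_final_topology)
  have QO: "Q \<in> Obj KH"
    unfolding Obj_KH using f(1,3,4) small_subset[OF f(1) Obj_KHD(3)[OF O(2)]] tQ by (simp add: Q_def)
  define q where "q = mk X f Q"
  have q: "q \<in> Hom KH X Q"
    unfolding q_def by (rule mk_Hom[OF O(2) QO])
      (unfold Q_def, rule quotient_imp_continuous_map[OF quotient_map_final_topology])
  have ap_q: "ap q x = f x" if "x \<in> topspace X" for x using that by (simp add: q_def ap_mk)
  have img_q: "img q = topspace Q" unfolding img_eq[OF q] tQ using ap_q by auto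
  have qeq: "ap q x = ap q y \<longleftrightarrow> (x, y) \<in> Rel" if "x \<in> topspace X" "y \<in> topspace X" for x y
    using that f(2) ap_q by simp
  have comm: "q \<cdot>\<^bsub>KH\<^esub> r1 = q \<cdot>\<^bsub>KH\<^esub> r2"
    by (rule Hom_KH_eqI[OF KH.Comp_in_Hom[OF r1 q] KH.Comp_in_Hom[OF r2 q]])
      (simp add: ap_Comp[OF r1 q] ap_Comp[OF r2 q] qeq ap_in[OF r1] ap_in[OF r2] RelI)
  have "is_coequalizer KH r1 r2 q"
    unfolding is_coequalizer_def
  proof (intro conjI allI ballI impI)
    fix W a assume "a \<in> Hom KH (Cod KH r1) W" and eq: "a \<cdot>\<^bsub>KH\<^esub> r1 = a \<cdot>\<^bsub>KH\<^esub> r2"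
    then have a: "a \<in> Hom KH X W" using HomD(3)[OF r1] by simp
    have "ap a x = ap a x'" if xx: "x \<in> topspace X" "x' \<in> topspace X" "ap q x = ap q x'" for x x'
    proof -
      have "(x, x') \<in> Rel" using qeq[OF xx(1,2)] xx(3) by simp
      then obtain z where z: "z \<in> topspace R" "ap r1 z = x" "ap r2 z = x'" using RelE by blast
      have "ap a (ap r1 z) = ap a (ap r2 z)"
        using ap_Comp[OF r1 a z(1)] ap_Comp[OF r2 a z(1)] eq by simp
      then show ?thesis using z by simp
    qed
    then show "\<exists>!h. h \<in> Hom KH (Cod KH q) W \<and> h \<cdot>\<^bsub>KH\<^esub> q = a"
      unfolding HomD(3)[OF q] by (rule KH_descend[OF q img_q a])
  qed (use HomD[OF r1] HomD[OF r2] HomD[OF q] comm in simp_all)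
  moreover have "is_pullback KH q q r1 r2"
  proof (rule KH.is_pullbackI[OF r1 r2 q q comm])
    fix W a b assume a: "a \<in> Hom KH W X" and b: "b \<in> Hom KH W X" and eq: "q \<cdot>\<^bsub>KH\<^esub> a = q \<cdot>\<^bsub>KH\<^esub> b"
    define g where "g w = (ap a w, ap b w)" for w
    have "continuous_map W (prod_topology X X) g"
      unfolding g_def continuous_map_pairwise using ap_cont[OF a] ap_cont[OF b] by (simp add: o_def)
    moreover have im: "g ` topspace W \<subseteq> pr ` topspace R"
    proof (rule image_subsetI)
      fix w assume w: "w \<in> topspace W"
      have "ap q (ap a w) = ap q (ap b w)"
        using ap_Comp[OF a q w] ap_Comp[OF b q w] eq by simp
      then have "(ap a w, ap b w) \<in> Rel" using qeq ap_in[OF a w] ap_in[OF b w] by blast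
      then show "g w \<in> pr ` topspace R" unfolding g_def Rel_def .
    qed
    ultimately have "continuous_map W R (\<lambda>w. inv_into (topspace R) pr (g w))"
      by (rule continuous_map_factor_injective[OF Obj_KHD(1)[OF O(1)] HX pr_cont pr_inj])
    then have h: "mk W (\<lambda>w. inv_into (topspace R) pr (g w)) R \<in> Hom KH W R" (is "?h \<in> _")
      by (rule mk_Hom[OF KH.Hom_Obj(1)[OF a] O(1)])
    have prh: "pr (ap ?h w) = g w" if "w \<in> topspace W" for w
      using im that by (auto simp: ap_mk intro!: f_inv_into_f)
    have prr1: "ap r1 (ap ?h w) = ap a w" and prr2: "ap r2 (ap ?h w) = ap b w" if "w \<in> topspace W" for w
      using prh[OF that] by (simp_all only: pr_def g_def prod.inject)
    have "r1 \<cdot>\<^bsub>KH\<^esub> ?h = a"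
      by (rule Hom_KH_eqI[OF KH.Comp_in_Hom[OF h r1] a])
        (simp add: ap_Comp[OF h r1] prr1)
    moreover have "r2 \<cdot>\<^bsub>KH\<^esub> ?h = b"
      by (rule Hom_KH_eqI[OF KH.Comp_in_Hom[OF h r2] b])
        (simp add: ap_Comp[OF h r2] prr2)
    ultimately show "\<exists>h. h \<in> Hom KH W R \<and> r1 \<cdot>\<^bsub>KH\<^esub> h = a \<and> r2 \<cdot>\<^bsub>KH\<^esub> h = b"
      using h by blast
  next
    fix W h k assume "h \<in> Hom KH W R" "k \<in> Hom KH W R" "r1 \<cdot>\<^bsub>KH\<^esub> h = r1 \<cdot>\<^bsub>KH\<^esub> k" "r2 \<cdot>\<^bsub>KH\<^esub> h = r2 \<cdot>\<^bsub>KH\<^esub> k"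
    then show "h = k" using E by blast
  qed
  ultimately show ?thesis
    unfolding effective_def by blast
qed

text \<open>Finiteness of \<open>I\<close> makes the glued map continuous: the preimage of a closed
  set is a union of one closed piece per summand.\<close>

lemma is_coproduct_KHI:
  fixes S :: "'u topology"
  assumes fin: "finite I" and S: "S \<in> Obj KH" and \<iota>: "\<And>i. i \<in> I \<Longrightarrow> \<iota> i \<in> Hom KH (A i) S"
    and inj: "\<And>i. i \<in> I \<Longrightarrow> inj_on (ap (\<iota> i)) (topspace (A i))"
    and disj: "\<And>i j. i \<in> I \<Longrightarrow> j \<in> I \<Longrightarrow> i \<noteq> j \<Longrightarrow> img (\<iota> i) \<inter> img (\<iota> j) = {}"
    and cover: "topspace S = (\<Union>i\<in>I. img (\<iota> i))"
  shows "is_coproduct KH I A S \<iota>"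
  unfolding is_coproduct_def
proof (intro conjI ballI allI impI S \<iota>)
  fix W a assume W: "W \<in> Obj KH" and "\<forall>i\<in>I. a i \<in> Hom KH (A i) W"
  then have a: "a i \<in> Hom KH (A i) W" if "i \<in> I" for i using that by blast
  define ix where "ix s = (SOME i. i \<in> I \<and> s \<in> img (\<iota> i))" for s
  define h where "h s = ap (a (ix s)) (inv_into (topspace (A (ix s))) (ap (\<iota> (ix s))) s)" for s
  have h\<iota>: "h (ap (\<iota> i) x) = ap (a i) x" if i: "i \<in> I" and x: "x \<in> topspace (A i)" for i x
  proof -
    have "ap (\<iota> i) x \<in> img (\<iota> i)" unfolding img_eq[OF \<iota>[OF i]] using x by blast
    then have "ix (ap (\<iota> i) x) = i"
      unfolding ix_def using i disj by (intro some_equality) auto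
    then show ?thesis
      unfolding h_def by (simp add: inv_into_f_f[OF inj[OF i] x])
  qed
  have "continuous_map S W h"
    unfolding continuous_map_closedin
  proof (intro conjI allI impI)
    show "h \<in> topspace S \<rightarrow> topspace W"
    proof
      fix s assume "s \<in> topspace S"
      then obtain i x where i: "i \<in> I" "x \<in> topspace (A i)" "s = ap (\<iota> i) x"
        unfolding cover using img_eq[OF \<iota>] by blast
      then show "h s \<in> topspace W" using h\<iota> ap_in[OF a] by simp
    qed
    fix D assume D: "closedin W D"
    have "{s \<in> topspace S. h s \<in> D} = (\<Union>i\<in>I. ap (\<iota> i) ` {x \<in> topspace (A i). ap (a i) x \<in> D})"
    proof (intro subset_antisym subsetI)
      fix s assume s: "s \<in> {s \<in> topspace S. h s \<in> D}"
      then obtain i x where i: "i \<in> I" "x \<in> topspace (A i)" "s = ap (\<iota> i) x"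
        unfolding cover using img_eq[OF \<iota>] by blast
      then show "s \<in> (\<Union>i\<in>I. ap (\<iota> i) ` {x \<in> topspace (A i). ap (a i) x \<in> D})"
        using s h\<iota> by auto
    next
      fix s assume "s \<in> (\<Union>i\<in>I. ap (\<iota> i) ` {x \<in> topspace (A i). ap (a i) x \<in> D})"
      then obtain i x where "i \<in> I" "x \<in> topspace (A i)" "s = ap (\<iota> i) x" "ap (a i) x \<in> D" by blast
      then show "s \<in> {s \<in> topspace S. h s \<in> D}"
        using h\<iota> ap_in[OF \<iota>] by simp
    qed
    moreover have "closedin S (ap (\<iota> i) ` {x \<in> topspace (A i). ap (a i) x \<in> D})" if i: "i \<in> I" for i
      using closed_map_KH[OF \<iota>[OF i]] closedin_continuous_map_preimage[OF ap_cont[OF a[OF i]] D]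
      unfolding closed_map_def by blast
    ultimately show "closedin S {s \<in> topspace S. h s \<in> D}"
      using fin by (auto intro: closedin_Union)
  qed
  then have h: "mk S h W \<in> Hom KH S W" by (rule mk_Hom[OF S W])
  show "\<exists>!h. h \<in> Hom KH S W \<and> (\<forall>i\<in>I. h \<cdot>\<^bsub>KH\<^esub> \<iota> i = a i)"
  proof (rule ex1I[of _ "mk S h W"], intro conjI ballI h)
    fix i assume i: "i \<in> I"
    show "mk S h W \<cdot>\<^bsub>KH\<^esub> \<iota> i = a i"
      by (rule Hom_KH_eqI[OF KH.Comp_in_Hom[OF \<iota>[OF i] h] a[OF i]])
        (simp add: ap_Comp[OF \<iota>[OF i] h] ap_mk ap_in[OF \<iota>[OF i]] h\<iota>[OF i])
  next
    fix k assume k: "k \<in> Hom KH S W \<and> (\<forall>i\<in>I. k \<cdot>\<^bsub>KH\<^esub> \<iota> i = a i)"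
    then have kH: "k \<in> Hom KH S W" by blast
    show "k = mk S h W"
    proof (rule Hom_KH_eqI[OF kH h])
      fix s assume s: "s \<in> topspace S"
      then obtain i x where i: "i \<in> I" "x \<in> topspace (A i)" "s = ap (\<iota> i) x"
        unfolding cover using img_eq[OF \<iota>] by blast
      then show "ap k s = ap (mk S h W) s"
        using ap_Comp[OF \<iota>[OF i(1)] kH i(2)] k h\<iota> by (simp add: ap_mk[OF s[unfolded i(3)]])
    qed
  qed
qed

text \<open>The concrete description is kept beside the universal property because it transfers
  along isomorphisms to the coproducts chosen by \<open>coprod\<close>.\<close>

lemma ex_coproduct_KH:
  fixes A :: "nat \<Rightarrow> 'u topology"
  assumes AO: "\<forall>i<n. A i \<in> Obj KH"
  shows "\<exists>S \<iota>. is_coproduct KH {..<n} A S \<iota> \<and> S \<in> Obj KH \<and> (\<forall>i<n. \<iota> i \<in> Hom KH (A i) S) \<and>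
    (\<forall>i<n. inj_on (ap (\<iota> i)) (topspace (A i))) \<and>
    (\<forall>i<n. \<forall>j<n. i \<noteq> j \<longrightarrow> img (\<iota> i) \<inter> img (\<iota> j) = {}) \<and> topspace S = (\<Union>i<n. img (\<iota> i))"
proof -
  have A: "A i \<in> Obj KH" if "i < n" for i using AO that by blast
  define T where "T = sum_topology A {..<n}"
  have tT: "topspace T = (\<Union>i<n. Pair i ` topspace (A i))"
    by (auto simp: T_def)
  have inc: "continuous_map (A i) T (Pair i)" if "i < n" for i
    unfolding T_def using that by (intro continuous_map_component_injection) simp
  have "compactin T (\<Union>i<n. Pair i ` topspace (A i))"
  proof (rule compactin_Union)
    show "finite ((\<lambda>i. Pair i ` topspace (A i)) ` {..<n})" by simp
    fix S assume "S \<in> (\<lambda>i. Pair i ` topspace (A i)) ` {..<n}"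
    then obtain i where i: "i < n" "S = Pair i ` topspace (A i)" by blast
    show "compactin T S"
      unfolding i(2) using Obj_KHD(1)[OF A[OF i(1)]] inc[OF i(1)]
      by (intro image_compactin) (auto simp: compact_space_def)
  qed
  then have "compact_space T" unfolding compact_space_def tT .
  moreover have "Hausdorff_space T"
    unfolding Hausdorff_space_def
  proof (intro allI impI, elim conjE)
    fix x y assume xy: "x \<in> topspace T" "y \<in> topspace T" "x \<noteq> y"
    obtain i a where x: "x = (i, a)" "i < n" "a \<in> topspace (A i)" using xy(1) tT by blast
    obtain j b where y: "y = (j, b)" "j < n" "b \<in> topspace (A j)" using xy(2) tT by blast
    have opn: "openin T (Pair i ` U)" if "openin (A i) U" "i < n" for i U
      using open_map_component_injection[of i "{..<n}" A] that unfolding open_map_def T_def by simp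
    show "\<exists>U V. openin T U \<and> openin T V \<and> x \<in> U \<and> y \<in> V \<and> disjnt U V"
    proof (cases "i = j")
      case True
      then obtain U V where UV: "openin (A i) U" "openin (A i) V" "a \<in> U" "b \<in> V" "disjnt U V"
        using Obj_KHD(2)[OF A[OF x(2)]] x y xy(3) unfolding Hausdorff_space_def by (metis prod.inject)
      show ?thesis
        using opn[OF UV(1) x(2)] opn[OF UV(2) x(2)] UV True x y
        by (intro exI[of _ "Pair i ` U"] exI[of _ "Pair i ` V"]) (auto simp: disjnt_iff)
    next
      case False
      then show ?thesis
        using opn[OF openin_topspace x(2)] opn[OF openin_topspace y(2)] x y
        by (intro exI[of _ "Pair i ` topspace (A i)"] exI[of _ "Pair j ` topspace (A j)"]) (auto simp: disjnt_iff)
    qed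
  qed
  moreover have "small TYPE('u) (topspace T)"
  proof (rule small_subset)
    show "topspace T \<subseteq> {..<n} \<times> (\<Union>i\<in>{..<n}. topspace (A i))" unfolding tT by blast
    show "small TYPE('u) ({..<n} \<times> (\<Union>i\<in>{..<n}. topspace (A i)))"
      using Obj_KHD(3)[OF A] by (intro small_Times[OF inacc] small_UNION[OF inacc] small_finite[OF inacc, of "{..<n}"]) auto
  qed
  ultimately obtain S :: "'u topology" and e d where S: "S \<in> Obj KH" and ed: "homeomorphic_maps T S e d"
    by (rule KH_copy)
  have e: "continuous_map T S e" and de: "\<And>x. x \<in> topspace T \<Longrightarrow> d (e x) = x"
    using ed unfolding homeomorphic_maps_def by auto
  have de': "d (e (i, x)) = (i, x)" if "i < n" "x \<in> topspace (A i)" for i x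
    using that by (intro de) (auto simp: tT)
  have surj: "e ` topspace T = topspace S"
    by (rule homeomorphic_imp_surjective_map[OF homeomorphic_maps_imp_map[OF ed]])
  define \<iota> where "\<iota> i = mk (A i) (\<lambda>x. e (i, x)) S" for i
  have \<iota>: "\<iota> i \<in> Hom KH (A i) S" if i: "i < n" for i
    unfolding \<iota>_def using continuous_map_compose[OF inc[OF i] e] by (intro mk_Hom A i S) (simp add: o_def)
  have ap\<iota>: "ap (\<iota> i) x = e (i, x)" if "x \<in> topspace (A i)" for i x
    using that by (simp add: \<iota>_def ap_mk)
  have img\<iota>: "img (\<iota> i) = e ` Pair i ` topspace (A i)" if i: "i < n" for i
    unfolding img_eq[OF \<iota>[OF i]] image_image using ap\<iota> by (intro image_cong) auto
  have inj: "inj_on (ap (\<iota> i)) (topspace (A i))" if i: "i < n" for i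
  proof (rule inj_onI)
    fix x y assume xy: "x \<in> topspace (A i)" "y \<in> topspace (A i)" "ap (\<iota> i) x = ap (\<iota> i) y"
    then have "d (e (i, x)) = d (e (i, y))" by (simp add: ap\<iota>)
    then show "x = y" using de'[OF i xy(1)] de'[OF i xy(2)] by simp
  qed
  have disj: "img (\<iota> i) \<inter> img (\<iota> j) = {}" if ij: "i < n" "j < n" "i \<noteq> j" for i j
  proof -
    have "e (i, x) \<noteq> e (j, y)" if xy: "x \<in> topspace (A i)" "y \<in> topspace (A j)" for x y
    proof
      assume "e (i, x) = e (j, y)"
      then have "d (e (i, x)) = d (e (j, y))" by simp
      then show False using de'[OF ij(1) xy(1)] de'[OF ij(2) xy(2)] ij(3) by simp
    qed
    then show ?thesis unfolding img\<iota>[OF ij(1)] img\<iota>[OF ij(2)] by auto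
  qed
  have cover: "topspace S = (\<Union>i<n. img (\<iota> i))"
    unfolding surj[symmetric] tT using img\<iota> by auto
  have "is_coproduct KH {..<n} A S \<iota>"
    by (rule is_coproduct_KHI) (use S \<iota> inj disj cover in auto)
  with S \<iota> inj disj cover show ?thesis
    by (intro exI[of _ S] exI[of _ \<iota>]) simp
qed

lemma has_finite_coproducts_KH: "has_finite_coproducts (KH :: ('u topology, _) cat)"
  unfolding has_finite_coproducts_def
proof (intro allI impI)
  fix n and A :: "nat \<Rightarrow> 'u topology" assume "\<forall>i<n. A i \<in> Obj KH"
  from ex_coproduct_KH[OF this] show "\<exists>S \<iota>. is_coproduct KH {..<n} A S \<iota>"
    by (elim exE conjE) (intro exI)
qed

end


section \<open>Extensivity, filtral covers and copowers in \<open>KH\<close>\<close>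

context
  assumes inacc: "inaccessible TYPE('u)"
begin

section \<open>Binary coproducts as disjoint unions, and extensivity\<close>

lemma is_binary_coproduct_KHI:
  fixes S :: "'u topology"
  assumes i: "i \<in> Hom KH X S" and j: "j \<in> Hom KH Y S"
    and inj: "inj_on (ap i) (topspace X)" "inj_on (ap j) (topspace Y)"
    and disj: "img i \<inter> img j = {}" and cover: "topspace S = img i \<union> img j"
  shows "is_binary_coproduct KH X Y S i j"
proof -
  define A where "A = (\<lambda>k::nat. if k = 0 then X else Y)"
  define \<iota> where "\<iota> = (\<lambda>k::nat. if k = 0 then i else j)"
  have "is_coproduct KH {..<2} A S \<iota>"
  proof (rule is_coproduct_KHI[OF inacc])
    show "topspace S = (\<Union>k\<in>{..<2}. img (\<iota> k))"
      unfolding cover by (auto simp: \<iota>_def numeral_2_eq_2 less_Suc_eq)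
  qed (use assms KH.Hom_Obj[OF i] in \<open>auto simp: A_def \<iota>_def\<close>)
  from KH.is_binary_coproduct_of_family[OF this] show ?thesis
    by (simp add: A_def \<iota>_def)
qed

text \<open>A given coproduct is compared with the disjoint sum by the canonical isomorphism
  \<open>e\<close>, whose injectivity carries disjointness and covering back. This is the access to
  \<open>coprod\<close>, about which only the universal property is known.\<close>

lemma binary_coproduct_KHD:
  fixes S :: "'u topology"
  assumes cp: "is_binary_coproduct KH X Y S i j"
  shows "inj_on (ap i) (topspace X)" "inj_on (ap j) (topspace Y)" "img i \<inter> img j = {}"
    "topspace S = img i \<union> img j"
proof -
  note D = KH.binary_coproductD[OF cp]
  define A where "A = (\<lambda>k::nat. if k = 0 then X else Y)"
  have AO: "\<forall>k<2. A k \<in> Obj KH"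
    using KH.Hom_Obj[OF D(2)] KH.Hom_Obj[OF D(3)] by (simp add: A_def)
  obtain S' \<iota> where S': "is_coproduct KH {..<2} A S' \<iota>" "S' \<in> Obj KH"
    and inj: "\<forall>i<2. inj_on (ap (\<iota> i)) (topspace (A i))"
    and disj: "\<forall>i<2. \<forall>j<2. i \<noteq> j \<longrightarrow> img (\<iota> i) \<inter> img (\<iota> j) = {}"
    and cover: "topspace S' = (\<Union>i<2. img (\<iota> i))"
    using ex_coproduct_KH[OF inacc AO] by (elim exE conjE) (rule that)
  have cp': "is_binary_coproduct KH X Y S' (\<iota> 0) (\<iota> 1)"
    using KH.is_binary_coproduct_of_family[OF S'(1)] by (simp add: A_def)
  obtain e where e: "e \<in> Hom KH S S'" "is_iso KH e" "e \<cdot>\<^bsub>KH\<^esub> i = \<iota> 0" "e \<cdot>\<^bsub>KH\<^esub> j = \<iota> 1"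
    using KH.binary_coproduct_iso[OF cp cp'] .
  obtain d where d: "d \<in> Hom KH S' S" "d \<cdot>\<^bsub>KH\<^esub> e = Ident KH S"
    using KH.is_iso_obtain[OF e(1,2)] by blast
  have ei: "ap e (ap i x) = ap (\<iota> 0) x" if "x \<in> topspace X" for x
    using ap_Comp[OF D(2) e(1) that] e(3) by simp
  have ej: "ap e (ap j x) = ap (\<iota> 1) x" if "x \<in> topspace Y" for x
    using ap_Comp[OF D(3) e(1) that] e(4) by simp
  have de: "ap d (ap e s) = s" if "s \<in> topspace S" for s
    using ap_Comp[OF e(1) d(1) that] d(2) ap_Ident[OF that] by simp
  have inj0: "inj_on (ap (\<iota> 0)) (topspace X)" and inj1: "inj_on (ap (\<iota> 1)) (topspace Y)"
    using inj[rule_format, of 0] inj[rule_format, of 1] by (simp_all add: A_def)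
  show "inj_on (ap i) (topspace X)"
  proof (rule inj_onI)
    fix x y assume xy: "x \<in> topspace X" "y \<in> topspace X" "ap i x = ap i y"
    then have "ap (\<iota> 0) x = ap (\<iota> 0) y"
      using ei[OF xy(1)] ei[OF xy(2)] by simp
    then show "x = y" by (rule inj_onD[OF inj0 _ xy(1,2)])
  qed
  show "inj_on (ap j) (topspace Y)"
  proof (rule inj_onI)
    fix x y assume xy: "x \<in> topspace Y" "y \<in> topspace Y" "ap j x = ap j y"
    then have "ap (\<iota> 1) x = ap (\<iota> 1) y"
      using ej[OF xy(1)] ej[OF xy(2)] by simp
    then show "x = y" by (rule inj_onD[OF inj1 _ xy(1,2)])
  qed
  have img0: "img (\<iota> 0) = ap e ` img i" and img1: "img (\<iota> 1) = ap e ` img j"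
    using img_Comp[OF D(2) e(1)] img_Comp[OF D(3) e(1)] e(3,4) by simp_all
  have "ap e ` img i \<inter> ap e ` img j = {}"
    using disj[rule_format, of 0 1] unfolding img0 img1 by simp
  then show "img i \<inter> img j = {}" by blast
  have sub: "img i \<union> img j \<subseteq> topspace S"
    using closedin_subset[OF closedin_img[OF D(2)]] closedin_subset[OF closedin_img[OF D(3)]] by blast
  have cover': "topspace S' = ap e ` (img i \<union> img j)"
    unfolding cover image_Un img0[symmetric] img1[symmetric] by (auto simp: numeral_2_eq_2 lessThan_Suc)
  have "s \<in> img i \<union> img j" if s: "s \<in> topspace S" for s
  proof -
    obtain s' where s': "s' \<in> img i \<union> img j" "ap e s = ap e s'"
      using ap_in[OF e(1) s] unfolding cover' by blast
    have "s = ap d (ap e s')" using de[OF s] unfolding s'(2) by (rule sym)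
    also have "\<dots> = s'" by (rule de[OF subsetD[OF sub s'(1)]])
    finally show ?thesis using s'(1) by blast
  qed
  then show "topspace S = img i \<union> img j" using sub by blast
qed

lemma coproduct_category_KH: "coproduct_category (KH :: ('u topology, _) cat)"
  by (intro coproduct_category.intro coproduct_category_axioms.intro category_KH
      has_finite_coproducts_KH[OF inacc])

lemma coprod_KH_disjoint:
  assumes "X \<in> Obj KH" "Y \<in> Obj (KH :: ('u topology, _) cat)"
  shows "inj_on (ap (inl KH X Y)) (topspace X)" "inj_on (ap (inr KH X Y)) (topspace Y)"
    "img (inl KH X Y) \<inter> img (inr KH X Y) = {}"
    "topspace (coprod KH X Y) = img (inl KH X Y) \<union> img (inr KH X Y)"
proof -
  interpret coproduct_category "KH :: ('u topology, 'u topology \<times> ('u \<Rightarrow> 'u) \<times> 'u topology) cat"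
    by (rule coproduct_category_KH)
  note * = binary_coproduct_KHD[OF coprod_is_coproduct[OF assms]]
  show "inj_on (ap (inl KH X Y)) (topspace X)" "inj_on (ap (inr KH X Y)) (topspace Y)"
    "img (inl KH X Y) \<inter> img (inr KH X Y) = {}"
    "topspace (coprod KH X Y) = img (inl KH X Y) \<union> img (inr KH X Y)"
    by (fact *)+
qed

text \<open>The heart of fullness for the slice functor: an arrow into \<open>Q1 + Q2\<close> lying
  over \<open>X1\<close> misses the second summand, because that summand is sent into the part of
  \<open>X1 + X2\<close> disjoint from \<open>X1\<close>.\<close>

lemma KH_coprod_left:
  assumes q1: "q1 \<in> Hom KH Q1 X1" and q2: "q2 \<in> Hom KH Q2 (X2 :: 'u topology)"
    and k: "k \<in> Hom KH A (coprod KH Q1 Q2)" and p: "p \<in> Hom KH A X1"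
    and eq: "coprod_arr KH q1 q2 \<cdot>\<^bsub>KH\<^esub> k = inl KH X1 X2 \<cdot>\<^bsub>KH\<^esub> p"
  shows "\<exists>h. h \<in> Hom KH A Q1 \<and> inl KH Q1 Q2 \<cdot>\<^bsub>KH\<^esub> h = k \<and> q1 \<cdot>\<^bsub>KH\<^esub> h = p"
proof -
  interpret coproduct_category "KH :: ('u topology, 'u topology \<times> ('u \<Rightarrow> 'u) \<times> 'u topology) cat"
    by (rule coproduct_category_KH)
  note O = KH.Hom_Obj[OF q1] KH.Hom_Obj[OF q2]
  note c = coprod_arr[OF q1 q2]
  note iQ = inl_Hom[OF O(1,3)] and jQ = inr_Hom[OF O(1,3)] and iX = inl_Hom[OF O(2,4)] and jX = inr_Hom[OF O(2,4)]
  note dQ = coprod_KH_disjoint[OF O(1,3)] and dX = coprod_KH_disjoint[OF O(2,4)]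
  have "img k \<subseteq> img (inl KH Q1 Q2)"
  proof
    fix s assume s: "s \<in> img k"
    then obtain a where a: "a \<in> topspace A" "s = ap k a" unfolding img_eq[OF k] by blast
    have "ap (coprod_arr KH q1 q2) s = ap (inl KH X1 X2) (ap p a)"
      using ap_Comp[OF k c(1) a(1)] ap_Comp[OF p iX a(1)] eq a(2) by simp
    then have 1: "ap (coprod_arr KH q1 q2) s \<in> img (inl KH X1 X2)"
      unfolding img_eq[OF iX] using ap_in[OF p a(1)] by simp
    have "s \<notin> img (inr KH Q1 Q2)"
    proof
      assume "s \<in> img (inr KH Q1 Q2)"
      then obtain y where y: "y \<in> topspace Q2" "s = ap (inr KH Q1 Q2) y" unfolding img_eq[OF jQ] by blast
      have "ap (coprod_arr KH q1 q2) s = ap (inr KH X1 X2) (ap q2 y)"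
        using ap_Comp[OF jQ c(1) y(1)] ap_Comp[OF q2 jX y(1)] c(3) y(2) by simp
      then have "ap (coprod_arr KH q1 q2) s \<in> img (inr KH X1 X2)"
        unfolding img_eq[OF jX] using ap_in[OF q2 y(1)] by simp
      then show False using 1 dX(3) by blast
    qed
    then show "s \<in> img (inl KH Q1 Q2)"
      using ap_in[OF k a(1)] a(2) dQ(4) by blast
  qed
  then obtain h where h: "h \<in> Hom KH A Q1" "inl KH Q1 Q2 \<cdot>\<^bsub>KH\<^esub> h = k"
    using KH_factor[OF k iQ dQ(1)] by blast
  have "inl KH X1 X2 \<cdot>\<^bsub>KH\<^esub> (q1 \<cdot>\<^bsub>KH\<^esub> h) = coprod_arr KH q1 q2 \<cdot>\<^bsub>KH\<^esub> (inl KH Q1 Q2 \<cdot>\<^bsub>KH\<^esub> h)"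
    using KH.Comp_assoc[OF h(1) q1 iX] KH.Comp_assoc[OF h(1) iQ c(1)] c(2) by simp
  also have "\<dots> = inl KH X1 X2 \<cdot>\<^bsub>KH\<^esub> p" using h(2) eq by simp
  finally have "q1 \<cdot>\<^bsub>KH\<^esub> h = p"
    using monicD[OF monic_KH[OF inacc iX, THEN iffD2, OF dX(1)], unfolded HomD(2)[OF iX], OF KH.Comp_in_Hom[OF h(1) q1] p] by blast
  then show ?thesis using h by blast
qed

lemma KH_coprod_right:
  assumes q1: "q1 \<in> Hom KH Q1 X1" and q2: "q2 \<in> Hom KH Q2 (X2 :: 'u topology)"
    and k: "k \<in> Hom KH A (coprod KH Q1 Q2)" and p: "p \<in> Hom KH A X2"
    and eq: "coprod_arr KH q1 q2 \<cdot>\<^bsub>KH\<^esub> k = inr KH X1 X2 \<cdot>\<^bsub>KH\<^esub> p"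
  shows "\<exists>h. h \<in> Hom KH A Q2 \<and> inr KH Q1 Q2 \<cdot>\<^bsub>KH\<^esub> h = k \<and> q2 \<cdot>\<^bsub>KH\<^esub> h = p"
proof -
  interpret coproduct_category "KH :: ('u topology, 'u topology \<times> ('u \<Rightarrow> 'u) \<times> 'u topology) cat"
    by (rule coproduct_category_KH)
  note O = KH.Hom_Obj[OF q1] KH.Hom_Obj[OF q2]
  note c = coprod_arr[OF q1 q2]
  note iQ = inl_Hom[OF O(1,3)] and jQ = inr_Hom[OF O(1,3)] and iX = inl_Hom[OF O(2,4)] and jX = inr_Hom[OF O(2,4)]
  note dQ = coprod_KH_disjoint[OF O(1,3)] and dX = coprod_KH_disjoint[OF O(2,4)]
  have "img k \<subseteq> img (inr KH Q1 Q2)"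
  proof
    fix s assume s: "s \<in> img k"
    then obtain a where a: "a \<in> topspace A" "s = ap k a" unfolding img_eq[OF k] by blast
    have "ap (coprod_arr KH q1 q2) s = ap (inr KH X1 X2) (ap p a)"
      using ap_Comp[OF k c(1) a(1)] ap_Comp[OF p jX a(1)] eq a(2) by simp
    then have 1: "ap (coprod_arr KH q1 q2) s \<in> img (inr KH X1 X2)"
      unfolding img_eq[OF jX] using ap_in[OF p a(1)] by simp
    have "s \<notin> img (inl KH Q1 Q2)"
    proof
      assume "s \<in> img (inl KH Q1 Q2)"
      then obtain y where y: "y \<in> topspace Q1" "s = ap (inl KH Q1 Q2) y" unfolding img_eq[OF iQ] by blast
      have "ap (coprod_arr KH q1 q2) s = ap (inl KH X1 X2) (ap q1 y)"
        using ap_Comp[OF iQ c(1) y(1)] ap_Comp[OF q1 iX y(1)] c(2) y(2) by simp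
      then have "ap (coprod_arr KH q1 q2) s \<in> img (inl KH X1 X2)"
        unfolding img_eq[OF iX] using ap_in[OF q1 y(1)] by simp
      then show False using 1 dX(3) by blast
    qed
    then show "s \<in> img (inr KH Q1 Q2)"
      using ap_in[OF k a(1)] a(2) dQ(4) by blast
  qed
  then obtain h where h: "h \<in> Hom KH A Q2" "inr KH Q1 Q2 \<cdot>\<^bsub>KH\<^esub> h = k"
    using KH_factor[OF k jQ dQ(2)] by blast
  have "inr KH X1 X2 \<cdot>\<^bsub>KH\<^esub> (q2 \<cdot>\<^bsub>KH\<^esub> h) = coprod_arr KH q1 q2 \<cdot>\<^bsub>KH\<^esub> (inr KH Q1 Q2 \<cdot>\<^bsub>KH\<^esub> h)"
    using KH.Comp_assoc[OF h(1) q2 jX] KH.Comp_assoc[OF h(1) jQ c(1)] c(3) by simp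
  also have "\<dots> = inr KH X1 X2 \<cdot>\<^bsub>KH\<^esub> p" using h(2) eq by simp
  finally have "q2 \<cdot>\<^bsub>KH\<^esub> h = p"
    using monicD[OF monic_KH[OF inacc jX, THEN iffD2, OF dX(2)], unfolded HomD(2)[OF jX], OF KH.Comp_in_Hom[OF h(1) q2] p] by blast
  then show ?thesis using h by blast
qed

lemma extensive_KH: "extensive_category (KH :: ('u topology, _) cat)"
  unfolding extensive_category_def
proof (intro conjI ballI category_KH has_finite_coproducts_KH[OF inacc])
  interpret coproduct_category "KH :: ('u topology, 'u topology \<times> ('u \<Rightarrow> 'u) \<times> 'u topology) cat"
    by (rule coproduct_category_KH)
  fix X1 X2 :: "'u topology" assume X: "X1 \<in> Obj KH" "X2 \<in> Obj KH"
  let ?P = "product_cat (slice_cat KH X1) (slice_cat KH X2)"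
  let ?S = "slice_cat KH (coprod KH X1 X2)"
  let ?F = "slice_coprod_functor (KH :: ('u topology, 'u topology \<times> ('u \<Rightarrow> 'u) \<times> 'u topology) cat)"
  note iX = inl_Hom[OF X] and jX = inr_Hom[OF X] and dX = coprod_KH_disjoint[OF X]
  have FO: "FObj ?F (p1, p2) = coprod_arr KH p1 p2" for p1 p2
    by (simp add: slice_coprod_functor_def)
  have FA: "FArr ?F ((p1, h1, q1), (p2, h2, q2)) =
      (coprod_arr KH p1 p2, coprod_arr KH h1 h2, coprod_arr KH q1 q2)" for p1 h1 q1 p2 h2 q2
    by (simp add: slice_coprod_functor_def)
  show "is_equivalence ?P ?S ?F"
  proof (rule is_equivalenceI[OF slice_coprod_is_functor[OF X]])
    fix P Q g assume P: "P \<in> Obj ?P" and Q: "Q \<in> Obj ?P" and g: "g \<in> Hom ?S (FObj ?F P) (FObj ?F Q)"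
    obtain p1 p2 where p: "P = (p1, p2)" "p1 \<in> Hom KH (Dom KH p1) X1" "p2 \<in> Hom KH (Dom KH p2) X2"
      using P by (auto simp: product_cat_def Obj_slice)
    obtain q1 q2 where q: "Q = (q1, q2)" "q1 \<in> Hom KH (Dom KH q1) X1" "q2 \<in> Hom KH (Dom KH q2) X2"
      using Q by (auto simp: product_cat_def Obj_slice)
    note c = coprod_arr[OF p(2,3)] and c' = coprod_arr[OF q(2,3)]
    have "g \<in> Hom ?S (coprod_arr KH p1 p2) (coprod_arr KH q1 q2)"
      using g unfolding p(1) q(1) FO .
    then obtain k where k: "g = (coprod_arr KH p1 p2, k, coprod_arr KH q1 q2)"
      "k \<in> Hom KH (coprod KH (Dom KH p1) (Dom KH p2)) (coprod KH (Dom KH q1) (Dom KH q2))"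
      "coprod_arr KH q1 q2 \<cdot>\<^bsub>KH\<^esub> k = coprod_arr KH p1 p2"
      unfolding Hom_slice_iff HomD(2)[OF c(1)] HomD(2)[OF c'(1)] by blast
    note Op = KH.Hom_Obj(1)[OF p(2)] KH.Hom_Obj(1)[OF p(3)]
    note ip = inl_Hom[OF Op] and jp = inr_Hom[OF Op]
    \<comment> \<open>Restricted to a summand, \<open>k\<close> lies over the corresponding summand
      of the base and so factors through the matching summand of its target. The two factors
      reassemble to \<open>k\<close>.\<close>
    obtain h1 where h1: "h1 \<in> Hom KH (Dom KH p1) (Dom KH q1)"
      "inl KH (Dom KH q1) (Dom KH q2) \<cdot>\<^bsub>KH\<^esub> h1 = k \<cdot>\<^bsub>KH\<^esub> inl KH (Dom KH p1) (Dom KH p2)" "q1 \<cdot>\<^bsub>KH\<^esub> h1 = p1"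
      using KH_coprod_left[OF q(2,3) KH.Comp_in_Hom[OF ip k(2)] p(2)] KH.Comp_assoc[OF ip k(2) c'(1)] k(3) c(2) by auto
    obtain h2 where h2: "h2 \<in> Hom KH (Dom KH p2) (Dom KH q2)"
      "inr KH (Dom KH q1) (Dom KH q2) \<cdot>\<^bsub>KH\<^esub> h2 = k \<cdot>\<^bsub>KH\<^esub> inr KH (Dom KH p1) (Dom KH p2)" "q2 \<cdot>\<^bsub>KH\<^esub> h2 = p2"
      using KH_coprod_right[OF q(2,3) KH.Comp_in_Hom[OF jp k(2)] p(3)] KH.Comp_assoc[OF jp k(2) c'(1)] k(3) c(3) by auto
    have "coprod_arr KH h1 h2 = k"
      by (rule coprod_arr_eqI[OF h1(1) h2(1) k(2)]) (simp_all add: h1(2) h2(2))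
    then have "FArr ?F ((p1, h1, q1), (p2, h2, q2)) = g"
      unfolding FA k(1) by simp
    moreover have "((p1, h1, q1), (p2, h2, q2)) \<in> Hom ?P P Q"
      unfolding Hom_product_iff Hom_slice_iff p(1) q(1)
      using HomD(1,3)[OF p(2)] HomD(1,3)[OF p(3)] HomD(1,3)[OF q(2)] HomD(1,3)[OF q(3)] h1(1,3) h2(1,3) by simp
    ultimately show "\<exists>f \<in> Hom ?P P Q. FArr ?F f = g" by blast
  next
    fix P Q f f' assume f: "f \<in> Hom ?P P Q" and f': "f' \<in> Hom ?P P Q" and eq: "FArr ?F f = FArr ?F f'"
    obtain p1 p2 q1 q2 where PQ: "P = (p1, p2)" "Q = (q1, q2)" by (metis surj_pair)
    obtain h1 h2 where h: "f = ((p1, h1, q1), (p2, h2, q2))" "h1 \<in> Hom KH (Dom KH p1) (Dom KH q1)"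
      "h2 \<in> Hom KH (Dom KH p2) (Dom KH q2)"
      using f unfolding Hom_product_iff Hom_slice_iff PQ by (cases f) auto
    obtain h1' h2' where h': "f' = ((p1, h1', q1), (p2, h2', q2))" "h1' \<in> Hom KH (Dom KH p1) (Dom KH q1)"
      "h2' \<in> Hom KH (Dom KH p2) (Dom KH q2)"
      using f' unfolding Hom_product_iff Hom_slice_iff PQ by (cases f') auto
    have ceq: "coprod_arr KH h1 h2 = coprod_arr KH h1' h2'"
      using eq unfolding h(1) h'(1) FA by simp
    note Oq = KH.Hom_Obj(2)[OF h(2)] KH.Hom_Obj(2)[OF h(3)]
    note dq = coprod_KH_disjoint[OF Oq]
    have "h1 = h1'"
    proof (rule monicD[OF monic_KH[OF inacc inl_Hom[OF Oq], THEN iffD2, OF dq(1)]])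
      show "inl KH (Dom KH q1) (Dom KH q2) \<cdot>\<^bsub>KH\<^esub> h1 = inl KH (Dom KH q1) (Dom KH q2) \<cdot>\<^bsub>KH\<^esub> h1'"
        using coprod_arr(2)[OF h(2,3)] coprod_arr(2)[OF h'(2,3)] ceq by simp
    qed (use h(2) h'(2) HomD(2)[OF inl_Hom[OF Oq]] in simp_all)
    moreover have "h2 = h2'"
    proof (rule monicD[OF monic_KH[OF inacc inr_Hom[OF Oq], THEN iffD2, OF dq(2)]])
      show "inr KH (Dom KH q1) (Dom KH q2) \<cdot>\<^bsub>KH\<^esub> h2 = inr KH (Dom KH q1) (Dom KH q2) \<cdot>\<^bsub>KH\<^esub> h2'"
        using coprod_arr(3)[OF h(2,3)] coprod_arr(3)[OF h'(2,3)] ceq by simp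
    qed (use h(3) h'(3) HomD(2)[OF inr_Hom[OF Oq]] in simp_all)
    ultimately show "f = f'" unfolding h(1) h'(1) by simp
  next
    fix p assume "p \<in> Obj ?S"
    then obtain D where p: "p \<in> Hom KH D (coprod KH X1 X2)" unfolding Obj_slice by blast
    note DO = KH.Hom_Obj(1)[OF p]
    \<comment> \<open>Essential surjectivity: the summands of the base pull back to two
      complementary closed subspaces of \<open>D\<close>, so \<open>D\<close> is their coproduct and
      \<open>p\<close> is the sum of its restrictions.\<close>
    have cl: "closedin D {x \<in> topspace D. ap p x \<in> img (inl KH X1 X2)}"
      "closedin D {x \<in> topspace D. ap p x \<in> img (inr KH X1 X2)}"
      using closedin_continuous_map_preimage[OF ap_cont[OF p] closedin_img[OF iX]]
        closedin_continuous_map_preimage[OF ap_cont[OF p] closedin_img[OF jX]] .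
    obtain M1 m1 where m1: "m1 \<in> Hom KH M1 D" "monic KH m1" "img m1 = {x \<in> topspace D. ap p x \<in> img (inl KH X1 X2)}"
      by (rule closed_sub[OF inacc DO cl(1)]) (rule that)
    obtain M2 m2 where m2: "m2 \<in> Hom KH M2 D" "monic KH m2" "img m2 = {x \<in> topspace D. ap p x \<in> img (inr KH X1 X2)}"
      by (rule closed_sub[OF inacc DO cl(2)]) (rule that)
    have s1: "img (p \<cdot>\<^bsub>KH\<^esub> m1) \<subseteq> img (inl KH X1 X2)" and s2: "img (p \<cdot>\<^bsub>KH\<^esub> m2) \<subseteq> img (inr KH X1 X2)"
      unfolding img_Comp[OF m1(1) p] img_Comp[OF m2(1) p] m1(3) m2(3) by auto
    obtain p1 where p1: "p1 \<in> Hom KH M1 X1" "inl KH X1 X2 \<cdot>\<^bsub>KH\<^esub> p1 = p \<cdot>\<^bsub>KH\<^esub> m1"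
      using KH_factor[OF KH.Comp_in_Hom[OF m1(1) p] iX dX(1) s1] by blast
    obtain p2 where p2: "p2 \<in> Hom KH M2 X2" "inr KH X1 X2 \<cdot>\<^bsub>KH\<^esub> p2 = p \<cdot>\<^bsub>KH\<^esub> m2"
      using KH_factor[OF KH.Comp_in_Hom[OF m2(1) p] jX dX(2) s2] by blast
    have cov: "topspace D = img m1 \<union> img m2"
      using ap_in[OF p] dX(4) unfolding m1(3) m2(3) by blast
    have dis: "img m1 \<inter> img m2 = {}"
      using dX(3) unfolding m1(3) m2(3) by blast
    have "is_binary_coproduct KH M1 M2 D m1 m2"
      by (rule is_binary_coproduct_KHI[OF m1(1) m2(1) _ _ dis cov])
        (use monic_KH[OF inacc m1(1)] monic_KH[OF inacc m2(1)] m1(2) m2(2) in simp_all)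
    then obtain e where e: "e \<in> Hom KH (coprod KH M1 M2) D" "is_iso KH e"
      "e \<cdot>\<^bsub>KH\<^esub> inl KH M1 M2 = m1" "e \<cdot>\<^bsub>KH\<^esub> inr KH M1 M2 = m2"
      using KH.binary_coproduct_iso[OF coprod_is_coproduct[OF KH.Hom_Obj(1)[OF m1(1)] KH.Hom_Obj(1)[OF m2(1)]]] by blast
    obtain e' where e': "e' \<in> Hom KH D (coprod KH M1 M2)" "e' \<cdot>\<^bsub>KH\<^esub> e = Ident KH (coprod KH M1 M2)"
      "e \<cdot>\<^bsub>KH\<^esub> e' = Ident KH D"
      using KH.is_iso_obtain[OF e(1,2)] by blast
    note OM = KH.Hom_Obj(1)[OF m1(1)] KH.Hom_Obj(1)[OF m2(1)]
    note pe = KH.Comp_in_Hom[OF e(1) p]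
    have cp: "coprod_arr KH p1 p2 = p \<cdot>\<^bsub>KH\<^esub> e"
      using KH.Comp_assoc[OF inl_Hom[OF OM] e(1) p] KH.Comp_assoc[OF inr_Hom[OF OM] e(1) p] e(3,4) p1(2) p2(2)
      by (intro coprod_arr_eqI[OF p1(1) p2(1) pe]) simp_all
    note D = HomD[OF p] HomD[OF pe]
    interpret S: category ?S by (rule KH.category_slice_cat)
    have 1: "(p \<cdot>\<^bsub>KH\<^esub> e, e, p) \<in> Hom ?S (p \<cdot>\<^bsub>KH\<^esub> e) p"
      unfolding Hom_slice_iff using D e(1) by simp
    have "(p \<cdot>\<^bsub>KH\<^esub> e) \<cdot>\<^bsub>KH\<^esub> e' = p"
      using KH.Comp_assoc[OF e'(1) e(1) p] e'(3) KH.Comp_Ident[OF p] by simp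
    then have 2: "(p, e', p \<cdot>\<^bsub>KH\<^esub> e) \<in> Hom ?S p (p \<cdot>\<^bsub>KH\<^esub> e)"
      unfolding Hom_slice_iff using D e'(1) by simp
    have "is_iso ?S (p \<cdot>\<^bsub>KH\<^esub> e, e, p)"
      unfolding S.is_iso_iff[OF 1]
      by (rule bexI[OF _ 2]) (use D e'(2,3) in \<open>simp add: slice_cat_def\<close>)
    then have "isomorphic ?S (FObj ?F (p1, p2)) p"
      unfolding isomorphic_def FO cp using 1 by blast
    moreover have "(p1, p2) \<in> Obj ?P"
      using HomD[OF p1(1)] HomD[OF p2(1)] by (simp add: product_cat_def slice_cat_def)
    ultimately show "\<exists>c\<in>Obj ?P. isomorphic ?S (FObj ?F c) p" by blast
  qed
qed

lemma pretopos_KH: "pretopos (KH :: ('u topology, _) cat)"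
  unfolding pretopos_def exact_category_def
  using regular_KH[OF inacc] effective_KH[OF inacc] extensive_KH by blast

text \<open>The initial object maps to the empty space and therefore has no points, whereas an
  isomorphism with the terminal object would give it one.\<close>

lemma nontrivial_KH: "nontrivial_category (KH :: ('u topology, _) cat)"
  unfolding nontrivial_category_def
proof
  let ?C = "KH :: ('u topology, 'u topology \<times> ('u \<Rightarrow> 'u) \<times> 'u topology) cat"
  define Z T where ZT: "Z = initial_obj ?C" "T = terminal_obj ?C"
  obtain Z0 where "is_initial ?C Z0" using KH.ex_initial[OF has_finite_coproducts_KH[OF inacc]] by blast
  then have Z: "is_initial ?C Z" unfolding ZT by (rule KH.initial_obj)
  have T: "is_terminal ?C T" unfolding ZT by (rule KH.terminal_obj[OF is_terminal_KH_point[OF inacc]])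
  obtain t where t: "topspace T = {t}" using terminal_KH_topspace[OF inacc T] .
  have "discrete_topology {} \<in> Obj ?C"
    unfolding Obj_KH using small_finite[OF inacc, of "{}"] by (simp add: compact_space_discrete_topology)
  then obtain f where f: "f \<in> Hom ?C Z (discrete_topology {})"
    using Z unfolding is_initial_def by blast
  have "x \<notin> topspace Z" for x using ap_in[OF f, of x] by auto
  moreover assume "isomorphic ?C (initial_obj ?C) (terminal_obj ?C)"
  then obtain g where "g \<in> Hom ?C T Z"
    unfolding ZT[symmetric] isomorphic_def using KH.is_iso_obtain by metis
  ultimately show False using ap_in[of g T Z t] t by simp
qed

section \<open>Stone-Cech covers and copowers of the terminal object\<close>

lemma stone_cech_extension:
  assumes Y: "compact_space Y" "Hausdorff_space Y" and g: "g ` I \<subseteq> topspace Y"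
  shows "\<exists>h. continuous_map (stone_cech I) Y h \<and> (\<forall>x\<in>I. h (stone_cech_pt I x) = g x)"
  by (rule dense_extension[OF Y stone_cech_pt g stone_cech_dense stone_cech_disjoint])

lemma stone_cech_copy:
  fixes I :: "'x set"
  assumes "small TYPE('u) I"
  obtains X :: "'u topology" and e d where "X \<in> Obj KH" "homeomorphic_maps (stone_cech I) X e d"
proof (rule KH_copy[OF compact_stone_cech Hausdorff_stone_cech])
  show "small TYPE('u) (topspace (stone_cech I))"
    by (rule small_subset[OF topspace_stone_cech small_PiE[OF inacc small_Pow[OF inacc assms]]])
      (rule small_finite[OF inacc], simp)
qed (rule that)

lemma filtral_KH: "filtral_category (KH :: ('u topology, _) cat)"
  unfolding filtral_category_def
proof (intro conjI ballI coherent_KH[OF inacc])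
  fix K :: "'u topology" assume K: "K \<in> Obj KH"
  define I where "I = topspace K"
  let ?T = "stone_cech I"
  obtain X :: "'u topology" and e d where X: "X \<in> Obj KH" and ed: "homeomorphic_maps ?T X e d"
    using stone_cech_copy[OF Obj_KHD(3)[OF K]] unfolding I_def .
  have e: "continuous_map ?T X e" and d: "continuous_map X ?T d"
    and de: "\<And>x. x \<in> topspace ?T \<Longrightarrow> d (e x) = x" and ed': "\<And>x. x \<in> topspace X \<Longrightarrow> e (d x) = x"
    using ed unfolding homeomorphic_maps_def by auto
  have dT: "d x \<in> topspace ?T" if "x \<in> topspace X" for x
    using continuous_map_image_subset_topspace[OF d] that by blast
  have eX: "e x \<in> topspace X" if "x \<in> topspace ?T" for x
    using continuous_map_image_subset_topspace[OF e] that by blast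
  have id: "(\<lambda>x. x) ` I \<subseteq> topspace K" by (simp add: I_def)
  \<comment> \<open>The identity on the underlying set of \<open>K\<close>, seen as a map from a
    discrete space, extends to the compactification; it hits every point of \<open>K\<close> already
    on the dense part.\<close>
  obtain h where h: "continuous_map ?T K h" "\<And>x. x \<in> I \<Longrightarrow> h (stone_cech_pt I x) = x"
    using stone_cech_extension[OF Obj_KHD(1,2)[OF K] id] by blast
  have f: "mk X (h \<circ> d) K \<in> Hom KH X K" (is "?f \<in> _")
    by (rule mk_Hom[OF X K continuous_map_compose[OF d h(1)]])
  have "topspace K \<subseteq> img ?f"
  proof
    fix x assume x: "x \<in> topspace K"
    then have pt: "stone_cech_pt I x \<in> topspace ?T"
      using stone_cech_pt[of I] unfolding I_def by blast
    then have "ap ?f (e (stone_cech_pt I x)) = x"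
      using h(2)[of x] x by (simp add: ap_mk eX de I_def)
    then show "x \<in> img ?f"
      unfolding img_eq[OF f] using eX[OF pt] by (metis image_eqI)
  qed
  then have "img ?f = topspace K"
    using closedin_subset[OF closedin_img[OF f]] by blast
  then have "regular_epi KH ?f"
    by (rule regular_epi_KH[OF inacc f])
  moreover have "filtral_lattice (Sub KH X)"
  proof (rule filtral_latticeI[OF set_rep_Sub[OF inacc] sub_img_carrier[OF inacc X] Obj_KHD(1)[OF X]])
    fix x y assume xy: "x \<in> topspace X" "y \<in> topspace X" "x \<noteq> y"
    then have "d x \<noteq> d y" using ed' by metis
    then obtain V where V: "closedin ?T V" "openin ?T V" "d x \<in> V" "d y \<notin> V"
      using stone_cech_separated[OF dT[OF xy(1)] dT[OF xy(2)]] by blast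
    show "\<exists>V. closedin X V \<and> openin X V \<and> x \<in> V \<and> y \<notin> V"
      using closedin_continuous_map_preimage[OF d V(1)] openin_continuous_map_preimage[OF d V(2)] V(3,4) xy(1)
      by (intro exI[of _ "{x \<in> topspace X. d x \<in> V}"]) simp
  qed
  ultimately show "\<exists>X f. f \<in> Hom KH X K \<and> regular_epi KH f \<and> filtral_obj KH X"
    using f X unfolding filtral_obj_def by blast
qed

lemma terminal_copowers_KH: "has_terminal_copowers TYPE('u) (KH :: ('u topology, _) cat)"
  unfolding has_terminal_copowers_def
proof (intro allI impI)
  let ?C = "KH :: ('u topology, 'u topology \<times> ('u \<Rightarrow> 'u) \<times> 'u topology) cat"
  fix I :: "'u set" assume I: "small TYPE('u) I"
  define T where "T = terminal_obj ?C"
  have T: "is_terminal ?C T" unfolding T_def by (rule KH.terminal_obj[OF is_terminal_KH_point[OF inacc]])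
  then have TO: "T \<in> Obj KH" by (simp add: is_terminal_def)
  obtain t where t: "topspace T = {t}" using terminal_KH_topspace[OF inacc T] .
  have tt: "t \<in> topspace T" by (simp add: t)
  let ?B = "stone_cech I"
  obtain X :: "'u topology" and e d where X: "X \<in> Obj KH" and ed: "homeomorphic_maps ?B X e d"
    using stone_cech_copy[OF I] .
  have e: "continuous_map ?B X e" and d: "continuous_map X ?B d"
    and de: "\<And>x. x \<in> topspace ?B \<Longrightarrow> d (e x) = x" and ed': "\<And>x. x \<in> topspace X \<Longrightarrow> e (d x) = x"
    using ed unfolding homeomorphic_maps_def by auto
  have dB: "d x \<in> topspace ?B" if "x \<in> topspace X" for x
    using continuous_map_image_subset_topspace[OF d] that by blast
  have pt: "stone_cech_pt I i \<in> topspace ?B" if "i \<in> I" for i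
    using stone_cech_pt[of I] that by blast
  have ptX: "e (stone_cech_pt I i) \<in> topspace X" if "i \<in> I" for i
    using continuous_map_image_subset_topspace[OF e] pt[OF that] by blast
  define \<iota> where "\<iota> i = mk T (\<lambda>_. e (stone_cech_pt I i)) X" for i
  have \<iota>: "\<iota> i \<in> Hom ?C T X" if "i \<in> I" for i
    unfolding \<iota>_def using ptX[OF that] by (intro mk_Hom TO X) simp
  have ap\<iota>: "ap (\<iota> i) t = e (stone_cech_pt I i)" for i
    by (simp add: \<iota>_def ap_mk tt)
  have "is_coproduct ?C I (\<lambda>_. T) X \<iota>"
    unfolding is_coproduct_def
  proof (intro conjI ballI allI impI X \<iota>)
    fix W and a :: "'u \<Rightarrow> 'u topology \<times> ('u \<Rightarrow> 'u) \<times> 'u topology"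
    assume W: "W \<in> Obj ?C" and "\<forall>i\<in>I. a i \<in> Hom ?C T W"
    then have a: "a i \<in> Hom ?C T W" if "i \<in> I" for i using that by blast
    have im: "(\<lambda>i. ap (a i) t) ` I \<subseteq> topspace W"
      using ap_in[OF a tt] by blast
    obtain h where h: "continuous_map ?B W h" "\<And>i. i \<in> I \<Longrightarrow> h (stone_cech_pt I i) = ap (a i) t"
      using stone_cech_extension[OF Obj_KHD(1,2)[OF W] im] by blast
    have f: "mk X (h \<circ> d) W \<in> Hom KH X W" (is "?f \<in> _")
      by (rule mk_Hom[OF X W continuous_map_compose[OF d h(1)]])
    show "\<exists>!h. h \<in> Hom ?C X W \<and> (\<forall>i\<in>I. h \<cdot>\<^bsub>?C\<^esub> \<iota> i = a i)"
    proof (rule ex1I[of _ ?f], intro conjI ballI f)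
      fix i assume i: "i \<in> I"
      show "?f \<cdot>\<^bsub>?C\<^esub> \<iota> i = a i"
        by (rule Hom_KH_eqI[OF KH.Comp_in_Hom[OF \<iota>[OF i] f] a[OF i]])
          (simp add: t ap_Comp[OF \<iota>[OF i] f tt] ap\<iota> ap_mk ptX[OF i] de pt[OF i] h(2)[OF i])
    next
      fix k assume k: "k \<in> Hom ?C X W \<and> (\<forall>i\<in>I. k \<cdot>\<^bsub>?C\<^esub> \<iota> i = a i)"
      then have kH: "k \<in> Hom ?C X W" by blast
      \<comment> \<open>Uniqueness: both maps are continuous into a Hausdorff space and agree on the
        dense set of principal ultrafilters.\<close>
      have agree: "(ap k \<circ> e) x = h x" if x: "x \<in> topspace ?B" for x
      proof (rule continuous_maps_agree_dense[OF continuous_map_compose[OF e ap_cont[OF kH]] h(1)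
            Obj_KHD(2)[OF W] stone_cech_dense _ x])
        fix y assume "y \<in> stone_cech_pt I ` I"
        then obtain i where i: "i \<in> I" "y = stone_cech_pt I i" by blast
        have "ap (k \<cdot>\<^bsub>?C\<^esub> \<iota> i) t = ap (a i) t" using k i(1) by simp
        then show "(ap k \<circ> e) y = h y"
          using ap_Comp[OF \<iota>[OF i(1)] kH tt] by (simp add: ap\<iota> i(2) h(2)[OF i(1)])
      qed
      show "k = ?f"
      proof (rule Hom_KH_eqI[OF kH f])
        fix x assume x: "x \<in> topspace X"
        show "ap k x = ap ?f x"
          using agree[OF dB[OF x]] ed'[OF x] by (simp add: ap_mk[OF x])
      qed
    qed
  qed
  then show "\<exists>S \<iota>. is_coproduct ?C I (\<lambda>_. terminal_obj ?C) S \<iota>"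
    unfolding T_def by blast
qed

theorem KH_like_KH: "KH_like TYPE('u) (KH :: ('u topology, _) cat)"
  unfolding KH_like_def
  using pretopos_KH nontrivial_KH well_powered_KH[OF inacc] well_pointed_KH[OF inacc] filtral_KH
    terminal_copowers_KH by blast

end


section \<open>Points and subobjects in a category like \<open>KH\<close>\<close>

text \<open>Apply the inverse functor to \<open>\<phi>\<close> and conjugate by the unit. Existence
  of an arrow is the point here; no relation to \<open>\<phi>\<close> is asserted.\<close>

lemma equivalence_reflects_Hom:
  assumes eqv: "is_equivalence C D F" and A: "A \<in> Obj C" "B \<in> Obj C"
    and \<phi>: "\<phi> \<in> Hom D (FObj F A) (FObj F B)"
  shows "\<exists>g. g \<in> Hom C A B"
proof -
  obtain G \<eta> where F: "is_functor C D F" and G: "is_functor D C G"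
    and \<eta>: "natural_iso C C id_functor (comp_functor G F) \<eta>"
    using eqv unfolding is_equivalence_def by blast
  interpret C: category C by (rule is_functorD(1)[OF F])
  have \<eta>H: "\<eta> X \<in> Hom C X (FObj G (FObj F X))" "is_iso C (\<eta> X)" if "X \<in> Obj C" for X
    using \<eta> that unfolding natural_iso_def id_functor_def comp_functor_def by auto
  obtain k where k: "k \<in> Hom C (FObj G (FObj F B)) B"
    using C.is_iso_obtain[OF \<eta>H[OF A(2)]] by blast
  show ?thesis
    using C.Comp_in_Hom[OF C.Comp_in_Hom[OF \<eta>H(1)[OF A(1)] is_functorD(4)[OF G \<phi>]] k] by blast
qed

locale kh_like =
  fixes C :: "('o, 'm) cat" (structure) and U :: "'u itself"
  assumes KH_like: "KH_like U C"

sublocale kh_like \<subseteq> coproduct_category C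
  using KH_like unfolding KH_like_def pretopos_def extensive_category_def
  by (intro coproduct_category.intro coproduct_category_axioms.intro) blast+

context kh_like
begin

abbreviation one :: 'o where "one \<equiv> terminal_obj C"
abbreviation zero :: 'o where "zero \<equiv> initial_obj C"
abbreviation pts :: "'o \<Rightarrow> 'm set" where "pts X \<equiv> Hom C one X"

section \<open>Terminal and initial object, and objects without points\<close>

lemma regular: "regular_category C"
  using KH_like unfolding KH_like_def pretopos_def exact_category_def by blast

lemma pullback_exists: "f \<in> Hom C X Z \<Longrightarrow> g \<in> Hom C Y Z \<Longrightarrow> \<exists>p q. is_pullback C f g p q"
  using regular unfolding regular_category_def by (intro ex_pullback) blast+

lemma well_pointed: "well_pointed U C"
  using KH_like unfolding KH_like_def by blast

lemma terminal: "is_terminal C one"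
  using well_pointed terminal_obj unfolding well_pointed_def by blast

lemma one_Obj: "one \<in> Obj C"
  using terminal unfolding is_terminal_def by blast

lemma to_one_ex: "X \<in> Obj C \<Longrightarrow> \<exists>f. f \<in> Hom C X one"
  using terminal unfolding is_terminal_def by blast

lemma to_one_unique: "f \<in> Hom C X one \<Longrightarrow> g \<in> Hom C X one \<Longrightarrow> f = g"
  using terminal Hom_Obj(1)[of f X one] unfolding is_terminal_def by blast

lemma initial: "is_initial C zero"
  using ex_initial[OF fin_coproducts] initial_obj by blast

lemma zero_Obj: "zero \<in> Obj C"
  using initial unfolding is_initial_def by blast

lemma from_zero_ex: "X \<in> Obj C \<Longrightarrow> \<exists>f. f \<in> Hom C zero X"
  using initial unfolding is_initial_def by blast

lemma from_zero_unique: "f \<in> Hom C zero X \<Longrightarrow> g \<in> Hom C zero X \<Longrightarrow> f = g"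
  using initial Hom_Obj(2)[of f zero X] unfolding is_initial_def by blast

lemma pts_ext:
  assumes "f \<in> Hom C X Y" "g \<in> Hom C X Y" "\<And>x. x \<in> pts X \<Longrightarrow> f \<cdot> x = g \<cdot> x"
  shows "f = g"
  using pt_faithfulD[of U] well_pointed assms unfolding well_pointed_def by blast

lemma small_pts: "X \<in> Obj C \<Longrightarrow> small U (pts X)"
  using well_pointed unfolding well_pointed_def faithful_def
  by (auto dest!: is_functorD(3) simp: pt_functor_def Set_cat_def Let_def)

text \<open>A point of \<open>0\<close> would be inverse to the arrow from \<open>0\<close> to
  \<open>1\<close>. This is where nontriviality enters.\<close>

lemma pts_zero: "pts zero = {}"
proof (rule ccontr)
  assume "pts zero \<noteq> {}"
  then obtain p where p: "p \<in> Hom C one zero" by blast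
  obtain u where u: "u \<in> Hom C zero one" using to_one_ex[OF zero_Obj] by blast
  have "p \<cdot> u = Ident C zero"
    by (rule from_zero_unique[OF Comp_in_Hom[OF u p] Ident_in_Hom[OF zero_Obj]])
  moreover have "u \<cdot> p = Ident C one"
    by (rule to_one_unique[OF Comp_in_Hom[OF p u] Ident_in_Hom[OF one_Obj]])
  ultimately have "is_iso C u" using is_iso_iff[OF u] p by blast
  then have "isomorphic C zero one" unfolding isomorphic_def using u by blast
  then show False
    using KH_like unfolding KH_like_def nontrivial_category_def by blast
qed

text \<open>Disjointness of coproducts: if both injections of \<open>1\<close> into \<open>1 + 1\<close> agree on \<open>X\<close>, then
  \<open>X + 0\<close> and \<open>0 + X\<close> map to each other over \<open>1 + 1\<close>, and extensivity turns this into arrows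
  between \<open>X\<close> and \<open>0\<close>.\<close>

lemma coprod_disjoint:
  assumes u: "u \<in> Hom C X one" and eq: "inl C one one \<cdot> u = inr C one one \<cdot> u"
  shows "\<exists>h. h \<in> Hom C X zero"
proof -
  note XO = Hom_Obj(1)[OF u]
  obtain z where z: "z \<in> Hom C zero one" using to_one_ex[OF zero_Obj] by blast
  let ?P = "product_cat (slice_cat C one) (slice_cat C one)"
  let ?S = "slice_cat C (coprod C one one)"
  let ?F = "slice_coprod_functor C"
  have eqv: "is_equivalence ?P ?S ?F"
    using KH_like one_Obj unfolding KH_like_def pretopos_def extensive_category_def by blast
  note c = coprod_arr[OF u z] and c' = coprod_arr[OF z u]
  note il = inl_Hom[OF XO zero_Obj] and ir = inr_Hom[OF XO zero_Obj]
  note il' = inl_Hom[OF zero_Obj XO] and ir' = inr_Hom[OF zero_Obj XO]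
  note i1 = inl_Hom[OF one_Obj one_Obj] and j1 = inr_Hom[OF one_Obj one_Obj]
  obtain v where v: "v \<in> Hom C zero X" using from_zero_ex[OF XO] by blast
  obtain k where k: "k \<in> Hom C (coprod C X zero) X" "k \<cdot> inl C X zero = Ident C X"
    using coprod_ex[OF XO zero_Obj Ident_in_Hom[OF XO] v] by blast
  let ?\<phi> = "inr C zero X \<cdot> k"
  have \<phi>: "?\<phi> \<in> Hom C (coprod C X zero) (coprod C zero X)"
    by (rule Comp_in_Hom[OF k(1) ir'])
  have \<phi>l: "?\<phi> \<cdot> inl C X zero = inr C zero X"
    using Comp_assoc[OF il k(1) ir'] k(2) Comp_Ident[OF ir'] by simp
  have "coprod_arr C z u \<cdot> ?\<phi> = coprod_arr C u z"
  proof (rule coprod_eqI[OF XO zero_Obj Comp_in_Hom[OF \<phi> c'(1)] c(1)])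
    show "coprod_arr C z u \<cdot> ?\<phi> \<cdot> inl C X zero = coprod_arr C u z \<cdot> inl C X zero"
      using Comp_assoc[OF il \<phi> c'(1)] \<phi>l c'(3) c(2) eq by simp
    show "coprod_arr C z u \<cdot> ?\<phi> \<cdot> inr C X zero = coprod_arr C u z \<cdot> inr C X zero"
      by (rule from_zero_unique[OF Comp_in_Hom[OF ir Comp_in_Hom[OF \<phi> c'(1)]] Comp_in_Hom[OF ir c(1)]])
  qed
  then have "(coprod_arr C u z, ?\<phi>, coprod_arr C z u) \<in> Hom ?S (FObj ?F (u, z)) (FObj ?F (z, u))"
    unfolding Hom_slice_iff using HomD[OF c(1)] HomD[OF c'(1)] \<phi> by (simp add: slice_coprod_functor_def)
  moreover have "(u, z) \<in> Obj ?P" "(z, u) \<in> Obj ?P"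
    using HomD[OF u] HomD[OF z] by (simp_all add: product_cat_def slice_cat_def)
  ultimately obtain g where "g \<in> Hom ?P (u, z) (z, u)"
    using equivalence_reflects_Hom[OF eqv] by blast
  then obtain h where "h \<in> Hom C (Dom C u) (Dom C z)"
    unfolding Hom_product_iff Hom_slice_iff by auto
  then show ?thesis using HomD(2)[OF u] HomD(2)[OF z] by auto
qed

lemma inl_neq_inr: "inl C one one \<noteq> inr C one one"
proof
  assume "inl C one one = inr C one one"
  then obtain h where "h \<in> Hom C one zero"
    using coprod_disjoint[OF Ident_in_Hom[OF one_Obj]] by auto
  then show False using pts_zero by blast
qed

text \<open>On an object without points well-pointedness makes any two parallel arrows out of it
  equal, vacuously. Applied to the two injections of \<open>1\<close> into \<open>1 + 1\<close>,
  this gives the hypothesis of \<open>coprod_disjoint\<close>.\<close>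

lemma pointless_to_zero:
  assumes X: "X \<in> Obj C" and no: "pts X = {}"
  shows "\<exists>h. h \<in> Hom C X zero"
proof -
  obtain u where u: "u \<in> Hom C X one" using to_one_ex[OF X] by blast
  have "inl C one one \<cdot> u = inr C one one \<cdot> u"
    by (rule pts_ext[OF Comp_in_Hom[OF u inl_Hom[OF one_Obj one_Obj]] Comp_in_Hom[OF u inr_Hom[OF one_Obj one_Obj]]])
      (use no in blast)
  then show ?thesis by (rule coprod_disjoint[OF u])
qed

text \<open>The factorisation runs through \<open>0\<close>, and its triangle commutes vacuously. So
  pointless subobjects lie below all others.\<close>

lemma pointless_factors:
  assumes m: "m \<in> Hom C M X" and no: "pts M = {}" and n: "n \<in> Hom C N X"
  shows "factors_through C m n"
proof -
  obtain h where h: "h \<in> Hom C M zero" using pointless_to_zero[OF Hom_Obj(1)[OF m] no] by blast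
  obtain v where v: "v \<in> Hom C zero N" using from_zero_ex[OF Hom_Obj(1)[OF n]] by blast
  have "m = n \<cdot> (v \<cdot> h)"
    by (rule pts_ext[OF m Comp_in_Hom[OF Comp_in_Hom[OF h v] n]]) (use no in blast)
  then show ?thesis
    unfolding factors_through_def using Comp_in_Hom[OF h v] HomD(2)[OF m] HomD(2)[OF n] by auto
qed

lemma from_zero_monic:
  assumes b: "b \<in> Hom C zero X"
  shows "monic C b"
  unfolding monic_def
proof (intro conjI allI ballI impI)
  show "b \<in> Arr C" by (rule HomD(1)[OF b])
  fix W f g assume f: "f \<in> Hom C W (Dom C b)" and g: "g \<in> Hom C W (Dom C b)"
  then have f': "f \<in> Hom C W zero" and g': "g \<in> Hom C W zero" by (simp_all add: HomD(2)[OF b])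
  show "f = g"
    by (rule pts_ext[OF f' g']) (use Comp_in_Hom[OF _ f'] pts_zero in blast)
qed

lemma point_monic:
  assumes p: "p \<in> pts X"
  shows "monic C p"
  unfolding monic_def
proof (intro conjI allI ballI impI)
  show "p \<in> Arr C" by (rule HomD(1)[OF p])
  fix W f g assume "f \<in> Hom C W (Dom C p)" "g \<in> Hom C W (Dom C p)"
  then show "f = g" using to_one_unique by (simp add: HomD(2)[OF p])
qed

text \<open>The trace of \<open>m\<close> on the points of its codomain. For monic \<open>m\<close>
  these traces are the future closed sets; for any arrow the trace is the image on points.\<close>

definition ptm :: "'m \<Rightarrow> 'm set" where
  "ptm m = {p \<in> pts (Cod C m). factors_through C p m}"

section \<open>Point sets under pullback, image and join\<close>

lemma ptm_iff: "m \<in> Hom C M X \<Longrightarrow> p \<in> ptm m \<longleftrightarrow> p \<in> pts X \<and> factors_through C p m"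
  by (auto simp: ptm_def HomD(3))

lemma ptm_eq_image: "m \<in> Hom C M X \<Longrightarrow> ptm m = (\<cdot>) m ` pts M"
proof (intro subset_antisym subsetI)
  fix p assume m: "m \<in> Hom C M X" and p: "p \<in> ptm m"
  then show "p \<in> (\<cdot>) m ` pts M"
    using HomD(2)[OF m] by (auto simp: ptm_def factors_through_def HomD(2))
next
  fix p assume m: "m \<in> Hom C M X" and p: "p \<in> (\<cdot>) m ` pts M"
  then obtain h where h: "h \<in> pts M" "p = m \<cdot> h" by blast
  then show "p \<in> ptm m"
    unfolding ptm_iff[OF m] using Comp_in_Hom[OF h(1) m] factors_Comp[OF h(1) m] by simp
qed

lemma ptm_empty_iff: "m \<in> Hom C M X \<Longrightarrow> ptm m = {} \<longleftrightarrow> pts M = {}"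
  by (simp add: ptm_eq_image)

lemma ptm_Ident: "X \<in> Obj C \<Longrightarrow> ptm (Ident C X) = pts X"
  using ptm_iff[OF Ident_in_Hom] factors_Ident by blast

lemma ptm_mono:
  assumes "factors_through C m n" "m \<in> Hom C M X" "n \<in> Hom C N X"
  shows "ptm m \<subseteq> ptm n"
  using factors_trans[OF _ assms(1) HomD(1)[OF assms(3)]] ptm_iff[OF assms(2)] ptm_iff[OF assms(3)] by blast

lemma ptm_pullback:
  assumes pb: "is_pullback C f n m q"
  shows "ptm m = {p \<in> pts (Dom C f). f \<cdot> p \<in> ptm n}"
proof -
  note D = is_pullbackD(1-5)[OF pb]
  show ?thesis
    using ptm_iff[OF D(1)] ptm_iff[OF D(4)] factors_pullback[OF pb] Comp_in_Hom[OF _ D(3)] by blast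
qed

lemma ptm_point: "p \<in> pts X \<Longrightarrow> ptm p = {p}"
proof -
  assume p: "p \<in> pts X"
  have "pts one = {Ident C one}"
    using to_one_unique[OF _ Ident_in_Hom[OF one_Obj]] Ident_in_Hom[OF one_Obj] by blast
  then show ?thesis using ptm_eq_image[OF p] Comp_Ident[OF p] by simp
qed

text \<open>A point of \<open>M\<close> followed by \<open>m\<close> is the only endomorphism of
  \<open>1\<close>. So for subobjects of \<open>1\<close>, having a point already means being the
  whole of \<open>1\<close>.\<close>

lemma Ident_one_factors_iff:
  assumes m: "m \<in> Hom C M one"
  shows "factors_through C (Ident C one) m \<longleftrightarrow> pts M \<noteq> {}"
proof
  assume "factors_through C (Ident C one) m"
  then have "Ident C one \<in> ptm m" using ptm_iff[OF m] Ident_in_Hom[OF one_Obj] by blast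
  then show "pts M \<noteq> {}" using ptm_empty_iff[OF m] by blast
next
  assume "pts M \<noteq> {}"
  then obtain h where h: "h \<in> pts M" by blast
  have "m \<cdot> h = Ident C one"
    by (rule to_one_unique[OF Comp_in_Hom[OF h m] Ident_in_Hom[OF one_Obj]])
  then show "factors_through C (Ident C one) m"
    using factors_Comp[OF h m] by simp
qed

lemma image_exists:
  assumes f: "f \<in> Hom C X Y"
  obtains k where "monic C k" "k \<in> Hom C (Dom C k) Y" "is_image C f (subobj C k)"
proof -
  obtain S where S: "is_image C f S"
    using regular HomD(1)[OF f] unfolding regular_category_def by blast
  then have "S \<in> carrier (Sub C Y)"
    unfolding is_image_def least_def HomD(3)[OF f] by blast
  then obtain k where k: "monic C k" "Cod C k = Y" "S = subobj C k" by (rule Sub_obtain)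
  then show ?thesis using that[of k] S monic_Hom[OF k(1,2)] by simp
qed

lemma image_stable:
  assumes "is_pullback C f g p q" "is_image C f S"
  shows "is_image C q (sub_pullback C g S)"
  using regular assms unfolding regular_category_def by blast

lemma pullback_of_large:
  assumes g: "g \<in> Hom C W Y" and k: "monic C k" "k \<in> Hom C K Y" and fac: "factors_through C g k"
  shows "sub_pullback C g (subobj C k) = subobj C (Ident C W)"
proof -
  obtain k' r where pb: "is_pullback C g k k' r" using pullback_exists[OF g k(2)] by blast
  note D = is_pullbackD(1-5)[OF pb]
  have DW: "Dom C g = W" by (rule HomD(2)[OF g])
  have W: "W \<in> Obj C" by (rule Hom_Obj(1)[OF g])
  have k'H: "k' \<in> Hom C (Dom C k') W" using D(1) DW by simp
  have "factors_through C (Ident C W) k'"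
    using factors_pullback[OF pb, of "Ident C W" W] Ident_in_Hom[OF W] DW Comp_Ident[OF g] fac by simp
  then have "subobj C k' = subobj C (Ident C W)"
    using subobj_eq_iff[OF pullback_monic[OF pb k(1)] Ident_monic[OF W]] factors_Ident[OF k'H]
      HomD(3)[OF k'H] HomD(3)[OF Ident_in_Hom[OF W]] by simp
  then show ?thesis using sub_pullback_subobj[OF pb k(1)] by simp
qed

text \<open>Points of the image lift to points of \<open>X\<close>. Pull \<open>f\<close> back along
  such a point \<open>p\<close>: by stability the image of the resulting arrow to \<open>1\<close>
  is all of \<open>1\<close>. Its domain therefore has a point, since otherwise it would factor
  through \<open>0\<close>; that point gives a preimage of \<open>p\<close>.\<close>

lemma image_ptm:
  assumes f: "f \<in> Hom C X Y" and k: "monic C k" "k \<in> Hom C K Y" and im: "is_image C f (subobj C k)"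
  shows "ptm k = (\<cdot>) f ` pts X"
proof (intro subset_antisym subsetI)
  have fk: "factors_through C f k"
    using im is_image_subobj_iff[OF HomD(1)[OF f] k(1)] HomD(3)[OF f] HomD(3)[OF k(2)] by simp
  fix p assume "p \<in> (\<cdot>) f ` pts X"
  then have "p \<in> ptm f" using ptm_eq_image[OF f] by simp
  then show "p \<in> ptm k" using ptm_mono[OF fk f k(2)] by blast
next
  fix p assume "p \<in> ptm k"
  then have p: "p \<in> pts Y" and pk: "factors_through C p k" using ptm_iff[OF k(2)] by auto
  obtain a q where pb: "is_pullback C f p a q" using pullback_exists[OF f p] by blast
  note D = is_pullbackD(1-5)[OF pb, unfolded HomD(2)[OF f] HomD(2)[OF p]]
  have "is_image C q (subobj C (Ident C one))"
    using image_stable[OF pb im] pullback_of_large[OF p k pk] by simp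
  then have le: "factors_through C (Ident C one) n"
    if "monic C n" "Cod C n = one" "factors_through C q n" for n
    using that is_image_subobj_iff[OF HomD(1)[OF D(2)] Ident_monic[OF one_Obj]]
      HomD(3)[OF Ident_in_Hom[OF one_Obj]] HomD(3)[OF D(2)] by simp
  have "pts (Dom C a) \<noteq> {}"
  proof
    assume no: "pts (Dom C a) = {}"
    obtain b where b: "b \<in> Hom C zero one" using from_zero_ex[OF one_Obj] by blast
    have "factors_through C (Ident C one) b"
      by (rule le[OF from_zero_monic[OF b] HomD(3)[OF b] pointless_factors[OF D(2) no b]])
    then show False using Ident_one_factors_iff[OF b] pts_zero by blast
  qed
  then obtain h where h: "h \<in> pts (Dom C a)" by blast
  have "f \<cdot> (a \<cdot> h) = p \<cdot> (q \<cdot> h)"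
    using Comp_assoc[OF h D(1) f] Comp_assoc[OF h D(2) p] D(5) by simp
  also have "q \<cdot> h = Ident C one"
    by (rule to_one_unique[OF Comp_in_Hom[OF h D(2)] Ident_in_Hom[OF one_Obj]])
  finally have "f \<cdot> (a \<cdot> h) = p" using Comp_Ident[OF p] by simp
  then show "p \<in> (\<cdot>) f ` pts X" using Comp_in_Hom[OF h D(1)] by blast
qed

text \<open>If \<open>f\<close> is \<open>n \<cdot> h\<close> with \<open>n\<close> monic, then
  \<open>h\<close> coequalises the pair that \<open>f\<close> coequalises, and the arrow induced by
  \<open>h\<close> is a section of \<open>n\<close>.\<close>

lemma regular_epi_image:
  assumes f: "f \<in> Hom C X Y" and re: "regular_epi C f"
  shows "is_image C f (subobj C (Ident C Y))"
proof -
  have Y: "Y \<in> Obj C" by (rule Hom_Obj(2)[OF f])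
  obtain a b where ab: "is_coequalizer C a b f" using re unfolding regular_epi_def by blast
  note ab' = ab[unfolded is_coequalizer_def]
  have a: "a \<in> Hom C (Dom C a) X" and b: "b \<in> Hom C (Dom C a) X" and fab: "f \<cdot> a = f \<cdot> b"
    using ab' HomD(2)[OF f] by (auto simp: Hom_iff)
  have univ: "\<exists>!h. h \<in> Hom C Y W \<and> h \<cdot> f = c" if "c \<in> Hom C X W" "c \<cdot> a = c \<cdot> b" for c W
    using ab' that HomD[OF f] HomD(3)[OF a] by simp
  have "factors_through C (Ident C Y) n"
    if n: "monic C n" "Cod C n = Y" "factors_through C f n" for n
  proof -
    have nH: "n \<in> Hom C (Dom C n) Y" by (rule monic_Hom[OF n(1,2)])
    obtain h where h: "h \<in> Hom C X (Dom C n)" "f = n \<cdot> h"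
      using n(3) HomD(2)[OF f] unfolding factors_through_def by auto
    have "n \<cdot> (h \<cdot> a) = n \<cdot> (h \<cdot> b)"
      using Comp_assoc[OF a h(1) nH] Comp_assoc[OF b h(1) nH] fab h(2) by simp
    then have "h \<cdot> a = h \<cdot> b"
      using monicD[OF n(1) Comp_in_Hom[OF a h(1)] Comp_in_Hom[OF b h(1)]] by simp
    then obtain t where t: "t \<in> Hom C Y (Dom C n)" "t \<cdot> f = h"
      using univ[OF h(1)] by blast
    have "(n \<cdot> t) \<cdot> f = f" using Comp_assoc[OF f t(1) nH] t(2) h(2) by simp
    moreover have "Ident C Y \<cdot> f = f" by (rule Ident_Comp[OF f])
    ultimately have "n \<cdot> t = Ident C Y"
      using univ[OF f fab] Comp_in_Hom[OF t(1) nH] Ident_in_Hom[OF Y] by blast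
    then show ?thesis using factors_Comp[OF t(1) nH] by simp
  qed
  then show ?thesis
    using is_image_subobj_iff[OF HomD(1)[OF f] Ident_monic[OF Y]] HomD(3)[OF Ident_in_Hom[OF Y]]
      HomD(3)[OF f] factors_Ident[OF f] by simp
qed

lemma regular_epi_surj:
  assumes f: "f \<in> Hom C X Y" and re: "regular_epi C f"
  shows "(\<cdot>) f ` pts X = pts Y"
  using image_ptm[OF f Ident_monic Ident_in_Hom regular_epi_image[OF f re]] ptm_Ident Hom_Obj(2)[OF f] by simp

lemma coherent: "coherent_category C"
  using KH_like unfolding KH_like_def filtral_category_def by blast

lemma join_exists:
  assumes "X \<in> Obj C" "F \<subseteq> carrier (Sub C X)" "finite F"
  shows "\<exists>S. least (Sub C X) S (Upper (Sub C X) F)"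
  using coherent assms unfolding coherent_category_def by blast

lemma join_stable:
  assumes "f \<in> Hom C X Y" "F \<subseteq> carrier (Sub C Y)" "finite F" "least (Sub C Y) S (Upper (Sub C Y) F)"
  shows "least (Sub C X) (sub_pullback C f S) (Upper (Sub C X) (sub_pullback C f ` F))"
  using coherent assms HomD[OF assms(1)] unfolding coherent_category_def by blast

text \<open>Suppose a point \<open>p\<close> of the join lay in neither part. Pulled back along
  \<open>p\<close>, both parts are pointless subobjects of \<open>1\<close>, hence below
  \<open>0\<close>, and by stability so is the pulled back join. But a subobject containing
  \<open>p\<close> pulls back to all of \<open>1\<close>.\<close>

lemma ptm_join:
  assumes m: "monic C m" "m \<in> Hom C M X" and n: "monic C n" "n \<in> Hom C N X"
    and k: "monic C k" "k \<in> Hom C K X"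
    and lub: "least (Sub C X) (subobj C k) (Upper (Sub C X) {subobj C m, subobj C n})"
  shows "ptm k = ptm m \<union> ptm n"
proof (intro subset_antisym subsetI)
  have F: "{subobj C m, subobj C n} \<subseteq> carrier (Sub C X)"
    using subobj_closed[OF m(1) HomD(3)[OF m(2)]] subobj_closed[OF n(1) HomD(3)[OF n(2)]] by simp
  have "factors_through C m k" "factors_through C n k"
    using least_Upper_above[OF lub _ F] le_Sub[OF m(1) k(1)] le_Sub[OF n(1) k(1)] by blast+
  then have sub: "ptm m \<subseteq> ptm k" "ptm n \<subseteq> ptm k"
    using ptm_mono[OF _ m(2) k(2)] ptm_mono[OF _ n(2) k(2)] by blast+
  fix p assume "p \<in> ptm m \<union> ptm n"
  then show "p \<in> ptm k" using sub by blast
next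
  have F: "{subobj C m, subobj C n} \<subseteq> carrier (Sub C X)"
    using subobj_closed[OF m(1) HomD(3)[OF m(2)]] subobj_closed[OF n(1) HomD(3)[OF n(2)]] by simp
  fix p assume "p \<in> ptm k"
  then have p: "p \<in> pts X" and pk: "factors_through C p k" using ptm_iff[OF k(2)] by auto
  show "p \<in> ptm m \<union> ptm n"
  proof (rule ccontr)
    assume not: "p \<notin> ptm m \<union> ptm n"
    obtain b where b: "b \<in> Hom C zero one" using from_zero_ex[OF one_Obj] by blast
    note bm = from_zero_monic[OF b]
    have pull: "sub_pullback C p (subobj C l) \<sqsubseteq>\<^bsub>Sub C one\<^esub> subobj C b"
      if l: "monic C l" "l \<in> Hom C L X" "p \<notin> ptm l" for l L
    proof -
      obtain l' r where pb: "is_pullback C p l l' r" using pullback_exists[OF p l(2)] by blast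
      have D: "l' \<in> Hom C (Dom C l') one" using is_pullbackD(1)[OF pb] HomD(2)[OF p] by simp
      have "\<not> factors_through C p l" using l(3) p ptm_iff[OF l(2)] by blast
      then have "\<not> factors_through C (Ident C one) l'"
        using factors_pullback[OF pb, of "Ident C one" one] Ident_in_Hom[OF one_Obj] HomD(2)[OF p] Comp_Ident[OF p] by simp
      then have "pts (Dom C l') = {}" using Ident_one_factors_iff[OF D] by blast
      then have "factors_through C l' b" by (rule pointless_factors[OF D _ b])
      then show ?thesis
        unfolding sub_pullback_subobj[OF pb l(1)] using le_Sub[OF pullback_monic[OF pb l(1)] bm] by simp
    qed
    have "subobj C b \<in> Upper (Sub C one) (sub_pullback C p ` {subobj C m, subobj C n})"
      using pull[OF m] pull[OF n] not subobj_closed[OF bm HomD(3)[OF b]] by (auto intro!: Upper_memI)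
    then have "sub_pullback C p (subobj C k) \<sqsubseteq>\<^bsub>Sub C one\<^esub> subobj C b"
      using join_stable[OF p F _ lub] by (intro least_le) auto
    then have "factors_through C (Ident C one) b"
      unfolding pullback_of_large[OF p k pk] using le_Sub[OF Ident_monic[OF one_Obj] bm] by simp
    then show False using Ident_one_factors_iff[OF b] pts_zero by blast
  qed
qed

text \<open>The point set of a subobject. All members of a class have the same trace
  (\<open>pS_subobj\<close>), so the union avoids choosing one.\<close>

definition pS :: "'m set \<Rightarrow> 'm set" where
  "pS S = (\<Union>m\<in>S. ptm m)"

lemma pS_subobj:
  assumes m: "monic C m"
  shows "pS (subobj C m) = ptm m"
proof -
  have "ptm n \<subseteq> ptm m" if "n \<in> subobj C m" for n
  proof -
    have n: "monic C n" "Cod C n = Cod C m" "factors_through C n m" using that by (simp_all add: subobj_def)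
    show ?thesis by (rule ptm_mono[OF n(3) monic_Hom[OF n(1,2)] Arr_Hom[OF monic_Arr[OF m]]])
  qed
  then show ?thesis
    unfolding pS_def using mem_subobj_self[OF m] by blast
qed

lemma point_le_iff:
  assumes p: "p \<in> pts X" and S: "S \<in> carrier (Sub C X)"
  shows "subobj C p \<sqsubseteq>\<^bsub>Sub C X\<^esub> S \<longleftrightarrow> p \<in> pS S"
proof -
  obtain m where m: "monic C m" "Cod C m = X" "S = subobj C m" using Sub_obtain[OF S] .
  show ?thesis
    unfolding m(3) pS_subobj[OF m(1)] le_Sub[OF point_monic[OF p] m(1)] ptm_iff[OF monic_Hom[OF m(1,2)]]
    using p by blast
qed

lemma point_closed: "p \<in> pts X \<Longrightarrow> subobj C p \<in> carrier (Sub C X)"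
  by (rule subobj_closed[OF point_monic HomD(3)])

lemma pS_mono:
  assumes S: "S \<in> carrier (Sub C X)" and T: "T \<in> carrier (Sub C X)" and le: "S \<sqsubseteq>\<^bsub>Sub C X\<^esub> T"
  shows "pS S \<subseteq> pS T"
proof -
  obtain m where m: "monic C m" "Cod C m = X" "S = subobj C m" using Sub_obtain[OF S] .
  obtain n where n: "monic C n" "Cod C n = X" "T = subobj C n" using Sub_obtain[OF T] .
  show ?thesis
    using le ptm_mono[OF _ monic_Hom[OF m(1,2)] monic_Hom[OF n(1,2)]]
    unfolding m(3) n(3) pS_subobj[OF m(1)] pS_subobj[OF n(1)] le_Sub[OF m(1) n(1)] by blast
qed

lemma pS_sub: "S \<in> carrier (Sub C X) \<Longrightarrow> pS S \<subseteq> pts X"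
proof -
  assume S: "S \<in> carrier (Sub C X)"
  obtain m where m: "monic C m" "Cod C m = X" "S = subobj C m" using Sub_obtain[OF S] .
  show ?thesis unfolding m(3) pS_subobj[OF m(1)] using ptm_iff[OF monic_Hom[OF m(1,2)]] by blast
qed

lemma pS_empty_le:
  assumes S: "S \<in> carrier (Sub C X)" and T: "T \<in> carrier (Sub C X)" and "pS S = {}"
  shows "S \<sqsubseteq>\<^bsub>Sub C X\<^esub> T"
proof -
  obtain m where m: "monic C m" "Cod C m = X" "S = subobj C m" using Sub_obtain[OF S] .
  obtain n where n: "monic C n" "Cod C n = X" "T = subobj C n" using Sub_obtain[OF T] .
  note mH = monic_Hom[OF m(1,2)] and nH = monic_Hom[OF n(1,2)]
  have "pts (Dom C m) = {}"
    using assms(3) unfolding m(3) pS_subobj[OF m(1)] ptm_empty_iff[OF mH] .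
  then show ?thesis
    unfolding m(3) n(3) le_Sub[OF m(1) n(1)] by (rule pointless_factors[OF mH _ nH])
qed

lemma empty_sub:
  assumes X: "X \<in> Obj C"
  obtains b where "monic C b" "b \<in> Hom C zero X" "ptm b = {}"
proof -
  obtain b where b: "b \<in> Hom C zero X" using from_zero_ex[OF X] by blast
  then show ?thesis using that from_zero_monic[OF b] ptm_empty_iff[OF b] pts_zero by blast
qed

lemma pS_lub:
  assumes S: "S \<in> carrier (Sub C X)" and T: "T \<in> carrier (Sub C X)"
    and lub: "least (Sub C X) R (Upper (Sub C X) {S, T})"
  shows "pS R = pS S \<union> pS T"
proof -
  obtain m where m: "monic C m" "Cod C m = X" "S = subobj C m" using Sub_obtain[OF S] .
  obtain n where n: "monic C n" "Cod C n = X" "T = subobj C n" using Sub_obtain[OF T] .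
  have "R \<in> carrier (Sub C X)" using lub by (rule least_closed)
  then obtain k where k: "monic C k" "Cod C k = X" "R = subobj C k" by (rule Sub_obtain)
  show ?thesis
    using ptm_join[OF m(1) monic_Hom[OF m(1,2)] n(1) monic_Hom[OF n(1,2)] k(1) monic_Hom[OF k(1,2)]] lub
    unfolding m(3) n(3) k(3) pS_subobj[OF m(1)] pS_subobj[OF n(1)] pS_subobj[OF k(1)] .
qed

end


section \<open>The topology on the points of an object\<close>

context kh_like
begin

section \<open>Subobject lattices of filtral objects\<close>

lemma filtral_distrib: "filtral_obj C X \<Longrightarrow> bounded_distrib_lattice (Sub C X)"
  unfolding filtral_obj_def filtral_lattice_def by blast

lemma filtral_bounded: "filtral_obj C X \<Longrightarrow> bounded_lattice (Sub C X)"
  using filtral_distrib unfolding bounded_distrib_lattice_def by blast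

lemma pS_ops:
  assumes fil: "filtral_obj C X"
  shows pS_join: "S \<in> carrier (Sub C X) \<Longrightarrow> T \<in> carrier (Sub C X) \<Longrightarrow> pS (S \<squnion>\<^bsub>Sub C X\<^esub> T) = pS S \<union> pS T"
    and pS_meet: "S \<in> carrier (Sub C X) \<Longrightarrow> T \<in> carrier (Sub C X) \<Longrightarrow> pS (S \<sqinter>\<^bsub>Sub C X\<^esub> T) = pS S \<inter> pS T"
    and pS_bottom: "pS \<bottom>\<^bsub>Sub C X\<^esub> = {}"
    and pS_top: "pS \<top>\<^bsub>Sub C X\<^esub> = pts X"
proof -
  let ?L = "Sub C X"
  have X: "X \<in> Obj C" using fil unfolding filtral_obj_def by blast
  interpret bounded_lattice ?L by (rule filtral_bounded[OF fil])
  show "pS \<bottom>\<^bsub>?L\<^esub> = {}"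
  proof -
    obtain b where b: "monic C b" "b \<in> Hom C zero X" "ptm b = {}" by (rule empty_sub[OF X])
    note bc = subobj_closed[OF b(1) HomD(3)[OF b(2)]]
    show ?thesis
      using pS_mono[OF bottom_closed bc bottom_lower[OF bc]] pS_subobj[OF b(1)] b(3) by simp
  qed
  show "pS \<top>\<^bsub>?L\<^esub> = pts X"
    using pS_sub[OF top_closed] point_le_iff[OF _ top_closed] top_higher[OF point_closed] by blast
  assume S: "S \<in> carrier ?L" and T: "T \<in> carrier ?L"
  show "pS (S \<squnion>\<^bsub>?L\<^esub> T) = pS S \<union> pS T"
    by (rule joinI[OF _ S T]) (rule pS_lub[OF S T])
  have "p \<in> pS (S \<sqinter>\<^bsub>?L\<^esub> T) \<longleftrightarrow> p \<in> pS S \<and> p \<in> pS T" if p: "p \<in> pts X" for p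
    unfolding point_le_iff[OF p S, symmetric] point_le_iff[OF p T, symmetric]
      point_le_iff[OF p meet_closed[OF S T], symmetric]
    using le_trans[OF _ meet_left[OF S T] point_closed[OF p] meet_closed[OF S T] S]
      le_trans[OF _ meet_right[OF S T] point_closed[OF p] meet_closed[OF S T] T]
      meet_le[OF _ _ S T point_closed[OF p]] by blast
  then show "pS (S \<sqinter>\<^bsub>?L\<^esub> T) = pS S \<inter> pS T"
    using pS_sub[OF S] pS_sub[OF meet_closed[OF S T]] by blast
qed

text \<open>The order-embedding half of filtrality. Filters are ordered by reverse inclusion, so the
  smaller subobject has the larger filter.\<close>

lemma filtral_le_iff:
  assumes fil: "filtral_obj C X" and S: "S \<in> carrier (Sub C X)" and T: "T \<in> carrier (Sub C X)"
  shows "{y \<in> carrier (boolean_center (Sub C X)). T \<sqsubseteq>\<^bsub>Sub C X\<^esub> y} \<subseteq>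
      {y \<in> carrier (boolean_center (Sub C X)). S \<sqsubseteq>\<^bsub>Sub C X\<^esub> y} \<longleftrightarrow> S \<sqsubseteq>\<^bsub>Sub C X\<^esub> T"
  using fil S T unfolding filtral_obj_def filtral_lattice_def poset_iso_def order_emb_def
  by (simp add: filter_poset_def)

text \<open>If \<open>S\<close> and \<open>z\<close> have no common point, then their meet is the bottom; apply this to the
  complements \<open>z\<close> of the complemented \<open>y\<close> above \<open>T\<close>.\<close>

lemma filtral_pS_le:
  assumes fil: "filtral_obj C X" and S: "S \<in> carrier (Sub C X)" and T: "T \<in> carrier (Sub C X)"
    and sub: "pS S \<subseteq> pS T"
  shows "S \<sqsubseteq>\<^bsub>Sub C X\<^esub> T"
proof -
  let ?L = "Sub C X"
  interpret bounded_lattice ?L by (rule filtral_bounded[OF fil])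
  have "S \<sqsubseteq>\<^bsub>?L\<^esub> y" if y: "y \<in> carrier (boolean_center ?L)" and Ty: "T \<sqsubseteq>\<^bsub>?L\<^esub> y" for y
  proof -
    obtain z where yz: "y \<in> carrier ?L" "z \<in> carrier ?L" "y \<sqinter>\<^bsub>?L\<^esub> z = \<bottom>\<^bsub>?L\<^esub>" "y \<squnion>\<^bsub>?L\<^esub> z = \<top>\<^bsub>?L\<^esub>"
      using y unfolding boolean_center_def by auto
    have "pS y \<inter> pS z = {}"
      using pS_meet[OF fil yz(1,2)] pS_bottom[OF fil] yz(3) by simp
    moreover have "pS S \<subseteq> pS y"
      using sub pS_mono[OF T yz(1) Ty] by blast
    ultimately have "pS (S \<sqinter>\<^bsub>?L\<^esub> z) = {}"
      unfolding pS_meet[OF fil S yz(2)] by blast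
    note Sz = pS_empty_le[OF meet_closed[OF S yz(2)] meet_closed[OF S yz(1)] this]
    have "S \<sqsubseteq>\<^bsub>?L\<^esub> S \<sqinter>\<^bsub>?L\<^esub> (y \<squnion>\<^bsub>?L\<^esub> z)"
      unfolding yz(4) by (rule meet_le[OF le_refl[OF S] top_higher[OF S] S top_closed S])
    also have "S \<sqinter>\<^bsub>?L\<^esub> (y \<squnion>\<^bsub>?L\<^esub> z) = (S \<sqinter>\<^bsub>?L\<^esub> y) \<squnion>\<^bsub>?L\<^esub> (S \<sqinter>\<^bsub>?L\<^esub> z)"
      using filtral_distrib[OF fil] S yz(1,2) unfolding bounded_distrib_lattice_def by blast
    also have "\<dots> \<sqsubseteq>\<^bsub>?L\<^esub> S \<sqinter>\<^bsub>?L\<^esub> y"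
      by (rule join_le[OF le_refl Sz]) (simp_all add: S yz)
    also have "S \<sqinter>\<^bsub>?L\<^esub> y \<sqsubseteq>\<^bsub>?L\<^esub> y" by (rule meet_right[OF S yz(1)])
    finally show ?thesis using S yz(1,2) by simp
  qed
  then show ?thesis
    using filtral_le_iff[OF fil S T] by blast
qed

lemma filtral_set_rep:
  assumes fil: "filtral_obj C X"
  shows "set_rep (Sub C X) pS"
proof
  let ?L = "Sub C X"
  interpret bounded_lattice ?L by (rule filtral_bounded[OF fil])
  show "eq ?L = (=)" by (simp add: Sub_def)
  show "S \<sqsubseteq>\<^bsub>?L\<^esub> T \<longleftrightarrow> pS S \<subseteq> pS T" if "S \<in> carrier ?L" "T \<in> carrier ?L" for S T
    using pS_mono[OF that] filtral_pS_le[OF fil that] by blast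
  show "inj_on pS (carrier ?L)"
  proof (rule inj_onI)
    fix S T assume ST: "S \<in> carrier ?L" "T \<in> carrier ?L" "pS S = pS T"
    show "S = T"
      by (rule le_antisym[OF filtral_pS_le[OF fil ST(1,2)] filtral_pS_le[OF fil ST(2,1)] ST(1,2)]) (simp_all add: ST(3))
  qed
qed

text \<open>Intersections and compactness at once: the complemented subobjects containing some finite
  intersection of the family form a filter, and this is the filter of some subobject.\<close>

lemma filtral_Inter:
  assumes fil: "filtral_obj C X" and M: "M \<subseteq> carrier (Sub C X)"
  shows "\<exists>R \<in> carrier (Sub C X). pS R = pts X \<inter> \<Inter>(pS ` M) \<and>
    (pS R = {} \<longrightarrow> (\<exists>F. finite F \<and> F \<subseteq> M \<and> pts X \<inter> \<Inter>(pS ` F) = {}))"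
proof -
  let ?L = "Sub C X"
  let ?B = "boolean_center ?L"
  interpret set_rep ?L pS by (rule filtral_set_rep[OF fil])
  interpret bounded_lattice ?L by (rule filtral_bounded[OF fil])
  have bmeet: "y \<sqinter>\<^bsub>?L\<^esub> z \<in> carrier ?B" "y \<sqinter>\<^bsub>?B\<^esub> z = y \<sqinter>\<^bsub>?L\<^esub> z"
    if "y \<in> carrier ?B" "z \<in> carrier ?B" for y z
  proof -
    note * = boolean_center_meet[OF filtral_set_rep[OF fil] filtral_bounded[OF fil] _ _ that]
    show "y \<sqinter>\<^bsub>?L\<^esub> z \<in> carrier ?B"
      by (rule *(1)) (erule (1) pS_join[OF fil] pS_meet[OF fil])+
    show "y \<sqinter>\<^bsub>?B\<^esub> z = y \<sqinter>\<^bsub>?L\<^esub> z"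
      by (rule *(2)) (erule (1) pS_join[OF fil] pS_meet[OF fil])+
  qed
  have BL: "y \<in> carrier ?L" if "y \<in> carrier ?B" for y using that by (simp add: boolean_center_def)
  have leB: "y \<sqsubseteq>\<^bsub>?B\<^esub> z \<longleftrightarrow> y \<sqsubseteq>\<^bsub>?L\<^esub> z" for y z by (simp add: boolean_center_def)
  have topB: "\<top>\<^bsub>?L\<^esub> \<in> carrier ?B" and botB: "\<bottom>\<^bsub>?L\<^esub> \<in> carrier ?B"
  proof -
    have eqI: "z = w" if "z \<in> carrier ?L" "w \<in> carrier ?L" "pS z = pS w" for z w
      using inj that by (auto simp: inj_on_def)
    have "\<top>\<^bsub>?L\<^esub> \<sqinter>\<^bsub>?L\<^esub> \<bottom>\<^bsub>?L\<^esub> = \<bottom>\<^bsub>?L\<^esub>"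
      by (rule eqI) (simp_all add: pS_meet[OF fil] pS_join[OF fil] pS_bottom[OF fil])
    moreover have "\<top>\<^bsub>?L\<^esub> \<squnion>\<^bsub>?L\<^esub> \<bottom>\<^bsub>?L\<^esub> = \<top>\<^bsub>?L\<^esub>"
      by (rule eqI) (simp_all add: pS_meet[OF fil] pS_join[OF fil] pS_bottom[OF fil])
    moreover have "\<bottom>\<^bsub>?L\<^esub> \<sqinter>\<^bsub>?L\<^esub> \<top>\<^bsub>?L\<^esub> = \<bottom>\<^bsub>?L\<^esub>"
      by (rule eqI) (simp_all add: pS_meet[OF fil] pS_join[OF fil] pS_bottom[OF fil])
    moreover have "\<bottom>\<^bsub>?L\<^esub> \<squnion>\<^bsub>?L\<^esub> \<top>\<^bsub>?L\<^esub> = \<top>\<^bsub>?L\<^esub>"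
      by (rule eqI) (simp_all add: pS_meet[OF fil] pS_join[OF fil] pS_bottom[OF fil])
    ultimately show "\<top>\<^bsub>?L\<^esub> \<in> carrier ?B" "\<bottom>\<^bsub>?L\<^esub> \<in> carrier ?B"
      unfolding boolean_center_def by auto
  qed
  define G where "G = {y \<in> carrier ?B. \<exists>F. finite F \<and> F \<subseteq> M \<and> pts X \<inter> \<Inter>(pS ` F) \<subseteq> pS y}"
  have "lattice_filter ?B G"
    unfolding lattice_filter_def
  proof (intro conjI ballI impI)
    show "G \<subseteq> carrier ?B" unfolding G_def by blast
    have "\<top>\<^bsub>?L\<^esub> \<in> G"
      unfolding G_def using topB pS_top[OF fil] by blast
    then show "G \<noteq> {}" by blast
    fix y z assume y: "y \<in> G" and z: "z \<in> carrier ?B" and yz: "y \<sqsubseteq>\<^bsub>?B\<^esub> z"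
    have "y \<in> carrier ?B" using y unfolding G_def by blast
    then have "pS y \<subseteq> pS z" using pS_mono[OF BL BL[OF z]] yz unfolding leB by blast
    then show "z \<in> G" using y z unfolding G_def by blast
  next
    fix y z assume y: "y \<in> G" and z: "z \<in> G"
    obtain F where F: "finite F" "F \<subseteq> M" "pts X \<inter> \<Inter>(pS ` F) \<subseteq> pS y" and yB: "y \<in> carrier ?B"
      using y unfolding G_def by blast
    obtain F' where F': "finite F'" "F' \<subseteq> M" "pts X \<inter> \<Inter>(pS ` F') \<subseteq> pS z" and zB: "z \<in> carrier ?B"
      using z unfolding G_def by blast
    have "pts X \<inter> \<Inter>(pS ` (F \<union> F')) \<subseteq> pS (y \<sqinter>\<^bsub>?L\<^esub> z)"
      unfolding pS_meet[OF fil BL[OF yB] BL[OF zB]] using F(3) F'(3) by blast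
    moreover have "finite (F \<union> F')" "F \<union> F' \<subseteq> M" using F(1,2) F'(1,2) by auto
    ultimately show "y \<sqinter>\<^bsub>?B\<^esub> z \<in> G"
      unfolding bmeet(2)[OF yB zB] G_def using bmeet(1)[OF yB zB]
      by (intro CollectI conjI exI[of _ "F \<union> F'"])
  qed
  then have "G \<in> carrier (filter_poset ?B)"
    by (simp add: filter_poset_def)
  moreover have "(\<lambda>x. {y \<in> carrier ?B. x \<sqsubseteq>\<^bsub>?L\<^esub> y}) ` carrier ?L = carrier (filter_poset ?B)"
    using fil unfolding filtral_obj_def filtral_lattice_def poset_iso_def bij_betw_def by blast
  ultimately obtain R where R: "R \<in> carrier ?L" "{y \<in> carrier ?B. R \<sqsubseteq>\<^bsub>?L\<^esub> y} = G"
    by (metis (no_types, lifting) imageE)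
  have "pS R = pts X \<inter> \<Inter>(pS ` M)"
  proof (intro subset_antisym subsetI)
    fix p assume p: "p \<in> pS R"
    have "p \<in> pS S" if S: "S \<in> M" for S
    proof -
      have SL: "S \<in> carrier ?L" using M S by blast
      have "{y \<in> carrier ?B. S \<sqsubseteq>\<^bsub>?L\<^esub> y} \<subseteq> G"
      proof
        fix y assume y: "y \<in> {y \<in> carrier ?B. S \<sqsubseteq>\<^bsub>?L\<^esub> y}"
        then have "pS S \<subseteq> pS y" using pS_mono[OF SL BL] by blast
        then have "pts X \<inter> \<Inter>(pS ` {S}) \<subseteq> pS y" by auto
        moreover have "finite {S}" "{S} \<subseteq> M" using S by auto
        ultimately show "y \<in> G" unfolding G_def using y by blast
      qed
      then have "R \<sqsubseteq>\<^bsub>?L\<^esub> S" using filtral_le_iff[OF fil R(1) SL] R(2) by simp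
      then show ?thesis using pS_mono[OF R(1) SL] p by blast
    qed
    then show "p \<in> pts X \<inter> \<Inter>(pS ` M)" using pS_sub[OF R(1)] p by blast
  next
    fix p assume p: "p \<in> pts X \<inter> \<Inter>(pS ` M)"
    then have pX: "p \<in> pts X" by blast
    \<comment> \<open>A point common to the family lies in every complemented subobject containing a
      finite intersection of it. So its filter contains \<open>G\<close>, the filter of
      \<open>R\<close>, and the point lies below \<open>R\<close>.\<close>
    have "G \<subseteq> {y \<in> carrier ?B. subobj C p \<sqsubseteq>\<^bsub>?L\<^esub> y}"
    proof
      fix y assume "y \<in> G"
      then obtain F where F: "F \<subseteq> M" "pts X \<inter> \<Inter>(pS ` F) \<subseteq> pS y" and yB: "y \<in> carrier ?B"
        unfolding G_def by blast
      have "p \<in> pS y" using F p by blast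
      then show "y \<in> {y \<in> carrier ?B. subobj C p \<sqsubseteq>\<^bsub>?L\<^esub> y}"
        using point_le_iff[OF pX BL[OF yB]] yB by blast
    qed
    then have "subobj C p \<sqsubseteq>\<^bsub>?L\<^esub> R"
      using filtral_le_iff[OF fil point_closed[OF pX] R(1)] R(2) by simp
    then show "p \<in> pS R" using point_le_iff[OF pX R(1)] by blast
  qed
  \<comment> \<open>If \<open>R\<close> has no points it lies below the bottom, so the bottom
    belongs to its filter \<open>G\<close>; the finite family witnessing that membership has empty
    intersection.\<close>
  moreover have "\<exists>F. finite F \<and> F \<subseteq> M \<and> pts X \<inter> \<Inter>(pS ` F) = {}" if "pS R = {}"
  proof -
    have "R \<sqsubseteq>\<^bsub>?L\<^esub> \<bottom>\<^bsub>?L\<^esub>" using pS_empty_le[OF R(1) bottom_closed that] .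
    then have "\<bottom>\<^bsub>?L\<^esub> \<in> G" using R(2) botB by blast
    then show ?thesis unfolding G_def pS_bottom[OF fil] subset_empty mem_Collect_eq by (elim conjE)
  qed
  ultimately show ?thesis
    by (intro bexI[OF _ R(1)] conjI impI)
qed

text \<open>As subobjects, distinct points are incomparable, so some complemented subobject contains
  \<open>p\<close> but not \<open>q\<close>. Its complement contains \<open>q\<close>, and the two
  sets will be the disjoint open neighbourhoods.\<close>

lemma filtral_separated:
  assumes fil: "filtral_obj C X" and p: "p \<in> pts X" and q: "q \<in> pts X" and neq: "p \<noteq> q"
  shows "\<exists>S \<in> carrier (Sub C X). \<exists>T \<in> carrier (Sub C X). pS S \<inter> pS T = {} \<and> pS S \<union> pS T = pts X \<and> p \<in> pS S \<and> q \<in> pS T"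
proof -
  let ?L = "Sub C X"
  let ?B = "boolean_center ?L"
  have "\<not> subobj C q \<sqsubseteq>\<^bsub>?L\<^esub> subobj C p"
    unfolding point_le_iff[OF q point_closed[OF p]] pS_subobj[OF point_monic[OF p]] ptm_point[OF p] using neq by simp
  then have "\<not> {y \<in> carrier ?B. subobj C p \<sqsubseteq>\<^bsub>?L\<^esub> y} \<subseteq> {y \<in> carrier ?B. subobj C q \<sqsubseteq>\<^bsub>?L\<^esub> y}"
    unfolding filtral_le_iff[OF fil point_closed[OF q] point_closed[OF p]] .
  then obtain y where y: "y \<in> carrier ?B" "subobj C p \<sqsubseteq>\<^bsub>?L\<^esub> y" "\<not> subobj C q \<sqsubseteq>\<^bsub>?L\<^esub> y"
    by blast
  obtain z where yz: "y \<in> carrier ?L" "z \<in> carrier ?L" "y \<sqinter>\<^bsub>?L\<^esub> z = \<bottom>\<^bsub>?L\<^esub>" "y \<squnion>\<^bsub>?L\<^esub> z = \<top>\<^bsub>?L\<^esub>"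
    using y(1) unfolding boolean_center_def by auto
  have "pS y \<inter> pS z = {}" "pS y \<union> pS z = pts X"
    using pS_meet[OF fil yz(1,2)] pS_join[OF fil yz(1,2)] pS_bottom[OF fil] pS_top[OF fil] yz(3,4) by simp_all
  moreover have "p \<in> pS y" "q \<notin> pS y"
    using y(2,3) point_le_iff[OF p yz(1)] point_le_iff[OF q yz(1)] by simp_all
  ultimately show ?thesis using yz(1,2) q by blast
qed

section \<open>Descent along filtral covers\<close>

lemma filtral_cover:
  assumes "Y \<in> Obj C"
  obtains X f where "f \<in> Hom C X Y" "regular_epi C f" "filtral_obj C X"
  using KH_like assms unfolding KH_like_def filtral_category_def by blast

lemma pS_pullback:
  assumes f: "f \<in> Hom C X Y" and S: "S \<in> carrier (Sub C Y)"
  shows "sub_pullback C f S \<in> carrier (Sub C X)" and "pS (sub_pullback C f S) = {p \<in> pts X. f \<cdot> p \<in> pS S}"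
proof -
  obtain n where n: "monic C n" "Cod C n = Y" "S = subobj C n" using Sub_obtain[OF S] .
  obtain m q where pb: "is_pullback C f n m q" using pullback_exists[OF f monic_Hom[OF n(1,2)]] by blast
  note mm = pullback_monic[OF pb n(1)] and D = is_pullbackD(1)[OF pb]
  show "sub_pullback C f S \<in> carrier (Sub C X)"
    unfolding n(3) sub_pullback_subobj[OF pb n(1)]
    by (rule subobj_closed[OF mm]) (use HomD(3)[OF D] HomD(2)[OF f] in simp)
  show "pS (sub_pullback C f S) = {p \<in> pts X. f \<cdot> p \<in> pS S}"
    unfolding n(3) sub_pullback_subobj[OF pb n(1)] pS_subobj[OF mm] pS_subobj[OF n(1)]
    using ptm_pullback[OF pb] HomD(2)[OF f] by simp
qed

lemma pS_image:
  assumes f: "f \<in> Hom C X Y" and S: "S \<in> carrier (Sub C X)"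
  shows "\<exists>R \<in> carrier (Sub C Y). pS R = (\<cdot>) f ` pS S"
proof -
  obtain n where n: "monic C n" "Cod C n = X" "S = subobj C n" using Sub_obtain[OF S] .
  note nH = monic_Hom[OF n(1,2)] and fn = Comp_in_Hom[OF monic_Hom[OF n(1,2)] f]
  obtain k where k: "monic C k" "k \<in> Hom C (Dom C k) Y" "is_image C (f \<cdot> n) (subobj C k)"
    by (rule image_exists[OF fn])
  have "ptm k = (\<lambda>p. (f \<cdot> n) \<cdot> p) ` pts (Dom C n)"
    by (rule image_ptm[OF fn k])
  also have "\<dots> = (\<lambda>p. f \<cdot> (n \<cdot> p)) ` pts (Dom C n)"
    using Comp_assoc[OF _ nH f] by (intro image_cong) auto
  also have "\<dots> = (\<cdot>) f ` ptm n"
    unfolding ptm_eq_image[OF nH] image_image ..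
  finally show ?thesis
    unfolding n(3) pS_subobj[OF n(1)] using pS_subobj[OF k(1)] subobj_closed[OF k(1) HomD(3)[OF k(2)]] by blast
qed

text \<open>Over a filtral cover \<open>f\<close> the claim holds for the pulled back monos
  \<open>m'\<close> and \<open>n'\<close>. To descend, note that the leg \<open>q\<close> from
  \<open>m'\<close> to \<open>m\<close> is a pullback of \<open>f\<close>, so its image is all of
  \<open>M\<close> by stability. Since \<open>q\<close> factors through \<open>t\<close>, the
  intersection of \<open>m\<close> and \<open>n\<close> seen inside \<open>M\<close>, this
  \<open>t\<close> is everything, that is, \<open>m\<close> factors through
  \<open>n\<close>.\<close>

lemma ptm_subset_factors:
  assumes m: "monic C m" "m \<in> Hom C M Y" and n: "monic C n" "n \<in> Hom C N Y" and sub: "ptm m \<subseteq> ptm n"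
  shows "factors_through C m n"
proof -
  note MO = Hom_Obj(1)[OF m(2)]
  obtain X f where f: "f \<in> Hom C X Y" "regular_epi C f" "filtral_obj C X"
    by (rule filtral_cover[OF Hom_Obj(2)[OF m(2)]])
  have Df: "Dom C f = X" by (rule HomD(2)[OF f(1)])
  obtain m' q where pm: "is_pullback C f m m' q" using pullback_exists[OF f(1) m(2)] by blast
  obtain n' r where pn: "is_pullback C f n n' r" using pullback_exists[OF f(1) n(2)] by blast
  note Dm = is_pullbackD(1,2,5)[OF pm, unfolded Df HomD(2)[OF m(2)]]
  note Dn = is_pullbackD(1,2,5)[OF pn, unfolded Df HomD(2)[OF n(2)]]
  note mm = pullback_monic[OF pm m(1)] and mn = pullback_monic[OF pn n(1)]
  have "ptm m' \<subseteq> ptm n'"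
    unfolding ptm_pullback[OF pm] ptm_pullback[OF pn] using sub by blast
  then have "factors_through C m' n'"
    using filtral_pS_le[OF f(3) subobj_closed[OF mm HomD(3)[OF Dm(1)]] subobj_closed[OF mn HomD(3)[OF Dn(1)]]]
    unfolding pS_subobj[OF mm] pS_subobj[OF mn] le_Sub[OF mm mn] by blast
  then obtain l where l: "l \<in> Hom C (Dom C m') (Dom C n')" "m' = n' \<cdot> l"
    unfolding factors_through_def by blast
  obtain t s where pt: "is_pullback C m n t s" using pullback_exists[OF m(2) n(2)] by blast
  note Dt = is_pullbackD(1)[OF pt, unfolded HomD(2)[OF m(2)]] and mt = pullback_monic[OF pt n(1)]
  have "m \<cdot> q = n \<cdot> (r \<cdot> l)"
    using Dm(3) l(2) Comp_assoc[OF l(1) Dn(1) f(1)] Comp_assoc[OF l(1) Dn(2) n(2)] Dn(3) by simp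
  then have "factors_through C (m \<cdot> q) n"
    using factors_Comp[OF Comp_in_Hom[OF l(1) Dn(2)] n(2)] by simp
  then have qt: "factors_through C q t"
    using factors_pullback[OF pt, of q "Dom C m'"] Dm(2) HomD(2)[OF m(2)] by simp
  have Y: "Y \<in> Obj C" by (rule Hom_Obj(2)[OF m(2)])
  have "is_image C q (subobj C (Ident C M))"
    using image_stable[OF pm regular_epi_image[OF f(1,2)]]
      pullback_of_large[OF m(2) Ident_monic[OF Y] Ident_in_Hom[OF Y] factors_Ident[OF m(2)]] by simp
  then have "factors_through C (Ident C M) t"
    using is_image_subobj_iff[OF HomD(1)[OF Dm(2)] Ident_monic[OF MO]] HomD(3)[OF Dm(2)]
      HomD(3)[OF Ident_in_Hom[OF MO]] mt HomD(3)[OF Dt] qt by simp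
  then show ?thesis
    using factors_pullback[OF pt, of "Ident C M" M] Ident_in_Hom[OF MO] HomD(2)[OF m(2)] Comp_Ident[OF m(2)] by simp
qed

lemma factors_on_points:
  assumes f: "f \<in> Hom C X Y" and n: "monic C n" "n \<in> Hom C N Y"
    and pts: "\<And>p. p \<in> pts X \<Longrightarrow> f \<cdot> p \<in> ptm n"
  shows "factors_through C f n"
proof -
  have X: "X \<in> Obj C" by (rule Hom_Obj(1)[OF f])
  have Df: "Dom C f = X" by (rule HomD(2)[OF f])
  obtain m q where pb: "is_pullback C f n m q" using pullback_exists[OF f n(2)] by blast
  note D = is_pullbackD(1)[OF pb, unfolded Df]
  have "ptm (Ident C X) \<subseteq> ptm m"
    unfolding ptm_Ident[OF X] ptm_pullback[OF pb] Df using pts by blast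
  then have "factors_through C (Ident C X) m"
    by (rule ptm_subset_factors[OF Ident_monic[OF X] Ident_in_Hom[OF X] pullback_monic[OF pb n(1)] D])
  then show ?thesis
    using factors_pullback[OF pb, of "Ident C X" X] Ident_in_Hom[OF X] Df Comp_Ident[OF f] by simp
qed

text \<open>Injectivity on points gives a mono by well-pointedness. Surjectivity then makes the
  identity of \<open>Y\<close> factor through it, as factorisation through a mono is decided on
  points; a split mono of this kind is invertible.\<close>

lemma bijective_on_points_iso:
  assumes f: "f \<in> Hom C X Y" and inj: "inj_on ((\<cdot>) f) (pts X)" and surj: "pts Y \<subseteq> (\<cdot>) f ` pts X"
  shows "is_iso C f"
proof -
  have Y: "Y \<in> Obj C" by (rule Hom_Obj(2)[OF f])
  have mf: "monic C f"
    unfolding monic_def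
  proof (intro conjI allI ballI impI)
    show "f \<in> Arr C" by (rule HomD(1)[OF f])
    fix W a b assume "a \<in> Hom C W (Dom C f)" "b \<in> Hom C W (Dom C f)" and eq: "f \<cdot> a = f \<cdot> b"
    then have a: "a \<in> Hom C W X" and b: "b \<in> Hom C W X" by (simp_all add: HomD(2)[OF f])
    show "a = b"
    proof (rule pts_ext[OF a b])
      fix w assume w: "w \<in> pts W"
      have "f \<cdot> (a \<cdot> w) = f \<cdot> (b \<cdot> w)"
        using Comp_assoc[OF w a f] Comp_assoc[OF w b f] eq by simp
      then show "a \<cdot> w = b \<cdot> w"
        by (rule inj_onD[OF inj _ Comp_in_Hom[OF w a] Comp_in_Hom[OF w b]])
    qed
  qed
  have "factors_through C (Ident C Y) f"
  proof (rule factors_on_points[OF Ident_in_Hom[OF Y] mf f])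
    fix p assume "p \<in> pts Y"
    then show "Ident C Y \<cdot> p \<in> ptm f"
      using surj ptm_eq_image[OF f] Ident_Comp[of p one Y] by auto
  qed
  then obtain g where g: "g \<in> Hom C Y X" "f \<cdot> g = Ident C Y"
    unfolding factors_through_def using HomD(2)[OF f] HomD(2)[OF Ident_in_Hom[OF Y]] by auto
  show ?thesis
    unfolding is_iso_iff[OF f] using g split_monic_iso[OF mf f g] by blast
qed

text \<open>The intersection is formed upstairs, where the object is filtral, from the inverse
  images. Taking the image along the cover, which is surjective on points, returns exactly the
  intersection downstairs.\<close>

lemma pS_Inter:
  assumes Y: "Y \<in> Obj C" and M: "M \<subseteq> carrier (Sub C Y)"
  shows "\<exists>R \<in> carrier (Sub C Y). pS R = pts Y \<inter> \<Inter>(pS ` M)"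
proof -
  obtain X f where f: "f \<in> Hom C X Y" "regular_epi C f" "filtral_obj C X" by (rule filtral_cover[OF Y])
  have M': "sub_pullback C f ` M \<subseteq> carrier (Sub C X)"
    using pS_pullback(1)[OF f(1)] M by blast
  obtain R' where R': "R' \<in> carrier (Sub C X)" "pS R' = pts X \<inter> \<Inter>(pS ` sub_pullback C f ` M)"
    using filtral_Inter[OF f(3) M'] by blast
  obtain R where R: "R \<in> carrier (Sub C Y)" "pS R = (\<cdot>) f ` pS R'"
    using pS_image[OF f(1) R'(1)] by blast
  have "pS (sub_pullback C f S) = {p \<in> pts X. f \<cdot> p \<in> pS S}" if "S \<in> M" for S
    using pS_pullback(2)[OF f(1)] M that by blast
  then have R'': "pS R' = {p \<in> pts X. f \<cdot> p \<in> pts Y \<inter> \<Inter>(pS ` M)}"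
    unfolding R'(2) using Comp_in_Hom[OF _ f(1)] by auto
  have "pS R = pts Y \<inter> \<Inter>(pS ` M)"
    unfolding R(2) R''
  proof (intro subset_antisym subsetI)
    fix y assume y: "y \<in> pts Y \<inter> \<Inter>(pS ` M)"
    then obtain x where "x \<in> pts X" "y = f \<cdot> x" using regular_epi_surj[OF f(1,2)] by blast
    then show "y \<in> (\<cdot>) f ` {p \<in> pts X. f \<cdot> p \<in> pts Y \<inter> \<Inter>(pS ` M)}" using y by blast
  qed blast
  then show ?thesis using R(1) by blast
qed

definition pt_top :: "'o \<Rightarrow> 'm topology" where
  "pt_top X = closed_sets_topology (pts X) (pS ` carrier (Sub C X))"

section \<open>The compact Hausdorff topology on points\<close>

lemma pt_top:
  assumes X: "X \<in> Obj C"
  shows topspace_pt_top: "topspace (pt_top X) = pts X"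
    and closedin_pt_top: "closedin (pt_top X) A \<longleftrightarrow> A \<in> pS ` carrier (Sub C X)"
proof -
  have 1: "A \<subseteq> pts X" if "A \<in> pS ` carrier (Sub C X)" for A
    using that pS_sub by blast
  have 2: "{} \<in> pS ` carrier (Sub C X)"
  proof -
    obtain b where b: "monic C b" "b \<in> Hom C zero X" "ptm b = {}" by (rule empty_sub[OF X])
    then show ?thesis using pS_subobj[OF b(1)] subobj_closed[OF b(1) HomD(3)[OF b(2)]] by (metis imageI)
  qed
  have 3: "A \<union> B \<in> pS ` carrier (Sub C X)" if AB: "A \<in> pS ` carrier (Sub C X)" "B \<in> pS ` carrier (Sub C X)" for A B
  proof -
    obtain S T where ST: "S \<in> carrier (Sub C X)" "T \<in> carrier (Sub C X)" "A = pS S" "B = pS T" using AB by blast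
    obtain R where R: "least (Sub C X) R (Upper (Sub C X) {S, T})"
      using join_exists[OF X, of "{S, T}"] ST by auto
    show ?thesis
      using pS_lub[OF ST(1,2) R] least_closed[OF R] ST(3,4) by (metis imageI)
  qed
  have 4: "pts X \<inter> \<Inter>F \<in> pS ` carrier (Sub C X)" if F: "F \<subseteq> pS ` carrier (Sub C X)" for F
  proof -
    obtain M where M: "M \<subseteq> carrier (Sub C X)" "F = pS ` M" using F by (meson subset_imageE)
    then show ?thesis using pS_Inter[OF X M(1)] by (metis imageI)
  qed
  show "topspace (pt_top X) = pts X" "closedin (pt_top X) A \<longleftrightarrow> A \<in> pS ` carrier (Sub C X)"
    unfolding pt_top_def
    by (rule topspace_closed_sets_topology closedin_closed_sets_topology;
        (assumption | rule 1 | rule 2 | rule 3 | rule 4)+)+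
qed

lemma closedin_ptm:
  assumes m: "monic C m" "m \<in> Hom C M X"
  shows "closedin (pt_top X) (ptm m)"
  unfolding closedin_pt_top[OF Hom_Obj(2)[OF m(2)]]
  using pS_subobj[OF m(1)] subobj_closed[OF m(1) HomD(3)[OF m(2)]] by (metis imageI)

lemma closedin_pt_top_obtain:
  assumes X: "X \<in> Obj C" and A: "closedin (pt_top X) A"
  obtains m where "monic C m" "m \<in> Hom C (Dom C m) X" "A = ptm m"
proof -
  obtain S where S: "S \<in> carrier (Sub C X)" "A = pS S" using A unfolding closedin_pt_top[OF X] by blast
  obtain m where m: "monic C m" "Cod C m = X" "S = subobj C m" using Sub_obtain[OF S(1)] .
  show ?thesis using that[OF m(1) monic_Hom[OF m(1,2)]] S(2) pS_subobj[OF m(1)] m(3) by simp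
qed

lemma pt_continuous:
  assumes f: "f \<in> Hom C X Y"
  shows "continuous_map (pt_top X) (pt_top Y) ((\<cdot>) f)"
  unfolding continuous_map_closedin topspace_pt_top[OF Hom_Obj(1)[OF f]] topspace_pt_top[OF Hom_Obj(2)[OF f]]
proof (intro conjI allI impI)
  show "(\<cdot>) f \<in> pts X \<rightarrow> pts Y" using Comp_in_Hom[OF _ f] by blast
  fix A assume "closedin (pt_top Y) A"
  then obtain S where S: "S \<in> carrier (Sub C Y)" "A = pS S"
    unfolding closedin_pt_top[OF Hom_Obj(2)[OF f]] by blast
  show "closedin (pt_top X) {p \<in> pts X. f \<cdot> p \<in> A}"
    unfolding closedin_pt_top[OF Hom_Obj(1)[OF f]] S(2) pS_pullback(2)[OF f S(1), symmetric]
    using pS_pullback(1)[OF f S(1)] by blast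
qed

lemma pt_closed_map:
  assumes f: "f \<in> Hom C X Y"
  shows "closed_map (pt_top X) (pt_top Y) ((\<cdot>) f)"
  unfolding closed_map_def closedin_pt_top[OF Hom_Obj(1)[OF f]] closedin_pt_top[OF Hom_Obj(2)[OF f]]
proof (intro allI impI)
  fix A assume "A \<in> pS ` carrier (Sub C X)"
  then obtain S where "S \<in> carrier (Sub C X)" "A = pS S" by blast
  then show "(\<cdot>) f ` A \<in> pS ` carrier (Sub C Y)"
    using pS_image[OF f] by (metis imageI)
qed

lemma filtral_compact_Hausdorff:
  assumes fil: "filtral_obj C X"
  shows "compact_space (pt_top X)" "Hausdorff_space (pt_top X)"
proof -
  have X: "X \<in> Obj C" using fil unfolding filtral_obj_def by blast
  note ts = topspace_pt_top[OF X] and cl = closedin_pt_top[OF X]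
  show "compact_space (pt_top X)"
    unfolding compact_space_fip
  proof (intro allI impI, elim conjE)
    fix K assume K: "\<forall>A\<in>K. closedin (pt_top X) A" and fip: "\<forall>F. finite F \<and> F \<subseteq> K \<longrightarrow> \<Inter>F \<noteq> {}"
    have "K \<subseteq> pS ` carrier (Sub C X)" using K unfolding cl by blast
    then obtain M where M: "M \<subseteq> carrier (Sub C X)" "K = pS ` M" by (meson subset_imageE)
    show "\<Inter>K \<noteq> {}"
    proof
      assume "\<Inter>K = {}"
      then have "pts X \<inter> \<Inter>(pS ` M) = {}" unfolding M(2) by blast
      then obtain F where F: "finite F" "F \<subseteq> M" "pts X \<inter> \<Inter>(pS ` F) = {}"
        using filtral_Inter[OF fil M(1)] by auto
      \<comment> \<open>A member \<open>S\<close> of the family is added to \<open>F\<close> because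
        the intersection of an empty \<open>F\<close> is the whole type, while the bound from
        \<open>filtral_Inter\<close> is relative to \<open>pts X\<close>.\<close>
      have ne: "M \<noteq> {}" using \<open>\<Inter>K = {}\<close> M(2) by auto
      then obtain S where S: "S \<in> M" by blast
      have "\<Inter>(pS ` (insert S F)) = {}"
        using F(3) pS_sub[of S X] S M(1) by auto
      moreover have "finite (pS ` insert S F)" "pS ` insert S F \<subseteq> K" using F(1,2) S M(2) by auto
      ultimately show False using fip by blast
    qed
  qed
  show "Hausdorff_space (pt_top X)"
    unfolding Hausdorff_space_def ts
  proof (intro allI impI, elim conjE)
    fix p q assume pq: "p \<in> pts X" "q \<in> pts X" "p \<noteq> q"
    obtain S T where ST: "S \<in> carrier (Sub C X)" "T \<in> carrier (Sub C X)" "pS S \<inter> pS T = {}"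
      "pS S \<union> pS T = pts X" "p \<in> pS S" "q \<in> pS T"
      using filtral_separated[OF fil pq] by blast
    have "pS S = topspace (pt_top X) - pS T" "pS T = topspace (pt_top X) - pS S"
      unfolding ts using ST(3,4) by blast+
    moreover have "closedin (pt_top X) (pS S)" "closedin (pt_top X) (pS T)"
      unfolding cl using ST(1,2) by blast+
    ultimately have "openin (pt_top X) (pS S)" "openin (pt_top X) (pS T)"
      using openin_diff[OF openin_topspace] by metis+
    then show "\<exists>U V. openin (pt_top X) U \<and> openin (pt_top X) V \<and> p \<in> U \<and> q \<in> V \<and> disjnt U V"
      using ST(3,5,6) unfolding disjnt_def by blast
  qed
qed

lemma pt_top_compact_Hausdorff:
  assumes Y: "Y \<in> Obj C"
  shows compact_pt_top: "compact_space (pt_top Y)" and Hausdorff_pt_top: "Hausdorff_space (pt_top Y)"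
proof -
  obtain X f where f: "f \<in> Hom C X Y" "regular_epi C f" "filtral_obj C X" by (rule filtral_cover[OF Y])
  note X = Hom_Obj(1)[OF f(1)] and cH = filtral_compact_Hausdorff[OF f(3)]
  have surj: "(\<cdot>) f ` topspace (pt_top X) = topspace (pt_top Y)"
    unfolding topspace_pt_top[OF X] topspace_pt_top[OF Y] by (rule regular_epi_surj[OF f(1,2)])
  show "compact_space (pt_top Y)"
    using image_compactin[OF cH(1)[unfolded compact_space_def] pt_continuous[OF f(1)]]
    unfolding surj compact_space_def .
  show "Hausdorff_space (pt_top Y)"
    using normal_Hausdorff_space_closed_continuous_map_image[OF
        compact_Hausdorff_or_regular_imp_normal_space[OF cH(1)] cH(2) pt_closed_map[OF f(1)] pt_continuous[OF f(1)] surj]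
      cH(2) by blast
qed

end


section \<open>The equivalence with \<open>KH\<close>\<close>

lemma iso_KH:
  assumes inacc: "inaccessible TYPE('u)" and u: "u \<in> Hom KH X (Y :: 'u topology)"
    and inj: "inj_on (ap u) (topspace X)" and surj: "topspace Y \<subseteq> img u"
  shows "is_iso KH u"
proof -
  note Y = KH.Hom_Obj(2)[OF u]
  note id = KH.Ident_in_Hom[OF Y]
  have "img (Ident KH Y) \<subseteq> img u"
    unfolding img_eq[OF id] using surj by (auto simp: ap_Ident)
  then obtain v where v: "v \<in> Hom KH Y X" "u \<cdot>\<^bsub>KH\<^esub> v = Ident KH Y"
    using KH_factor[OF id u inj] by blast
  show ?thesis
    unfolding KH.is_iso_iff[OF u]
    using v KH.split_monic_iso[OF monic_KH[OF inacc u, THEN iffD2, OF inj] u v] by blast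
qed

context kh_like
begin

section \<open>Fullness by closed graphs\<close>

lemma product_exists:
  assumes X: "X \<in> Obj C" and Y: "Y \<in> Obj C"
  shows "\<exists>P a b. a \<in> Hom C P X \<and> b \<in> Hom C P Y \<and>
    (\<forall>W. \<forall>u \<in> Hom C W X. \<forall>v \<in> Hom C W Y. \<exists>h \<in> Hom C W P. a \<cdot> h = u \<and> b \<cdot> h = v) \<and>
    (\<forall>W. \<forall>h \<in> Hom C W P. \<forall>k \<in> Hom C W P. a \<cdot> h = a \<cdot> k \<longrightarrow> b \<cdot> h = b \<cdot> k \<longrightarrow> h = k)"
proof -
  obtain f where f: "f \<in> Hom C X one" using to_one_ex[OF X] by blast
  obtain g where g: "g \<in> Hom C Y one" using to_one_ex[OF Y] by blast
  obtain a b where pb: "is_pullback C f g a b" using pullback_exists[OF f g] by blast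
  note D = is_pullbackD(1,2)[OF pb, unfolded HomD(2)[OF f] HomD(2)[OF g]]
  have "\<exists>h \<in> Hom C W (Dom C a). a \<cdot> h = u \<and> b \<cdot> h = v" if uv: "u \<in> Hom C W X" "v \<in> Hom C W Y" for W u v
    using is_pullbackD(6)[OF pb, unfolded HomD(2)[OF f] HomD(2)[OF g], OF uv
        to_one_unique[OF Comp_in_Hom[OF uv(1) f] Comp_in_Hom[OF uv(2) g]]] by blast
  moreover have "h = k" if "h \<in> Hom C W (Dom C a)" "k \<in> Hom C W (Dom C a)" "a \<cdot> h = a \<cdot> k" "b \<cdot> h = b \<cdot> k" for W h k
    by (rule is_pullback_unique[OF pb that])
  ultimately show ?thesis
    using D by (intro exI[of _ "Dom C a"] exI[of _ a] exI[of _ b]) simp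
qed

lemma pt_full:
  assumes X: "X \<in> Obj C" and Y: "Y \<in> Obj C" and \<gamma>: "continuous_map (pt_top X) (pt_top Y) \<gamma>"
  shows "\<exists>f \<in> Hom C X Y. \<forall>p \<in> pts X. f \<cdot> p = \<gamma> p"
proof -
  obtain P a b where a: "a \<in> Hom C P X" and b: "b \<in> Hom C P Y"
    and pair: "\<And>W u v. u \<in> Hom C W X \<Longrightarrow> v \<in> Hom C W Y \<Longrightarrow> \<exists>h \<in> Hom C W P. a \<cdot> h = u \<and> b \<cdot> h = v"
    and jm: "\<And>W h k. h \<in> Hom C W P \<Longrightarrow> k \<in> Hom C W P \<Longrightarrow> a \<cdot> h = a \<cdot> k \<Longrightarrow> b \<cdot> h = b \<cdot> k \<Longrightarrow> h = k"
    using product_exists[OF X Y] by metis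
  have PO: "P \<in> Obj C" by (rule Hom_Obj(1)[OF a])
  have \<gamma>Y: "\<gamma> p \<in> pts Y" if "p \<in> pts X" for p
    using continuous_map_image_subset_topspace[OF \<gamma>] that topspace_pt_top[OF X] topspace_pt_top[OF Y] by blast
  \<comment> \<open>The points of \<open>P\<close> carry the topology given by subobjects of
    \<open>P\<close>. Both projections are continuous for it and the points of \<open>Y\<close> are
    Hausdorff, so the graph is closed and comes from a subobject.\<close>
  define G where "G = {r \<in> topspace (pt_top P). \<gamma> (a \<cdot> r) = b \<cdot> r}"
  have "closedin (pt_top P) G"
    unfolding G_def
    using continuous_map_compose[OF pt_continuous[OF a] \<gamma>] pt_continuous[OF b]
    by (intro closedin_continuous_maps_eq[OF Hausdorff_pt_top[OF Y]]) (simp_all add: o_def)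
  then obtain m where m: "monic C m" "m \<in> Hom C (Dom C m) P" "G = ptm m"
    using closedin_pt_top_obtain[OF PO] by blast
  define R where "R = Dom C m"
  have mR: "m \<in> Hom C R P" using m(2) unfolding R_def .
  note am = Comp_in_Hom[OF mR a] and bm = Comp_in_Hom[OF mR b]
  have memG: "r \<in> G \<longleftrightarrow> r \<in> pts P \<and> \<gamma> (a \<cdot> r) = b \<cdot> r" for r
    unfolding G_def topspace_pt_top[OF PO] by blast
  have mG: "m \<cdot> x \<in> G" if "x \<in> pts R" for x
    unfolding m(3) ptm_eq_image[OF mR] using that by blast
  have graph: "(b \<cdot> m) \<cdot> x = \<gamma> ((a \<cdot> m) \<cdot> x)" if "x \<in> pts R" for x
    using mG[OF that] Comp_assoc[OF that mR a] Comp_assoc[OF that mR b] unfolding memG by simp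
  have "is_iso C (a \<cdot> m)"
  proof (rule bijective_on_points_iso[OF am])
    show "inj_on ((\<cdot>) (a \<cdot> m)) (pts R)"
    proof (rule inj_onI)
      fix x y assume xy: "x \<in> pts R" "y \<in> pts R" "(a \<cdot> m) \<cdot> x = (a \<cdot> m) \<cdot> y"
      have "m \<cdot> x = m \<cdot> y"
      proof (rule jm[OF Comp_in_Hom[OF xy(1) mR] Comp_in_Hom[OF xy(2) mR]])
        show "a \<cdot> (m \<cdot> x) = a \<cdot> (m \<cdot> y)"
          using xy(3) Comp_assoc[OF xy(1) mR a] Comp_assoc[OF xy(2) mR a] by simp
        show "b \<cdot> (m \<cdot> x) = b \<cdot> (m \<cdot> y)"
          using graph[OF xy(1)] graph[OF xy(2)] xy(3) Comp_assoc[OF xy(1) mR b] Comp_assoc[OF xy(2) mR b] by simp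
      qed
      then show "x = y"
        using monicD[OF m(1)] xy(1,2) unfolding R_def by blast
    qed
    show "pts X \<subseteq> (\<cdot>) (a \<cdot> m) ` pts R"
    proof
      fix p assume p: "p \<in> pts X"
      obtain r where r: "r \<in> pts P" "a \<cdot> r = p" "b \<cdot> r = \<gamma> p" using pair[OF p \<gamma>Y[OF p]] by blast
      then have "r \<in> G" unfolding memG by simp
      then obtain x where x: "x \<in> pts R" "r = m \<cdot> x" unfolding m(3) ptm_eq_image[OF mR] by blast
      then have "(a \<cdot> m) \<cdot> x = p" using r(2) Comp_assoc[OF x(1) mR a] by simp
      then show "p \<in> (\<cdot>) (a \<cdot> m) ` pts R" using x(1) by blast
    qed
  qed
  then obtain k where k: "k \<in> Hom C X R" "(a \<cdot> m) \<cdot> k = Ident C X"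
    using is_iso_obtain[OF am] by blast
  have "(b \<cdot> m \<cdot> k) \<cdot> p = \<gamma> p" if p: "p \<in> pts X" for p
  proof -
    note kp = Comp_in_Hom[OF p k(1)]
    have "(b \<cdot> m \<cdot> k) \<cdot> p = \<gamma> ((a \<cdot> m) \<cdot> (k \<cdot> p))"
      using Comp_assoc[OF p k(1) bm] graph[OF kp] by simp
    also have "(a \<cdot> m) \<cdot> (k \<cdot> p) = p"
      using Comp_assoc[OF p k(1) am] k(2) Ident_Comp[OF p] by simp
    finally show ?thesis .
  qed
  then show ?thesis using Comp_in_Hom[OF k(1) bm] by blast
qed

text \<open>Points of \<open>X\<close> are arrows of \<open>C\<close>, of type \<open>'m\<close>;
  the chosen injection renames them into \<open>'u\<close>, where objects of \<open>KH\<close> have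
  their points. It exists for objects because \<open>pts X\<close> is small.\<close>

definition pt_emb :: "'o \<Rightarrow> 'm \<Rightarrow> 'u" where
  "pt_emb X = (SOME e. inj_on e (pts X))"

definition pt_inv :: "'o \<Rightarrow> 'u \<Rightarrow> 'm" where
  "pt_inv X = inv_into (pts X) (pt_emb X)"

definition pt_space :: "'o \<Rightarrow> 'u topology" where
  "pt_space X = final_topology (pt_top X) (pt_emb X)"

definition pt_map :: "'m \<Rightarrow> 'u topology \<times> ('u \<Rightarrow> 'u) \<times> 'u topology" where
  "pt_map f = mk (pt_space (Dom C f)) (\<lambda>u. pt_emb (Cod C f) (f \<cdot> pt_inv (Dom C f) u)) (pt_space (Cod C f))"

definition points_functor :: "('o, 'm, 'u topology, 'u topology \<times> ('u \<Rightarrow> 'u) \<times> 'u topology) cfunctor" where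
  "points_functor = \<lparr>FObj = pt_space, FArr = pt_map\<rparr>"

section \<open>The functor of points with values in \<open>KH\<close>\<close>

lemma pt_emb_inj:
  assumes X: "X \<in> Obj C"
  shows "inj_on (pt_emb X) (pts X)"
proof -
  obtain e :: "'m \<Rightarrow> 'u" where "inj_on e (pts X)" using small_inj[OF small_pts[OF X]] .
  then show ?thesis unfolding pt_emb_def by (rule someI[of "\<lambda>e. inj_on e (pts X)"])
qed

lemma pt_inv_emb: "X \<in> Obj C \<Longrightarrow> p \<in> pts X \<Longrightarrow> pt_inv X (pt_emb X p) = p"
  unfolding pt_inv_def by (rule inv_into_f_f[OF pt_emb_inj])

lemma topspace_pt_space: "X \<in> Obj C \<Longrightarrow> topspace (pt_space X) = pt_emb X ` pts X"
  unfolding pt_space_def topspace_final_topology by (simp add: topspace_pt_top)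

lemma pt_inv:
  assumes X: "X \<in> Obj C" and u: "u \<in> topspace (pt_space X)"
  shows "pt_inv X u \<in> pts X" "pt_emb X (pt_inv X u) = u"
  using u pt_inv_emb[OF X] unfolding topspace_pt_space[OF X] by auto

lemma pt_space_homeomorphic:
  assumes X: "X \<in> Obj C"
  shows "homeomorphic_map (pt_top X) (pt_space X) (pt_emb X)"
  unfolding pt_space_def
  by (rule homeomorphic_map_final_topology) (simp add: topspace_pt_top[OF X] pt_emb_inj[OF X])

lemma pt_emb_continuous: "X \<in> Obj C \<Longrightarrow> continuous_map (pt_top X) (pt_space X) (pt_emb X)"
  by (rule homeomorphic_imp_continuous_map[OF pt_space_homeomorphic])

lemma continuous_map_from_pt_space:
  assumes X: "X \<in> Obj C" and f: "continuous_map (pt_top X) Z f"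
  shows "continuous_map (pt_space X) Z (\<lambda>u. f (pt_inv X u))"
proof -
  have q: "quotient_map (pt_top X) (pt_space X) (pt_emb X)"
    unfolding pt_space_def by (rule quotient_map_final_topology)
  have "continuous_map (pt_top X) Z ((\<lambda>u. f (pt_inv X u)) \<circ> pt_emb X)"
    by (rule continuous_map_eq[OF f]) (simp add: topspace_pt_top[OF X] pt_inv_emb[OF X])
  then show ?thesis
    using continuous_compose_quotient_map_eq[OF q] by blast
qed

lemma pt_space_Obj:
  assumes X: "X \<in> Obj C"
  shows "pt_space X \<in> Obj KH"
proof -
  have hs: "pt_top X homeomorphic_space pt_space X"
    using pt_space_homeomorphic[OF X] homeomorphic_map_imp_homeomorphic_space by blast
  have "small TYPE('u) (pts X)" using small_pts[OF X] by (simp add: small_def)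
  then have "small TYPE('u) (topspace (pt_space X))"
    unfolding topspace_pt_space[OF X] by (rule small_image)
  then show ?thesis
    unfolding Obj_KH
    using homeomorphic_compact_space[OF hs] homeomorphic_Hausdorff_space[OF hs] compact_pt_top[OF X] Hausdorff_pt_top[OF X]
    by simp
qed

lemma pt_map_Hom:
  assumes f: "f \<in> Hom C X Y"
  shows "pt_map f \<in> Hom KH (pt_space X) (pt_space Y)"
  unfolding pt_map_def HomD(2)[OF f] HomD(3)[OF f]
  using continuous_map_compose[OF continuous_map_from_pt_space[OF Hom_Obj(1)[OF f] pt_continuous[OF f]]
      pt_emb_continuous[OF Hom_Obj(2)[OF f]]]
  by (intro mk_Hom pt_space_Obj Hom_Obj[OF f]) (simp add: o_def)

lemma ap_pt_map:
  assumes f: "f \<in> Hom C X Y" and p: "p \<in> pts X"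
  shows "ap (pt_map f) (pt_emb X p) = pt_emb Y (f \<cdot> p)"
  unfolding pt_map_def HomD(2)[OF f] HomD(3)[OF f]
  using p by (simp add: ap_mk topspace_pt_space[OF Hom_Obj(1)[OF f]] pt_inv_emb[OF Hom_Obj(1)[OF f]])

lemma pt_space_eqI:
  assumes X: "X \<in> Obj C" and u: "u \<in> Hom KH (pt_space X) Z" and v: "v \<in> Hom KH (pt_space X) Z"
    and eq: "\<And>p. p \<in> pts X \<Longrightarrow> ap u (pt_emb X p) = ap v (pt_emb X p)"
  shows "u = v"
  by (rule Hom_KH_eqI[OF u v]) (use eq in \<open>auto simp: topspace_pt_space[OF X]\<close>)

lemma points_is_functor: "is_functor C KH points_functor"
  unfolding is_functor_def
proof (intro conjI ballI impI)
  show "category C" by (rule category_axioms)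
  show "category (KH :: ('u topology, 'u topology \<times> ('u \<Rightarrow> 'u) \<times> 'u topology) cat)" by (rule category_KH)
  show "FObj points_functor X \<in> Obj KH" if "X \<in> Obj C" for X
    using pt_space_Obj[OF that] by (simp add: points_functor_def)
  show "FArr points_functor f \<in> Hom KH (FObj points_functor (Dom C f)) (FObj points_functor (Cod C f))"
    if "f \<in> Arr C" for f
    using pt_map_Hom[OF Arr_Hom[OF that]] by (simp add: points_functor_def)
  show "FArr points_functor (Ident C X) = Ident KH (FObj points_functor X)" if X: "X \<in> Obj C" for X
  proof -
    note i = Ident_in_Hom[OF X]
    have "pt_map (Ident C X) = Ident KH (pt_space X)"
      by (rule pt_space_eqI[OF X pt_map_Hom[OF i] KH.Ident_in_Hom[OF pt_space_Obj[OF X]]])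
        (simp add: ap_pt_map[OF i] ap_Ident topspace_pt_space[OF X] Ident_Comp[of _ one X])
    then show ?thesis by (simp add: points_functor_def)
  qed
  show "FArr points_functor (g \<cdot> f) = FArr points_functor g \<cdot>\<^bsub>KH\<^esub> FArr points_functor f"
    if fg: "f \<in> Arr C" "g \<in> Arr C" "Dom C g = Cod C f" for f g
  proof -
    have f: "f \<in> Hom C (Dom C f) (Cod C f)" and g: "g \<in> Hom C (Cod C f) (Cod C g)"
      using fg by (simp_all add: Hom_iff)
    have "pt_map (g \<cdot> f) = pt_map g \<cdot>\<^bsub>KH\<^esub> pt_map f"
    proof (rule pt_space_eqI[OF Hom_Obj(1)[OF f] pt_map_Hom[OF Comp_in_Hom[OF f g]]
          KH.Comp_in_Hom[OF pt_map_Hom[OF f] pt_map_Hom[OF g]]])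
      fix p assume p: "p \<in> pts (Dom C f)"
      have "pt_emb (Dom C f) p \<in> topspace (pt_space (Dom C f))"
        unfolding topspace_pt_space[OF Hom_Obj(1)[OF f]] using p by blast
      then show "ap (pt_map (g \<cdot> f)) (pt_emb (Dom C f) p) = ap (pt_map g \<cdot>\<^bsub>KH\<^esub> pt_map f) (pt_emb (Dom C f) p)"
        by (simp add: ap_Comp[OF pt_map_Hom[OF f] pt_map_Hom[OF g]] ap_pt_map[OF Comp_in_Hom[OF f g] p]
            ap_pt_map[OF f p] ap_pt_map[OF g Comp_in_Hom[OF p f]] Comp_assoc[OF p f g])
    qed
    then show ?thesis by (simp add: points_functor_def)
  qed
qed

lemma points_faithful:
  assumes f: "f \<in> Hom C X Y" and g: "g \<in> Hom C X Y" and eq: "pt_map f = pt_map g"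
  shows "f = g"
proof (rule pts_ext[OF f g])
  fix p assume p: "p \<in> pts X"
  have "pt_emb Y (f \<cdot> p) = pt_emb Y (g \<cdot> p)"
    using ap_pt_map[OF f p] ap_pt_map[OF g p] eq by simp
  then show "f \<cdot> p = g \<cdot> p"
    by (rule inj_onD[OF pt_emb_inj[OF Hom_Obj(2)[OF f]] _ Comp_in_Hom[OF p f] Comp_in_Hom[OF p g]])
qed

lemma points_full:
  assumes X: "X \<in> Obj C" and Y: "Y \<in> Obj C" and g: "g \<in> Hom KH (pt_space X) (pt_space Y)"
  shows "\<exists>f \<in> Hom C X Y. pt_map f = g"
proof -
  have embX: "pt_emb X p \<in> topspace (pt_space X)" if "p \<in> pts X" for p
    unfolding topspace_pt_space[OF X] using that by blast
  define \<gamma> where "\<gamma> p = pt_inv Y (ap g (pt_emb X p))" for p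
  have "continuous_map (pt_space Y) (pt_top Y) (\<lambda>u. pt_inv Y u)"
    using continuous_map_from_pt_space[OF Y continuous_map_id] by simp
  from continuous_map_compose[OF continuous_map_compose[OF pt_emb_continuous[OF X] ap_cont[OF g]] this]
  have "continuous_map (pt_top X) (pt_top Y) \<gamma>"
    unfolding \<gamma>_def[abs_def] by (simp add: o_def)
  then obtain f where f: "f \<in> Hom C X Y" "\<And>p. p \<in> pts X \<Longrightarrow> f \<cdot> p = \<gamma> p"
    using pt_full[OF X Y] by blast
  have "pt_map f = g"
  proof (rule pt_space_eqI[OF X pt_map_Hom[OF f(1)] g])
    fix p assume p: "p \<in> pts X"
    show "ap (pt_map f) (pt_emb X p) = ap g (pt_emb X p)"
      unfolding ap_pt_map[OF f(1) p] f(2)[OF p] \<gamma>_def by (rule pt_inv(2)[OF Y ap_in[OF g embX[OF p]]])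
  qed
  then show ?thesis using f(1) by blast
qed

section \<open>Copowers, effective quotients and essential surjectivity\<close>

lemma copower_exists:
  fixes I :: "'u set"
  assumes "small TYPE('u) I"
  shows "\<exists>S \<iota>. is_coproduct C I (\<lambda>_. one) S \<iota>"
  using KH_like assms unfolding KH_like_def has_terminal_copowers_def small_def by blast

text \<open>The closure is the trace of a subobject \<open>m\<close> through which all injections
  factor. The arrow \<open>k\<close> that these factors induce on \<open>S\<close> is a section of
  \<open>m\<close> by uniqueness in the universal property, so \<open>m\<close> contains every
  point.\<close>

lemma copower_dense:
  assumes cp: "is_coproduct C I (\<lambda>_. one) S \<iota>"
  shows "pt_top S closure_of (\<iota> ` I) = pts S"
proof -
  note cp' = cp[unfolded is_coproduct_def]
  have S: "S \<in> Obj C" using cp' by blast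
  have \<iota>: "\<iota> i \<in> pts S" if "i \<in> I" for i using cp' that by blast
  obtain m where m: "monic C m" "m \<in> Hom C (Dom C m) S" "pt_top S closure_of (\<iota> ` I) = ptm m"
    using closedin_pt_top_obtain[OF S closedin_closure_of] by blast
  have "\<iota> ` I \<subseteq> ptm m"
    unfolding m(3)[symmetric] by (rule closure_of_subset) (use \<iota> in \<open>auto simp: topspace_pt_top[OF S]\<close>)
  then have "\<forall>i\<in>I. \<exists>h. h \<in> pts (Dom C m) \<and> m \<cdot> h = \<iota> i"
    unfolding ptm_eq_image[OF m(2)] by (metis (no_types, lifting) image_iff image_subset_iff)
  then obtain h where h: "\<And>i. i \<in> I \<Longrightarrow> h i \<in> pts (Dom C m)" "\<And>i. i \<in> I \<Longrightarrow> m \<cdot> h i = \<iota> i"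
    by metis
  obtain k where k: "k \<in> Hom C S (Dom C m)" "\<And>i. i \<in> I \<Longrightarrow> k \<cdot> \<iota> i = h i"
    using cp' h(1) Hom_Obj(1)[OF m(2)] by blast
  have "\<exists>!l. l \<in> Hom C S S \<and> (\<forall>i\<in>I. l \<cdot> \<iota> i = \<iota> i)"
    using cp' S \<iota> by blast
  moreover have "(m \<cdot> k) \<cdot> \<iota> i = \<iota> i" if "i \<in> I" for i
    using Comp_assoc[OF \<iota>[OF that] k(1) m(2)] k(2)[OF that] h(2)[OF that] by simp
  moreover have "Ident C S \<cdot> \<iota> i = \<iota> i" if "i \<in> I" for i
    by (rule Ident_Comp[OF \<iota>[OF that]])
  ultimately have mk: "m \<cdot> k = Ident C S"
    using Comp_in_Hom[OF k(1) m(2)] Ident_in_Hom[OF S] by blast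
  have "factors_through C (Ident C S) m"
    using factors_Comp[OF k(1) m(2)] mk by simp
  then have "pts S \<subseteq> ptm m"
    using ptm_mono[OF _ Ident_in_Hom[OF S] m(2)] ptm_Ident[OF S] by blast
  then show ?thesis
    unfolding m(3) using ptm_iff[OF m(2)] by blast
qed

text \<open>Disjoint sets of indices are separated by an arrow to \<open>1 + 1\<close>.\<close>

lemma copower_disjoint:
  assumes cp: "is_coproduct C I (\<lambda>_. one) S \<iota>" and AB: "A \<subseteq> I" "B \<subseteq> I" "A \<inter> B = {}"
  shows "pt_top S closure_of (\<iota> ` A) \<inter> pt_top S closure_of (\<iota> ` B) = {}"
proof -
  note cp' = cp[unfolded is_coproduct_def]
  have S: "S \<in> Obj C" using cp' by blast
  have \<iota>: "\<iota> i \<in> pts S" if "i \<in> I" for i using cp' that by blast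
  let ?T = "coprod C one one"
  let ?c = "\<lambda>i. if i \<in> A then inl C one one else inr C one one"
  note i1 = inl_Hom[OF one_Obj one_Obj] and j1 = inr_Hom[OF one_Obj one_Obj]
  have c: "\<forall>i\<in>I. ?c i \<in> Hom C one ?T" using i1 j1 by simp
  obtain \<kappa> where \<kappa>: "\<kappa> \<in> Hom C S ?T" "\<And>i. i \<in> I \<Longrightarrow> \<kappa> \<cdot> \<iota> i = ?c i"
    using cp'[THEN conjunct2, THEN conjunct2, THEN bspec, OF Hom_Obj(2)[OF i1], THEN spec, of ?c] c by blast
  have \<kappa>B: "\<kappa> \<cdot> \<iota> i = inr C one one" if "i \<in> B" for i
  proof -
    have "i \<in> I" "i \<notin> A" using that AB by auto
    then show ?thesis using \<kappa>(2)[of i] by simp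
  qed
  have cl: "closedin (pt_top S) {s \<in> topspace (pt_top S). \<kappa> \<cdot> s \<in> {x}}" if x: "x \<in> pts ?T" for x
    using closedin_continuous_map_preimage[OF pt_continuous[OF \<kappa>(1)] closedin_ptm[OF point_monic[OF x] x]]
    unfolding ptm_point[OF x] .
  have "pt_top S closure_of (\<iota> ` A) \<subseteq> {s \<in> topspace (pt_top S). \<kappa> \<cdot> s \<in> {inl C one one}}"
    by (rule closure_of_minimal[OF _ cl[OF i1]]) (use \<kappa>(2) AB \<iota> in \<open>auto simp: topspace_pt_top[OF S]\<close>)
  moreover have "pt_top S closure_of (\<iota> ` B) \<subseteq> {s \<in> topspace (pt_top S). \<kappa> \<cdot> s \<in> {inr C one one}}"
    by (rule closure_of_minimal[OF _ cl[OF j1]]) (use \<kappa>B AB \<iota> in \<open>auto simp: topspace_pt_top[OF S]\<close>)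
  moreover have "{s \<in> topspace (pt_top S). \<kappa> \<cdot> s \<in> {inl C one one}} \<inter>
      {s \<in> topspace (pt_top S). \<kappa> \<cdot> s \<in> {inr C one one}} = {}"
    using inl_neq_inr by auto
  ultimately show ?thesis by blast
qed

text \<open>The relation \<open>h p = h p'\<close> is closed, hence given by a subobject of \<open>S \<times> S\<close>, which is an internal
  equivalence relation and therefore effective.\<close>

lemma effective_quotient:
  assumes S: "S \<in> Obj C" and h: "continuous_map (pt_top S) K h" and K: "Hausdorff_space K"
  shows "\<exists>Q q. q \<in> Hom C S Q \<and> regular_epi C q \<and> (\<forall>p \<in> pts S. \<forall>p' \<in> pts S. q \<cdot> p = q \<cdot> p' \<longleftrightarrow> h p = h p')"
proof -
  obtain P a b where a: "a \<in> Hom C P S" and b: "b \<in> Hom C P S"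
    and pair: "\<And>W u v. u \<in> Hom C W S \<Longrightarrow> v \<in> Hom C W S \<Longrightarrow> \<exists>h \<in> Hom C W P. a \<cdot> h = u \<and> b \<cdot> h = v"
    and jm: "\<And>W h k. h \<in> Hom C W P \<Longrightarrow> k \<in> Hom C W P \<Longrightarrow> a \<cdot> h = a \<cdot> k \<Longrightarrow> b \<cdot> h = b \<cdot> k \<Longrightarrow> h = k"
    using product_exists[OF S S] by metis
  have PO: "P \<in> Obj C" by (rule Hom_Obj(1)[OF a])
  have "closedin (pt_top P) {r \<in> topspace (pt_top P). h (a \<cdot> r) = h (b \<cdot> r)}"
    using continuous_map_compose[OF pt_continuous[OF a] h] continuous_map_compose[OF pt_continuous[OF b] h]
    by (intro closedin_continuous_maps_eq[OF K]) (simp_all add: o_def)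
  then obtain m where m: "monic C m" "m \<in> Hom C (Dom C m) P" "{r \<in> topspace (pt_top P). h (a \<cdot> r) = h (b \<cdot> r)} = ptm m"
    using closedin_pt_top_obtain[OF PO] by blast
  define R where "R = Dom C m"
  have mR: "m \<in> Hom C R P" using m(2) unfolding R_def .
  have memR: "r \<in> ptm m \<longleftrightarrow> r \<in> pts P \<and> h (a \<cdot> r) = h (b \<cdot> r)" for r
    unfolding m(3)[symmetric] topspace_pt_top[OF PO] by blast
  have mono: "x = y" if "x \<in> Hom C W R" "y \<in> Hom C W R" "m \<cdot> x = m \<cdot> y" for W x y
    using monicD[OF m(1)] that unfolding R_def by blast
  define r1 r2 where r12: "r1 = a \<cdot> m" "r2 = b \<cdot> m"
  have r1: "r1 \<in> Hom C R S" and r2: "r2 \<in> Hom C R S"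
    unfolding r12 by (rule Comp_in_Hom[OF mR a], rule Comp_in_Hom[OF mR b])
  have r1c: "r1 \<cdot> x = a \<cdot> (m \<cdot> x)" and r2c: "r2 \<cdot> x = b \<cdot> (m \<cdot> x)" if "x \<in> Hom C W R" for W x
    unfolding r12 using Comp_assoc[OF that mR a] Comp_assoc[OF that mR b] by simp_all
  have rel: "h (r1 \<cdot> x) = h (r2 \<cdot> x)" if x: "x \<in> pts R" for x
  proof -
    have "m \<cdot> x \<in> ptm m" unfolding ptm_eq_image[OF mR] using x by blast
    then show ?thesis unfolding memR r1c[OF x] r2c[OF x] by blast
  qed
  \<comment> \<open>Two arrows identified by \<open>h\<close> on points factor jointly through
    \<open>R\<close>, since factorisation through \<open>m\<close> is decided on points.
    Reflexivity, symmetry and transitivity are instances, and so is the description of the fibres of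
    \<open>q\<close> below.\<close>
  have lift: "\<exists>t \<in> Hom C W R. r1 \<cdot> t = u \<and> r2 \<cdot> t = v"
    if u: "u \<in> Hom C W S" and v: "v \<in> Hom C W S" and uv: "\<And>p. p \<in> pts W \<Longrightarrow> h (u \<cdot> p) = h (v \<cdot> p)" for W u v
  proof -
    obtain w where w: "w \<in> Hom C W P" "a \<cdot> w = u" "b \<cdot> w = v" using pair[OF u v] by blast
    have "w \<cdot> p \<in> ptm m" if p: "p \<in> pts W" for p
      unfolding memR using Comp_in_Hom[OF p w(1)] Comp_assoc[OF p w(1) a] Comp_assoc[OF p w(1) b] w(2,3) uv[OF p] by simp
    then have "factors_through C w m"
      by (rule factors_on_points[OF w(1) m(1) mR])
    then obtain t where t: "t \<in> Hom C W R" "w = m \<cdot> t"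
      unfolding factors_through_def using HomD(2)[OF w(1)] R_def by auto
    then show ?thesis using r1c[OF t(1)] r2c[OF t(1)] w(2,3) by blast
  qed
  have "internal_equivalence C r1 r2"
    unfolding internal_equivalence_def HomD(2)[OF r1] HomD(2)[OF r2] HomD(3)[OF r1] HomD(3)[OF r2]
  proof (intro conjI allI ballI impI)
    show "r1 \<in> Arr C" "r2 \<in> Arr C" by (rule HomD(1)[OF r1], rule HomD(1)[OF r2])
    fix W x y assume x: "x \<in> Hom C W R" and y: "y \<in> Hom C W R" and eq: "r1 \<cdot> x = r1 \<cdot> y" "r2 \<cdot> x = r2 \<cdot> y"
    have "m \<cdot> x = m \<cdot> y"
      by (rule jm[OF Comp_in_Hom[OF x mR] Comp_in_Hom[OF y mR]])
        (use eq in \<open>simp_all add: r1c[OF x] r1c[OF y] r2c[OF x] r2c[OF y]\<close>)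
    then show "x = y" by (rule mono[OF x y])
  next
    show "\<exists>d \<in> Hom C S R. r1 \<cdot> d = Ident C S \<and> r2 \<cdot> d = Ident C S"
      by (rule lift[OF Ident_in_Hom[OF S] Ident_in_Hom[OF S] refl])
  next
    show "\<exists>s \<in> Hom C R R. r1 \<cdot> s = r2 \<and> r2 \<cdot> s = r1"
      by (rule lift[OF r2 r1 rel[symmetric]])
  next
    fix p1 p2 assume pb: "is_pullback C r2 r1 p1 p2"
    note D = is_pullbackD(1,2,5)[OF pb, unfolded HomD(2)[OF r1] HomD(2)[OF r2]]
    show "\<exists>t \<in> Hom C (Dom C p1) R. r1 \<cdot> t = r1 \<cdot> p1 \<and> r2 \<cdot> t = r2 \<cdot> p2"
    proof (rule lift[OF Comp_in_Hom[OF D(1) r1] Comp_in_Hom[OF D(2) r2]])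
      fix p assume p: "p \<in> pts (Dom C p1)"
      note 1 = Comp_in_Hom[OF p D(1)] and 2 = Comp_in_Hom[OF p D(2)]
      have "r2 \<cdot> (p1 \<cdot> p) = r1 \<cdot> (p2 \<cdot> p)"
        using Comp_assoc[OF p D(1) r2] Comp_assoc[OF p D(2) r1] D(3) by simp
      then show "h (r1 \<cdot> p1 \<cdot> p) = h (r2 \<cdot> p2 \<cdot> p)"
        using rel[OF 1] rel[OF 2] Comp_assoc[OF p D(1) r1] Comp_assoc[OF p D(2) r2] by simp
    qed
  qed simp_all
  then obtain q where coeq: "is_coequalizer C r1 r2 q" and pb: "is_pullback C q q r1 r2"
    using KH_like unfolding KH_like_def pretopos_def exact_category_def effective_def by blast
  have re: "regular_epi C q" unfolding regular_epi_def using coeq by blast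
  have q: "q \<in> Hom C S (Cod C q)" and comm: "q \<cdot> r1 = q \<cdot> r2"
    using coeq HomD(3)[OF r1] unfolding is_coequalizer_def Hom_iff by auto
  have "q \<cdot> p = q \<cdot> p' \<longleftrightarrow> h p = h p'" if p: "p \<in> pts S" "p' \<in> pts S" for p p'
  proof
    assume "q \<cdot> p = q \<cdot> p'"
    then obtain t where "t \<in> Hom C one (Dom C r1)" "r1 \<cdot> t = p" "r2 \<cdot> t = p'"
      using is_pullbackD(6)[OF pb, unfolded HomD(2)[OF q], OF p] by blast
    then show "h p = h p'" using rel[of t] HomD(2)[OF r1] by auto
  next
    assume hp: "h p = h p'"
    have "\<exists>t \<in> Hom C one R. r1 \<cdot> t = p \<and> r2 \<cdot> t = p'"
    proof (rule lift[OF p])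
      fix x assume x: "x \<in> pts one"
      have "x = Ident C one" by (rule to_one_unique[OF x Ident_in_Hom[OF one_Obj]])
      then show "h (p \<cdot> x) = h (p' \<cdot> x)" using Comp_Ident[OF p(1)] Comp_Ident[OF p(2)] hp by simp
    qed
    then obtain t where t: "t \<in> Hom C one R" "r1 \<cdot> t = p" "r2 \<cdot> t = p'" by blast
    show "q \<cdot> p = q \<cdot> p'"
      using Comp_assoc[OF t(1) r1 q] Comp_assoc[OF t(1) r2 q] comm t(2,3) by simp
  qed
  then show ?thesis using q re by blast
qed

lemma points_essentially_surjective:
  assumes inacc: "inaccessible TYPE('u)" and K: "K \<in> Obj (KH :: ('u topology, _) cat)"
  shows "\<exists>Q \<in> Obj C. isomorphic KH (pt_space Q) K"
proof -
  define I where "I = topspace K"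
  obtain S \<iota> where cp: "is_coproduct C I (\<lambda>_. one) S \<iota>"
    using copower_exists[OF Obj_KHD(3)[OF K]] unfolding I_def by blast
  have S: "S \<in> Obj C" and \<iota>: "\<iota> ` I \<subseteq> pts S" using cp unfolding is_coproduct_def by auto
  note tS = topspace_pt_top[OF S]
  have id: "(\<lambda>x. x) ` I \<subseteq> topspace K" by (simp add: I_def)
  have "\<exists>h. continuous_map (pt_top S) K h \<and> (\<forall>i\<in>I. h (\<iota> i) = i)"
    by (rule dense_extension[OF Obj_KHD(1,2)[OF K] \<iota>[folded tS] id copower_dense[OF cp, folded tS] copower_disjoint[OF cp]])
  then obtain h where h: "continuous_map (pt_top S) K h" "\<And>i. i \<in> I \<Longrightarrow> h (\<iota> i) = i"
    by blast
  obtain Q q where q: "q \<in> Hom C S Q" "regular_epi C q"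
    and qh: "\<And>p p'. p \<in> pts S \<Longrightarrow> p' \<in> pts S \<Longrightarrow> q \<cdot> p = q \<cdot> p' \<longleftrightarrow> h p = h p'"
    using effective_quotient[OF S h(1) Obj_KHD(2)[OF K]] by blast
  have Q: "Q \<in> Obj C" by (rule Hom_Obj(2)[OF q(1)])
  note surj = regular_epi_surj[OF q]
  \<comment> \<open>The map that \<open>h\<close> induces on \<open>pts Q\<close>. It is well
    defined and injective because \<open>q\<close> and \<open>h\<close> identify the same points,
    and continuous because \<open>q\<close> is a closed surjection on points, hence a quotient
    map.\<close>
  define \<theta> where "\<theta> z = h (inv_into (pts S) ((\<cdot>) q) z)" for z
  have \<theta>q: "\<theta> (q \<cdot> p) = h p" if p: "p \<in> pts S" for p
  proof -
    have "q \<cdot> p \<in> (\<cdot>) q ` pts S" using p by blast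
    from inv_into_into[OF this] f_inv_into_f[OF this] show ?thesis
      unfolding \<theta>_def using qh p by blast
  qed
  have "quotient_map (pt_top S) (pt_top Q) ((\<cdot>) q)"
    by (rule continuous_closed_imp_quotient_map[OF pt_continuous[OF q(1)] pt_closed_map[OF q(1)]])
      (simp add: tS topspace_pt_top[OF Q] surj)
  moreover have "continuous_map (pt_top S) K (\<theta> \<circ> (\<cdot>) q)"
    by (rule continuous_map_eq[OF h(1)]) (simp add: tS \<theta>q)
  ultimately have \<theta>: "continuous_map (pt_top Q) K \<theta>"
    using continuous_compose_quotient_map_eq by blast
  have t: "mk (pt_space Q) (\<lambda>u. \<theta> (pt_inv Q u)) K \<in> Hom KH (pt_space Q) K" (is "?t \<in> _")
    by (rule mk_Hom[OF pt_space_Obj[OF Q] K continuous_map_from_pt_space[OF Q \<theta>]])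
  have tq: "ap ?t (pt_emb Q (q \<cdot> p)) = h p" if p: "p \<in> pts S" for p
    using Comp_in_Hom[OF p q(1)] by (simp add: ap_mk topspace_pt_space[OF Q] pt_inv_emb[OF Q] \<theta>q[OF p])
  have tQ: "topspace (pt_space Q) = (\<lambda>p. pt_emb Q (q \<cdot> p)) ` pts S"
    unfolding topspace_pt_space[OF Q] surj[symmetric] image_image ..
  have "is_iso KH ?t"
  proof (rule iso_KH[OF inacc t])
    show "inj_on (ap ?t) (topspace (pt_space Q))"
    proof (rule inj_onI)
      fix u v assume "u \<in> topspace (pt_space Q)" "v \<in> topspace (pt_space Q)" and eq: "ap ?t u = ap ?t v"
      then obtain p p' where p: "p \<in> pts S" "u = pt_emb Q (q \<cdot> p)" and p': "p' \<in> pts S" "v = pt_emb Q (q \<cdot> p')"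
        unfolding tQ by blast
      have "h p = h p'" using eq unfolding p(2) p'(2) tq[OF p(1)] tq[OF p'(1)] .
      then show "u = v" using qh[OF p(1) p'(1)] p(2) p'(2) by simp
    qed
    show "topspace K \<subseteq> img ?t"
    proof
      fix x assume "x \<in> topspace K"
      then have x: "x \<in> I" unfolding I_def .
      then have p: "\<iota> x \<in> pts S" using \<iota> by blast
      have "x = ap ?t (pt_emb Q (q \<cdot> \<iota> x))" using tq[OF p] h(2)[OF x] by simp
      then show "x \<in> img ?t" unfolding img_eq[OF t] tQ using p by blast
    qed
  qed
  then have "isomorphic KH (pt_space Q) K"
    unfolding isomorphic_def using t by blast
  then show ?thesis using Q by blast
qed

lemma points_is_equivalence:
  assumes "inaccessible TYPE('u)"
  shows "is_equivalence C KH points_functor"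
proof (rule is_equivalenceI[OF points_is_functor])
  show "\<exists>f \<in> Hom C X Y. FArr points_functor f = g"
    if "X \<in> Obj C" "Y \<in> Obj C" "g \<in> Hom KH (FObj points_functor X) (FObj points_functor Y)" for X Y g
    using points_full that by (simp add: points_functor_def)
  show "f = f'" if "f \<in> Hom C X Y" "f' \<in> Hom C X Y" "FArr points_functor f = FArr points_functor f'" for X Y f f'
    using points_faithful that by (simp add: points_functor_def)
  show "\<exists>c \<in> Obj C. isomorphic KH (FObj points_functor c) d" if "d \<in> Obj KH" for d
    using points_essentially_surjective[OF assms that] by (simp add: points_functor_def)
qed

end

theorem theorem5p1:
  assumes "inaccessible TYPE('u)"
  shows "KH_like TYPE('u) (KH :: ('u topology, 'u topology \<times> ('u \<Rightarrow> 'u) \<times> 'u topology) cat) \<and>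
    (\<forall>C :: ('o, 'm) cat. KH_like TYPE('u) C \<longrightarrow>
      equivalent_categories C
        (KH :: ('u topology, 'u topology \<times> ('u \<Rightarrow> 'u) \<times> 'u topology) cat))"
proof (intro conjI allI impI)
  show "KH_like TYPE('u) (KH :: ('u topology, 'u topology \<times> ('u \<Rightarrow> 'u) \<times> 'u topology) cat)"
    by (rule KH_like_KH[OF assms])
  fix C :: "('o, 'm) cat" assume C: "KH_like TYPE('u) C"
  show "equivalent_categories C (KH :: ('u topology, 'u topology \<times> ('u \<Rightarrow> 'u) \<times> 'u topology) cat)"
    unfolding equivalent_categories_def
    using kh_like.points_is_equivalence[OF kh_like.intro[OF C] assms] by blast
qed

end
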